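(* Let $\mathbf{k}$ be a commutative ring. If $\mathfrak{g}$ is a twisted pre-Lie algebra over $\mathbf{k}$, and $U_{\mathbb{S}}\mathfrak{g}$ is the universal enveloping algebra of the associated twisted Lie algebra, then: (1) the canonical morphism $\operatorname{Sym}_{\mathbb{S}}\mathfrak{g}\to\operatorname{gr}(U_{\mathbb{S}}\mathfrak{g})$ is an isomorphism; (2) the canonical morphism lifts to a twisted coalgebra isomorphism $\operatorname{Sym}_{\mathbb{S}}\mathfrak{g}\to U_{\mathbb{S}}\mathfrak{g}$ (that is, there is a filtered isomorphism of twisted coalgebras whose associated graded is the canonical morphism).
   Context: An $\mathbb{S}$-module is an $\mathbb{N}$-graded $\mathbf{k}$-module $M=\bigoplus_{m\ge0}M_m$ with an action of $S_m$ on each $M_m$ by $\mathbf{k}$-module automorphisms; morphisms are graded and equivariant. $M\otimes_{\mathbb{S}}N=\bigoplus_p\bigoplus_{m+n=p}\operatorname{Ind}_{S_m\times S_n}^{S_p}M_m\otimes N_n$, with braiding $\beta(g\otimes h)=(12)^{|h|,|g|}(h\otimes g)$ for homogeneous $g,h$. Here, for $i_1+\cdots+i_n=r$ and $\sigma\in S_n$, $\sigma^{i_1,\dots,i_n}\in S_r$ is the block permutation moving the $j$-th of the consecutive blocks of sizes $i_1,\dots,i_n$ to the $\sigma(j)$-th place, preserving order within blocks. "Twisted" structures are structures in this symmetric monoidal category. A twisted pre-Lie algebra is an $\mathbb{S}$-module $\mathfrak{g}$ with an $\mathbb{S}$-module morphism $\circ:\mathfrak{g}\otimes_{\mathbb{S}}\mathfrak{g}\to\mathfrak{g}$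 satisfying $(x\circ y)\circ z-x\circ(y\circ z)=(23)^{|x|,|z|,|y|}\bigl((x\circ z)\circ y-x\circ(z\circ y)\bigr)$ for homogeneous $x,y,z$. Its associated twisted Lie algebra has bracket $\{x,y\}=x\circ y-(12)^{|y|,|x|}(y\circ x)$. $T_{\mathbb{S}}\mathfrak{g}=\bigoplus_n\mathfrak{g}^{\otimes_{\mathbb{S}}n}$ is the free twisted associative algebra; $\operatorname{Sym}_{\mathbb{S}}\mathfrak{g}$ and $U_{\mathbb{S}}\mathfrak{g}$ are its quotients by the twisted ideals (ideals that are $\mathbb{S}$-submodules) generated by $xy-(12)^{|y|,|x|}yx$, respectively $xy-(12)^{|y|,|x|}yx-\{x,y\}$, for $x,y\in\mathfrak{g}$. $U_{\mathbb{S}}\mathfrak{g}$ is filtered by the images of $\bigoplus_{i\le n}\mathfrak{g}^{\otimes_{\mathbb{S}}i}$, and the canonical morphism $\operatorname{Sym}_{\mathbb{S}}\mathfrak{g}\to\operatorname{gr}U_{\mathbb{S}}\mathfrak{g}$ is the epimorphism induced by $\mathfrak{g}\to U_{\mathbb{S}}\mathfrak{g}$. Both algebras carry the standard twisted cocommutative coproduct $A\to A\otimes_{\mathbb{S}}A$, the morphism of twisted algebras with $\Delta(x)=1\otimes x+x\otimes1$ for $x\in\mathfrak{g}$, where $(u\otimes v)\cdot(x\otimes y)=(23)^{|u|,|x|,|v|,|y|}(ux\otimes vy)$. *)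

theory Defs
  imports "HOL-Algebra.Module" "HOL-Algebra.AbelCoset" "HOL-Algebra.Group_Action"
    "HOL-Algebra.Sym_Groups" "HOL.Hull"
begin

section \<open>Linear algebra over a commutative ring\<close>

text \<open>Module records inherit \<open>mult\<close> and \<open>one\<close> from rings; the locale
  \<^locale>\<open>module\<close> does not look at these fields, and they are left undefined below.\<close>

definition linear_map ::
  "('r, 'k) ring_scheme \<Rightarrow> ('r, 'a, 'm) module_scheme \<Rightarrow> ('r, 'b, 'n) module_scheme \<Rightarrow> ('a \<Rightarrow> 'b) \<Rightarrow> bool"
  where "linear_map R M N f \<longleftrightarrow>
    f \<in> hom (add_monoid M) (add_monoid N) \<and>
    (\<forall>r\<in>carrier R. \<forall>x\<in>carrier M. f (r \<odot>\<^bsub>M\<^esub> x) = r \<odot>\<^bsub>N\<^esub> f x)"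

text \<open>The map induced on cosets modulo \<open>N\<close> by a map \<open>f\<close> of representatives
  (same pattern as \<open>rcoset_mult\<close> for quotient rings).\<close>

definition coset_map :: "('b, 'm) ring_scheme \<Rightarrow> 'b set \<Rightarrow> ('a \<Rightarrow> 'b) \<Rightarrow> 'a set \<Rightarrow> 'b set"
  where "coset_map M N f X = (\<Union>x\<in>X. N +>\<^bsub>M\<^esub> f x)"

definition coset_map2 ::
  "('c, 'm) ring_scheme \<Rightarrow> 'c set \<Rightarrow> ('a \<Rightarrow> 'b \<Rightarrow> 'c) \<Rightarrow> 'a set \<Rightarrow> 'b set \<Rightarrow> 'c set"
  where "coset_map2 M N f X Y = (\<Union>x\<in>X. \<Union>y\<in>Y. N +>\<^bsub>M\<^esub> f x y)"

definition FactModule :: "('r, 'a, 'm) module_scheme \<Rightarrow> 'a set \<Rightarrow> ('r, 'a set) module"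
  where "FactModule M N =
    \<lparr>carrier = a_rcosets\<^bsub>M\<^esub> N, monoid.mult = undefined, one = undefined, zero = N, add = set_add M,
     smult = (\<lambda>r. coset_map M N (\<lambda>x. r \<odot>\<^bsub>M\<^esub> x))\<rparr>"

definition free_module :: "('r, 'k) ring_scheme \<Rightarrow> 'x set \<Rightarrow> ('r, 'x \<Rightarrow> 'r) module"
  where "free_module R X =
    \<lparr>carrier = {a. range a \<subseteq> carrier R \<and> finite {x. a x \<noteq> \<zero>\<^bsub>R\<^esub>} \<and> {x. a x \<noteq> \<zero>\<^bsub>R\<^esub>} \<subseteq> X},
     monoid.mult = undefined, one = undefined, zero = (\<lambda>x. \<zero>\<^bsub>R\<^esub>),
     add = (\<lambda>a b x. a x \<oplus>\<^bsub>R\<^esub> b x), smult = (\<lambda>r a x. r \<otimes>\<^bsub>R\<^esub> a x)\<rparr>"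

definition basis_vec :: "('r, 'k) ring_scheme \<Rightarrow> 'x \<Rightarrow> 'x \<Rightarrow> 'r"
  where "basis_vec R x = (\<lambda>y. if y = x then \<one>\<^bsub>R\<^esub> else \<zero>\<^bsub>R\<^esub>)"

definition linear_extension ::
  "('r, 'k) ring_scheme \<Rightarrow> ('r, 'b, 'm) module_scheme \<Rightarrow> ('x \<Rightarrow> 'b) \<Rightarrow> ('x \<Rightarrow> 'r) \<Rightarrow> 'b"
  where "linear_extension R V h a = (\<Oplus>\<^bsub>V\<^esub>x\<in>{x. a x \<noteq> \<zero>\<^bsub>R\<^esub>}. a x \<odot>\<^bsub>V\<^esub> h x)"

text \<open>The linear map to \<open>V\<close> out of a module given by generators and relations (a quotient of a
  free module), specified by the images \<open>h\<close> of the generators.  Its value on a coset is the common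
  value of the linear extension of \<open>h\<close> on all representatives.\<close>

definition lift_linear ::
  "('r, 'k) ring_scheme \<Rightarrow> ('r, 'b, 'm) module_scheme \<Rightarrow> ('x \<Rightarrow> 'b) \<Rightarrow> ('x \<Rightarrow> 'r) set \<Rightarrow> 'b"
  where "lift_linear R V h X = the_elem (linear_extension R V h ` X)"

definition direct_sum :: "(nat \<Rightarrow> ('r, 'a) module) \<Rightarrow> ('r, nat \<Rightarrow> 'a) module"
  where "direct_sum M =
    \<lparr>carrier = {f. (\<forall>n. f n \<in> carrier (M n)) \<and> finite {n. f n \<noteq> \<zero>\<^bsub>M n\<^esub>}},
     monoid.mult = undefined, one = undefined, zero = (\<lambda>n. \<zero>\<^bsub>M n\<^esub>),
     add = (\<lambda>f h n. f n \<oplus>\<^bsub>M n\<^esub> h n), smult = (\<lambda>r f n. r \<odot>\<^bsub>M n\<^esub> f n)\<rparr>"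


section \<open>Permutations\<close>

text \<open>The block permutation: with consecutive blocks of sizes \<open>ds\<close> in \<open>{1..sum_list ds}\<close>, the
  \<open>j\<close>-th block is moved to the \<open>\<sigma> j\<close>-th place.  Permutations are functions from old to new
  positions, and they act on the left.\<close>

definition block_perm :: "(nat \<Rightarrow> nat) \<Rightarrow> nat list \<Rightarrow> nat \<Rightarrow> nat"
  where "block_perm \<sigma> ds p =
    (if p \<in> {1..sum_list ds} then
       let j = (LEAST j. p \<le> sum_list (take j ds))
       in (\<Sum>l | l \<in> {1..length ds} \<and> \<sigma> l < \<sigma> j. ds ! (l - 1)) + (p - sum_list (take (j - 1) ds))
     else p)"

text \<open>The embeddings of \<open>S\<^sub>m \<times> S\<^sub>n\<close> into \<open>S\<^sub>m\<^sub>+\<^sub>n\<close> and of products of several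
  symmetric groups.\<close>

definition perm_prod :: "nat \<Rightarrow> (nat \<Rightarrow> nat) \<Rightarrow> (nat \<Rightarrow> nat) \<Rightarrow> nat \<Rightarrow> nat"
  where "perm_prod m \<sigma> \<tau> p = (if p \<le> m then \<sigma> p else m + \<tau> (p - m))"

fun perm_prods :: "(nat \<times> (nat \<Rightarrow> nat)) list \<Rightarrow> nat \<Rightarrow> nat"
  where
    "perm_prods [] = id"
  | "perm_prods ((m, \<sigma>) # xs) = perm_prod m \<sigma> (perm_prods xs)"


section \<open>S-modules and their tensor products\<close>

text \<open>An S-module is given by its family of homogeneous components.\<close>

record ('r, 'a) smod =
  grade :: "nat \<Rightarrow> ('r, 'a) module"
  act :: "nat \<Rightarrow> (nat \<Rightarrow> nat) \<Rightarrow> 'a \<Rightarrow> 'a"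

definition smodule :: "('r, 'k) ring_scheme \<Rightarrow> ('r, 'a, 'm) smod_scheme \<Rightarrow> bool"
  where "smodule R M \<longleftrightarrow> (\<forall>m.
    module R (grade M m) \<and>
    group_action (sym_group m) (carrier (grade M m))
      (\<lambda>\<sigma>. restrict (act M m \<sigma>) (carrier (grade M m))) \<and>
    (\<forall>\<sigma>\<in>carrier (sym_group m). linear_map R (grade M m) (grade M m) (act M m \<sigma>)))"

definition smod_hom ::
  "('r, 'k) ring_scheme \<Rightarrow> ('r, 'a, 'm) smod_scheme \<Rightarrow> ('r, 'b, 'n) smod_scheme \<Rightarrow> (nat \<Rightarrow> 'a \<Rightarrow> 'b) \<Rightarrow> bool"
  where "smod_hom R M N f \<longleftrightarrow> (\<forall>m.
    linear_map R (grade M m) (grade N m) (f m) \<and>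
    (\<forall>\<sigma>\<in>carrier (sym_group m). \<forall>x\<in>carrier (grade M m).
       f m (act M m \<sigma> x) = act N m \<sigma> (f m x)))"

definition smod_iso ::
  "('r, 'k) ring_scheme \<Rightarrow> ('r, 'a, 'm) smod_scheme \<Rightarrow> ('r, 'b, 'n) smod_scheme \<Rightarrow> (nat \<Rightarrow> 'a \<Rightarrow> 'b) \<Rightarrow> bool"
  where "smod_iso R M N f \<longleftrightarrow>
    smod_hom R M N f \<and> (\<forall>m. bij_betw (f m) (carrier (grade M m)) (carrier (grade N m)))"

text \<open>The tensor product \<open>M\<^sub>1 \<otimes> \<dots> \<otimes> M\<^sub>n\<close> of a list of S-modules.  Its component of degree
  \<open>p\<close> is the direct sum, over \<open>i\<^sub>1 + \<dots> + i\<^sub>n = p\<close>, of the induced modules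
  \<open>k[S\<^sub>p] \<otimes> (M\<^sub>1(i\<^sub>1) \<otimes> \<dots> \<otimes> M\<^sub>n(i\<^sub>n))\<close>, the outer tensor product being over the
  group algebra of \<open>S(i\<^sub>1) \<times> \<dots> \<times> S(i\<^sub>n)\<close>.  The generator \<open>(\<sigma>, [(i\<^sub>1,x\<^sub>1), \<dots>, (i\<^sub>n,x\<^sub>n)])\<close>
  stands for \<open>\<sigma> \<otimes> (x\<^sub>1 \<otimes> \<dots> \<otimes> x\<^sub>n)\<close> with \<open>x\<^sub>j\<close> homogeneous of degree \<open>i\<^sub>j\<close>; the
  three families of relations are additivity and homogeneity in each \<open>x\<^sub>j\<close>, and balancing over
  the subgroup.\<close>

type_synonym 'a gen = "(nat \<Rightarrow> nat) \<times> (nat \<times> 'a) list"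
type_synonym ('r, 'a) tens = "('a gen \<Rightarrow> 'r) set"

definition tensor_gens :: "('r, 'a, 'm) smod_scheme list \<Rightarrow> nat \<Rightarrow> 'a gen set"
  where "tensor_gens Ms p =
    {(\<sigma>, w). \<sigma> \<in> carrier (sym_group p) \<and> sum_list (map fst w) = p \<and>
       list_all2 (\<lambda>M (i, x). x \<in> carrier (grade M i)) Ms w}"

definition tensor_relations ::
  "('r, 'k) ring_scheme \<Rightarrow> ('r, 'a, 'm) smod_scheme list \<Rightarrow> nat \<Rightarrow> ('a gen \<Rightarrow> 'r) set"
  where "tensor_relations R Ms p =
    (let F = free_module R (tensor_gens Ms p); e = basis_vec R in
      {e (\<sigma>, w[j := (i, x \<oplus>\<^bsub>grade (Ms ! j) i\<^esub> y)])
          \<ominus>\<^bsub>F\<^esub> (e (\<sigma>, w[j := (i, x)]) \<oplus>\<^bsub>F\<^esub> e (\<sigma>, w[j := (i, y)]))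
        | \<sigma> w j i x y. j < length Ms \<and>
            (\<sigma>, w[j := (i, x)]) \<in> tensor_gens Ms p \<and> (\<sigma>, w[j := (i, y)]) \<in> tensor_gens Ms p} \<union>
      {e (\<sigma>, w[j := (i, r \<odot>\<^bsub>grade (Ms ! j) i\<^esub> x)]) \<ominus>\<^bsub>F\<^esub> r \<odot>\<^bsub>F\<^esub> e (\<sigma>, w[j := (i, x)])
        | \<sigma> w j i r x. j < length Ms \<and> r \<in> carrier R \<and> (\<sigma>, w[j := (i, x)]) \<in> tensor_gens Ms p} \<union>
      {e (\<sigma> \<circ> perm_prods (zip (map fst w) \<tau>s), w)
          \<ominus>\<^bsub>F\<^esub> e (\<sigma>, map (\<lambda>(M, (i, x), \<tau>). (i, act M i \<tau> x)) (zip Ms (zip w \<tau>s)))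
        | \<sigma> w \<tau>s. (\<sigma>, w) \<in> tensor_gens Ms p \<and>
            list_all2 (\<lambda>(i, x) \<tau>. \<tau> \<in> carrier (sym_group i)) w \<tau>s})"

definition tensor_kernel ::
  "('r, 'k) ring_scheme \<Rightarrow> ('r, 'a, 'm) smod_scheme list \<Rightarrow> nat \<Rightarrow> ('a gen \<Rightarrow> 'r) set"
  where "tensor_kernel R Ms p =
    (\<lambda>H. submodule H R (free_module R (tensor_gens Ms p))) hull (tensor_relations R Ms p)"

definition tensor_module ::
  "('r, 'k) ring_scheme \<Rightarrow> ('r, 'a, 'm) smod_scheme list \<Rightarrow> nat \<Rightarrow> ('r, ('r, 'a) tens) module"
  where "tensor_module R Ms p =
    FactModule (free_module R (tensor_gens Ms p)) (tensor_kernel R Ms p)"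

text \<open>The class \<open>\<sigma> \<cdot> (x\<^sub>1 \<otimes> \<dots> \<otimes> x\<^sub>n)\<close> of a generator.\<close>

definition tensor_class ::
  "('r, 'k) ring_scheme \<Rightarrow> ('r, 'a, 'm) smod_scheme list \<Rightarrow> (nat \<Rightarrow> nat) \<Rightarrow> (nat \<times> 'a) list \<Rightarrow> ('r, 'a) tens"
  where "tensor_class R Ms \<sigma> w =
    (let p = sum_list (map fst w)
     in tensor_kernel R Ms p +>\<^bsub>free_module R (tensor_gens Ms p)\<^esub> basis_vec R (\<sigma>, w))"

definition tensor ::
  "('r, 'k) ring_scheme \<Rightarrow> ('r, 'a, 'm) smod_scheme list \<Rightarrow> ('r, ('r, 'a) tens) smod"
  where "tensor R Ms =
    \<lparr>grade = tensor_module R Ms,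
     act = (\<lambda>p \<rho>. lift_linear R (tensor_module R Ms p) (\<lambda>(\<sigma>, w). tensor_class R Ms (\<rho> \<circ> \<sigma>) w))\<rparr>"

text \<open>The morphism \<open>f \<otimes> f : M \<otimes> M \<rightarrow> N \<otimes> N\<close>.\<close>

definition tensor_map2 ::
  "('r, 'k) ring_scheme \<Rightarrow> ('r, 'b, 'n) smod_scheme \<Rightarrow> (nat \<Rightarrow> 'a \<Rightarrow> 'b) \<Rightarrow>
   nat \<Rightarrow> ('r, 'a) tens \<Rightarrow> ('r, 'b) tens"
  where "tensor_map2 R N f p =
    lift_linear R (tensor_module R [N, N] p)
      (\<lambda>(\<sigma>, w). tensor_class R [N, N] \<sigma> (map (\<lambda>(i, x). (i, f i x)) w))"


section \<open>Twisted algebras\<close>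

text \<open>A twisted algebra is recorded through its products \<open>A\<^sub>m \<times> A\<^sub>n \<rightarrow> A\<^sub>m\<^sub>+\<^sub>n\<close> of homogeneous
  elements and its unit in degree zero.\<close>

record ('r, 'a) talg = "('r, 'a) smod" +
  tmul :: "nat \<Rightarrow> nat \<Rightarrow> 'a \<Rightarrow> 'a \<Rightarrow> 'a"
  tone :: 'a

definition talg_hom ::
  "('r, 'k) ring_scheme \<Rightarrow> ('r, 'a, 'm) talg_scheme \<Rightarrow> ('r, 'b, 'n) talg_scheme \<Rightarrow> (nat \<Rightarrow> 'a \<Rightarrow> 'b) \<Rightarrow> bool"
  where "talg_hom R A B f \<longleftrightarrow>
    smod_hom R A B f \<and> f 0 (tone A) = tone B \<and>
    (\<forall>m n. \<forall>x\<in>carrier (grade A m). \<forall>y\<in>carrier (grade A n).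
       f (m + n) (tmul A m n x y) = tmul B m n (f m x) (f n y))"

definition twisted_ideal ::
  "('r, 'k) ring_scheme \<Rightarrow> ('r, 'a, 'm) talg_scheme \<Rightarrow> (nat \<Rightarrow> 'a set) \<Rightarrow> bool"
  where "twisted_ideal R A J \<longleftrightarrow>
    (\<forall>p. submodule (J p) R (grade A p)) \<and>
    (\<forall>p. \<forall>\<sigma>\<in>carrier (sym_group p). \<forall>x\<in>J p. act A p \<sigma> x \<in> J p) \<and>
    (\<forall>p q. \<forall>x\<in>J p. \<forall>a\<in>carrier (grade A q).
       tmul A q p a x \<in> J (q + p) \<and> tmul A p q x a \<in> J (p + q))"

definition ideal_generated ::
  "('r, 'k) ring_scheme \<Rightarrow> ('r, 'a, 'm) talg_scheme \<Rightarrow> (nat \<Rightarrow> 'a set) \<Rightarrow> nat \<Rightarrow> 'a set"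
  where "ideal_generated R A G p = \<Inter>{J p | J. twisted_ideal R A J \<and> (\<forall>q. G q \<subseteq> J q)}"

definition quotient_talg :: "('r, 'a, 'm) talg_scheme \<Rightarrow> (nat \<Rightarrow> 'a set) \<Rightarrow> ('r, 'a set) talg"
  where "quotient_talg A I =
    \<lparr>grade = (\<lambda>p. FactModule (grade A p) (I p)),
     act = (\<lambda>p \<sigma>. coset_map (grade A p) (I p) (act A p \<sigma>)),
     tmul = (\<lambda>p q. coset_map2 (grade A (p + q)) (I (p + q)) (tmul A p q)),
     tone = I 0 +>\<^bsub>grade A 0\<^esub> tone A\<rparr>"

text \<open>The twisted algebra \<open>A \<otimes> A\<close>.  For generators \<open>\<sigma>(u \<otimes> v)\<close> and \<open>\<tau>(x \<otimes> y)\<close> equivariance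
  of the product and \<open>(u \<otimes> v)(x \<otimes> y) = (23)\<^bsup>|u|,|x|,|v|,|y|\<^esup>(ux \<otimes> vy)\<close> give
  \<open>((\<sigma> \<times> \<tau>) \<circ> (23)\<^bsup>|u|,|x|,|v|,|y|\<^esup>)(ux \<otimes> vy)\<close>.\<close>

definition tensor_square_mul_gen ::
  "('r, 'k) ring_scheme \<Rightarrow> ('r, 'a, 'm) talg_scheme \<Rightarrow> 'a gen \<Rightarrow> 'a gen \<Rightarrow> ('r, 'a) tens"
  where "tensor_square_mul_gen R A s t =
    (let (\<sigma>, uv) = s; (\<tau>, xy) = t;
         (a, u) = uv ! 0; (b, v) = uv ! 1; (c, x) = xy ! 0; (d, y) = xy ! 1
     in tensor_class R [A, A]
          (perm_prod (a + b) \<sigma> \<tau> \<circ> block_perm (transpose 2 3) [a, c, b, d])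
          [(a + c, tmul A a c u x), (b + d, tmul A b d v y)])"

definition tensor_square ::
  "('r, 'k) ring_scheme \<Rightarrow> ('r, 'a, 'm) talg_scheme \<Rightarrow> ('r, ('r, 'a) tens) talg"
  where "tensor_square R A =
    \<lparr>grade = grade (tensor R [A, A]),
     act = act (tensor R [A, A]),
     tmul = (\<lambda>p q X Y. let V = tensor_module R [A, A] (p + q) in
       lift_linear R V (\<lambda>s. lift_linear R V (\<lambda>t. tensor_square_mul_gen R A s t) Y) X),
     tone = tensor_class R [A, A] id [(0, tone A), (0, tone A)]\<rparr>"

text \<open>The unit object: \<open>k\<close> concentrated in degree zero.\<close>

definition unit_talg :: "('r, 'k) ring_scheme \<Rightarrow> ('r, 'r) talg"
  where "unit_talg R =
    \<lparr>grade = (\<lambda>p. \<lparr>carrier = (if p = 0 then carrier R else {\<zero>\<^bsub>R\<^esub>}), monoid.mult = undefined, one = undefined,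
                  zero = \<zero>\<^bsub>R\<^esub>, add = add R, smult = monoid.mult R\<rparr>),
     act = (\<lambda>p \<sigma> x. x),
     tmul = (\<lambda>p q x y. x \<otimes>\<^bsub>R\<^esub> y),
     tone = \<one>\<^bsub>R\<^esub>\<rparr>"

text \<open>The direct sum of S-modules \<open>A 0, A 1, \<dots>\<close>, and the twisted algebra structure on it given
  by products \<open>A i \<otimes> A j \<rightarrow> A (i + j)\<close> and a unit in \<open>A 0\<close>.  We call the summation index
  \<^emph>\<open>weight\<close>, as opposed to the degree of an S-module.\<close>

definition weight_part :: "(nat \<Rightarrow> ('r, 'a) smod) \<Rightarrow> nat \<Rightarrow> nat \<Rightarrow> 'a \<Rightarrow> nat \<Rightarrow> 'a"
  where "weight_part A n p x = (\<lambda>i. if i = n then x else \<zero>\<^bsub>grade (A i) p\<^esub>)"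

definition weighted_talg ::
  "(nat \<Rightarrow> ('r, 'a) smod) \<Rightarrow> (nat \<Rightarrow> nat \<Rightarrow> nat \<Rightarrow> nat \<Rightarrow> 'a \<Rightarrow> 'a \<Rightarrow> 'a) \<Rightarrow> 'a \<Rightarrow> ('r, nat \<Rightarrow> 'a) talg"
  where "weighted_talg A \<mu> e =
    \<lparr>grade = (\<lambda>p. direct_sum (\<lambda>n. grade (A n) p)),
     act = (\<lambda>p \<sigma> f n. act (A n) p \<sigma> (f n)),
     tmul = (\<lambda>p q f h n. \<Oplus>\<^bsub>grade (A n) (p + q)\<^esub>i\<in>{..n}. \<mu> i (n - i) p q (f i) (h (n - i))),
     tone = weight_part A 0 0 e\<rparr>"


section \<open>Tensor, symmetric and enveloping algebras\<close>

definition tensor_power ::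
  "('r, 'k) ring_scheme \<Rightarrow> ('r, 'a) smod \<Rightarrow> nat \<Rightarrow> ('r, ('r, 'a) tens) smod"
  where "tensor_power R \<gamma> n = tensor R (replicate n \<gamma>)"

text \<open>The identification of the tensor product of the \<open>i\<close>-th and \<open>j\<close>-th tensor powers with the
  \<open>(i + j)\<close>-th: concatenation, \<open>\<sigma>(x\<^sub>1 \<otimes> \<dots>) \<otimes> \<tau>(y\<^sub>1 \<otimes> \<dots>) \<mapsto> (\<sigma> \<times> \<tau>)(x\<^sub>1 \<otimes> \<dots> \<otimes> y\<^sub>1 \<otimes> \<dots>)\<close>.\<close>

definition tensor_concat ::
  "('r, 'k) ring_scheme \<Rightarrow> ('r, 'a) smod \<Rightarrow> nat \<Rightarrow> nat \<Rightarrow> nat \<Rightarrow> nat \<Rightarrow>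
   ('r, 'a) tens \<Rightarrow> ('r, 'a) tens \<Rightarrow> ('r, 'a) tens"
  where "tensor_concat R \<gamma> i j p q X Y =
    (let V = tensor_module R (replicate (i + j) \<gamma>) (p + q) in
      lift_linear R V (\<lambda>(\<sigma>, w). lift_linear R V (\<lambda>(\<tau>, w').
        tensor_class R (replicate (i + j) \<gamma>) (perm_prod p \<sigma> \<tau>) (w @ w')) Y) X)"

definition tensor_talg ::
  "('r, 'k) ring_scheme \<Rightarrow> ('r, 'a) smod \<Rightarrow> ('r, nat \<Rightarrow> ('r, 'a) tens) talg"
  where "tensor_talg R \<gamma> =
    weighted_talg (tensor_power R \<gamma>) (tensor_concat R \<gamma>) (tensor_class R (replicate 0 \<gamma>) id [])"

definition tensor_incl ::
  "('r, 'k) ring_scheme \<Rightarrow> ('r, 'a) smod \<Rightarrow> nat \<Rightarrow> 'a \<Rightarrow> nat \<Rightarrow> ('r, 'a) tens"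
  where "tensor_incl R \<gamma> m x =
    weight_part (tensor_power R \<gamma>) 1 m (tensor_class R [\<gamma>] id [(m, x)])"

text \<open>The element \<open>xy - (12)\<^bsup>|y|,|x|\<^esup>yx\<close> for \<open>x, y\<close> homogeneous of degrees \<open>m, n\<close>.\<close>

definition twisted_commutator ::
  "('r, 'k) ring_scheme \<Rightarrow> ('r, 'a) smod \<Rightarrow> nat \<Rightarrow> nat \<Rightarrow> 'a \<Rightarrow> 'a \<Rightarrow> nat \<Rightarrow> ('r, 'a) tens"
  where "twisted_commutator R \<gamma> m n x y =
    (let T = tensor_talg R \<gamma> in
      tmul T m n (tensor_incl R \<gamma> m x) (tensor_incl R \<gamma> n y)
        \<ominus>\<^bsub>grade T (m + n)\<^esub> act T (m + n) (block_perm (transpose 1 2) [n, m])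
             (tmul T n m (tensor_incl R \<gamma> n y) (tensor_incl R \<gamma> m x)))"

definition sym_ideal ::
  "('r, 'k) ring_scheme \<Rightarrow> ('r, 'a) smod \<Rightarrow> nat \<Rightarrow> (nat \<Rightarrow> ('r, 'a) tens) set"
  where "sym_ideal R \<gamma> =
    ideal_generated R (tensor_talg R \<gamma>)
      (\<lambda>p. {twisted_commutator R \<gamma> m n x y
             | m n x y. m + n = p \<and> x \<in> carrier (grade \<gamma> m) \<and> y \<in> carrier (grade \<gamma> n)})"

text \<open>Here \<open>br m n x y\<close> is the Lie bracket of \<open>x, y\<close> homogeneous of degrees \<open>m, n\<close>.\<close>

definition env_ideal ::
  "('r, 'k) ring_scheme \<Rightarrow> ('r, 'a) smod \<Rightarrow> (nat \<Rightarrow> nat \<Rightarrow> 'a \<Rightarrow> 'a \<Rightarrow> 'a) \<Rightarrow>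
   nat \<Rightarrow> (nat \<Rightarrow> ('r, 'a) tens) set"
  where "env_ideal R \<gamma> br =
    ideal_generated R (tensor_talg R \<gamma>)
      (\<lambda>p. {twisted_commutator R \<gamma> m n x y
               \<ominus>\<^bsub>grade (tensor_talg R \<gamma>) p\<^esub> tensor_incl R \<gamma> p (br m n x y)
             | m n x y. m + n = p \<and> x \<in> carrier (grade \<gamma> m) \<and> y \<in> carrier (grade \<gamma> n)})"

text \<open>In the rest of this section \<open>I\<close> is a twisted ideal of the tensor algebra, such as
  \<^const>\<open>sym_ideal\<close> or \<^const>\<open>env_ideal\<close>.\<close>

definition tensor_quot ::
  "('r, 'k) ring_scheme \<Rightarrow> ('r, 'a) smod \<Rightarrow> (nat \<Rightarrow> (nat \<Rightarrow> ('r, 'a) tens) set) \<Rightarrow>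
   ('r, (nat \<Rightarrow> ('r, 'a) tens) set) talg"
  where "tensor_quot R \<gamma> I = quotient_talg (tensor_talg R \<gamma>) I"

definition quot_incl ::
  "('r, 'k) ring_scheme \<Rightarrow> ('r, 'a) smod \<Rightarrow> (nat \<Rightarrow> (nat \<Rightarrow> ('r, 'a) tens) set) \<Rightarrow>
   nat \<Rightarrow> 'a \<Rightarrow> (nat \<Rightarrow> ('r, 'a) tens) set"
  where "quot_incl R \<gamma> I m x = I m +>\<^bsub>grade (tensor_talg R \<gamma>) m\<^esub> tensor_incl R \<gamma> m x"

text \<open>The degree-\<open>p\<close> part of the image in the quotient of the sum of the \<open>i\<close>-th tensor powers,
  \<open>i \<in> S\<close>.  The \<open>n\<close>-th step of the filtration is the case \<open>S = {..n}\<close>, and \<open>S = {..<n}\<close> is the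
  preceding step (zero for \<open>n = 0\<close>).\<close>

definition tensor_image ::
  "('r, 'k) ring_scheme \<Rightarrow> ('r, 'a) smod \<Rightarrow> (nat \<Rightarrow> (nat \<Rightarrow> ('r, 'a) tens) set) \<Rightarrow>
   nat set \<Rightarrow> nat \<Rightarrow> (nat \<Rightarrow> ('r, 'a) tens) set set"
  where "tensor_image R \<gamma> I S p =
    (\<lambda>t. I p +>\<^bsub>grade (tensor_talg R \<gamma>) p\<^esub> t) `
      {t \<in> carrier (grade (tensor_talg R \<gamma>) p). \<forall>i. i \<notin> S \<longrightarrow> t i = \<zero>\<^bsub>grade (tensor_power R \<gamma> i) p\<^esub>}"

definition gr_part ::
  "('r, 'k) ring_scheme \<Rightarrow> ('r, 'a) smod \<Rightarrow> (nat \<Rightarrow> (nat \<Rightarrow> ('r, 'a) tens) set) \<Rightarrow>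
   nat \<Rightarrow> ('r, (nat \<Rightarrow> ('r, 'a) tens) set set) smod"
  where "gr_part R \<gamma> I n =
    (let A = tensor_quot R \<gamma> I in
      \<lparr>grade = (\<lambda>p. FactModule ((grade A p)\<lparr>carrier := tensor_image R \<gamma> I {..n} p\<rparr>)
                      (tensor_image R \<gamma> I {..<n} p)),
       act = (\<lambda>p \<sigma>. coset_map (grade A p) (tensor_image R \<gamma> I {..<n} p) (act A p \<sigma>))\<rparr>)"

definition gr_talg ::
  "('r, 'k) ring_scheme \<Rightarrow> ('r, 'a) smod \<Rightarrow> (nat \<Rightarrow> (nat \<Rightarrow> ('r, 'a) tens) set) \<Rightarrow>
   ('r, nat \<Rightarrow> (nat \<Rightarrow> ('r, 'a) tens) set set) talg"
  where "gr_talg R \<gamma> I =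
    (let A = tensor_quot R \<gamma> I in
      weighted_talg (gr_part R \<gamma> I)
        (\<lambda>i j p q. coset_map2 (grade A (p + q)) (tensor_image R \<gamma> I {..<i + j} (p + q)) (tmul A p q))
        (tensor_image R \<gamma> I {..<0} 0 +>\<^bsub>grade A 0\<^esub> tone A))"

text \<open>The class in weight \<open>n\<close> of the associated graded algebra of an element \<open>u\<close> of the \<open>n\<close>-th
  step of the filtration.\<close>

definition gr_class ::
  "('r, 'k) ring_scheme \<Rightarrow> ('r, 'a) smod \<Rightarrow> (nat \<Rightarrow> (nat \<Rightarrow> ('r, 'a) tens) set) \<Rightarrow>
   nat \<Rightarrow> nat \<Rightarrow> (nat \<Rightarrow> ('r, 'a) tens) set \<Rightarrow> nat \<Rightarrow> (nat \<Rightarrow> ('r, 'a) tens) set set"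
  where "gr_class R \<gamma> I n p u =
    weight_part (gr_part R \<gamma> I) n p
      (tensor_image R \<gamma> I {..<n} p +>\<^bsub>grade (tensor_quot R \<gamma> I) p\<^esub> u)"

text \<open>The following three predicates determine \<open>\<kappa>\<close>, \<open>\<Delta>\<close> and \<open>\<epsilon>\<close> uniquely on the homogeneous
  components, since the image of \<open>\<gamma>\<close> generates the quotient as a twisted algebra.\<close>

definition canonical_morphism ::
  "('r, 'k) ring_scheme \<Rightarrow> ('r, 'a) smod \<Rightarrow> (nat \<Rightarrow> nat \<Rightarrow> 'a \<Rightarrow> 'a \<Rightarrow> 'a) \<Rightarrow>
   (nat \<Rightarrow> (nat \<Rightarrow> ('r, 'a) tens) set \<Rightarrow> nat \<Rightarrow> (nat \<Rightarrow> ('r, 'a) tens) set set) \<Rightarrow> bool"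
  where "canonical_morphism R \<gamma> br \<kappa> \<longleftrightarrow>
    talg_hom R (tensor_quot R \<gamma> (sym_ideal R \<gamma>)) (gr_talg R \<gamma> (env_ideal R \<gamma> br)) \<kappa> \<and>
    (\<forall>m. \<forall>x\<in>carrier (grade \<gamma> m).
       \<kappa> m (quot_incl R \<gamma> (sym_ideal R \<gamma>) m x) =
       gr_class R \<gamma> (env_ideal R \<gamma> br) 1 m (quot_incl R \<gamma> (env_ideal R \<gamma> br) m x))"

definition standard_coproduct ::
  "('r, 'k) ring_scheme \<Rightarrow> ('r, 'a) smod \<Rightarrow> (nat \<Rightarrow> (nat \<Rightarrow> ('r, 'a) tens) set) \<Rightarrow>
   (nat \<Rightarrow> (nat \<Rightarrow> ('r, 'a) tens) set \<Rightarrow> ('r, (nat \<Rightarrow> ('r, 'a) tens) set) tens) \<Rightarrow> bool"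
  where "standard_coproduct R \<gamma> I \<Delta> \<longleftrightarrow>
    (let A = tensor_quot R \<gamma> I in
      talg_hom R A (tensor_square R A) \<Delta> \<and>
      (\<forall>m. \<forall>x\<in>carrier (grade \<gamma> m).
         \<Delta> m (quot_incl R \<gamma> I m x) =
         tensor_class R [A, A] id [(0, tone A), (m, quot_incl R \<gamma> I m x)]
           \<oplus>\<^bsub>tensor_module R [A, A] m\<^esub>
         tensor_class R [A, A] id [(m, quot_incl R \<gamma> I m x), (0, tone A)]))"

definition standard_counit ::
  "('r, 'k) ring_scheme \<Rightarrow> ('r, 'a) smod \<Rightarrow> (nat \<Rightarrow> (nat \<Rightarrow> ('r, 'a) tens) set) \<Rightarrow>
   (nat \<Rightarrow> (nat \<Rightarrow> ('r, 'a) tens) set \<Rightarrow> 'r) \<Rightarrow> bool"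
  where "standard_counit R \<gamma> I \<epsilon> \<longleftrightarrow>
    talg_hom R (tensor_quot R \<gamma> I) (unit_talg R) \<epsilon> \<and>
    (\<forall>m. \<forall>x\<in>carrier (grade \<gamma> m). \<epsilon> m (quot_incl R \<gamma> I m x) = \<zero>\<^bsub>R\<^esub>)"

definition tcoalg_iso ::
  "('r, 'k) ring_scheme \<Rightarrow>
   ('r, 'a, 'm) smod_scheme \<Rightarrow> (nat \<Rightarrow> 'a \<Rightarrow> ('r, 'a) tens) \<Rightarrow> (nat \<Rightarrow> 'a \<Rightarrow> 'r) \<Rightarrow>
   ('r, 'b, 'n) smod_scheme \<Rightarrow> (nat \<Rightarrow> 'b \<Rightarrow> ('r, 'b) tens) \<Rightarrow> (nat \<Rightarrow> 'b \<Rightarrow> 'r) \<Rightarrow>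
   (nat \<Rightarrow> 'a \<Rightarrow> 'b) \<Rightarrow> bool"
  where "tcoalg_iso R C \<Delta>\<^sub>C \<epsilon>\<^sub>C D \<Delta>\<^sub>D \<epsilon>\<^sub>D f \<longleftrightarrow>
    smod_iso R C D f \<and>
    (\<forall>p. \<forall>x\<in>carrier (grade C p).
       \<Delta>\<^sub>D p (f p x) = tensor_map2 R D f p (\<Delta>\<^sub>C p x) \<and> \<epsilon>\<^sub>D p (f p x) = \<epsilon>\<^sub>C p x)"


section \<open>Twisted pre-Lie algebras\<close>

definition prelie_op ::
  "('r, 'k) ring_scheme \<Rightarrow> ('r, 'a) smod \<Rightarrow> (nat \<Rightarrow> ('r, 'a) tens \<Rightarrow> 'a) \<Rightarrow>
   nat \<Rightarrow> nat \<Rightarrow> 'a \<Rightarrow> 'a \<Rightarrow> 'a"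
  where "prelie_op R \<gamma> c m n x y = c (m + n) (tensor_class R [\<gamma>, \<gamma>] id [(m, x), (n, y)])"

definition twisted_pre_lie_algebra ::
  "('r, 'k) ring_scheme \<Rightarrow> ('r, 'a) smod \<Rightarrow> (nat \<Rightarrow> ('r, 'a) tens \<Rightarrow> 'a) \<Rightarrow> bool"
  where "twisted_pre_lie_algebra R \<gamma> c \<longleftrightarrow>
    smodule R \<gamma> \<and> smod_hom R (tensor R [\<gamma>, \<gamma>]) \<gamma> c \<and>
    (let op = prelie_op R \<gamma> c in
      \<forall>a b d. \<forall>x\<in>carrier (grade \<gamma> a). \<forall>y\<in>carrier (grade \<gamma> b). \<forall>z\<in>carrier (grade \<gamma> d).
        op (a + b) d (op a b x y) z \<ominus>\<^bsub>grade \<gamma> (a + b + d)\<^esub> op a (b + d) x (op b d y z) =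
        act \<gamma> (a + b + d) (block_perm (transpose 2 3) [a, d, b])
          (op (a + d) b (op a d x z) y \<ominus>\<^bsub>grade \<gamma> (a + b + d)\<^esub> op a (d + b) x (op d b z y)))"

definition associated_bracket ::
  "('r, 'k) ring_scheme \<Rightarrow> ('r, 'a) smod \<Rightarrow> (nat \<Rightarrow> ('r, 'a) tens \<Rightarrow> 'a) \<Rightarrow>
   nat \<Rightarrow> nat \<Rightarrow> 'a \<Rightarrow> 'a \<Rightarrow> 'a"
  where "associated_bracket R \<gamma> c m n x y =
    prelie_op R \<gamma> c m n x y
      \<ominus>\<^bsub>grade \<gamma> (m + n)\<^esub> act \<gamma> (m + n) (block_perm (transpose 1 2) [n, m]) (prelie_op R \<gamma> c n m y x)"

end

theory Submission
  imports Defs "HOL-Library.Multiset"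
begin

text \<open>The pre-Lie product extends to \<open>Sym \<gg>\<close> as a derivation \<open>A \<mapsto> A \<circ> x\<close> for each \<open>x\<close> in \<open>\<gg>\<close>, and
  the pre-Lie identity says exactly that \<open>A \<cdot> x = A x + A \<circ> x\<close> makes \<open>Sym \<gg>\<close> a right module over
  \<open>U \<gg>\<close> (Guin and Oudom).  Acting on \<open>1\<close> gives a map \<open>\<psi> : U \<gg> \<rightarrow> Sym \<gg>\<close> that sends \<open>x\<^sub>1 \<dots> x\<^sub>n\<close> to the
  sum of all products obtained by grafting letters onto earlier ones.  Its leading term is
  \<open>x\<^sub>1 \<dots> x\<^sub>n\<close>, so the associated graded of \<open>\<psi>\<close> composed with the canonical epimorphism
  \<open>Sym \<gg> \<rightarrow> gr (U \<gg>)\<close> is the identity; hence that epimorphism is an isomorphism and \<open>\<psi>\<close> is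
  bijective.  Grafting commutes with splitting a word into two complementary subwords, so \<open>\<psi>\<close>
  respects the coproducts, and the required lift is \<open>\<psi>\<inverse>\<close>.\<close>

section \<open>Linear maps, spans and quotients\<close>

text \<open>Over an arbitrary commutative ring there is no symmetrisation map, and \<gamma> need not
  be free or flat, so neither averaging nor a monomial basis is available: \<open>Sym\<close> and
  \<open>U\<close> are accessible only through generators and relations. Maps out of them are
  obtained from functions on words that respect the relations (\<open>wfun\<close>,
  \<open>relfun\<close>, \<open>symfun\<close>), and identities between maps are tested on words.
  The permutations of the twisted setting are absorbed into labels carried by the letters; the
  braiding and the (23) of the pre-Lie identity become mere reordering. \<open>Sym\<close> is
  treated as the enveloping algebra for the zero product, so that the locale \<open>word_op\<close>
  serves both algebras. What distinguishes it is that its ideal is homogeneous for the weight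
  (\<open>S_I_homogeneous\<close>): this gives meaning to the top component, on which the arguments
  by filtration rest. As \<open>psi\<close> need not be multiplicative, its compatibility with the
  coproducts cannot be tested on \<gamma> alone; it follows from the word identity
  \<open>graft_splits\<close>.\<close>

abbreviation mspan :: "('r, 'k) ring_scheme \<Rightarrow> ('r, 'a, 'm) module_scheme \<Rightarrow> 'a set \<Rightarrow> 'a set"
  where "mspan R M S \<equiv> (\<lambda>H. submodule H R M) hull S"

lemma linear_mapI:
  assumes "\<And>x. x \<in> carrier M \<Longrightarrow> f x \<in> carrier N"
    and "\<And>x y. x \<in> carrier M \<Longrightarrow> y \<in> carrier M \<Longrightarrow> f (x \<oplus>\<^bsub>M\<^esub> y) = f x \<oplus>\<^bsub>N\<^esub> f y"
    and "\<And>r x. r \<in> carrier R \<Longrightarrow> x \<in> carrier M \<Longrightarrow> f (r \<odot>\<^bsub>M\<^esub> x) = r \<odot>\<^bsub>N\<^esub> f x"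
  shows "linear_map R M N f"
  using assms by (auto simp: linear_map_def hom_def)

lemma linear_closed: "linear_map R M N f \<Longrightarrow> x \<in> carrier M \<Longrightarrow> f x \<in> carrier N"
  by (auto simp: linear_map_def hom_def)

lemma linear_add: "linear_map R M N f \<Longrightarrow> x \<in> carrier M \<Longrightarrow> y \<in> carrier M \<Longrightarrow>
    f (x \<oplus>\<^bsub>M\<^esub> y) = f x \<oplus>\<^bsub>N\<^esub> f y"
  by (auto simp: linear_map_def hom_def)

lemma linear_smult: "linear_map R M N f \<Longrightarrow> r \<in> carrier R \<Longrightarrow> x \<in> carrier M \<Longrightarrow>
    f (r \<odot>\<^bsub>M\<^esub> x) = r \<odot>\<^bsub>N\<^esub> f x"
  by (auto simp: linear_map_def)

lemma module_cring: "module R M \<Longrightarrow> cring R"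
  and module_abelian_group: "module R M \<Longrightarrow> abelian_group M"
  by (auto simp: module_def)

lemma module_add_closed: "module R M \<Longrightarrow> x \<in> carrier M \<Longrightarrow> y \<in> carrier M \<Longrightarrow> x \<oplus>\<^bsub>M\<^esub> y \<in> carrier M"
  and module_zero_closed: "module R M \<Longrightarrow> \<zero>\<^bsub>M\<^esub> \<in> carrier M"
  and module_minus_closed: "module R M \<Longrightarrow> x \<in> carrier M \<Longrightarrow> y \<in> carrier M \<Longrightarrow> x \<ominus>\<^bsub>M\<^esub> y \<in> carrier M"
  and module_smult_closed: "module R M \<Longrightarrow> r \<in> carrier R \<Longrightarrow> x \<in> carrier M \<Longrightarrow> r \<odot>\<^bsub>M\<^esub> x \<in> carrier M"
proof -
  assume "module R M" then interpret module R M .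
  show "x \<in> carrier M \<Longrightarrow> y \<in> carrier M \<Longrightarrow> x \<oplus>\<^bsub>M\<^esub> y \<in> carrier M"
    "\<zero>\<^bsub>M\<^esub> \<in> carrier M"
    "x \<in> carrier M \<Longrightarrow> y \<in> carrier M \<Longrightarrow> x \<ominus>\<^bsub>M\<^esub> y \<in> carrier M"
    "r \<in> carrier R \<Longrightarrow> x \<in> carrier M \<Longrightarrow> r \<odot>\<^bsub>M\<^esub> x \<in> carrier M" by auto
qed

lemmas module_closed = module_add_closed module_zero_closed module_minus_closed module_smult_closed

lemma linear_zero:
  assumes "module R M" "module R N" "linear_map R M N f"
  shows "f \<zero>\<^bsub>M\<^esub> = \<zero>\<^bsub>N\<^esub>"
proof -
  interpret M: module R M by fact
  interpret N: module R N by fact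
  have "f (\<zero>\<^bsub>R\<^esub> \<odot>\<^bsub>M\<^esub> \<zero>\<^bsub>M\<^esub>) = \<zero>\<^bsub>R\<^esub> \<odot>\<^bsub>N\<^esub> f \<zero>\<^bsub>M\<^esub>"
    by (rule linear_smult[OF assms(3)]) auto
  thus ?thesis using linear_closed[OF assms(3) M.zero_closed] by simp
qed

lemma (in abelian_group) minus_eq_zero_iff:
  assumes "x \<in> carrier G" "y \<in> carrier G"
  shows "x \<ominus> y = \<zero> \<longleftrightarrow> x = y"
  using assms add.inv_solve_right'[of \<zero> x y] by (auto simp: a_minus_def r_neg)

lemma (in abelian_group) minus_eq_iff:
  assumes "x \<in> carrier G" "y \<in> carrier G" "z \<in> carrier G"
  shows "x \<ominus> y = z \<longleftrightarrow> x = z \<oplus> y"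
  using assms add.inv_solve_right[of z x y] by (auto simp: a_minus_def)

lemma (in module) inv_eq_smult: "x \<in> carrier M \<Longrightarrow> \<ominus>\<^bsub>M\<^esub> x = (\<ominus> \<one>) \<odot>\<^bsub>M\<^esub> x"
  by (simp add: smult_l_minus)

lemma linear_inv:
  assumes "module R M" "module R N" "linear_map R M N f" "x \<in> carrier M"
  shows "f (\<ominus>\<^bsub>M\<^esub> x) = \<ominus>\<^bsub>N\<^esub> f x"
proof -
  interpret M: module R M by fact
  interpret N: module R N by fact
  show ?thesis using linear_closed[OF assms(3,4)]
    by (simp add: M.inv_eq_smult N.inv_eq_smult assms(4) linear_smult[OF assms(3)])
qed

lemma linear_minus:
  assumes "module R M" "module R N" "linear_map R M N f" "x \<in> carrier M" "y \<in> carrier M"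
  shows "f (x \<ominus>\<^bsub>M\<^esub> y) = f x \<ominus>\<^bsub>N\<^esub> f y"
proof -
  interpret M: module R M by fact
  show ?thesis using assms
    by (simp add: a_minus_def linear_add[OF assms(3)] linear_inv[OF assms(1-3)])
qed

lemma linear_comp: "linear_map R M N f \<Longrightarrow> linear_map R N L g \<Longrightarrow> linear_map R M L (\<lambda>x. g (f x))"
  by (rule linear_mapI) (auto simp: linear_closed linear_add linear_smult)

lemma linear_cong:
  assumes "linear_map R M N f" "module R M" "\<And>x. x \<in> carrier M \<Longrightarrow> g x = f x"
  shows "linear_map R M N g"
  using assms(1) by (intro linear_mapI)
    (auto simp: assms(3) module_closed[OF assms(2)] linear_closed linear_add linear_smult)

lemma linear_id: "linear_map R M M (\<lambda>x. x)"
  by (rule linear_mapI) auto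

lemma linear_const_zero:
  assumes "module R N"
  shows "linear_map R M N (\<lambda>x. \<zero>\<^bsub>N\<^esub>)"
proof -
  interpret N: module R N by fact
  show ?thesis by (rule linear_mapI) auto
qed

lemma linear_plus:
  assumes "module R N" "linear_map R M N f" "linear_map R M N g"
  shows "linear_map R M N (\<lambda>x. f x \<oplus>\<^bsub>N\<^esub> g x)"
proof -
  interpret N: module R N by fact
  show ?thesis using assms(2,3)
    by (intro linear_mapI)
      (auto simp: linear_closed linear_add linear_smult N.a_ac N.smult_r_distr)
qed

section \<open>Submodules, spans and tests on generators\<close>

lemma (in module) submoduleI':
  assumes "H \<subseteq> carrier M" "\<zero>\<^bsub>M\<^esub> \<in> H"
    and "\<And>a b. a \<in> H \<Longrightarrow> b \<in> H \<Longrightarrow> a \<oplus>\<^bsub>M\<^esub> b \<in> H"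
    and "\<And>a x. a \<in> carrier R \<Longrightarrow> x \<in> H \<Longrightarrow> a \<odot>\<^bsub>M\<^esub> x \<in> H"
  shows "submodule H R M"
  using assms by (intro submoduleI) (auto simp: inv_eq_smult subset_iff)

lemma submoduleD:
  assumes "submodule H R M" "module R M"
  shows "H \<subseteq> carrier M" "\<zero>\<^bsub>M\<^esub> \<in> H" "\<And>a. a \<in> H \<Longrightarrow> \<ominus>\<^bsub>M\<^esub> a \<in> H"
    "\<And>a b. a \<in> H \<Longrightarrow> b \<in> H \<Longrightarrow> a \<oplus>\<^bsub>M\<^esub> b \<in> H"
    "\<And>a b. a \<in> H \<Longrightarrow> b \<in> H \<Longrightarrow> a \<ominus>\<^bsub>M\<^esub> b \<in> H"
    "\<And>r a. r \<in> carrier R \<Longrightarrow> a \<in> H \<Longrightarrow> r \<odot>\<^bsub>M\<^esub> a \<in> H"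
proof -
  interpret module R M by fact
  note E = submoduleE[OF assms(1)]
  show "H \<subseteq> carrier M" "\<And>a. a \<in> H \<Longrightarrow> \<ominus>\<^bsub>M\<^esub> a \<in> H"
    "\<And>a b. a \<in> H \<Longrightarrow> b \<in> H \<Longrightarrow> a \<oplus>\<^bsub>M\<^esub> b \<in> H"
    "\<And>a b. a \<in> H \<Longrightarrow> b \<in> H \<Longrightarrow> a \<ominus>\<^bsub>M\<^esub> b \<in> H"
    "\<And>r a. r \<in> carrier R \<Longrightarrow> a \<in> H \<Longrightarrow> r \<odot>\<^bsub>M\<^esub> a \<in> H" using E by (auto simp: a_minus_def)
  show "\<zero>\<^bsub>M\<^esub> \<in> H" using subgroup.one_closed[OF submodule.axioms(1)[OF assms(1)]] by simp
qed

text \<open>The hull is the intersection of all submodules containing \<open>S\<close>. That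
  \<open>S\<close> lies in the carrier makes this family nonempty, as it contains the whole module;
  otherwise the hull would be the entire type.\<close>

lemma mspan_submodule:
  assumes "module R M" "S \<subseteq> carrier M"
  shows "submodule (mspan R M S) R M"
proof -
  interpret module R M by fact
  note D = submoduleD[OF _ assms(1)]
  have "carrier M \<in> {H. submodule H R M \<and> S \<subseteq> H}" using carrier_is_submodule assms by auto
  thus ?thesis unfolding hull_def
    by (intro submoduleI') (auto intro: D)
qed

lemma mspan_minimal: "S \<subseteq> H \<Longrightarrow> submodule H R M \<Longrightarrow> mspan R M S \<subseteq> H"
  by (rule hull_minimal)

lemma mspan_closed: "module R M \<Longrightarrow> S \<subseteq> carrier M \<Longrightarrow> x \<in> mspan R M S \<Longrightarrow> x \<in> carrier M"
  using submoduleD(1)[OF mspan_submodule] by blast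

text \<open>The elements of the carrier with property \<open>P\<close> form a submodule containing
  \<open>S\<close>, so linear combinations never have to be written out.\<close>

lemma mspan_induct [consumes 3, case_names base zero add smult]:
  assumes "module R M" "S \<subseteq> carrier M" "x \<in> mspan R M S"
    and "\<And>x. x \<in> S \<Longrightarrow> P x" "P \<zero>\<^bsub>M\<^esub>"
    "\<And>x y. x \<in> carrier M \<Longrightarrow> y \<in> carrier M \<Longrightarrow> P x \<Longrightarrow> P y \<Longrightarrow> P (x \<oplus>\<^bsub>M\<^esub> y)"
    "\<And>r x. r \<in> carrier R \<Longrightarrow> x \<in> carrier M \<Longrightarrow> P x \<Longrightarrow> P (r \<odot>\<^bsub>M\<^esub> x)"
  shows "P x"
proof -
  interpret module R M by fact
  have "submodule {x \<in> carrier M. P x} R M"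
    using assms by (intro submoduleI') auto
  moreover have "S \<subseteq> {x \<in> carrier M. P x}" using assms by auto
  ultimately have "mspan R M S \<subseteq> {x \<in> carrier M. P x}" by (intro mspan_minimal)
  thus ?thesis using assms(3) by auto
qed

text \<open>The preimage of a submodule under a linear map is a submodule, so generators suffice.
  With \<open>H\<close> zero this shows that a map kills a module of relations; with other
  \<open>H\<close> it shows that maps preserve ideals and filtrations.\<close>

lemma linear_vanish_mspan:
  assumes "module R M" "module R N" "linear_map R M N f" "S \<subseteq> carrier M"
    "\<And>s. s \<in> S \<Longrightarrow> f s \<in> H" "submodule H R N" "x \<in> mspan R M S"
  shows "f x \<in> H"
proof -
  note D = submoduleD[OF assms(6,2)]
  interpret N: module R N by fact
  show ?thesis using assms(1,4,7)
  proof (induct rule: mspan_induct)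
    case (base x) thus ?case using assms(5) by auto
  next
    case zero thus ?case using D linear_zero[OF assms(1-3)] by simp
  next
    case (add x y) thus ?case using D linear_add[OF assms(3)] by simp
  next
    case (smult r x) thus ?case using D linear_smult[OF assms(3)] by simp
  qed
qed

lemma zero_submodule: "module R M \<Longrightarrow> submodule {\<zero>\<^bsub>M\<^esub>} R M"
proof -
  assume "module R M" then interpret module R M .
  show ?thesis by (rule submoduleI') auto
qed

lemma linear_agree:
  assumes "module R M" "module R N" "linear_map R M N f" "linear_map R M N g" "S \<subseteq> carrier M"
    "\<And>s. s \<in> S \<Longrightarrow> f s = g s" "x \<in> mspan R M S"
  shows "f x = g x"
  using assms(1,5,7)
proof (induct rule: mspan_induct)
  case zero thus ?case using linear_zero[OF assms(1,2)] assms(3,4) by metis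
qed (use assms in \<open>auto simp: linear_add linear_smult\<close>)

section \<open>Bilinear maps\<close>

definition bilinear_map ::
  "('r, 'k) ring_scheme \<Rightarrow> ('r, 'a, 'm) module_scheme \<Rightarrow> ('r, 'b, 'n) module_scheme \<Rightarrow>
   ('r, 'c, 'l) module_scheme \<Rightarrow> ('a \<Rightarrow> 'b \<Rightarrow> 'c) \<Rightarrow> bool"
  where "bilinear_map R M N V f \<longleftrightarrow>
    (\<forall>x\<in>carrier M. linear_map R N V (f x)) \<and> (\<forall>y\<in>carrier N. linear_map R M V (\<lambda>x. f x y))"

lemma bilinear_right: "bilinear_map R M N V f \<Longrightarrow> x \<in> carrier M \<Longrightarrow> linear_map R N V (f x)"
  and bilinear_left: "bilinear_map R M N V f \<Longrightarrow> y \<in> carrier N \<Longrightarrow> linear_map R M V (\<lambda>x. f x y)"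
  by (auto simp: bilinear_map_def)

lemma bilinear_closed: "bilinear_map R M N V f \<Longrightarrow> x \<in> carrier M \<Longrightarrow> y \<in> carrier N \<Longrightarrow> f x y \<in> carrier V"
  using bilinear_right linear_closed by metis

lemma bilinear_agree:
  assumes "module R M" "module R N" "module R V" "bilinear_map R M N V f" "bilinear_map R M N V g"
    "S \<subseteq> carrier M" "T \<subseteq> carrier N" "\<And>s t. s \<in> S \<Longrightarrow> t \<in> T \<Longrightarrow> f s t = g s t"
    "x \<in> mspan R M S" "y \<in> mspan R N T"
  shows "f x y = g x y"
proof -
  have y: "y \<in> carrier N" by (rule mspan_closed[OF assms(2,7,10)])
  have "f s y = g s y" if s: "s \<in> S" for s
  proof -
    have "s \<in> carrier M" using s assms(6) by blast
    from linear_agree[OF assms(2,3) bilinear_right[OF assms(4) this] bilinear_right[OF assms(5) this] assms(7) _ assms(10)]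
    show ?thesis using assms(8)[OF s] by blast
  qed
  from linear_agree[OF assms(1,3) bilinear_left[OF assms(4) y] bilinear_left[OF assms(5) y] assms(6) this assms(9)]
  show ?thesis .
qed

lemma bilinear_vanish_mspan:
  assumes "module R M" "module R N" "module R V" "bilinear_map R M N V f"
    "S \<subseteq> carrier M" "T \<subseteq> carrier N" "\<And>s t. s \<in> S \<Longrightarrow> t \<in> T \<Longrightarrow> f s t \<in> H" "submodule H R V"
    "x \<in> mspan R M S" "y \<in> mspan R N T"
  shows "f x y \<in> H"
proof -
  have y: "y \<in> carrier N" by (rule mspan_closed[OF assms(2,6,10)])
  have "f s y \<in> H" if s: "s \<in> S" for s
  proof -
    have "s \<in> carrier M" using s assms(5) by blast
    from linear_vanish_mspan[OF assms(2,3) bilinear_right[OF assms(4) this] assms(6) _ assms(8,10)]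
    show ?thesis using assms(7)[OF s] by blast
  qed
  from linear_vanish_mspan[OF assms(1,3) bilinear_left[OF assms(4) y] assms(5) this assms(8,9)]
  show ?thesis .
qed

lemma bilinear_comp_linear: "bilinear_map R M N V f \<Longrightarrow> linear_map R V W g \<Longrightarrow>
    bilinear_map R M N W (\<lambda>x y. g (f x y))"
  by (auto simp: bilinear_map_def intro: linear_comp)

lemma bilinear_comp_args:
  assumes "bilinear_map R M N V f" "linear_map R M' M g" "linear_map R N' N h"
  shows "bilinear_map R M' N' V (\<lambda>x y. f (g x) (h y))"
  unfolding bilinear_map_def
  using linear_comp[OF assms(3) bilinear_right[OF assms(1)]] linear_closed[OF assms(2)]
    linear_comp[OF assms(2) bilinear_left[OF assms(1)]] linear_closed[OF assms(3)]
  by blast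

section \<open>Cosets and quotient modules\<close>

lemma submodule_abelian_subgroup:
  assumes "module R M" "submodule N R M"
  shows "abelian_subgroup N M"
  using assms by (intro abelian_subgroupI3 additive_subgroup.intro submodule.axioms(1) module_abelian_group)

lemma mem_coset_iff:
  assumes "module R M" "submodule N R M" "x \<in> carrier M"
  shows "y \<in> N +>\<^bsub>M\<^esub> x \<longleftrightarrow> y \<in> carrier M \<and> N +>\<^bsub>M\<^esub> y = N +>\<^bsub>M\<^esub> x"
proof -
  interpret abelian_subgroup N M by (rule submodule_abelian_subgroup[OF assms(1,2)])
  have "y \<in> carrier M \<Longrightarrow> y \<in> N +>\<^bsub>M\<^esub> y" by (rule a_rcos_self)
  moreover have "N +>\<^bsub>M\<^esub> x = N +>\<^bsub>M\<^esub> y" if "y \<in> N +>\<^bsub>M\<^esub> x"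
    using a_repr_independence'[OF that] assms by blast
  moreover have "y \<in> carrier M" if "y \<in> N +>\<^bsub>M\<^esub> x"
    using a_elemrcos_carrier[OF assms(3) that] .
  ultimately show ?thesis by auto
qed

lemma coset_eq_iff:
  assumes "module R M" "submodule N R M" "x \<in> carrier M" "y \<in> carrier M"
  shows "N +>\<^bsub>M\<^esub> x = N +>\<^bsub>M\<^esub> y \<longleftrightarrow> x \<ominus>\<^bsub>M\<^esub> y \<in> N"
proof -
  interpret abelian_subgroup N M by (rule submodule_abelian_subgroup[OF assms(1,2)])
  show ?thesis
    using a_rcos_module[OF assms(4,3)] mem_coset_iff[OF assms(1,2,4), of x] assms(3)
    by (simp add: a_minus_def)
qed

lemma coset_self: "module R M \<Longrightarrow> submodule N R M \<Longrightarrow> x \<in> carrier M \<Longrightarrow> x \<in> N +>\<^bsub>M\<^esub> x"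
  by (simp add: mem_coset_iff)

lemma coset_zero: "module R M \<Longrightarrow> submodule N R M \<Longrightarrow> N +>\<^bsub>M\<^esub> \<zero>\<^bsub>M\<^esub> = N"
  using abelian_group.a_coset_add_zero module_abelian_group submoduleD(1) by metis

lemma coset_eq_zero_iff:
  assumes "module R M" "submodule N R M" "x \<in> carrier M"
  shows "N +>\<^bsub>M\<^esub> x = N \<longleftrightarrow> x \<in> N"
proof -
  interpret module R M by fact
  have "x \<ominus>\<^bsub>M\<^esub> \<zero>\<^bsub>M\<^esub> = x" using assms by (simp add: a_minus_def)
  thus ?thesis using coset_eq_iff[OF assms module_zero_closed[OF assms(1)]] coset_zero[OF assms(1,2)] by simp
qed

text \<open>\<open>coset_map\<close> is a union over all representatives; it collapses to one coset
  because every representative yields the same one.\<close>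

lemma coset_map_coset:
  assumes "module R M" "submodule N R M" "module R M'" "submodule N' R M'"
    "\<And>x. x \<in> carrier M \<Longrightarrow> f x \<in> carrier M'"
    "\<And>x y. x \<in> carrier M \<Longrightarrow> y \<in> carrier M \<Longrightarrow> N +>\<^bsub>M\<^esub> x = N +>\<^bsub>M\<^esub> y \<Longrightarrow> N' +>\<^bsub>M'\<^esub> f x = N' +>\<^bsub>M'\<^esub> f y"
    "x \<in> carrier M"
  shows "coset_map M' N' f (N +>\<^bsub>M\<^esub> x) = N' +>\<^bsub>M'\<^esub> f x"
proof -
  have "N' +>\<^bsub>M'\<^esub> f y = N' +>\<^bsub>M'\<^esub> f x" if "y \<in> N +>\<^bsub>M\<^esub> x" for y
    using assms(6)[OF _ assms(7)] that[unfolded mem_coset_iff[OF assms(1,2,7)]] by blast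
  moreover have "x \<in> N +>\<^bsub>M\<^esub> x" by (rule coset_self[OF assms(1,2,7)])
  ultimately show ?thesis unfolding coset_map_def by blast
qed

lemma coset_minus_linear:
  assumes "module R M" "submodule N R M" "module R M'" "submodule N' R M'"
    "linear_map R M M' f" "\<And>x. x \<in> N \<Longrightarrow> f x \<in> N'" "x \<in> carrier M" "y \<in> carrier M"
    "N +>\<^bsub>M\<^esub> x = N +>\<^bsub>M\<^esub> y"
  shows "N' +>\<^bsub>M'\<^esub> f x = N' +>\<^bsub>M'\<^esub> f y"
  using assms by (simp add: coset_eq_iff linear_closed linear_minus[OF assms(1,3,5), symmetric])

lemma coset_map_linear:
  assumes "module R M" "submodule N R M" "module R M'" "submodule N' R M'"
    "linear_map R M M' f" "\<And>x. x \<in> N \<Longrightarrow> f x \<in> N'" "x \<in> carrier M"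
  shows "coset_map M' N' f (N +>\<^bsub>M\<^esub> x) = N' +>\<^bsub>M'\<^esub> f x"
  by (rule coset_map_coset[OF assms(1-4) linear_closed[OF assms(5)] coset_minus_linear[OF assms(1-6)] assms(7)])

text \<open>Representatives are changed in one argument at a time. For products in a quotient
  algebra \<open>N\<close>, \<open>K\<close> and \<open>W\<close> are components of the ideal; for
  products in the associated graded algebra they are the preceding filtration steps.\<close>

lemma coset_map2_bilinear:
  assumes "module R M" "module R L" "module R V"
    "submodule N R M" "submodule K R L" "submodule W R V"
    "bilinear_map R M L V f" "\<And>x y. x \<in> N \<Longrightarrow> y \<in> carrier L \<Longrightarrow> f x y \<in> W"
    "\<And>x y. x \<in> carrier M \<Longrightarrow> y \<in> K \<Longrightarrow> f x y \<in> W" "x \<in> carrier M" "y \<in> carrier L"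
  shows "coset_map2 V W f (N +>\<^bsub>M\<^esub> x) (K +>\<^bsub>L\<^esub> y) = W +>\<^bsub>V\<^esub> f x y"
proof -
  have "W +>\<^bsub>V\<^esub> f x' y' = W +>\<^bsub>V\<^esub> f x y" if "x' \<in> N +>\<^bsub>M\<^esub> x" "y' \<in> K +>\<^bsub>L\<^esub> y" for x' y'
  proof -
    from that have *: "x' \<in> carrier M" "N +>\<^bsub>M\<^esub> x' = N +>\<^bsub>M\<^esub> x" "y' \<in> carrier L" "K +>\<^bsub>L\<^esub> y' = K +>\<^bsub>L\<^esub> y"
      by (auto simp: mem_coset_iff[OF assms(1,4,10)] mem_coset_iff[OF assms(2,5,11)])
    have "W +>\<^bsub>V\<^esub> f x' y' = W +>\<^bsub>V\<^esub> f x y'"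
      by (rule coset_minus_linear[OF assms(1,4,3,6) bilinear_left[OF assms(7) *(3)]
            assms(8)[OF _ *(3)] *(1) assms(10) *(2)])
    also have "\<dots> = W +>\<^bsub>V\<^esub> f x y"
      by (rule coset_minus_linear[OF assms(2,5,3,6) bilinear_right[OF assms(7,10)]
            assms(9)[OF assms(10)] *(3) assms(11) *(4)])
    finally show ?thesis .
  qed
  moreover have "x \<in> N +>\<^bsub>M\<^esub> x" "y \<in> K +>\<^bsub>L\<^esub> y"
    by (rule coset_self[OF assms(1,4,10)], rule coset_self[OF assms(2,5,11)])
  ultimately show ?thesis unfolding coset_map2_def by blast
qed

text \<open>The module axioms are equations and the existence of negatives, and these pass to the
  image of a surjection that preserves the operations. Applied to quotients and, with a constant
  map, to the zero module.\<close>

lemma module_image: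
  assumes "module R M" "carrier V = f ` carrier M" "\<zero>\<^bsub>V\<^esub> = f \<zero>\<^bsub>M\<^esub>"
    "\<And>x y. x \<in> carrier M \<Longrightarrow> y \<in> carrier M \<Longrightarrow> f x \<oplus>\<^bsub>V\<^esub> f y = f (x \<oplus>\<^bsub>M\<^esub> y)"
    "\<And>r x. r \<in> carrier R \<Longrightarrow> x \<in> carrier M \<Longrightarrow> r \<odot>\<^bsub>V\<^esub> f x = f (r \<odot>\<^bsub>M\<^esub> x)"
  shows "module R V"
proof -
  interpret module R M by fact
  show ?thesis
  proof (rule moduleI)
    show "abelian_group V"
    proof (rule abelian_groupI)
      fix x assume "x \<in> carrier V"
      then obtain x' where x': "x' \<in> carrier M" "x = f x'" using assms by auto
      have "f (\<ominus>\<^bsub>M\<^esub> x') \<oplus>\<^bsub>V\<^esub> x = \<zero>\<^bsub>V\<^esub>" using x' assms by (simp add: M.l_neg)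
      thus "\<exists>y\<in>carrier V. y \<oplus>\<^bsub>V\<^esub> x = \<zero>\<^bsub>V\<^esub>" using x' assms by blast
    qed (use assms in \<open>auto simp: M.a_ac\<close>)
  qed (use assms in \<open>auto simp: smult_l_distr smult_r_distr smult_assoc1 R.is_cring\<close>)
qed

lemma FactModule_simps:
  "carrier (FactModule M N) = (\<lambda>x. N +>\<^bsub>M\<^esub> x) ` carrier M" "\<zero>\<^bsub>FactModule M N\<^esub> = N"
  by (auto simp: FactModule_def A_RCOSETS_def RCOSETS_def a_r_coset_def)

lemma FactModule_add:
  assumes "module R M" "submodule N R M" "x \<in> carrier M" "y \<in> carrier M"
  shows "(N +>\<^bsub>M\<^esub> x) \<oplus>\<^bsub>FactModule M N\<^esub> (N +>\<^bsub>M\<^esub> y) = N +>\<^bsub>M\<^esub> (x \<oplus>\<^bsub>M\<^esub> y)"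
proof -
  interpret abelian_subgroup N M by (rule submodule_abelian_subgroup[OF assms(1,2)])
  show ?thesis using assms by (simp add: FactModule_def a_rcos_sum)
qed

lemma linear_smult_const:
  assumes "module R M" "r \<in> carrier R"
  shows "linear_map R M M (\<lambda>x. r \<odot>\<^bsub>M\<^esub> x)"
proof -
  interpret module R M by fact
  show ?thesis using assms
    by (intro linear_mapI) (auto simp: smult_r_distr smult_assoc1[symmetric] R.m_comm)
qed

lemma FactModule_smult:
  assumes "module R M" "submodule N R M" "r \<in> carrier R" "x \<in> carrier M"
  shows "r \<odot>\<^bsub>FactModule M N\<^esub> (N +>\<^bsub>M\<^esub> x) = N +>\<^bsub>M\<^esub> (r \<odot>\<^bsub>M\<^esub> x)"
  using assms submoduleD[OF assms(2,1)]
  by (simp add: FactModule_def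
      coset_map_linear[OF assms(1,2,1,2) linear_smult_const])

lemma module_FactModule:
  assumes "module R M" "submodule N R M"
  shows "module R (FactModule M N)"
  by (rule module_image[OF assms(1), where f = "\<lambda>x. N +>\<^bsub>M\<^esub> x"])
    (simp_all add: FactModule_simps coset_zero[OF assms] FactModule_add[OF assms] FactModule_smult[OF assms])

lemma linear_coset:
  assumes "module R M" "submodule N R M"
  shows "linear_map R M (FactModule M N) (\<lambda>x. N +>\<^bsub>M\<^esub> x)"
  by (rule linear_mapI)
    (simp_all add: FactModule_simps FactModule_add[OF assms] FactModule_smult[OF assms])

lemma linear_from_FactModule:
  assumes "module R M" "submodule N R M" "linear_map R M V f"
    "\<And>x. x \<in> carrier M \<Longrightarrow> g (N +>\<^bsub>M\<^esub> x) = f x"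
  shows "linear_map R (FactModule M N) V g"
  using assms(1)
  by (intro linear_mapI)
    (auto simp: FactModule_simps FactModule_add[OF assms(1,2)] FactModule_smult[OF assms(1,2)] assms(4)
      linear_closed[OF assms(3)] linear_add[OF assms(3)] linear_smult[OF assms(3)] module_closed)

text \<open>A linear map that kills \<open>N\<close> is constant on each coset, so the image is a
  singleton. This turns the set-theoretic definition of \<open>lift_linear\<close> into evaluation
  at a representative.\<close>

lemma the_elem_image_coset:
  assumes "module R M" "submodule N R M" "module R V" "linear_map R M V f"
    "\<And>x. x \<in> N \<Longrightarrow> f x = \<zero>\<^bsub>V\<^esub>" "x \<in> carrier M"
  shows "the_elem (f ` (N +>\<^bsub>M\<^esub> x)) = f x"
proof -
  interpret V: module R V by fact
  have "f y = f x" if "y \<in> N +>\<^bsub>M\<^esub> x" for y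
  proof -
    have y: "y \<in> carrier M" "y \<ominus>\<^bsub>M\<^esub> x \<in> N"
      using that mem_coset_iff[OF assms(1,2,6)] coset_eq_iff[OF assms(1,2)] assms(6) by auto
    have "f y \<ominus>\<^bsub>V\<^esub> f x = \<zero>\<^bsub>V\<^esub>"
      using linear_minus[OF assms(1,3,4) y(1) assms(6)] assms(5)[OF y(2)] by simp
    thus ?thesis using V.minus_eq_zero_iff[OF linear_closed[OF assms(4) y(1)]
          linear_closed[OF assms(4) assms(6)]] by simp
  qed
  hence "f ` (N +>\<^bsub>M\<^esub> x) = {f x}" using coset_self[OF assms(1,2,6)] by blast
  thus ?thesis by simp
qed

lemma quotient_linear_exists:
  assumes "module R M" "submodule N R M" "module R V" "linear_map R M V f" "\<And>x. x \<in> N \<Longrightarrow> f x = \<zero>\<^bsub>V\<^esub>"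
  shows "\<exists>g. linear_map R (FactModule M N) V g \<and> (\<forall>x\<in>carrier M. g (N +>\<^bsub>M\<^esub> x) = f x)"
  using linear_from_FactModule[OF assms(1,2,4), of "\<lambda>X. the_elem (f ` X)"] the_elem_image_coset[OF assms]
  by blast

lemma bilinear_from_FactModule:
  assumes "module R M" "submodule N R M" "module R L" "submodule K R L" "bilinear_map R M L V f"
    "\<And>x y. x \<in> carrier M \<Longrightarrow> y \<in> carrier L \<Longrightarrow> g (N +>\<^bsub>M\<^esub> x) (K +>\<^bsub>L\<^esub> y) = f x y"
  shows "bilinear_map R (FactModule M N) (FactModule L K) V g"
  unfolding bilinear_map_def FactModule_simps
  using linear_from_FactModule[OF assms(3,4) bilinear_right[OF assms(5)]]
    linear_from_FactModule[OF assms(1,2) bilinear_left[OF assms(5)]] assms(6) by (auto simp: ball_simps)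

lemma mspan_image_onto:
  assumes "module R M" "module R V" "linear_map R M V f" "carrier V = f ` carrier M"
    "S \<subseteq> carrier M" "carrier M = mspan R M S"
  shows "carrier V = mspan R V (f ` S)"
proof
  have S: "f ` S \<subseteq> carrier V" using assms by auto
  show "mspan R V (f ` S) \<subseteq> carrier V" using mspan_closed[OF assms(2) S] by blast
  show "carrier V \<subseteq> mspan R V (f ` S)"
  proof
    fix y assume "y \<in> carrier V"
    then obtain x where "x \<in> mspan R M S" "y = f x" using assms by auto
    thus "y \<in> mspan R V (f ` S)"
      using linear_vanish_mspan[OF assms(1,2,3,5) _ mspan_submodule[OF assms(2) S]]
        hull_subset[of "f ` S"] by blast
  qed
qed

section \<open>Functions of finite support\<close>

text \<open>Both free modules and direct sums are of this form.\<close>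

definition fin_supp :: "'i set \<Rightarrow> ('i \<Rightarrow> ('r, 'a) module) \<Rightarrow> ('r, 'i \<Rightarrow> 'a) module"
  where "fin_supp I M =
    \<lparr>carrier = {f. (\<forall>i. f i \<in> carrier (M i)) \<and> finite {i. f i \<noteq> \<zero>\<^bsub>M i\<^esub>} \<and> {i. f i \<noteq> \<zero>\<^bsub>M i\<^esub>} \<subseteq> I},
     monoid.mult = undefined, one = undefined, zero = (\<lambda>i. \<zero>\<^bsub>M i\<^esub>),
     add = (\<lambda>f h i. f i \<oplus>\<^bsub>M i\<^esub> h i), smult = (\<lambda>r f i. r \<odot>\<^bsub>M i\<^esub> f i)\<rparr>"

definition single :: "('i \<Rightarrow> ('r, 'a) module) \<Rightarrow> 'i \<Rightarrow> 'a \<Rightarrow> 'i \<Rightarrow> 'a"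
  where "single M i x = (\<lambda>j. if j = i then x else \<zero>\<^bsub>M j\<^esub>)"

text \<open>The map out of a direct sum that is induced by maps \<open>g i\<close> on the
  summands.\<close>

definition supp_sum ::
  "('i \<Rightarrow> ('r, 'a) module) \<Rightarrow> ('r, 'b, 'm) module_scheme \<Rightarrow> ('i \<Rightarrow> 'a \<Rightarrow> 'b) \<Rightarrow> ('i \<Rightarrow> 'a) \<Rightarrow> 'b"
  where "supp_sum M V g f = (\<Oplus>\<^bsub>V\<^esub>i\<in>{i. f i \<noteq> \<zero>\<^bsub>M i\<^esub>}. g i (f i))"

definition self_module :: "('r, 'k) ring_scheme \<Rightarrow> ('r, 'r) module"
  where "self_module R = \<lparr>carrier = carrier R, monoid.mult = undefined, one = undefined,
    zero = \<zero>\<^bsub>R\<^esub>, add = add R, smult = monoid.mult R\<rparr>"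

lemma self_module_simps:
  "carrier (self_module R) = carrier R" "\<zero>\<^bsub>self_module R\<^esub> = \<zero>\<^bsub>R\<^esub>"
  "x \<oplus>\<^bsub>self_module R\<^esub> y = x \<oplus>\<^bsub>R\<^esub> y" "r \<odot>\<^bsub>self_module R\<^esub> x = r \<otimes>\<^bsub>R\<^esub> x"
  by (auto simp: self_module_def)

lemma module_self_module: "cring R \<Longrightarrow> module R (self_module R)"
proof -
  assume "cring R" then interpret cring R .
  have "\<exists>y\<in>carrier R. y \<oplus>\<^bsub>R\<^esub> x = \<zero>\<^bsub>R\<^esub>" if "x \<in> carrier R" for x
    using that l_neg by blast
  thus ?thesis
    by (intro moduleI abelian_groupI)
      (auto simp: self_module_simps is_cring a_ac m_assoc l_distr r_distr)
qed

lemma free_module_eq: "free_module R X = fin_supp X (\<lambda>_. self_module R)"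
  by (auto simp: free_module_def fin_supp_def self_module_simps)

lemma direct_sum_eq: "direct_sum M = fin_supp UNIV M"
  by (auto simp: direct_sum_def fin_supp_def)

locale module_family =
  fixes R :: "('r, 'k) ring_scheme" and I :: "'i set" and M :: "'i \<Rightarrow> ('r, 'a) module"
  assumes modM: "module R (M i)" and cringR: "cring R"
begin

lemma carrier_iff: "f \<in> carrier (fin_supp I M) \<longleftrightarrow>
  (\<forall>i. f i \<in> carrier (M i)) \<and> finite {i. f i \<noteq> \<zero>\<^bsub>M i\<^esub>} \<and> {i. f i \<noteq> \<zero>\<^bsub>M i\<^esub>} \<subseteq> I"
  by (simp add: fin_supp_def)

lemma simps: "\<zero>\<^bsub>fin_supp I M\<^esub> = (\<lambda>i. \<zero>\<^bsub>M i\<^esub>)" "f \<oplus>\<^bsub>fin_supp I M\<^esub> h = (\<lambda>i. f i \<oplus>\<^bsub>M i\<^esub> h i)"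
  "r \<odot>\<^bsub>fin_supp I M\<^esub> f = (\<lambda>i. r \<odot>\<^bsub>M i\<^esub> f i)"
  by (simp_all add: fin_supp_def)

lemma module_fin_supp: "module R (fin_supp I M)"
proof -
  interpret M: module R "M i" for i by (rule modM)
  have sup: "finite {i. F (f i) (g i) i \<noteq> \<zero>\<^bsub>M i\<^esub>} \<and> {i. F (f i) (g i) i \<noteq> \<zero>\<^bsub>M i\<^esub>} \<subseteq> I"
    if "f \<in> carrier (fin_supp I M)" "g \<in> carrier (fin_supp I M)" "\<And>i. F \<zero>\<^bsub>M i\<^esub> \<zero>\<^bsub>M i\<^esub> i = \<zero>\<^bsub>M i\<^esub>" for F f g
  proof -
    have "{i. F (f i) (g i) i \<noteq> \<zero>\<^bsub>M i\<^esub>} \<subseteq> {i. f i \<noteq> \<zero>\<^bsub>M i\<^esub>} \<union> {i. g i \<noteq> \<zero>\<^bsub>M i\<^esub>}"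
      using that(3) by force
    thus ?thesis using that(1,2) unfolding carrier_iff by (meson finite_Un finite_subset le_sup_iff order_trans)
  qed
  show ?thesis
  proof (intro moduleI abelian_groupI cringR)
    fix f assume f: "f \<in> carrier (fin_supp I M)"
    have "(\<lambda>i. \<ominus>\<^bsub>M i\<^esub> f i) \<in> carrier (fin_supp I M)"
      using sup[OF f f, of "\<lambda>x y i. \<ominus>\<^bsub>M i\<^esub> x"] f unfolding carrier_iff by simp
    moreover have "(\<lambda>i. \<ominus>\<^bsub>M i\<^esub> f i) \<oplus>\<^bsub>fin_supp I M\<^esub> f = \<zero>\<^bsub>fin_supp I M\<^esub>"
      using f by (auto simp: simps carrier_iff M.l_neg)
    ultimately show "\<exists>g\<in>carrier (fin_supp I M). g \<oplus>\<^bsub>fin_supp I M\<^esub> f = \<zero>\<^bsub>fin_supp I M\<^esub>" by blast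
  next
    fix f g assume f: "f \<in> carrier (fin_supp I M)" and g: "g \<in> carrier (fin_supp I M)"
    show "f \<oplus>\<^bsub>fin_supp I M\<^esub> g \<in> carrier (fin_supp I M)"
      using sup[OF f g, of "\<lambda>x y i. x \<oplus>\<^bsub>M i\<^esub> y"] f g unfolding carrier_iff simps by simp
  next
    fix r f assume f: "f \<in> carrier (fin_supp I M)" and r: "r \<in> carrier R"
    show "r \<odot>\<^bsub>fin_supp I M\<^esub> f \<in> carrier (fin_supp I M)"
      using sup[OF f f, of "\<lambda>x y i. r \<odot>\<^bsub>M i\<^esub> x"] f r unfolding carrier_iff simps by simp
  qed (auto simp: simps carrier_iff M.a_ac M.smult_l_distr M.smult_r_distr M.smult_assoc1)
qed

lemma single_closed: "i \<in> I \<Longrightarrow> x \<in> carrier (M i) \<Longrightarrow> single M i x \<in> carrier (fin_supp I M)"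
  unfolding carrier_iff
  by (auto simp: single_def module_zero_closed[OF modM] intro: finite_subset[of _ "{i}"] split: if_splits)

lemma linear_single:
  assumes "i \<in> I"
  shows "linear_map R (M i) (fin_supp I M) (single M i)"
proof -
  interpret M: module R "M j" for j by (rule modM)
  have 1: "single M i x \<in> carrier (fin_supp I M)" if "x \<in> carrier (M i)" for x
    by (rule single_closed[OF assms that])
  show ?thesis
    by (rule linear_mapI, rule 1) (auto simp: single_def simps fun_eq_iff)
qed

lemma linear_eval: "linear_map R (fin_supp I M) (M i) (\<lambda>f. f i)"
  by (rule linear_mapI) (auto simp: carrier_iff simps)

text \<open>Induction on the support: setting one nonzero coordinate to zero leaves a function with
  one point less in its support.\<close>

lemma fin_supp_induct [consumes 1, case_names zero add]:
  assumes "f \<in> carrier (fin_supp I M)" "P (\<lambda>i. \<zero>\<^bsub>M i\<^esub>)"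
    "\<And>i x f. i \<in> I \<Longrightarrow> x \<in> carrier (M i) \<Longrightarrow> f \<in> carrier (fin_supp I M) \<Longrightarrow> P f \<Longrightarrow>
       P (single M i x \<oplus>\<^bsub>fin_supp I M\<^esub> f)"
  shows "P f"
proof -
  interpret M: module R "M i" for i by (rule modM)
  have "P f" if "finite S" "f \<in> carrier (fin_supp I M)" "{i. f i \<noteq> \<zero>\<^bsub>M i\<^esub>} = S" for f S
    using that
  proof (induct S arbitrary: f)
    case empty
    hence "f = (\<lambda>i. \<zero>\<^bsub>M i\<^esub>)" by auto
    thus ?case using assms(2) by simp
  next
    case (insert i S)
    define g where "g = f(i := \<zero>\<^bsub>M i\<^esub>)"
    have S: "{j. g j \<noteq> \<zero>\<^bsub>M j\<^esub>} = S" using insert(2,5) by (auto simp: g_def)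
    have g: "g \<in> carrier (fin_supp I M)" using insert(1,4,5) S unfolding carrier_iff by (auto simp: g_def)
    have i: "i \<in> I" "f i \<in> carrier (M i)" using insert(4,5) unfolding carrier_iff by auto
    have "f = single M i (f i) \<oplus>\<^bsub>fin_supp I M\<^esub> g"
      using insert(4) by (auto simp: simps single_def g_def carrier_iff)
    thus ?case using assms(3)[OF i g insert(3)[OF g S]] by simp
  qed
  thus ?thesis using assms(1) carrier_iff by blast
qed

lemma carrier_mspan: "carrier (fin_supp I M) = mspan R (fin_supp I M) {single M i x | i x. i \<in> I \<and> x \<in> carrier (M i)}"
  (is "_ = mspan _ _ ?S")
proof
  have S: "?S \<subseteq> carrier (fin_supp I M)" using single_closed by auto
  show "mspan R (fin_supp I M) ?S \<subseteq> carrier (fin_supp I M)"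
    using mspan_closed[OF module_fin_supp S] by blast
  note D = submoduleD[OF mspan_submodule[OF module_fin_supp S] module_fin_supp]
  show "carrier (fin_supp I M) \<subseteq> mspan R (fin_supp I M) ?S"
  proof
    fix f assume "f \<in> carrier (fin_supp I M)"
    thus "f \<in> mspan R (fin_supp I M) ?S"
    proof (induct rule: fin_supp_induct)
      case zero thus ?case using D(2) by (simp add: simps)
    next
      case (add i x f)
      have "single M i x \<in> mspan R (fin_supp I M) ?S" using add by (intro hull_inc) auto
      thus ?case using add(4) by (rule D(4))
    qed
  qed
qed

text \<open>The index set of \<open>supp_sum\<close> varies with \<open>f\<close>, and a sum of two
  functions may have smaller support than either. Extending all sums to a common finite
  \<open>Y\<close> allows them to be compared termwise.\<close>

lemma supp_sum_mono_neutral: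
  assumes "module R V" "\<And>i. i \<in> I \<Longrightarrow> linear_map R (M i) V (g i)" "f \<in> carrier (fin_supp I M)"
    "finite Y" "{i. f i \<noteq> \<zero>\<^bsub>M i\<^esub>} \<subseteq> Y" "Y \<subseteq> I"
  shows "supp_sum M V g f = (\<Oplus>\<^bsub>V\<^esub>i\<in>Y. g i (f i))"
proof -
  interpret V: module R V by fact
  have cl: "g i (f i) \<in> carrier V" if "i \<in> I" for i
    using linear_closed[OF assms(2)[OF that]] assms(3) unfolding carrier_iff by simp
  show ?thesis unfolding supp_sum_def
  proof (rule V.add.finprod_mono_neutral_cong_left[OF assms(4,5)])
    fix i assume i: "i \<in> Y - {i. f i \<noteq> \<zero>\<^bsub>M i\<^esub>}"
    hence "i \<in> I" using assms(6) by blast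
    from linear_zero[OF modM assms(1) assms(2)[OF this]] i show "g i (f i) = \<zero>\<^bsub>V\<^esub>" by simp
  next
    show "(\<lambda>i. g i (f i)) \<in> Y \<rightarrow> carrier V" using cl assms(6) by blast
  qed simp
qed

lemma supp_sum_closed:
  assumes "module R V" "\<And>i. i \<in> I \<Longrightarrow> linear_map R (M i) V (g i)" "f \<in> carrier (fin_supp I M)"
  shows "supp_sum M V g f \<in> carrier V"
proof -
  interpret V: module R V by fact
  have "g i (f i) \<in> carrier V" if "i \<in> I" for i
    using linear_closed[OF assms(2)[OF that]] assms(3) unfolding carrier_iff by simp
  thus ?thesis using assms(3) unfolding supp_sum_def carrier_iff
    by (intro V.finsum_closed) auto
qed

lemma linear_supp_sum:
  assumes "module R V" "\<And>i. i \<in> I \<Longrightarrow> linear_map R (M i) V (g i)"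
  shows "linear_map R (fin_supp I M) V (supp_sum M V g)"
proof (rule linear_mapI)
  interpret V: module R V by fact
  interpret F: module R "fin_supp I M" by (rule module_fin_supp)
  note cl = supp_sum_closed[OF assms]
  have gcl: "g i (f i) \<in> carrier V" if "i \<in> I" "f \<in> carrier (fin_supp I M)" for i f
    using linear_closed[OF assms(2)[OF that(1)]] that(2) unfolding carrier_iff by simp
  show "\<And>f. f \<in> carrier (fin_supp I M) \<Longrightarrow> supp_sum M V g f \<in> carrier V" by (rule cl)
  {
    fix f h assume f: "f \<in> carrier (fin_supp I M)" and h: "h \<in> carrier (fin_supp I M)"
    define Y where "Y = {i. f i \<noteq> \<zero>\<^bsub>M i\<^esub>} \<union> {i. h i \<noteq> \<zero>\<^bsub>M i\<^esub>} \<union> {i. (f \<oplus>\<^bsub>fin_supp I M\<^esub> h) i \<noteq> \<zero>\<^bsub>M i\<^esub>}"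
    have fh: "f \<oplus>\<^bsub>fin_supp I M\<^esub> h \<in> carrier (fin_supp I M)" using f h by simp
    have Y: "finite Y" "Y \<subseteq> I" using f h fh unfolding Y_def carrier_iff by blast+
    note N = supp_sum_mono_neutral[OF assms _ Y(1) _ Y(2)]
    have "supp_sum M V g (f \<oplus>\<^bsub>fin_supp I M\<^esub> h) = (\<Oplus>\<^bsub>V\<^esub>i\<in>Y. g i ((f \<oplus>\<^bsub>fin_supp I M\<^esub> h) i))"
      by (rule N[OF _ fh]) (auto simp: Y_def)
    also have "\<dots> = (\<Oplus>\<^bsub>V\<^esub>i\<in>Y. g i (f i) \<oplus>\<^bsub>V\<^esub> g i (h i))"
    proof (rule V.add.finprod_cong')
      fix i assume "i \<in> Y" hence i: "i \<in> I" using Y by auto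
      show "g i ((f \<oplus>\<^bsub>fin_supp I M\<^esub> h) i) = g i (f i) \<oplus>\<^bsub>V\<^esub> g i (h i)"
        unfolding simps by (rule linear_add[OF assms(2)[OF i]]) (use f h in \<open>auto simp: carrier_iff\<close>)
    qed (use gcl f h Y in \<open>auto simp: Pi_def subset_iff\<close>)
    also have "\<dots> = (\<Oplus>\<^bsub>V\<^esub>i\<in>Y. g i (f i)) \<oplus>\<^bsub>V\<^esub> (\<Oplus>\<^bsub>V\<^esub>i\<in>Y. g i (h i))"
      by (rule V.finsum_addf) (use gcl f h Y in \<open>auto simp: Pi_def subset_iff\<close>)
    also have "(\<Oplus>\<^bsub>V\<^esub>i\<in>Y. g i (f i)) = supp_sum M V g f"
      by (rule N[OF _ f, symmetric]) (auto simp: Y_def)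
    also have "(\<Oplus>\<^bsub>V\<^esub>i\<in>Y. g i (h i)) = supp_sum M V g h"
      by (rule N[OF _ h, symmetric]) (auto simp: Y_def)
    finally show "supp_sum M V g (f \<oplus>\<^bsub>fin_supp I M\<^esub> h) = supp_sum M V g f \<oplus>\<^bsub>V\<^esub> supp_sum M V g h" .
  next
    fix r f assume r: "r \<in> carrier R" and f: "f \<in> carrier (fin_supp I M)"
    define Y where "Y = {i. f i \<noteq> \<zero>\<^bsub>M i\<^esub>} \<union> {i. (r \<odot>\<^bsub>fin_supp I M\<^esub> f) i \<noteq> \<zero>\<^bsub>M i\<^esub>}"
    have rf: "r \<odot>\<^bsub>fin_supp I M\<^esub> f \<in> carrier (fin_supp I M)" using f r by simp
    have Y: "finite Y" "Y \<subseteq> I" using f rf unfolding Y_def carrier_iff by blast+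
    note N = supp_sum_mono_neutral[OF assms _ Y(1) _ Y(2)]
    have "supp_sum M V g (r \<odot>\<^bsub>fin_supp I M\<^esub> f) = (\<Oplus>\<^bsub>V\<^esub>i\<in>Y. g i ((r \<odot>\<^bsub>fin_supp I M\<^esub> f) i))"
      by (rule N[OF _ rf]) (auto simp: Y_def)
    also have "\<dots> = (\<Oplus>\<^bsub>V\<^esub>i\<in>Y. r \<odot>\<^bsub>V\<^esub> g i (f i))"
    proof (rule V.add.finprod_cong')
      fix i assume "i \<in> Y" hence i: "i \<in> I" using Y by auto
      show "g i ((r \<odot>\<^bsub>fin_supp I M\<^esub> f) i) = r \<odot>\<^bsub>V\<^esub> g i (f i)"
        unfolding simps by (rule linear_smult[OF assms(2)[OF i] r]) (use f in \<open>auto simp: carrier_iff\<close>)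
    qed (use gcl r f Y in \<open>auto simp: Pi_def subset_iff\<close>)
    also have "\<dots> = r \<odot>\<^bsub>V\<^esub> (\<Oplus>\<^bsub>V\<^esub>i\<in>Y. g i (f i))"
      by (rule V.finsum_smult_ldistr[symmetric]) (use gcl r f Y in \<open>auto simp: Pi_def subset_iff\<close>)
    also have "(\<Oplus>\<^bsub>V\<^esub>i\<in>Y. g i (f i)) = supp_sum M V g f"
      by (rule N[OF _ f, symmetric]) (auto simp: Y_def)
    finally show "supp_sum M V g (r \<odot>\<^bsub>fin_supp I M\<^esub> f) = r \<odot>\<^bsub>V\<^esub> supp_sum M V g f" .
  }
qed

lemma supp_sum_single:
  assumes "module R V" "\<And>i. i \<in> I \<Longrightarrow> linear_map R (M i) V (g i)" "i \<in> I" "x \<in> carrier (M i)"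
  shows "supp_sum M V g (single M i x) = g i x"
proof -
  interpret V: module R V by fact
  have s: "{j. single M i x j \<noteq> \<zero>\<^bsub>M j\<^esub>} \<subseteq> {i}" by (auto simp: single_def)
  have "supp_sum M V g (single M i x) = (\<Oplus>\<^bsub>V\<^esub>j\<in>{i}. g j (single M i x j))"
    by (rule supp_sum_mono_neutral[OF assms(1,2) single_closed[OF assms(3,4)] _ s])
      (simp_all add: assms(3))
  also have "\<dots> = g i (single M i x i)"
  proof -
    have "g i (single M i x i) \<in> carrier V"
      using linear_closed[OF assms(2)[OF assms(3)] assms(4)] by (simp add: single_def)
    thus ?thesis by (subst V.finsum_insert) auto
  qed
  finally show ?thesis by (simp add: single_def)
qed

end

section \<open>Free modules\<close>

lemma fin_supp_free: "cring R \<Longrightarrow> module_family R (\<lambda>_. self_module R)"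
  by (simp add: module_family.intro module_self_module)

lemma module_free_module: "cring R \<Longrightarrow> module R (free_module R X)"
  unfolding free_module_eq by (rule module_family.module_fin_supp[OF fin_supp_free])

lemma basis_vec_eq: "basis_vec R x = single (\<lambda>_. self_module R) x \<one>\<^bsub>R\<^esub>"
  by (auto simp: basis_vec_def single_def self_module_simps)

lemma basis_vec_closed: "cring R \<Longrightarrow> x \<in> X \<Longrightarrow> basis_vec R x \<in> carrier (free_module R X)"
  unfolding free_module_eq basis_vec_eq
  by (rule module_family.single_closed[OF fin_supp_free])
    (auto simp: self_module_simps cring.axioms(1) monoid.one_closed ring.is_monoid)

lemma linear_extension_eq:
  "linear_extension R V h = supp_sum (\<lambda>_. self_module R) V (\<lambda>x r. r \<odot>\<^bsub>V\<^esub> h x)"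
  by (auto simp: linear_extension_def supp_sum_def self_module_simps)

lemma linear_smult_vector:
  assumes "module R V" "v \<in> carrier V"
  shows "linear_map R (self_module R) V (\<lambda>r. r \<odot>\<^bsub>V\<^esub> v)"
proof -
  interpret module R V by fact
  show ?thesis using assms by (intro linear_mapI) (auto simp: self_module_simps smult_l_distr smult_assoc1)
qed

lemma linear_linear_extension:
  assumes "module R V" "\<And>x. x \<in> X \<Longrightarrow> h x \<in> carrier V"
  shows "linear_map R (free_module R X) V (linear_extension R V h)"
  unfolding free_module_eq linear_extension_eq
  by (rule module_family.linear_supp_sum[OF fin_supp_free[OF module_cring[OF assms(1)]] assms(1)])
    (rule linear_smult_vector[OF assms(1) assms(2)])

lemma linear_extension_basis_vec:
  assumes "module R V" "\<And>x. x \<in> X \<Longrightarrow> h x \<in> carrier V" "x \<in> X"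
  shows "linear_extension R V h (basis_vec R x) = h x"
proof -
  interpret module R V by fact
  have "linear_extension R V h (basis_vec R x) = \<one>\<^bsub>R\<^esub> \<odot>\<^bsub>V\<^esub> h x"
    unfolding linear_extension_eq basis_vec_eq
    by (rule module_family.supp_sum_single[OF fin_supp_free[OF module_cring[OF assms(1)]] assms(1) _ assms(3)])
      (auto simp: self_module_simps intro: linear_smult_vector[OF assms(1) assms(2)])
  thus ?thesis using assms by simp
qed

lemma carrier_free_module_mspan:
  assumes "cring R"
  shows "carrier (free_module R X) = mspan R (free_module R X) (basis_vec R ` X)" (is "_ = ?R")
proof
  interpret cring R by fact
  let ?F = "free_module R X"
  have S: "basis_vec R ` X \<subseteq> carrier ?F" by (rule image_subsetI) (rule basis_vec_closed[OF assms])
  show "?R \<subseteq> carrier ?F" by (rule subsetI) (rule mspan_closed[OF module_free_module[OF assms] S])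
  note sub = mspan_submodule[OF module_free_module[OF assms] S]
  note D = submoduleD[OF sub module_free_module[OF assms]]
  have "carrier ?F = mspan R ?F {single (\<lambda>_. self_module R) i x | i x. i \<in> X \<and> x \<in> carrier R}"
    using module_family.carrier_mspan[OF fin_supp_free[OF assms], of X] by (simp add: free_module_eq self_module_simps)
  also have "\<dots> \<subseteq> ?R"
  proof (rule mspan_minimal[OF _ sub], clarify)
    fix i x assume ix: "i \<in> X" "x \<in> carrier R"
    have "single (\<lambda>_. self_module R) i x = x \<odot>\<^bsub>?F\<^esub> basis_vec R i"
      using ix by (auto simp: free_module_def basis_vec_def single_def self_module_simps)
    moreover have "x \<odot>\<^bsub>?F\<^esub> basis_vec R i \<in> ?R"
      by (rule D(6)[OF ix(2) hull_inc[OF imageI[OF ix(1)]]])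
    ultimately show "single (\<lambda>_. self_module R) i x \<in> ?R" by simp
  qed
  finally show "carrier ?F \<subseteq> ?R" .
qed

section \<open>Sums over multisets\<close>

text \<open>Splitting and grafting produce words with multiplicity, hence sums over multisets. The
  carrier need not be the whole type, so the sum is folded over some enumeration;
  \<open>foldr_add_mset\<close> shows that the choice is immaterial when all values lie in the
  carrier.\<close>

definition msum :: "('r, 'b, 'm) module_scheme \<Rightarrow> ('x \<Rightarrow> 'b) \<Rightarrow> 'x multiset \<Rightarrow> 'b"
  where "msum V f A = foldr (\<lambda>x s. f x \<oplus>\<^bsub>V\<^esub> s) (SOME xs. mset xs = A) \<zero>\<^bsub>V\<^esub>"

context
  fixes R :: "('r, 'k) ring_scheme" and V :: "('r, 'b, 'm) module_scheme"
  assumes V: "module R V"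
begin

interpretation V: module R V by (rule V)

lemma foldr_add_closed: "(\<And>x. f x \<in> carrier V) \<Longrightarrow> foldr (\<lambda>x s. f x \<oplus>\<^bsub>V\<^esub> s) xs \<zero>\<^bsub>V\<^esub> \<in> carrier V"
  by (induct xs) auto

lemma foldr_add_append:
  assumes "\<And>x. f x \<in> carrier V"
  shows "foldr (\<lambda>x s. f x \<oplus>\<^bsub>V\<^esub> s) (xs @ ys) \<zero>\<^bsub>V\<^esub> =
    foldr (\<lambda>x s. f x \<oplus>\<^bsub>V\<^esub> s) xs \<zero>\<^bsub>V\<^esub> \<oplus>\<^bsub>V\<^esub> foldr (\<lambda>x s. f x \<oplus>\<^bsub>V\<^esub> s) ys \<zero>\<^bsub>V\<^esub>"
  using foldr_add_closed[of f, OF assms]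
  by (induct xs) (auto simp del: foldr_append simp: V.a_ac assms)

lemma foldr_add_mset:
  assumes f: "\<And>x. f x \<in> carrier V"
  shows "mset xs = mset ys \<Longrightarrow>
    foldr (\<lambda>x s. f x \<oplus>\<^bsub>V\<^esub> s) xs \<zero>\<^bsub>V\<^esub> = foldr (\<lambda>x s. f x \<oplus>\<^bsub>V\<^esub> s) ys \<zero>\<^bsub>V\<^esub>"
proof (induct xs arbitrary: ys)
  case (Cons x xs)
  note C = foldr_add_closed[of f, OF assms]
  have "x \<in> set ys" using mset_eq_setD[OF Cons.prems] by auto
  then obtain us vs where ys: "ys = us @ x # vs" by (auto simp: in_set_conv_decomp)
  have "mset xs = mset (us @ vs)" using Cons.prems by (simp add: ys)
  hence "foldr (\<lambda>x s. f x \<oplus>\<^bsub>V\<^esub> s) xs \<zero>\<^bsub>V\<^esub> = foldr (\<lambda>x s. f x \<oplus>\<^bsub>V\<^esub> s) (us @ vs) \<zero>\<^bsub>V\<^esub>"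
    by (rule Cons.hyps)
  thus ?case using f C by (simp del: foldr_append add: ys foldr_add_append[OF f] V.a_ac)
qed simp

lemma msum_mset:
  assumes "\<And>x. f x \<in> carrier V"
  shows "msum V f (mset xs) = foldr (\<lambda>x s. f x \<oplus>\<^bsub>V\<^esub> s) xs \<zero>\<^bsub>V\<^esub>"
  unfolding msum_def by (rule foldr_add_mset[OF assms]) (rule someI, rule refl)

lemma msum_empty: "msum V f {#} = \<zero>\<^bsub>V\<^esub>"
  by (simp add: msum_def)

lemma msum_closed: "(\<And>x. f x \<in> carrier V) \<Longrightarrow> msum V f A \<in> carrier V"
  unfolding msum_def by (rule foldr_add_closed)

lemma msum_add_mset: "(\<And>x. f x \<in> carrier V) \<Longrightarrow> msum V f (add_mset x A) = f x \<oplus>\<^bsub>V\<^esub> msum V f A"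
proof -
  assume f: "\<And>x. f x \<in> carrier V"
  obtain xs where xs: "mset xs = A" using ex_mset by blast
  have "msum V f (mset (x # xs)) = f x \<oplus>\<^bsub>V\<^esub> msum V f (mset xs)"
    by (simp only: msum_mset[of f, OF f] foldr.simps o_apply)
  thus ?thesis by (simp add: xs)
qed

lemma msum_single: "(\<And>x. f x \<in> carrier V) \<Longrightarrow> msum V f {#x#} = f x"
  by (simp add: msum_add_mset msum_empty)

lemma msum_union: "(\<And>x. f x \<in> carrier V) \<Longrightarrow> msum V f (A + B) = msum V f A \<oplus>\<^bsub>V\<^esub> msum V f B"
  by (induct A) (auto simp: msum_empty msum_closed msum_add_mset V.a_ac)

lemma msum_image: "(\<And>x. f x \<in> carrier V) \<Longrightarrow> msum V f (image_mset g A) = msum V (\<lambda>x. f (g x)) A"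
  by (induct A) (auto simp: msum_empty msum_add_mset)

lemma msum_bind: "(\<And>x. f x \<in> carrier V) \<Longrightarrow>
    msum V f (\<Sum>x\<in>#A. F x) = msum V (\<lambda>x. msum V f (F x)) A"
  by (induct A) (auto simp: msum_empty msum_add_mset msum_closed msum_union)

lemma msum_plus: "(\<And>x. f x \<in> carrier V) \<Longrightarrow> (\<And>x. g x \<in> carrier V) \<Longrightarrow>
    msum V (\<lambda>x. f x \<oplus>\<^bsub>V\<^esub> g x) A = msum V f A \<oplus>\<^bsub>V\<^esub> msum V g A"
  by (induct A) (auto simp: msum_empty msum_add_mset msum_closed V.a_ac)

lemma msum_cong: "(\<And>x. f x \<in> carrier V) \<Longrightarrow> (\<And>x. g x \<in> carrier V) \<Longrightarrow> (\<And>x. x \<in># A \<Longrightarrow> f x = g x) \<Longrightarrow>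
    msum V f A = msum V g A"
  by (induct A) (auto simp: msum_empty msum_add_mset)

lemma msum_swap: "(\<And>x y. f x y \<in> carrier V) \<Longrightarrow>
    msum V (\<lambda>x. msum V (f x) B) A = msum V (\<lambda>y. msum V (\<lambda>x. f x y) A) B"
proof (induct A)
  case empty
  show ?case by (induct B) (auto simp: msum_empty msum_add_mset)
next
  case (add x A)
  thus ?case by (simp add: msum_add_mset msum_closed msum_plus)
qed

lemma msum_in_submodule:
  assumes "submodule H R V" "\<And>x. f x \<in> carrier V" "\<And>x. x \<in># A \<Longrightarrow> f x \<in> H"
  shows "msum V f A \<in> H"
  using assms(3)
proof (induct A)
  case empty show ?case using submoduleD(2)[OF assms(1) V] by (simp add: msum_empty)
next
  case (add x A)
  thus ?case using submoduleD(4)[OF assms(1) V, of "f x" "msum V f A"]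
    by (simp add: msum_add_mset[of f, OF assms(2)])
qed

end

lemma linear_msum:
  assumes "module R V" "module R W" "linear_map R V W \<phi>" "\<And>x. f x \<in> carrier V"
  shows "\<phi> (msum V f A) = msum W (\<lambda>x. \<phi> (f x)) A"
proof (induct A)
  case empty show ?case using linear_zero[OF assms(1-3)] by (simp add: msum_empty[OF assms(1)] msum_empty[OF assms(2)])
next
  case (add x A)
  have "msum V f A \<in> carrier V" by (rule msum_closed[OF assms(1,4)])
  with add show ?case using assms(4) linear_closed[OF assms(3) assms(4)]
    by (simp add: msum_add_mset[OF assms(1)] msum_add_mset[OF assms(2)] linear_add[OF assms(3)])
qed

text \<open>Permutations act on \<open>{1..p}\<close>; this keeps the lower bound in that form.\<close>

declare One_nat_def [simp del]

section \<open>Permutations as lists\<close>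

definition iota :: "nat \<Rightarrow> nat list"
  where "iota p = [1..<Suc p]"

text \<open>The permutation \<open>k \<mapsto> L\<^sub>k\<close>, positions being counted from 1.\<close>

definition perm_of :: "nat list \<Rightarrow> nat \<Rightarrow> nat"
  where "perm_of L k = (if k \<in> {1..length L} then L ! (k - 1) else k)"

text \<open>The right action of permutations on positions: \<open>perm_of (plist \<tau> L)\<close>
  is \<open>perm_of L \<circ> \<tau>\<close> (see \<open>perm_of_plist\<close>). The left action on
  values is \<open>map\<close>.\<close>

definition plist :: "(nat \<Rightarrow> nat) \<Rightarrow> nat list \<Rightarrow> nat list"
  where "plist \<tau> L = map (\<lambda>k. perm_of L (\<tau> k)) (iota (length L))"

lemma length_iota [simp]: "length (iota p) = p" and set_iota [simp]: "set (iota p) = {1..p}"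
  and nth_iota [simp]: "i < p \<Longrightarrow> iota p ! i = Suc i" and distinct_iota [simp]: "distinct (iota p)"
  and iota_0 [simp]: "iota 0 = []"
  by (auto simp: iota_def simp del: upt_Suc)

lemma iota_add: "iota (i + j) = iota i @ map (\<lambda>k. k + i) (iota j)"
  by (rule nth_equalityI) (auto simp: nth_append)

lemma map_perm_of_iota [simp]: "map (perm_of L) (iota (length L)) = L"
  by (rule nth_equalityI) (auto simp: perm_of_def)

lemma perm_of_map_iota: "\<sigma> permutes {1..p} \<Longrightarrow> perm_of (map \<sigma> (iota p)) = \<sigma>"
  by (auto simp: perm_of_def fun_eq_iff dest: permutes_not_in)

text \<open>The condition \<open>mset L = mset (iota p)\<close> expresses throughout that
  \<open>L\<close> is the one-line notation of a permutation. In this form it is insensitive to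
  reordering and easy to combine with concatenation.\<close>

lemma mset_eq_iota: "mset L = mset (iota p) \<Longrightarrow> length L = p \<and> set L = {1..p} \<and> distinct L"
  by (metis length_iota set_iota distinct_iota mset_eq_length mset_eq_setD mset_eq_imp_distinct_iff)

lemma perm_of_permutes:
  assumes "mset L = mset (iota p)"
  shows "perm_of L permutes {1..p}"
proof (rule bij_imp_permutes)
  from mset_eq_iota[OF assms] have L: "length L = p" "set L = {1..p}" "distinct L" by auto
  have "perm_of L ` {1..p} = set (map (perm_of L) (iota (length L)))" by (simp add: L)
  hence "perm_of L ` {1..p} = {1..p}" by (metis map_perm_of_iota L(2))
  thus "bij_betw (perm_of L) {1..p} {1..p}"
    by (simp add: bij_betw_def finite_surj_inj)
qed (use mset_eq_iota[OF assms] in \<open>auto simp: perm_of_def\<close>)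

lemma mset_map_permutes:
  assumes "\<sigma> permutes {1..p}"
  shows "mset (map \<sigma> (iota p)) = mset (iota p)"
proof -
  have "mset (map \<sigma> (iota p)) = image_mset \<sigma> (mset_set {1..p})"
    by (metis distinct_iota mset_map mset_set_set set_iota)
  also have "\<dots> = mset_set {1..p}"
    using image_mset_mset_set[OF permutes_inj_on[OF assms, of "{1..p}"]] permutes_image[OF assms] by simp
  finally show ?thesis by (metis distinct_iota mset_set_set set_iota)
qed

lemma mset_map_permutes': "\<sigma> permutes {1..p} \<Longrightarrow> mset (map \<sigma> L) = mset (iota p) \<longleftrightarrow> mset L = mset (iota p)"
proof
  assume s: "\<sigma> permutes {1..p}"
  show "mset L = mset (iota p) \<Longrightarrow> mset (map \<sigma> L) = mset (iota p)"
    using mset_map_permutes[OF s] by (metis mset_map)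
  have i: "inv' \<sigma> permutes {1..p}" using s by (rule permutes_inv)
  assume "mset (map \<sigma> L) = mset (iota p)"
  hence "mset (map (inv' \<sigma>) (map \<sigma> L)) = mset (iota p)" using mset_map_permutes[OF i] by (metis mset_map)
  moreover have "map (inv' \<sigma>) (map \<sigma> L) = L" using permutes_inverses(2)[OF s] by (simp add: o_def)
  ultimately show "mset L = mset (iota p)" by (simp only:)
qed

lemma length_plist [simp]: "length (plist \<tau> L) = length L"
  by (simp add: plist_def)

lemma perm_of_map: "k \<in> {1..length L} \<Longrightarrow> perm_of (map f L) k = f (perm_of L k)"
  by (auto simp: perm_of_def)

lemma permutes_range: "\<tau> permutes {1..n} \<Longrightarrow> k \<in> {1..n} \<Longrightarrow> \<tau> k \<in> {1..n}"
  by (simp only: permutes_in_image)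

lemma map_plist: "\<tau> permutes {1..length L} \<Longrightarrow> map f (plist \<tau> L) = plist \<tau> (map f L)"
  by (auto simp: plist_def perm_of_map permutes_range simp del: atLeastAtMost_iff)

lemma mset_plist: "\<tau> permutes {1..length L} \<Longrightarrow> mset (plist \<tau> L) = mset L"
proof -
  assume t: "\<tau> permutes {1..length L}"
  have "mset (plist \<tau> L) = mset (map (perm_of L) (map \<tau> (iota (length L))))"
    by (simp add: plist_def o_def)
  also have "\<dots> = mset (map (perm_of L) (iota (length L)))"
    by (simp only: mset_map[of "perm_of L"] mset_map_permutes[OF t])
  finally show ?thesis by simp
qed

lemma perm_of_plist:
  assumes "\<tau> permutes {1..length L}"
  shows "perm_of (plist \<tau> L) = perm_of L \<circ> \<tau>"
proof
  fix k
  show "perm_of (plist \<tau> L) k = (perm_of L \<circ> \<tau>) k"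
  proof (cases "k \<in> {1..length L}")
    case True
    hence "perm_of (plist \<tau> L) k = perm_of L (\<tau> k)"
      unfolding plist_def by (subst perm_of_map) (auto simp: perm_of_def)
    thus ?thesis by simp
  next
    case False
    thus ?thesis using permutes_not_in[OF assms False] by (auto simp: perm_of_def)
  qed
qed

lemma plist_id [simp]: "plist id L = L" "plist (\<lambda>x. x) L = L"
  by (simp_all add: plist_def)

lemma perm_of_iota [simp]: "perm_of (iota p) = id"
  by (auto simp: perm_of_def fun_eq_iff)

lemma plist_map_iota:
  assumes "\<tau> permutes {1..p}"
  shows "plist \<tau> (map \<sigma> (iota p)) = map (\<sigma> \<circ> \<tau>) (iota p)"
proof -
  have "perm_of (map \<sigma> (iota p)) (\<tau> k) = \<sigma> (\<tau> k)" if "k \<in> {1..p}" for k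
    using permutes_range[OF assms that] by (simp add: perm_of_map)
  thus ?thesis by (simp add: plist_def)
qed

lemma atLeastAtMost_add: "{1..m + n} = {1..m} \<union> (\<lambda>k. k + m) ` {1..n::nat}"
proof -
  have "set (iota (m + n)) = set (iota m) \<union> (\<lambda>k. k + m) ` set (iota n)" by (simp only: iota_add set_append set_map)
  thus ?thesis by simp
qed

lemma perm_prod_permutes:
  assumes "\<sigma> permutes {1..m}" "\<tau> permutes {1..n}"
  shows "perm_prod m \<sigma> \<tau> permutes {1..m + n}"
proof (rule bij_imp_permutes)
  have s: "\<sigma> ` {1..m} = {1..m}" "\<tau> ` {1..n} = {1..n}" using assms by (simp_all add: permutes_image)
  have "perm_prod m \<sigma> \<tau> ` {1..m + n} = \<sigma> ` {1..m} \<union> (\<lambda>k. m + \<tau> k) ` {1..n}"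
    unfolding atLeastAtMost_add image_Un image_image
    by (intro arg_cong2[where f = "(\<union>)"] image_cong) (auto simp: perm_prod_def)
  also have "(\<lambda>k. m + \<tau> k) ` {1..n} = (\<lambda>k. k + m) ` \<tau> ` {1..n}"
    unfolding image_image by (rule image_cong) auto
  finally have "perm_prod m \<sigma> \<tau> ` {1..m + n} = {1..m + n}" by (simp only: s atLeastAtMost_add)
  thus "bij_betw (perm_prod m \<sigma> \<tau>) {1..m + n} {1..m + n}" by (simp add: bij_betw_def finite_surj_inj)
  fix x assume "x \<notin> {1..m + n}"
  hence "x = 0 \<or> x > m + n" "x \<notin> {1..m}" "x - m \<notin> {1..n}" by auto
  thus "perm_prod m \<sigma> \<tau> x = x"
    using permutes_not_in[OF assms(1), of x] permutes_not_in[OF assms(2), of "x - m"]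
    by (auto simp: perm_prod_def)
qed

lemma plist_perm_prod:
  assumes "\<sigma> permutes {1..length L}" "\<tau> permutes {1..length L'}"
  shows "plist (perm_prod (length L) \<sigma> \<tau>) (L @ L') = plist \<sigma> L @ plist \<tau> L'"
proof -
  have "perm_of (L @ L') (perm_prod (length L) \<sigma> \<tau> k) = perm_of L (\<sigma> k)" if "k \<in> {1..length L}" for k
    using permutes_range[OF assms(1) that] that by (auto simp: perm_prod_def perm_of_def nth_append)
  moreover have "perm_of (L @ L') (perm_prod (length L) \<sigma> \<tau> (k + length L)) = perm_of L' (\<tau> k)" if "k \<in> {1..length L'}" for k
    using permutes_range[OF assms(2) that] that by (auto simp: perm_prod_def perm_of_def nth_append)
  ultimately show ?thesis unfolding plist_def by (simp add: iota_add)
qed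

lemma map_perm_prod:
  assumes "\<tau> permutes {1..n}"
  shows "map (perm_prod m \<sigma> \<tau>) (iota (m + n)) = map \<sigma> (iota m) @ map (\<lambda>k. \<tau> k + m) (iota n)"
  by (simp add: iota_add perm_prod_def)

lemma perm_prods_permutes:
  "list_all2 (\<lambda>i \<tau>. \<tau> permutes {1..i}) ms \<tau>s \<Longrightarrow> perm_prods (zip ms \<tau>s) permutes {1..sum_list ms}"
  by (induct rule: list_all2_induct) (auto intro: perm_prod_permutes simp: permutes_id)

lemma plist_perm_prods:
  "list_all2 (\<lambda>L \<tau>. \<tau> permutes {1..length L}) Ls \<tau>s \<Longrightarrow>
    plist (perm_prods (zip (map length Ls) \<tau>s)) (concat Ls) = concat (map2 plist \<tau>s Ls)"
proof (induct rule: list_all2_induct)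
  case (Cons L Ls \<tau> \<tau>s)
  have "list_all2 (\<lambda>i \<tau>. \<tau> permutes {1..i}) (map length Ls) \<tau>s" using Cons(2) by (simp add: list_all2_map1)
  from perm_prods_permutes[OF this] have "perm_prods (zip (map length Ls) \<tau>s) permutes {1..length (concat Ls)}"
    by (simp add: length_concat)
  from plist_perm_prod[OF Cons(1) this] Cons(3) show ?case by simp
qed simp

section \<open>Block permutations\<close>

text \<open>The two bounds say that \<open>p\<close> lies in the \<open>j\<close>-th block. The
  lower one is strict, which excludes empty blocks and makes \<open>j\<close> the least index of the
  definition. The filtered sum is rewritten with a conditional so that it can be evaluated for a
  concrete number of blocks.\<close>

lemma block_perm_eq:
  assumes "j \<in> {1..length ds}" "sum_list (take (j - 1) ds) < p" "p \<le> sum_list (take j ds)"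
  shows "block_perm \<sigma> ds p =
    (\<Sum>l\<in>{1..length ds}. if \<sigma> l < \<sigma> j then ds ! (l - 1) else 0) + (p - sum_list (take (j - 1) ds))"
proof -
  have mono: "sum_list (take i ds) \<le> sum_list (take k ds)" if "i \<le> k" for i k
    using that by (metis append_take_drop_id le_add1 min.absorb1 sum_list_append take_take)
  have "(LEAST j. p \<le> sum_list (take j ds)) = j"
  proof (rule Least_equality[where P = "\<lambda>j. p \<le> sum_list (take j ds)", OF assms(3)])
    fix y assume y: "p \<le> sum_list (take y ds)"
    show "j \<le> y"
    proof (rule ccontr)
      assume "\<not> j \<le> y" hence "y \<le> j - 1" by simp
      from mono[OF this] y assms(2) show False by simp
    qed
  qed
  moreover have "p \<in> {1..sum_list ds}" using assms(2,3) mono[of j "length ds"] assms(1) by simp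
  ultimately show ?thesis unfolding block_perm_def Let_def
    by (simp add: sum.inter_filter[symmetric])
qed

lemma block_perm_outside: "p \<notin> {1..sum_list ds} \<Longrightarrow> block_perm \<sigma> ds p = p"
  by (auto simp: block_perm_def)

text \<open>The block of size \<open>c\<close> moves past the block of size \<open>b\<close> and
  conversely; everything else is fixed, including 0 and the positions beyond the last block. The
  swaps in lists of three and of two blocks are the cases with \<open>d\<close>, respectively
  \<open>a\<close> and \<open>d\<close>, equal to zero.\<close>

lemma block_perm_23:
  "block_perm (transpose 2 3) [a, c, b, d] p =
    (if p \<le> a then p else if p \<le> a + c then p + b else if p \<le> a + c + b then p - c else p)"
proof -
  have n: "{1..4::nat} = {1, 2, 3, 4}" by auto
  consider "p = 0 \<or> p > a + c + b + d" | "0 < p" "p \<le> a" | "a < p" "p \<le> a + c" | "a + c < p" "p \<le> a + c + b"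
    | "a + c + b < p" "p \<le> a + c + b + d" by linarith
  thus ?thesis
  proof cases
    case 1 thus ?thesis by (auto simp: block_perm_outside)
  next
    case 2 thus ?thesis
      by (subst block_perm_eq[where j = 1]) (auto simp: n transpose_def take_Cons' nth_Cons')
  next
    case 3 thus ?thesis
      by (subst block_perm_eq[where j = 2]) (auto simp: n transpose_def take_Cons' nth_Cons')
  next
    case 4 thus ?thesis
      by (subst block_perm_eq[where j = 3]) (auto simp: n transpose_def take_Cons' nth_Cons')
  next
    case 5 thus ?thesis
      by (subst block_perm_eq[where j = 4]) (auto simp: n transpose_def take_Cons' nth_Cons')
  qed
qed

lemma block_perm_23_short: "block_perm (transpose 2 3) [a, c, b] p = block_perm (transpose 2 3) [a, c, b, 0] p"
proof -
  have n: "{1..3::nat} = {1, 2, 3}" by auto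
  consider "p = 0 \<or> p > a + c + b" | "0 < p" "p \<le> a" | "a < p" "p \<le> a + c" | "a + c < p" "p \<le> a + c + b"
    by linarith
  thus ?thesis
  proof cases
    case 1 thus ?thesis by (auto simp: block_perm_outside block_perm_23)
  next
    case 2 thus ?thesis
      by (subst block_perm_eq[where j = 1]) (auto simp: n transpose_def take_Cons' nth_Cons' block_perm_23)
  next
    case 3 thus ?thesis
      by (subst block_perm_eq[where j = 2]) (auto simp: n transpose_def take_Cons' nth_Cons' block_perm_23)
  next
    case 4 thus ?thesis
      by (subst block_perm_eq[where j = 3]) (auto simp: n transpose_def take_Cons' nth_Cons' block_perm_23)
  qed
qed

lemma block_perm_12: "block_perm (transpose 1 2) [c, b] p = block_perm (transpose 2 3) [0, c, b, 0] p"
proof -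
  have n: "{1..2::nat} = {1, 2}" by auto
  consider "p = 0 \<or> p > c + b" | "0 < p" "p \<le> c" | "c < p" "p \<le> c + b"
    by linarith
  thus ?thesis
  proof cases
    case 1 thus ?thesis by (auto simp: block_perm_outside block_perm_23)
  next
    case 2 thus ?thesis
      by (subst block_perm_eq[where j = 1]) (auto simp: n transpose_def take_Cons' nth_Cons' block_perm_23)
  next
    case 3 thus ?thesis
      by (subst block_perm_eq[where j = 2]) (auto simp: n transpose_def take_Cons' nth_Cons' block_perm_23)
  qed
qed

text \<open>At each position of the result \<open>plist\<close> reads the entry at its image, so the
  sizes given to \<open>block_perm\<close> are those of the blocks of the result, in the order
  \<open>A\<close>, \<open>C\<close>, \<open>B\<close>, \<open>D\<close>.\<close>

lemma plist_block_perm_23: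
  assumes "length A = a" "length B = b" "length C = c" "length D = d"
  shows "plist (block_perm (transpose 2 3) [a, c, b, d]) (A @ B @ C @ D) = A @ C @ B @ D"
proof -
  have seg: "map (\<lambda>k. perm_of (A @ B @ C @ D) (block_perm (transpose 2 3) [a, c, b, d] (k + s))) (iota (length X)) = X"
    if "\<And>i. i < length X \<Longrightarrow> perm_of (A @ B @ C @ D) (block_perm (transpose 2 3) [a, c, b, d] (Suc i + s)) = X ! i" for X s
    using that by (intro nth_equalityI) auto
  note [simp] = block_perm_23 perm_of_def nth_append assms[symmetric]
  have "length (A @ B @ C @ D) = ((length A + length C) + length B) + length D" by simp
  hence "plist (block_perm (transpose 2 3) [a, c, b, d]) (A @ B @ C @ D) =
    map (\<lambda>k. perm_of (A @ B @ C @ D) (block_perm (transpose 2 3) [a, c, b, d] (k + 0))) (iota (length A)) @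
    map (\<lambda>k. perm_of (A @ B @ C @ D) (block_perm (transpose 2 3) [a, c, b, d] (k + length A))) (iota (length C)) @
    map (\<lambda>k. perm_of (A @ B @ C @ D) (block_perm (transpose 2 3) [a, c, b, d] (k + (length A + length C)))) (iota (length B)) @
    map (\<lambda>k. perm_of (A @ B @ C @ D) (block_perm (transpose 2 3) [a, c, b, d] (k + (length A + length C + length B)))) (iota (length D))"
    by (simp only: plist_def iota_add map_append map_map o_def append_assoc add_0_right)
  also have "\<dots> = A @ C @ B @ D"
    by (intro arg_cong2[where f = "(@)"] seg) auto
  finally show ?thesis .
qed

lemma block_perm_23_permutes:
  assumes "p = a + c + b + d"
  shows "block_perm (transpose 2 3) [a, c, b, d] permutes {1..p}"
proof (rule bij_imp_permutes)
  let ?f = "block_perm (transpose 2 3) [a, c, b, d]" and ?g = "block_perm (transpose 2 3) [a, b, c, d]"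
  show "bij_betw ?f {1..p} {1..p}"
    by (rule bij_betw_byWitness[where f' = ?g]) (auto simp: block_perm_23 assms)
qed (auto simp: block_perm_outside assms)

lemma block_perm_23_short_permutes: "p = a + c + b \<Longrightarrow> block_perm (transpose 2 3) [a, c, b] permutes {1..p}"
  using block_perm_23_permutes[of p a c b 0] by (simp add: block_perm_23_short[abs_def])

lemma block_perm_12_permutes: "p = c + b \<Longrightarrow> block_perm (transpose 1 2) [c, b] permutes {1..p}"
  using block_perm_23_permutes[of p 0 c b 0] by (simp add: block_perm_12[abs_def])

lemma plist_block_perm_23_short:
  assumes "length A = a" "length B = b" "length C = c"
  shows "plist (block_perm (transpose 2 3) [a, c, b]) (A @ B @ C) = A @ C @ B"
  using plist_block_perm_23[OF assms, of "[]" 0] by (simp add: block_perm_23_short[abs_def])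

lemma plist_block_perm_12:
  assumes "length B = b" "length C = c"
  shows "plist (block_perm (transpose 1 2) [c, b]) (B @ C) = C @ B"
  using plist_block_perm_23[OF _ assms, of "[]" 0 "[]" 0] by (simp add: block_perm_12[abs_def])

section \<open>Labelled words\<close>

text \<open>A generator \<open>\<sigma> \<otimes> (x\<^sub>1 \<otimes> \<dots> \<otimes> x\<^sub>n)\<close> is encoded by the word whose \<open>j\<close>-th letter is
  \<open>x\<^sub>j\<close> labelled by the list of values of \<open>\<sigma>\<close> on the \<open>j\<close>-th block of positions.  The symmetric
  group then acts by relabelling, and the twisted commutation relation merely exchanges two
  letters together with their labels.\<close>

type_synonym 'a letter = "nat list \<times> 'a"
type_synonym 'a word = "'a letter list"

fun lab :: "(nat \<Rightarrow> nat) \<Rightarrow> (nat \<times> 'a) list \<Rightarrow> 'a word"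
  where
    "lab \<sigma> [] = []"
  | "lab \<sigma> ((i, x) # w) = (map \<sigma> (iota i), x) # lab (\<lambda>k. \<sigma> (k + i)) w"

definition plain :: "'a word \<Rightarrow> (nat \<times> 'a) list"
  where "plain w = map (\<lambda>(l, x). (length l, x)) w"

definition labels :: "'a word \<Rightarrow> nat list"
  where "labels w = concat (map fst w)"

definition relabel :: "(nat \<Rightarrow> nat) \<Rightarrow> 'a word \<Rightarrow> 'a word"
  where "relabel f w = map (\<lambda>(l, x). (map f l, x)) w"

abbreviation shift :: "nat \<Rightarrow> 'a word \<Rightarrow> 'a word"
  where "shift m \<equiv> relabel (\<lambda>k. k + m)"

lemma labels_simps [simp]: "labels [] = []" "labels (a # w) = fst a @ labels w"
  "labels (u @ v) = labels u @ labels v" "labels (relabel f w) = map f (labels w)"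
  by (auto simp: labels_def relabel_def map_concat o_def case_prod_beta)

lemma plain_simps [simp]: "plain [] = []" "plain ((l, x) # w) = (length l, x) # plain w"
  "plain (u @ v) = plain u @ plain v" "plain (relabel f w) = plain w" "length (plain w) = length w"
  by (auto simp: plain_def relabel_def)

lemma relabel_simps [simp]: "relabel f [] = []" "relabel f ((l, x) # w) = (map f l, x) # relabel f w"
  "relabel f (u @ v) = relabel f u @ relabel f v" "length (relabel f w) = length w"
  by (auto simp: relabel_def)

lemma relabel_comp: "relabel f (relabel g w) = relabel (f \<circ> g) w"
  by (auto simp: relabel_def)

lemma relabel_cong: "(\<And>k. k \<in> set (labels w) \<Longrightarrow> f k = g k) \<Longrightarrow> relabel f w = relabel g w"
  by (induct w) auto

lemma relabel_id [simp]: "relabel id w = w" "relabel (\<lambda>k. k) w = w"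
  by (induct w) auto

lemma sum_plain: "sum_list (map fst (plain w)) = length (labels w)"
  by (induct w) auto

lemma plain_lab [simp]: "plain (lab \<sigma> w) = w"
  by (induct \<sigma> w rule: lab.induct) auto

lemma length_lab [simp]: "length (lab \<sigma> w) = length w"
  by (induct \<sigma> w rule: lab.induct) auto

lemma labels_lab: "labels (lab \<sigma> w) = map \<sigma> (iota (sum_list (map fst w)))"
  by (induct \<sigma> w rule: lab.induct) (auto simp: iota_add)

lemma lab_append: "lab \<sigma> (u @ v) = lab \<sigma> u @ lab (\<lambda>k. \<sigma> (k + sum_list (map fst u))) v"
  by (induct \<sigma> u rule: lab.induct) (auto simp: ac_simps)

lemma relabel_lab: "relabel f (lab \<sigma> w) = lab (\<lambda>k. f (\<sigma> k)) w"
  by (induct \<sigma> w rule: lab.induct) (auto simp: o_def)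

lemma lab_cong: "(\<And>k. k \<in> {1..sum_list (map fst w)} \<Longrightarrow> \<sigma> k = \<tau> k) \<Longrightarrow> lab \<sigma> w = lab \<tau> w"
proof (induct \<sigma> w arbitrary: \<tau> rule: lab.induct)
  case (2 \<sigma> i x w)
  have "lab (\<lambda>k. \<sigma> (k + i)) w = lab (\<lambda>k. \<tau> (k + i)) w" by (rule 2(1)) (use 2(2) in auto)
  thus ?case using 2(2) by auto
qed simp

text \<open>Together with \<open>plain_lab\<close> and \<open>labels_lab\<close> this makes
  generators and labelled words correspond: the permutation is recovered from the concatenated
  labels.\<close>

lemma lab_perm_of: "lab (perm_of (labels w)) (plain w) = w"
proof -
  \<comment> \<open>The recursion of \<open>lab\<close> shifts positions by the lengths already
    read; the prefix \<open>L\<close> records the labels of the letters that have been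
    passed.\<close>
  have "lab (\<lambda>k. perm_of (L @ labels w) (k + length L)) (plain w) = w" for L
  proof (induct w arbitrary: L)
    case (Cons a w)
    obtain l x where a: "a = (l, x)" by (cases a)
    have "map (\<lambda>k. perm_of (L @ l @ labels w) (k + length L)) (iota (length l)) = l"
      by (rule nth_equalityI) (auto simp: perm_of_def nth_append)
    thus ?case using Cons[of "L @ l"] by (simp add: a ac_simps)
  qed simp
  from this[of "[]"] show ?thesis by simp
qed

text \<open>The second factor of \<open>perm_prod\<close> acts on the positions after
  \<open>m\<close> and takes values there. Hence the product of the tensor algebra becomes
  concatenation of words with the labels of the second word shifted.\<close>

lemma lab_perm_prod:
  assumes "sum_list (map fst w) = m"
  shows "lab (perm_prod m \<sigma> \<tau>) (w @ w') = lab \<sigma> w @ shift m (lab \<tau> w')"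
proof -
  have "lab (perm_prod m \<sigma> \<tau>) w = lab \<sigma> w" using assms by (intro lab_cong) (auto simp: perm_prod_def)
  moreover have "lab (\<lambda>k. perm_prod m \<sigma> \<tau> (k + m)) w' = lab (\<lambda>k. \<tau> k + m) w'"
    by (rule lab_cong) (auto simp: perm_prod_def)
  ultimately show ?thesis using assms by (simp add: lab_append relabel_lab)
qed

section \<open>Splitting and grafting\<close>

text \<open>The unshuffle coproduct: a word of length n has 2^n splittings into complementary
  subwords, counted with multiplicity.\<close>

fun splits :: "'l list \<Rightarrow> ('l list \<times> 'l list) multiset"
  where
    "splits [] = {#([], [])#}"
  | "splits (a # w) = image_mset (\<lambda>(s, t). (a # s, t)) (splits w) + image_mset (\<lambda>(s, t). (s, a # t)) (splits w)"

text \<open>\<open>attach\<close> is the derivation \<open>u \<mapsto> u \<circ> a\<close>, and \<open>graft u v\<close> results from \<open>u\<close> by letting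
  the letters \<open>a\<close> of \<open>v\<close> act successively by \<open>u \<mapsto> ua + u \<circ> a\<close>.\<close>

fun attach :: "('l \<Rightarrow> 'l \<Rightarrow> 'l) \<Rightarrow> 'l list \<Rightarrow> 'l \<Rightarrow> 'l list multiset"
  where
    "attach f [] a = {#}"
  | "attach f (b # u) a = add_mset (f b a # u) (image_mset ((#) b) (attach f u a))"

fun graft :: "('l \<Rightarrow> 'l \<Rightarrow> 'l) \<Rightarrow> 'l list \<Rightarrow> 'l list \<Rightarrow> 'l list multiset"
  where
    "graft f u [] = {#u#}"
  | "graft f u (a # v) = graft f (u @ [a]) v + (\<Sum>u'\<in>#attach f u a. graft f u' v)"

definition mprod :: "'x multiset \<Rightarrow> 'y multiset \<Rightarrow> ('x \<times> 'y) multiset"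
  where "mprod X Y = (\<Sum>x\<in>#X. image_mset (Pair x) Y)"

lemma sum_mset_bind: "(\<Sum>x\<in>#(\<Sum>y\<in>#A. F y). G x) = (\<Sum>y\<in>#A. \<Sum>x\<in>#F y. (G x :: 'z multiset))"
  by (induct A) auto

lemma sum_mset_swap: "(\<Sum>x\<in>#A. \<Sum>y\<in>#B. (F x y :: 'z multiset)) = (\<Sum>y\<in>#B. \<Sum>x\<in>#A. F x y)"
  by (induct A) (auto simp: sum_mset.distrib)

lemma image_sum_mset: "image_mset f (\<Sum>x\<in>#A. F x) = (\<Sum>x\<in>#A. image_mset f (F x))"
  by (induct A) auto

lemma sum_mset_add_mset: "(\<Sum>x\<in>#A. add_mset (g x) (H x)) = image_mset g A + (\<Sum>x\<in>#A. H x)"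
  by (induct A) auto

lemma attach_append: "attach f (u @ v) a =
    image_mset (\<lambda>u'. u' @ v) (attach f u a) + image_mset (\<lambda>v'. u @ v') (attach f v a)"
  by (induct u) (auto simp: multiset.map_comp o_def)

lemma splits_append: "splits (u @ v) =
    (\<Sum>p\<in>#splits u. image_mset (\<lambda>q. (fst p @ fst q, snd p @ snd q)) (splits v))"
proof (induct u)
  case Nil show ?case by (simp add: case_prod_beta)
next
  case (Cons a u)
  show ?case by (simp add: Cons image_sum_mset multiset.map_comp o_def case_prod_beta)
qed

text \<open>Grafting replaces one letter by one letter, and the new letter goes to the side of the
  old one. So the derivation \<open>attach\<close> is also a coderivation for the unshuffle
  coproduct.\<close>

lemma splits_attach: "(\<Sum>u'\<in>#attach f u a. splits u') =
    (\<Sum>p\<in>#splits u. image_mset (\<lambda>s. (s, snd p)) (attach f (fst p) a) +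
       image_mset (\<lambda>t. (fst p, t)) (attach f (snd p) a))"
proof (induct u)
  case (Cons b u)
  have "(\<Sum>u'\<in>#attach f u a. splits (b # u')) =
    image_mset (\<lambda>(s, t). (b # s, t)) (\<Sum>u'\<in>#attach f u a. splits u') +
    image_mset (\<lambda>(s, t). (s, b # t)) (\<Sum>u'\<in>#attach f u a. splits u')"
    by (simp add: image_sum_mset sum_mset.distrib)
  thus ?case unfolding Cons
    by (simp add: image_sum_mset multiset.map_comp o_def case_prod_unfold sum_mset_add_mset
        sum_mset.distrib)
qed simp

lemma mprod_plus: "mprod (X + X') Y = mprod X Y + mprod X' Y" "mprod X (Y + Y') = mprod X Y + mprod X Y'"
  by (auto simp: mprod_def sum_mset.distrib)

lemma mprod_sum: "mprod (\<Sum>x\<in>#A. F x) Y = (\<Sum>x\<in>#A. mprod (F x) Y)" "mprod X (\<Sum>x\<in>#A. G x) = (\<Sum>x\<in>#A. mprod X (G x))"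
  by (induct A) (auto simp: mprod_plus, auto simp: mprod_def)

lemma splits_snoc: "splits (u @ [a]) = (\<Sum>p\<in>#splits u. {#(fst p @ [a], snd p), (fst p, snd p @ [a])#})"
  unfolding splits_append by (simp add: add_mset_commute)

text \<open>Both ways in which a letter acts respect splitting: an appended letter joins one of the
  two parts (\<open>splits_snoc\<close>), and a grafted one is grafted inside one of them
  (\<open>splits_attach\<close>). Induction on the acting word then gives the word form of the
  statement that \<open>psi\<close> respects coproducts.\<close>

lemma graft_splits: "(\<Sum>w'\<in>#graft f u w. splits w') =
    (\<Sum>p\<in>#splits u. \<Sum>q\<in>#splits w. mprod (graft f (fst p) (fst q)) (graft f (snd p) (snd q)))"
proof (induct w arbitrary: u)
  case Nil
  show ?case by (simp add: mprod_def)
next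
  case (Cons a w)
  let ?G = "\<lambda>p. \<Sum>q\<in>#splits w. mprod (graft f (fst p) (fst q)) (graft f (snd p) (snd q))"
  have "(\<Sum>w'\<in>#graft f u (a # w). splits w') =
      (\<Sum>p\<in>#splits (u @ [a]). ?G p) + (\<Sum>u'\<in>#attach f u a. \<Sum>p\<in>#splits u'. ?G p)"
    by (simp add: sum_mset_bind Cons)
  also have "(\<Sum>u'\<in>#attach f u a. \<Sum>p\<in>#splits u'. ?G p) =
     (\<Sum>p\<in>#(\<Sum>u'\<in>#attach f u a. splits u'). ?G p)"
    by (simp add: sum_mset_bind)
  also have "\<dots> = (\<Sum>p\<in>#splits u. (\<Sum>s\<in>#attach f (fst p) a. ?G (s, snd p)) + (\<Sum>t\<in>#attach f (snd p) a. ?G (fst p, t)))"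
    unfolding splits_attach by (simp add: sum_mset_bind multiset.map_comp o_def)
  also have "(\<Sum>p\<in>#splits (u @ [a]). ?G p) = (\<Sum>p\<in>#splits u. ?G (fst p @ [a], snd p) + ?G (fst p, snd p @ [a]))"
    unfolding splits_snoc by (simp add: sum_mset_bind)
  finally show ?case
    by (simp add: sum_mset.distrib multiset.map_comp o_def case_prod_beta mprod_plus mprod_sum ac_simps
      sum_mset_swap[of _ "splits w"])
qed

section \<open>S-modules and tensor products\<close>

text \<open>The content of \<open>smodule\<close> in equational form, with \<open>permutes\<close>
  in place of the carrier of \<open>sym_group\<close>. The tensor algebra and its quotients are
  shown to satisfy it too.\<close>

definition sym_module :: "('r, 'k) ring_scheme \<Rightarrow> ('r, 'a, 'm) smod_scheme \<Rightarrow> bool"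
  where "sym_module R M \<longleftrightarrow> (\<forall>m.
    module R (grade M m) \<and>
    (\<forall>\<sigma>. \<sigma> permutes {1..m} \<longrightarrow> linear_map R (grade M m) (grade M m) (act M m \<sigma>)) \<and>
    (\<forall>x\<in>carrier (grade M m). act M m id x = x) \<and>
    (\<forall>\<sigma> \<tau>. \<forall>x\<in>carrier (grade M m). \<sigma> permutes {1..m} \<longrightarrow> \<tau> permutes {1..m} \<longrightarrow>
       act M m (\<sigma> \<circ> \<tau>) x = act M m \<sigma> (act M m \<tau> x)))"

lemma sym_moduleD:
  assumes "sym_module R M"
  shows "module R (grade M m)"
    and "\<sigma> permutes {1..m} \<Longrightarrow> linear_map R (grade M m) (grade M m) (act M m \<sigma>)"
    and "x \<in> carrier (grade M m) \<Longrightarrow> act M m id x = x"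
    and "x \<in> carrier (grade M m) \<Longrightarrow> \<sigma> permutes {1..m} \<Longrightarrow> \<tau> permutes {1..m} \<Longrightarrow>
       act M m (\<sigma> \<circ> \<tau>) x = act M m \<sigma> (act M m \<tau> x)"
    and "x \<in> carrier (grade M m) \<Longrightarrow> \<sigma> permutes {1..m} \<Longrightarrow> act M m \<sigma> x \<in> carrier (grade M m)"
proof -
  show L: "\<sigma> permutes {1..m} \<Longrightarrow> linear_map R (grade M m) (grade M m) (act M m \<sigma>)" for \<sigma>
    using assms unfolding sym_module_def by blast
  show "x \<in> carrier (grade M m) \<Longrightarrow> \<sigma> permutes {1..m} \<Longrightarrow> act M m \<sigma> x \<in> carrier (grade M m)"
    using linear_closed[OF L] by blast
qed (use assms in \<open>unfold sym_module_def, blast+\<close>)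

lemma smodule_sym_module:
  assumes "smodule R M"
  shows "sym_module R M"
proof -
  have m: "module R (grade M m)"
    and g: "group_action (sym_group m) (carrier (grade M m)) (\<lambda>\<sigma>. restrict (act M m \<sigma>) (carrier (grade M m)))"
    and l: "\<sigma> permutes {1..m} \<Longrightarrow> linear_map R (grade M m) (grade M m) (act M m \<sigma>)" for m \<sigma>
    using assms by (auto simp: smodule_def sym_group_carrier)
  have "act M m id x = x" if "x \<in> carrier (grade M m)" for m x
  proof -
    interpret group_action "sym_group m" "carrier (grade M m)" "\<lambda>\<sigma>. restrict (act M m \<sigma>) (carrier (grade M m))"
      by (rule g)
    from fun_cong[OF id_eq_one, of x] that show ?thesis by (simp add: sym_group_one)
  qed
  moreover have "act M m (\<sigma> \<circ> \<tau>) x = act M m \<sigma> (act M m \<tau> x)"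
    if "x \<in> carrier (grade M m)" "\<sigma> permutes {1..m}" "\<tau> permutes {1..m}" for m \<sigma> \<tau> x
  proof -
    interpret group_action "sym_group m" "carrier (grade M m)" "\<lambda>\<sigma>. restrict (act M m \<sigma>) (carrier (grade M m))"
      by (rule g)
    from composition_rule[of x \<sigma> \<tau>] that linear_closed[OF l[OF that(3)] that(1)] show ?thesis
      by (simp add: sym_group_carrier sym_group_mult)
  qed
  ultimately show ?thesis using m l unfolding sym_module_def by blast
qed

text \<open>What a function on generators must satisfy in order to descend to the tensor product:
  the three families of \<open>tensor_relations\<close>. A factor is singled out by a decomposition
  \<open>u @ (i, x) # v\<close> instead of a list update, which fits recursion and
  concatenation.\<close>

definition tens_compat ::
  "('r, 'k) ring_scheme \<Rightarrow> ('r, 'a, 'm) smod_scheme list \<Rightarrow> nat \<Rightarrow> ('r, 'b, 'n) module_scheme \<Rightarrow>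
   ('a gen \<Rightarrow> 'b) \<Rightarrow> bool"
  where "tens_compat R Ms p V h \<longleftrightarrow>
    (\<forall>s\<in>tensor_gens Ms p. h s \<in> carrier V) \<and>
    (\<forall>\<sigma> u i x y v. (\<sigma>, u @ (i, x) # v) \<in> tensor_gens Ms p \<longrightarrow> (\<sigma>, u @ (i, y) # v) \<in> tensor_gens Ms p \<longrightarrow>
      h (\<sigma>, u @ (i, x \<oplus>\<^bsub>grade (Ms ! length u) i\<^esub> y) # v) = h (\<sigma>, u @ (i, x) # v) \<oplus>\<^bsub>V\<^esub> h (\<sigma>, u @ (i, y) # v)) \<and>
    (\<forall>\<sigma> u i r x v. r \<in> carrier R \<longrightarrow> (\<sigma>, u @ (i, x) # v) \<in> tensor_gens Ms p \<longrightarrow>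
      h (\<sigma>, u @ (i, r \<odot>\<^bsub>grade (Ms ! length u) i\<^esub> x) # v) = r \<odot>\<^bsub>V\<^esub> h (\<sigma>, u @ (i, x) # v)) \<and>
    (\<forall>\<sigma> w \<tau>s. (\<sigma>, w) \<in> tensor_gens Ms p \<longrightarrow> list_all2 (\<lambda>(i, x) \<tau>. \<tau> permutes {1..i}) w \<tau>s \<longrightarrow>
      h (\<sigma> \<circ> perm_prods (zip (map fst w) \<tau>s), w) =
      h (\<sigma>, map (\<lambda>(M, (i, x), \<tau>). (i, act M i \<tau> x)) (zip Ms (zip w \<tau>s))))"

lemma tens_compatD:
  assumes "tens_compat R Ms p V h"
  shows "s \<in> tensor_gens Ms p \<Longrightarrow> h s \<in> carrier V"
    and "(\<sigma>, u @ (i, x) # v) \<in> tensor_gens Ms p \<Longrightarrow> (\<sigma>, u @ (i, y) # v) \<in> tensor_gens Ms p \<Longrightarrow>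
      h (\<sigma>, u @ (i, x \<oplus>\<^bsub>grade (Ms ! length u) i\<^esub> y) # v) = h (\<sigma>, u @ (i, x) # v) \<oplus>\<^bsub>V\<^esub> h (\<sigma>, u @ (i, y) # v)"
    and "r \<in> carrier R \<Longrightarrow> (\<sigma>, u @ (i, x) # v) \<in> tensor_gens Ms p \<Longrightarrow>
      h (\<sigma>, u @ (i, r \<odot>\<^bsub>grade (Ms ! length u) i\<^esub> x) # v) = r \<odot>\<^bsub>V\<^esub> h (\<sigma>, u @ (i, x) # v)"
    and "(\<sigma>, w) \<in> tensor_gens Ms p \<Longrightarrow> list_all2 (\<lambda>(i, x) \<tau>. \<tau> permutes {1..i}) w \<tau>s \<Longrightarrow>
      h (\<sigma> \<circ> perm_prods (zip (map fst w) \<tau>s), w) =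
      h (\<sigma>, map (\<lambda>(M, (i, x), \<tau>). (i, act M i \<tau> x)) (zip Ms (zip w \<tau>s)))"
  using assms unfolding tens_compat_def by blast+

locale tensor_factors =
  fixes R :: "('r, 'k) ring_scheme" and Ms :: "('r, 'a, 'm) smod_scheme list"
  assumes cringR: "cring R" and factors: "M \<in> set Ms \<Longrightarrow> sym_module R M"
begin

abbreviation "gens \<equiv> tensor_gens Ms"
abbreviation "free p \<equiv> free_module R (gens p)"
abbreviation "ker p \<equiv> tensor_kernel R Ms p"
abbreviation "rel p \<equiv> tensor_relations R Ms p"

lemma gens_iff: "(\<sigma>, w) \<in> gens p \<longleftrightarrow> \<sigma> permutes {1..p} \<and> sum_list (map fst w) = p \<and>
    length w = length Ms \<and> (\<forall>j<length w. snd (w ! j) \<in> carrier (grade (Ms ! j) (fst (w ! j))))"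
  by (auto simp: tensor_gens_def sym_group_carrier list_all2_conv_all_nth case_prod_beta)

lemma factor: "j < length Ms \<Longrightarrow> sym_module R (Ms ! j)"
  using factors by simp

lemma gens_split:
  assumes "(\<sigma>, u @ (i, x) # v) \<in> gens p"
  shows "length u < length Ms" "x \<in> carrier (grade (Ms ! length u) i)"
    "y \<in> carrier (grade (Ms ! length u) i) \<Longrightarrow> (\<sigma>, u @ (i, y) # v) \<in> gens p"
proof -
  from assms show "length u < length Ms" by (auto simp: gens_iff)
  from assms have *: "\<forall>j<length (u @ (i, x) # v). snd ((u @ (i, x) # v) ! j) \<in> carrier (grade (Ms ! j) (fst ((u @ (i, x) # v) ! j)))"
    by (simp add: gens_iff)
  from spec[OF *, of "length u"] show "x \<in> carrier (grade (Ms ! length u) i)" by simp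
  assume y: "y \<in> carrier (grade (Ms ! length u) i)"
  have "snd ((u @ (i, y) # v) ! j) \<in> carrier (grade (Ms ! j) (fst ((u @ (i, y) # v) ! j)))"
    if "j < length (u @ (i, y) # v)" for j
    using spec[OF *, of j] that y by (cases "j = length u") (auto simp: nth_append nth_Cons')
  thus "(\<sigma>, u @ (i, y) # v) \<in> gens p" using assms by (simp add: gens_iff)
qed

lemma update_split:
  assumes "j < length Ms" "(\<sigma>, w[j := (i, x)]) \<in> gens p"
  shows "w[j := a] = take j w @ a # drop (Suc j) w" "length (take j w) = j"
proof -
  from assms have "j < length w" by (simp add: gens_iff)
  thus "w[j := a] = take j w @ a # drop (Suc j) w" "length (take j w) = j"
    by (auto simp: upd_conv_take_nth_drop)
qed

lemma balanced_gens:
  assumes "(\<sigma>, w) \<in> gens p" "list_all2 (\<lambda>(i, x) \<tau>. \<tau> permutes {1..i}) w \<tau>s"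
  shows "(\<sigma> \<circ> perm_prods (zip (map fst w) \<tau>s), w) \<in> gens p"
    "(\<sigma>, map (\<lambda>(M, (i, x), \<tau>). (i, act M i \<tau> x)) (zip Ms (zip w \<tau>s))) \<in> gens p"
proof -
  have "list_all2 (\<lambda>i \<tau>. \<tau> permutes {1..i}) (map fst w) \<tau>s"
    using assms(2) by (simp add: list_all2_map1 case_prod_unfold)
  from perm_prods_permutes[OF this] assms(1)
  show "(\<sigma> \<circ> perm_prods (zip (map fst w) \<tau>s), w) \<in> gens p"
    by (auto simp: gens_iff intro: permutes_compose)
  let ?w = "map (\<lambda>(M, (i, x), \<tau>). (i, act M i \<tau> x)) (zip Ms (zip w \<tau>s))"
  have l: "length w = length Ms" "length \<tau>s = length Ms"
    using assms by (auto simp: gens_iff list_all2_lengthD[symmetric])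
  have n: "?w ! j = (fst (w ! j), act (Ms ! j) (fst (w ! j)) (\<tau>s ! j) (snd (w ! j)))" if "j < length Ms" for j
    using that l by (simp add: case_prod_beta)
  have f: "map fst ?w = map fst w" using l n by (intro nth_equalityI) auto
  have "act (Ms ! j) (fst (w ! j)) (\<tau>s ! j) (snd (w ! j)) \<in> carrier (grade (Ms ! j) (fst (w ! j)))" if "j < length Ms" for j
    using assms that l by (intro sym_moduleD(5)[OF factor])
      (auto simp: gens_iff list_all2_conv_all_nth case_prod_beta)
  thus "(\<sigma>, ?w) \<in> gens p" using assms(1) l n unfolding gens_iff f by (simp del: map_map)
qed

lemma module_free: "module R (free p)"
  by (rule module_free_module[OF cringR])

text \<open>Besides the shape of a relation this provides that the sum and the scalar multiple
  occurring in it are generators, which \<open>tensor_relations\<close> leaves implicit.\<close>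

lemma relation_cases:
  assumes "r \<in> rel p"
  obtains (add) \<sigma> u i x y v where "(\<sigma>, u @ (i, x) # v) \<in> gens p" "(\<sigma>, u @ (i, y) # v) \<in> gens p"
      "(\<sigma>, u @ (i, x \<oplus>\<^bsub>grade (Ms ! length u) i\<^esub> y) # v) \<in> gens p"
      "r = basis_vec R (\<sigma>, u @ (i, x \<oplus>\<^bsub>grade (Ms ! length u) i\<^esub> y) # v)
        \<ominus>\<^bsub>free p\<^esub> (basis_vec R (\<sigma>, u @ (i, x) # v) \<oplus>\<^bsub>free p\<^esub> basis_vec R (\<sigma>, u @ (i, y) # v))"
  | (smult) \<sigma> u i a x v where "a \<in> carrier R" "(\<sigma>, u @ (i, x) # v) \<in> gens p"
      "(\<sigma>, u @ (i, a \<odot>\<^bsub>grade (Ms ! length u) i\<^esub> x) # v) \<in> gens p"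
      "r = basis_vec R (\<sigma>, u @ (i, a \<odot>\<^bsub>grade (Ms ! length u) i\<^esub> x) # v)
        \<ominus>\<^bsub>free p\<^esub> a \<odot>\<^bsub>free p\<^esub> basis_vec R (\<sigma>, u @ (i, x) # v)"
  | (balanced) \<sigma> w \<tau>s where "(\<sigma>, w) \<in> gens p" "list_all2 (\<lambda>(i, x) \<tau>. \<tau> permutes {1..i}) w \<tau>s"
      "r = basis_vec R (\<sigma> \<circ> perm_prods (zip (map fst w) \<tau>s), w)
        \<ominus>\<^bsub>free p\<^esub> basis_vec R (\<sigma>, map (\<lambda>(M, (i, x), \<tau>). (i, act M i \<tau> x)) (zip Ms (zip w \<tau>s)))"
proof -
  consider \<sigma> w j i x y where "j < length Ms" "(\<sigma>, w[j := (i, x)]) \<in> gens p" "(\<sigma>, w[j := (i, y)]) \<in> gens p"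
      "r = basis_vec R (\<sigma>, w[j := (i, x \<oplus>\<^bsub>grade (Ms ! j) i\<^esub> y)])
        \<ominus>\<^bsub>free p\<^esub> (basis_vec R (\<sigma>, w[j := (i, x)]) \<oplus>\<^bsub>free p\<^esub> basis_vec R (\<sigma>, w[j := (i, y)]))"
    | \<sigma> w j i a x where "j < length Ms" "a \<in> carrier R" "(\<sigma>, w[j := (i, x)]) \<in> gens p"
      "r = basis_vec R (\<sigma>, w[j := (i, a \<odot>\<^bsub>grade (Ms ! j) i\<^esub> x)])
        \<ominus>\<^bsub>free p\<^esub> a \<odot>\<^bsub>free p\<^esub> basis_vec R (\<sigma>, w[j := (i, x)])"
    | \<sigma> w \<tau>s where "(\<sigma>, w) \<in> gens p" "list_all2 (\<lambda>(i, x) \<tau>. \<tau> permutes {1..i}) w \<tau>s"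
      "r = basis_vec R (\<sigma> \<circ> perm_prods (zip (map fst w) \<tau>s), w)
        \<ominus>\<^bsub>free p\<^esub> basis_vec R (\<sigma>, map (\<lambda>(M, (i, x), \<tau>). (i, act M i \<tau> x)) (zip Ms (zip w \<tau>s)))"
    using assms unfolding tensor_relations_def Let_def sym_group_carrier Un_iff by blast
  thus thesis
  proof cases
    case 1
    note u = update_split[OF 1(1,2)]
    note g = 1(2,3)[unfolded u(1)]
    note c = gens_split[OF g(1), unfolded u(2)] gens_split(2)[OF g(2), unfolded u(2)]
    show thesis
      by (rule add[OF g]) (use 1 c u module_add_closed[OF sym_moduleD(1)[OF factor[OF 1(1)]]] in auto)
  next
    case 2
    note u = update_split[OF 2(1,3)]
    note g = 2(3)[unfolded u(1)]
    note c = gens_split[OF g(1), unfolded u(2)]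
    show thesis
      by (rule smult[OF 2(2) g]) (use 2 c u module_smult_closed[OF sym_moduleD(1)[OF factor[OF 2(1)]]] in auto)
  next
    case 3
    thus thesis by (rule balanced)
  qed
qed

lemma basis_closed: "s \<in> gens p \<Longrightarrow> basis_vec R s \<in> carrier (free p)"
  by (rule basis_vec_closed[OF cringR])

lemma rel_closed: "rel p \<subseteq> carrier (free p)"
proof
  fix r assume "r \<in> rel p"
  thus "r \<in> carrier (free p)"
    by (cases rule: relation_cases)
      (auto intro!: module_minus_closed[OF module_free] module_add_closed[OF module_free]
        module_smult_closed[OF module_free] basis_closed balanced_gens)
qed

lemma submodule_ker: "submodule (ker p) R (free p)"
  unfolding tensor_kernel_def by (rule mspan_submodule[OF module_free rel_closed])

lemma module_tensor: "module R (tensor_module R Ms p)"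
  unfolding tensor_module_def by (rule module_FactModule[OF module_free submodule_ker])

lemma class_eq: "(\<sigma>, w) \<in> gens p \<Longrightarrow> tensor_class R Ms \<sigma> w = ker p +>\<^bsub>free p\<^esub> basis_vec R (\<sigma>, w)"
  by (auto simp: tensor_class_def gens_iff)

lemma linear_class: "linear_map R (free p) (tensor_module R Ms p) (\<lambda>x. ker p +>\<^bsub>free p\<^esub> x)"
  unfolding tensor_module_def by (rule linear_coset[OF module_free submodule_ker])

text \<open>The difference of the two sides of each condition is the coset of an element of
  \<open>rel p\<close>, hence zero in the quotient. This is the universal compatible
  function.\<close>

lemma class_compat: "tens_compat R Ms p (tensor_module R Ms p) (\<lambda>(\<sigma>, w). tensor_class R Ms \<sigma> w)"
proof -
  note L = linear_class[of p]
  note F = module_free[of p]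
  have eq: "ker p +>\<^bsub>free p\<^esub> x = ker p +>\<^bsub>free p\<^esub> y"
    if "x \<ominus>\<^bsub>free p\<^esub> y \<in> rel p" "x \<in> carrier (free p)" "y \<in> carrier (free p)" for x y
  proof -
    have "x \<ominus>\<^bsub>free p\<^esub> y \<in> ker p" unfolding tensor_kernel_def by (rule hull_inc) fact
    thus ?thesis unfolding coset_eq_iff[OF F submodule_ker that(2,3)] .
  qed
  have mem: "(\<sigma>, w) \<in> gens p \<Longrightarrow> tensor_class R Ms \<sigma> w \<in> carrier (tensor_module R Ms p)" for \<sigma> w
    using linear_closed[OF L basis_closed] by (simp add: class_eq)
  have up: "(u @ (i, x) # v)[length u := a] = u @ a # v" for u v :: "(nat \<times> 'a) list" and i x a by simp
  show ?thesis unfolding tens_compat_def prod.case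
  proof (intro conjI allI impI ballI)
    fix s assume "s \<in> gens p"
    thus "(case s of (\<sigma>, w) \<Rightarrow> tensor_class R Ms \<sigma> w) \<in> carrier (tensor_module R Ms p)" using mem by (cases s) simp
  next
    fix \<sigma> u i x y v assume g: "(\<sigma>, u @ (i, x) # v) \<in> gens p" "(\<sigma>, u @ (i, y) # v) \<in> gens p"
    note c = gens_split[OF g(1)] gens_split[OF g(2)]
    have xy: "(\<sigma>, u @ (i, x \<oplus>\<^bsub>grade (Ms ! length u) i\<^esub> y) # v) \<in> gens p"
      by (rule gens_split(3)[OF g(1)]) (use c module_add_closed[OF sym_moduleD(1)[OF factor[OF c(1)]]] in blast)
    have "ker p +>\<^bsub>free p\<^esub> basis_vec R (\<sigma>, u @ (i, x \<oplus>\<^bsub>grade (Ms ! length u) i\<^esub> y) # v) =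
      ker p +>\<^bsub>free p\<^esub> (basis_vec R (\<sigma>, u @ (i, x) # v) \<oplus>\<^bsub>free p\<^esub> basis_vec R (\<sigma>, u @ (i, y) # v))"
    proof (rule eq)
      show "basis_vec R (\<sigma>, u @ (i, x \<oplus>\<^bsub>grade (Ms ! length u) i\<^esub> y) # v) \<ominus>\<^bsub>free p\<^esub>
        (basis_vec R (\<sigma>, u @ (i, x) # v) \<oplus>\<^bsub>free p\<^esub> basis_vec R (\<sigma>, u @ (i, y) # v)) \<in> rel p"
        unfolding tensor_relations_def Let_def
        apply (rule UnI1, rule UnI1, rule CollectI)
        apply (rule exI[of _ \<sigma>], rule exI[of _ "u @ (i, x) # v"], rule exI[of _ "length u"], rule exI[of _ i],
            rule exI[of _ x], rule exI[of _ y])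
        unfolding up using g c(1) by simp
    qed (use g xy in \<open>auto intro!: basis_closed module_add_closed[OF F]\<close>)
    thus "tensor_class R Ms \<sigma> (u @ (i, x \<oplus>\<^bsub>grade (Ms ! length u) i\<^esub> y) # v) =
      tensor_class R Ms \<sigma> (u @ (i, x) # v) \<oplus>\<^bsub>tensor_module R Ms p\<^esub> tensor_class R Ms \<sigma> (u @ (i, y) # v)"
      by (simp only: class_eq[OF g(1)] class_eq[OF g(2)] class_eq[OF xy]
          linear_add[OF L basis_closed[OF g(1)] basis_closed[OF g(2)], symmetric])
  next
    fix \<sigma> u i r x v assume r: "r \<in> carrier R" and g: "(\<sigma>, u @ (i, x) # v) \<in> gens p"
    note c = gens_split[OF g]
    have rx: "(\<sigma>, u @ (i, r \<odot>\<^bsub>grade (Ms ! length u) i\<^esub> x) # v) \<in> gens p"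
      by (rule gens_split(3)[OF g]) (use r c module_smult_closed[OF sym_moduleD(1)[OF factor[OF c(1)]]] in blast)
    have "ker p +>\<^bsub>free p\<^esub> basis_vec R (\<sigma>, u @ (i, r \<odot>\<^bsub>grade (Ms ! length u) i\<^esub> x) # v) =
      ker p +>\<^bsub>free p\<^esub> (r \<odot>\<^bsub>free p\<^esub> basis_vec R (\<sigma>, u @ (i, x) # v))"
    proof (rule eq)
      show "basis_vec R (\<sigma>, u @ (i, r \<odot>\<^bsub>grade (Ms ! length u) i\<^esub> x) # v) \<ominus>\<^bsub>free p\<^esub>
        r \<odot>\<^bsub>free p\<^esub> basis_vec R (\<sigma>, u @ (i, x) # v) \<in> rel p"
        unfolding tensor_relations_def Let_def
        apply (rule UnI1, rule UnI2, rule CollectI)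
        apply (rule exI[of _ \<sigma>], rule exI[of _ "u @ (i, x) # v"], rule exI[of _ "length u"], rule exI[of _ i],
            rule exI[of _ r], rule exI[of _ x])
        unfolding up using r g c(1) by simp
    qed (use r g rx in \<open>auto intro!: basis_closed module_smult_closed[OF F]\<close>)
    thus "tensor_class R Ms \<sigma> (u @ (i, r \<odot>\<^bsub>grade (Ms ! length u) i\<^esub> x) # v) =
      r \<odot>\<^bsub>tensor_module R Ms p\<^esub> tensor_class R Ms \<sigma> (u @ (i, x) # v)"
      by (simp only: class_eq[OF g] class_eq[OF rx] linear_smult[OF L r basis_closed[OF g], symmetric])
  next
    fix \<sigma> w \<tau>s assume g: "(\<sigma>, w) \<in> gens p" "list_all2 (\<lambda>(i, x) \<tau>. \<tau> permutes {1..i}) w \<tau>s"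
    note b = balanced_gens[OF g]
    show "tensor_class R Ms (\<sigma> \<circ> perm_prods (zip (map fst w) \<tau>s)) w =
      tensor_class R Ms \<sigma> (map (\<lambda>(M, (i, x), \<tau>). (i, act M i \<tau> x)) (zip Ms (zip w \<tau>s)))"
      unfolding class_eq[OF b(1)] class_eq[OF b(2)]
      by (rule eq[OF _ basis_closed[OF b(1)] basis_closed[OF b(2)]])
        (unfold tensor_relations_def Let_def sym_group_carrier, rule UnI2, use g in blast)
  qed
qed

lemma class_closed: "(\<sigma>, w) \<in> gens p \<Longrightarrow> tensor_class R Ms \<sigma> w \<in> carrier (tensor_module R Ms p)"
  using tens_compatD(1)[OF class_compat, of "(\<sigma>, w)" p] by simp

lemma tensor_mspan:
  "carrier (tensor_module R Ms p) = mspan R (tensor_module R Ms p) {tensor_class R Ms \<sigma> w | \<sigma> w. (\<sigma>, w) \<in> gens p}"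
proof -
  have S: "basis_vec R ` gens p \<subseteq> carrier (free p)" by (rule image_subsetI) (rule basis_closed)
  have "carrier (tensor_module R Ms p) =
      mspan R (tensor_module R Ms p) ((\<lambda>x. ker p +>\<^bsub>free p\<^esub> x) ` basis_vec R ` gens p)"
    by (rule mspan_image_onto[OF module_free module_tensor linear_class _ S carrier_free_module_mspan[OF cringR]])
      (simp add: tensor_module_def FactModule_simps)
  also have "(\<lambda>x. ker p +>\<^bsub>free p\<^esub> x) ` basis_vec R ` gens p = {tensor_class R Ms \<sigma> w | \<sigma> w. (\<sigma>, w) \<in> gens p}"
    unfolding image_image by (auto simp: class_eq[symmetric] image_iff) (metis class_eq)+
  finally show ?thesis .
qed

text \<open>The universal property of the tensor product: the linear extension of \<open>h\<close>
  kills the relations, hence the submodule they generate, and is therefore constant on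
  cosets.\<close>

lemma lift_linear_tensor:
  assumes V: "module R V" and h: "tens_compat R Ms p V h"
  shows "linear_map R (tensor_module R Ms p) V (lift_linear R V h)"
    and "(\<sigma>, w) \<in> gens p \<Longrightarrow> lift_linear R V h (tensor_class R Ms \<sigma> w) = h (\<sigma>, w)"
proof -
  let ?f = "linear_extension R V h"
  note hc = tens_compatD(1)[OF h]
  have L: "linear_map R (free p) V ?f" by (rule linear_linear_extension[OF V hc])
  have b: "?f (basis_vec R s) = h s" if "s \<in> gens p" for s by (rule linear_extension_basis_vec[OF V hc that])
  note F = module_free[of p]
  interpret V: module R V by (rule V)
  have diff: "?f (x \<ominus>\<^bsub>free p\<^esub> y) = \<zero>\<^bsub>V\<^esub>" if "x \<in> carrier (free p)" "y \<in> carrier (free p)" "?f x = ?f y" for x y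
    using linear_minus[OF F V L that(1,2)] that(3) V.minus_eq_zero_iff linear_closed[OF L that(2)] by simp
  have "?f r = \<zero>\<^bsub>V\<^esub>" if "r \<in> rel p" for r
    using that
  proof (cases rule: relation_cases)
    case (add \<sigma> u i x y v)
    show ?thesis unfolding add(4)
      by (rule diff) (simp_all only: basis_closed add(1-3) module_add_closed[OF F] linear_add[OF L] b
          tens_compatD(2)[OF h add(1,2)])
  next
    case (smult \<sigma> u i a x v)
    show ?thesis unfolding smult(4)
      by (rule diff) (simp_all only: basis_closed smult(1-3) module_smult_closed[OF F] linear_smult[OF L] b
          tens_compatD(3)[OF h smult(1,2)])
  next
    case (balanced \<sigma> w \<tau>s)
    note g = balanced_gens[OF balanced(1,2)]
    show ?thesis unfolding balanced(3)
      by (rule diff) (simp_all only: basis_closed g b tens_compatD(4)[OF h balanced(1,2)])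
  qed
  hence k: "?f x = \<zero>\<^bsub>V\<^esub>" if "x \<in> ker p" for x
    using linear_vanish_mspan[OF F V L rel_closed _ zero_submodule[OF V], of x] that
    unfolding tensor_kernel_def by blast
  have e: "lift_linear R V h (ker p +>\<^bsub>free p\<^esub> x) = ?f x" if "x \<in> carrier (free p)" for x
    unfolding lift_linear_def by (rule the_elem_image_coset[OF F submodule_ker V L k that])
  show "linear_map R (tensor_module R Ms p) V (lift_linear R V h)"
    unfolding tensor_module_def by (rule linear_from_FactModule[OF F submodule_ker L e])
  assume g: "(\<sigma>, w) \<in> gens p"
  show "lift_linear R V h (tensor_class R Ms \<sigma> w) = h (\<sigma>, w)"
    unfolding class_eq[OF g] e[OF basis_closed[OF g]] by (rule b[OF g])
qed

lemma tens_compat_cong: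
  assumes "tens_compat R Ms p V h" "\<And>s. s \<in> gens p \<Longrightarrow> h' s = h s"
  shows "tens_compat R Ms p V h'"
proof -
  note C = tens_compatD[OF assms(1)]
  show ?thesis unfolding tens_compat_def
  proof (intro conjI allI impI ballI)
    fix s assume "s \<in> gens p" thus "h' s \<in> carrier V" using C(1) assms(2) by simp
  next
    fix \<sigma> u i x y v assume g: "(\<sigma>, u @ (i, x) # v) \<in> gens p" "(\<sigma>, u @ (i, y) # v) \<in> gens p"
    note c = gens_split[OF g(1)] gens_split[OF g(2)]
    have "(\<sigma>, u @ (i, x \<oplus>\<^bsub>grade (Ms ! length u) i\<^esub> y) # v) \<in> gens p"
      by (rule c(3)) (use c module_add_closed[OF sym_moduleD(1)[OF factor[OF c(1)]]] in blast)
    thus "h' (\<sigma>, u @ (i, x \<oplus>\<^bsub>grade (Ms ! length u) i\<^esub> y) # v) =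
       h' (\<sigma>, u @ (i, x) # v) \<oplus>\<^bsub>V\<^esub> h' (\<sigma>, u @ (i, y) # v)" by (simp only: assms(2) g C(2)[OF g])
  next
    fix \<sigma> u i r x v assume r: "r \<in> carrier R" and g: "(\<sigma>, u @ (i, x) # v) \<in> gens p"
    note c = gens_split[OF g]
    have "(\<sigma>, u @ (i, r \<odot>\<^bsub>grade (Ms ! length u) i\<^esub> x) # v) \<in> gens p"
      by (rule c(3)) (use c r module_smult_closed[OF sym_moduleD(1)[OF factor[OF c(1)]]] in blast)
    thus "h' (\<sigma>, u @ (i, r \<odot>\<^bsub>grade (Ms ! length u) i\<^esub> x) # v) = r \<odot>\<^bsub>V\<^esub> h' (\<sigma>, u @ (i, x) # v)"
      by (simp only: assms(2) g C(3)[OF r g])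
  next
    fix \<sigma> w \<tau>s assume g: "(\<sigma>, w) \<in> gens p" "list_all2 (\<lambda>(i, x) \<tau>. \<tau> permutes {1..i}) w \<tau>s"
    show "h' (\<sigma> \<circ> perm_prods (zip (map fst w) \<tau>s), w) =
      h' (\<sigma>, map (\<lambda>(M, (i, x), \<tau>). (i, act M i \<tau> x)) (zip Ms (zip w \<tau>s)))"
      by (simp only: assms(2) balanced_gens[OF g] C(4)[OF g])
  qed
qed

text \<open>Left multiplication by \<rho> commutes with the balancing relation, which multiplies
  \<sigma> on the right.\<close>

lemma act_compat:
  assumes "\<rho> permutes {1..p}"
  shows "tens_compat R Ms p (tensor_module R Ms p) (\<lambda>(\<sigma>, w). tensor_class R Ms (\<rho> \<circ> \<sigma>) w)"
proof -
  have g: "(\<sigma>, w) \<in> gens p \<Longrightarrow> (\<rho> \<circ> \<sigma>, w) \<in> gens p" for \<sigma> w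
    using assms by (auto simp: gens_iff intro: permutes_compose)
  note C = tens_compatD[OF class_compat, unfolded prod.case]
  show ?thesis unfolding tens_compat_def prod.case
  proof (intro conjI allI impI ballI)
    fix s assume "s \<in> gens p"
    thus "(case s of (\<sigma>, w) \<Rightarrow> tensor_class R Ms (\<rho> \<circ> \<sigma>) w) \<in> carrier (tensor_module R Ms p)"
      using class_closed[OF g] by (cases s) simp
  qed (simp_all only: C(2)[OF g g] C(3)[OF _ g] C(4)[OF g] o_assoc)
qed

lemma act_tensor:
  assumes "\<rho> permutes {1..p}"
  shows "linear_map R (tensor_module R Ms p) (tensor_module R Ms p) (act (tensor R Ms) p \<rho>)"
    and "(\<sigma>, w) \<in> gens p \<Longrightarrow> act (tensor R Ms) p \<rho> (tensor_class R Ms \<sigma> w) = tensor_class R Ms (\<rho> \<circ> \<sigma>) w"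
  using lift_linear_tensor[OF module_tensor act_compat[OF assms]] by (simp_all add: tensor_def)

end

text \<open>The nested form of the lift is that of \<open>tensor_concat\<close> and of the product
  of \<open>tensor_square\<close>. For each generator \<open>s\<close> the inner lift is linear in
  \<open>Y\<close>; compatibility of the outer function is then an identity between linear maps of
  \<open>Y\<close>, tested on generators.\<close>

lemma bilinear_lift_tensor:
  assumes F: "tensor_factors R Ms" "tensor_factors R Ns" and V: "module R V"
    and h: "\<And>s. s \<in> tensor_gens Ms p \<Longrightarrow> tens_compat R Ns q V (h s)"
      "\<And>t. t \<in> tensor_gens Ns q \<Longrightarrow> tens_compat R Ms p V (\<lambda>s. h s t)"
  shows "bilinear_map R (tensor_module R Ms p) (tensor_module R Ns q) V
      (\<lambda>X Y. lift_linear R V (\<lambda>s. lift_linear R V (h s) Y) X)"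
    and "(\<sigma>, w) \<in> tensor_gens Ms p \<Longrightarrow> (\<tau>, w') \<in> tensor_gens Ns q \<Longrightarrow>
      lift_linear R V (\<lambda>s. lift_linear R V (h s) (tensor_class R Ns \<tau> w')) (tensor_class R Ms \<sigma> w) = h (\<sigma>, w) (\<tau>, w')"
proof -
  interpret M: tensor_factors R Ms by (rule F)
  interpret N: tensor_factors R Ns by (rule F)
  let ?B = "\<lambda>X Y. lift_linear R V (\<lambda>s. lift_linear R V (h s) Y) X"
  interpret V: module R V by (rule V)
  have L: "s \<in> M.gens p \<Longrightarrow> linear_map R (tensor_module R Ns q) V (lift_linear R V (h s))" for s
    by (rule N.lift_linear_tensor(1)[OF V h(1)])
  have E: "s \<in> M.gens p \<Longrightarrow> (\<tau>, w) \<in> N.gens q \<Longrightarrow> lift_linear R V (h s) (tensor_class R Ns \<tau> w) = h s (\<tau>, w)" for s \<tau> w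
    by (rule N.lift_linear_tensor(2)[OF V h(1)])
  have S: "{tensor_class R Ns \<sigma> w | \<sigma> w. (\<sigma>, w) \<in> N.gens q} \<subseteq> carrier (tensor_module R Ns q)"
    using N.class_closed by blast
  have agree: "f Y = g Y" if "linear_map R (tensor_module R Ns q) V f" "linear_map R (tensor_module R Ns q) V g"
      "\<And>\<sigma> w. (\<sigma>, w) \<in> N.gens q \<Longrightarrow> f (tensor_class R Ns \<sigma> w) = g (tensor_class R Ns \<sigma> w)"
      "Y \<in> carrier (tensor_module R Ns q)" for f g Y
    using linear_agree[OF N.module_tensor V that(1,2) S, of Y] that(3,4) N.tensor_mspan[of q] by blast
  \<comment> \<open>For fixed \<open>Y\<close> the relations in \<open>s\<close> have to be checked.
    Both sides are linear in \<open>Y\<close>, so \<open>agree\<close> reduces them to the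
    assumption on \<open>h\<close> for generators.\<close>
  have C: "tens_compat R Ms p V (\<lambda>s. lift_linear R V (h s) Y)" if Y: "Y \<in> carrier (tensor_module R Ns q)" for Y
    unfolding tens_compat_def
  proof (intro conjI allI impI ballI)
    fix s assume "s \<in> M.gens p" thus "lift_linear R V (h s) Y \<in> carrier V" using linear_closed[OF L Y] by simp
  next
    fix \<sigma> u i x y v assume g: "(\<sigma>, u @ (i, x) # v) \<in> M.gens p" "(\<sigma>, u @ (i, y) # v) \<in> M.gens p"
    note c = M.gens_split[OF g(1)] M.gens_split[OF g(2)]
    have xy: "(\<sigma>, u @ (i, x \<oplus>\<^bsub>grade (Ms ! length u) i\<^esub> y) # v) \<in> M.gens p"
      by (rule c(3)) (use c module_add_closed[OF sym_moduleD(1)[OF M.factor[OF c(1)]]] in blast)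
    show "lift_linear R V (h (\<sigma>, u @ (i, x \<oplus>\<^bsub>grade (Ms ! length u) i\<^esub> y) # v)) Y =
      lift_linear R V (h (\<sigma>, u @ (i, x) # v)) Y \<oplus>\<^bsub>V\<^esub> lift_linear R V (h (\<sigma>, u @ (i, y) # v)) Y"
      by (rule agree[OF L[OF xy] linear_plus[OF V L[OF g(1)] L[OF g(2)]] _ Y])
        (simp add: E xy g tens_compatD(2)[OF h(2) g])
  next
    fix \<sigma> u i r x v assume r: "r \<in> carrier R" and g: "(\<sigma>, u @ (i, x) # v) \<in> M.gens p"
    note c = M.gens_split[OF g]
    have rx: "(\<sigma>, u @ (i, r \<odot>\<^bsub>grade (Ms ! length u) i\<^esub> x) # v) \<in> M.gens p"
      by (rule c(3)) (use c r module_smult_closed[OF sym_moduleD(1)[OF M.factor[OF c(1)]]] in blast)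
    show "lift_linear R V (h (\<sigma>, u @ (i, r \<odot>\<^bsub>grade (Ms ! length u) i\<^esub> x) # v)) Y =
      r \<odot>\<^bsub>V\<^esub> lift_linear R V (h (\<sigma>, u @ (i, x) # v)) Y"
      by (rule agree[OF L[OF rx] linear_comp[OF L[OF g] linear_smult_const[OF V r]] _ Y])
        (simp add: E rx g tens_compatD(3)[OF h(2) r g])
  next
    fix \<sigma> w \<tau>s assume g: "(\<sigma>, w) \<in> M.gens p" "list_all2 (\<lambda>(i, x) \<tau>. \<tau> permutes {1..i}) w \<tau>s"
    note b = M.balanced_gens[OF g]
    show "lift_linear R V (h (\<sigma> \<circ> perm_prods (zip (map fst w) \<tau>s), w)) Y =
       lift_linear R V (h (\<sigma>, map (\<lambda>(M, (i, x), \<tau>). (i, act M i \<tau> x)) (zip Ms (zip w \<tau>s)))) Y"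
      by (rule agree[OF L[OF b(1)] L[OF b(2)] _ Y]) (simp only: E b tens_compatD(4)[OF h(2) g])
  qed
  have B: "?B (tensor_class R Ms \<sigma> w) Y = lift_linear R V (h (\<sigma>, w)) Y"
    if "(\<sigma>, w) \<in> M.gens p" "Y \<in> carrier (tensor_module R Ns q)" for \<sigma> w Y
    by (rule M.lift_linear_tensor(2)[OF V C[OF that(2)] that(1)])
  have LL: "linear_map R (tensor_module R Ms p) V (\<lambda>X. ?B X Y)" if "Y \<in> carrier (tensor_module R Ns q)" for Y
    by (rule M.lift_linear_tensor(1)[OF V C[OF that]])
  have SM: "{tensor_class R Ms \<sigma> w | \<sigma> w. (\<sigma>, w) \<in> M.gens p} \<subseteq> carrier (tensor_module R Ms p)"
    using M.class_closed by blast
  note NM = module_closed[OF N.module_tensor]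
  have agreeM: "f X = g X" if "linear_map R (tensor_module R Ms p) V f" "linear_map R (tensor_module R Ms p) V g"
      "\<And>\<sigma> w. (\<sigma>, w) \<in> M.gens p \<Longrightarrow> f (tensor_class R Ms \<sigma> w) = g (tensor_class R Ms \<sigma> w)"
      "X \<in> carrier (tensor_module R Ms p)" for f g X
    using linear_agree[OF M.module_tensor V that(1,2) SM, of X] that(3,4) M.tensor_mspan[of p] by blast
  show "bilinear_map R (tensor_module R Ms p) (tensor_module R Ns q) V ?B"
    unfolding bilinear_map_def
  proof (intro conjI ballI LL)
    \<comment> \<open>Linearity in \<open>Y\<close> is known only when \<open>X\<close> is a
      generator; \<open>agreeM\<close> transfers it to all \<open>X\<close>, since both sides are
      linear in \<open>X\<close>.\<close>
    fix X assume X: "X \<in> carrier (tensor_module R Ms p)"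
    show "linear_map R (tensor_module R Ns q) V (?B X)"
    proof (rule linear_mapI)
      show "?B X Y \<in> carrier V" if "Y \<in> carrier (tensor_module R Ns q)" for Y
        by (rule linear_closed[OF LL[OF that] X])
      fix Y Z assume Y: "Y \<in> carrier (tensor_module R Ns q)" and Z: "Z \<in> carrier (tensor_module R Ns q)"
      note YZ = NM(1)[OF Y Z]
      show "?B X (Y \<oplus>\<^bsub>tensor_module R Ns q\<^esub> Z) = ?B X Y \<oplus>\<^bsub>V\<^esub> ?B X Z"
        by (rule agreeM[OF LL[OF YZ] linear_plus[OF V LL[OF Y] LL[OF Z]] _ X])
          (simp only: B Y Z YZ linear_add[OF L Y Z])
    next
      fix r Y assume r: "r \<in> carrier R" and Y: "Y \<in> carrier (tensor_module R Ns q)"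
      note rY = NM(4)[OF r Y]
      show "?B X (r \<odot>\<^bsub>tensor_module R Ns q\<^esub> Y) = r \<odot>\<^bsub>V\<^esub> ?B X Y"
        by (rule agreeM[OF LL[OF rY] linear_comp[OF LL[OF Y] linear_smult_const[OF V r]] _ X])
          (simp only: B Y rY linear_smult[OF L r Y])
    qed
  qed
  assume g: "(\<sigma>, w) \<in> M.gens p" "(\<tau>, w') \<in> N.gens q"
  show "?B (tensor_class R Ms \<sigma> w) (tensor_class R Ns \<tau> w') = h (\<sigma>, w) (\<tau>, w')"
    by (simp only: B[OF g(1) N.class_closed[OF g(2)]] E[OF g])
qed

section \<open>Weighted algebras\<close>

lemma linear_finsum:
  assumes "module R V" "finite S" "\<And>i. i \<in> S \<Longrightarrow> linear_map R M V (F i)"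
  shows "linear_map R M V (\<lambda>x. \<Oplus>\<^bsub>V\<^esub>i\<in>S. F i x)"
proof -
  interpret V: module R V by fact
  have cl: "F i x \<in> carrier V" if "i \<in> S" "x \<in> carrier M" for i x
    by (rule linear_closed[OF assms(3)[OF that(1)] that(2)])
  show ?thesis
  proof (rule linear_mapI)
    fix x assume x: "x \<in> carrier M"
    show "(\<Oplus>\<^bsub>V\<^esub>i\<in>S. F i x) \<in> carrier V" using cl x by (intro V.finsum_closed) auto
    fix y assume y: "y \<in> carrier M"
    have "(\<Oplus>\<^bsub>V\<^esub>i\<in>S. F i (x \<oplus>\<^bsub>M\<^esub> y)) = (\<Oplus>\<^bsub>V\<^esub>i\<in>S. F i x \<oplus>\<^bsub>V\<^esub> F i y)"
      using cl x y by (intro V.add.finprod_cong') (auto simp: linear_add[OF assms(3)])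
    also have "\<dots> = (\<Oplus>\<^bsub>V\<^esub>i\<in>S. F i x) \<oplus>\<^bsub>V\<^esub> (\<Oplus>\<^bsub>V\<^esub>i\<in>S. F i y)"
      using cl x y by (intro V.finsum_addf) auto
    finally show "(\<Oplus>\<^bsub>V\<^esub>i\<in>S. F i (x \<oplus>\<^bsub>M\<^esub> y)) = (\<Oplus>\<^bsub>V\<^esub>i\<in>S. F i x) \<oplus>\<^bsub>V\<^esub> (\<Oplus>\<^bsub>V\<^esub>i\<in>S. F i y)" .
  next
    fix r x assume r: "r \<in> carrier R" and x: "x \<in> carrier M"
    have "(\<Oplus>\<^bsub>V\<^esub>i\<in>S. F i (r \<odot>\<^bsub>M\<^esub> x)) = (\<Oplus>\<^bsub>V\<^esub>i\<in>S. r \<odot>\<^bsub>V\<^esub> F i x)"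
      using cl r x by (intro V.add.finprod_cong') (auto simp: linear_smult[OF assms(3)])
    also have "\<dots> = r \<odot>\<^bsub>V\<^esub> (\<Oplus>\<^bsub>V\<^esub>i\<in>S. F i x)"
      using cl r x assms(2) by (intro V.finsum_smult_ldistr[symmetric]) auto
    finally show "(\<Oplus>\<^bsub>V\<^esub>i\<in>S. F i (r \<odot>\<^bsub>M\<^esub> x)) = r \<odot>\<^bsub>V\<^esub> (\<Oplus>\<^bsub>V\<^esub>i\<in>S. F i x)" .
  qed
qed

lemma module_family_grade: "cring R \<Longrightarrow> (\<And>n. module R (grade (A n) p)) \<Longrightarrow> module_family R (\<lambda>n. grade (A n) p)"
  by (simp add: module_family.intro)

lemma weight_part_eq: "weight_part A n p x = single (\<lambda>n. grade (A n) p) n x"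
  by (simp add: weight_part_def single_def)

lemma weighted_simps:
  "grade (weighted_talg A \<mu> e) p = fin_supp UNIV (\<lambda>n. grade (A n) p)"
  "act (weighted_talg A \<mu> e) p \<sigma> f n = act (A n) p \<sigma> (f n)"
  "tmul (weighted_talg A \<mu> e) p q f h n = (\<Oplus>\<^bsub>grade (A n) (p + q)\<^esub>i\<in>{..n}. \<mu> i (n - i) p q (f i) (h (n - i)))"
  "tone (weighted_talg A \<mu> e) = weight_part A 0 0 e"
  by (simp_all add: weighted_talg_def direct_sum_eq)

text \<open>This locale is instantiated by the tensor algebra and by the associated graded
  algebra.\<close>

locale weighted =
  fixes R :: "('r, 'k) ring_scheme" and A :: "nat \<Rightarrow> ('r, 'a) smod"
    and \<mu> :: "nat \<Rightarrow> nat \<Rightarrow> nat \<Rightarrow> nat \<Rightarrow> 'a \<Rightarrow> 'a \<Rightarrow> 'a" and e :: 'a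
  assumes cringR: "cring R" and modA: "module R (grade (A n) p)"
    and mul_bilinear: "bilinear_map R (grade (A i) p) (grade (A j) q) (grade (A (i + j)) (p + q)) (\<mu> i j p q)"
begin

abbreviation "W \<equiv> weighted_talg A \<mu> e"

sublocale fam: module_family R S "\<lambda>n. grade (A n) p" for S p
  by (rule module_family_grade[OF cringR modA])

lemma module_grade: "module R (grade W p)"
  unfolding weighted_simps by (rule fam.module_fin_supp)

lemma linear_into_grade:
  assumes "\<And>n. linear_map R M (grade (A n) p) (\<lambda>x. f x n)" "\<And>x. x \<in> carrier M \<Longrightarrow> finite {n. f x n \<noteq> \<zero>\<^bsub>grade (A n) p\<^esub>}"
  shows "linear_map R M (grade W p) f"
  unfolding weighted_simps
proof (rule linear_mapI)
  fix x assume "x \<in> carrier M"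
  thus "f x \<in> carrier (fin_supp UNIV (\<lambda>n. grade (A n) p))"
    using assms(2) linear_closed[OF assms(1)] unfolding fam.carrier_iff by simp
qed (simp_all only: fam.simps linear_add[OF assms(1)] linear_smult[OF assms(1)] fun_eq_iff simp_thms)

lemma linear_coord: "linear_map R (grade W p) (grade (A n) p) (\<lambda>f. f n)"
  unfolding weighted_simps by (rule fam.linear_eval)

lemma mul_linear:
  assumes "i \<le> n"
  shows "x \<in> carrier (grade (A i) p) \<Longrightarrow> linear_map R (grade (A (n - i)) q) (grade (A n) (p + q)) (\<mu> i (n - i) p q x)"
    and "y \<in> carrier (grade (A (n - i)) q) \<Longrightarrow> linear_map R (grade (A i) p) (grade (A n) (p + q)) (\<lambda>x. \<mu> i (n - i) p q x y)"
  using bilinear_right[OF mul_bilinear, of x i p "n - i" q] bilinear_left[OF mul_bilinear, of y "n - i" q i p] assms by auto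

lemma coord_closed: "f \<in> carrier (grade W p) \<Longrightarrow> f n \<in> carrier (grade (A n) p)"
  by (rule linear_closed[OF linear_coord])

lemma mul_zero:
  assumes "f \<in> carrier (grade W p)" "h \<in> carrier (grade W q)" "i \<le> n"
    "f i = \<zero>\<^bsub>grade (A i) p\<^esub> \<or> h (n - i) = \<zero>\<^bsub>grade (A (n - i)) q\<^esub>"
  shows "\<mu> i (n - i) p q (f i) (h (n - i)) = \<zero>\<^bsub>grade (A n) (p + q)\<^esub>"
  using assms(4) linear_zero[OF modA modA mul_linear(1)[OF assms(3) coord_closed[OF assms(1)]]]
    linear_zero[OF modA modA mul_linear(2)[OF assms(3) coord_closed[OF assms(2)]]] by metis

lemma tmul_eq_zero:
  assumes "f \<in> carrier (grade W p)" "h \<in> carrier (grade W q)"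
    "\<And>i. i \<le> n \<Longrightarrow> f i = \<zero>\<^bsub>grade (A i) p\<^esub> \<or> h (n - i) = \<zero>\<^bsub>grade (A (n - i)) q\<^esub>"
  shows "tmul W p q f h n = \<zero>\<^bsub>grade (A n) (p + q)\<^esub>"
proof -
  interpret V: module R "grade (A n) (p + q)" by (rule modA)
  have "tmul W p q f h n = (\<Oplus>\<^bsub>grade (A n) (p + q)\<^esub>i\<in>{..n}. \<zero>\<^bsub>grade (A n) (p + q)\<^esub>)"
    unfolding weighted_simps
    by (rule V.add.finprod_cong') (auto simp: mul_zero[OF assms(1,2) _ assms(3)])
  thus ?thesis by simp
qed

lemma bilinear_tmul: "bilinear_map R (grade W p) (grade W q) (grade W (p + q)) (tmul W p q)"
proof -
  \<comment> \<open>The support of a product is contained in the set of sums of weights from the two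
    supports.\<close>
  have fin: "finite {n. tmul W p q f h n \<noteq> \<zero>\<^bsub>grade (A n) (p + q)\<^esub>}"
    if f: "f \<in> carrier (grade W p)" and h: "h \<in> carrier (grade W q)" for f h
  proof -
    let ?F = "{n. f n \<noteq> \<zero>\<^bsub>grade (A n) p\<^esub>}" and ?H = "{n. h n \<noteq> \<zero>\<^bsub>grade (A n) q\<^esub>}"
    have "{n. tmul W p q f h n \<noteq> \<zero>\<^bsub>grade (A n) (p + q)\<^esub>} \<subseteq> (\<lambda>(i, j). i + j) ` (?F \<times> ?H)"
    proof
      fix n assume "n \<in> {n. tmul W p q f h n \<noteq> \<zero>\<^bsub>grade (A n) (p + q)\<^esub>}"
      then obtain i where "i \<le> n" "f i \<noteq> \<zero>\<^bsub>grade (A i) p\<^esub>" "h (n - i) \<noteq> \<zero>\<^bsub>grade (A (n - i)) q\<^esub>"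
        using tmul_eq_zero[OF f h, of n] by blast
      thus "n \<in> (\<lambda>(i, j). i + j) ` (?F \<times> ?H)" by (intro image_eqI[of _ _ "(i, n - i)"]) auto
    qed
    moreover have "finite ?F" "finite ?H" using f h unfolding weighted_simps fam.carrier_iff by auto
    ultimately show ?thesis by (meson finite_SigmaI finite_imageI finite_subset)
  qed
  show ?thesis unfolding bilinear_map_def
  proof (intro conjI ballI linear_into_grade fin)
    fix f n assume f: "f \<in> carrier (grade W p)"
    show "linear_map R (grade W q) (grade (A n) (p + q)) (\<lambda>h. tmul W p q f h n)"
      unfolding weighted_simps(3)
      by (rule linear_finsum[OF modA], simp, rule linear_comp[OF linear_coord mul_linear(1)])
        (use coord_closed[OF f] in auto)
  next
    fix h n assume h: "h \<in> carrier (grade W q)"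
    show "linear_map R (grade W p) (grade (A n) (p + q)) (\<lambda>f. tmul W p q f h n)"
      unfolding weighted_simps(3)
      by (rule linear_finsum[OF modA], simp, rule linear_comp[OF linear_coord mul_linear(2)])
        (use coord_closed[OF h] in auto)
  qed
qed

lemma tmul_weight_part:
  assumes x: "x \<in> carrier (grade (A i) p)" and y: "y \<in> carrier (grade (A j) q)"
  shows "tmul W p q (weight_part A i p x) (weight_part A j q y) = weight_part A (i + j) (p + q) (\<mu> i j p q x y)"
proof
  fix n
  have x': "weight_part A i p x \<in> carrier (grade W p)" and y': "weight_part A j q y \<in> carrier (grade W q)"
    unfolding weighted_simps weight_part_eq by (rule fam.single_closed[OF UNIV_I x], rule fam.single_closed[OF UNIV_I y])
  show "tmul W p q (weight_part A i p x) (weight_part A j q y) n = weight_part A (i + j) (p + q) (\<mu> i j p q x y) n"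
  proof (cases "n = i + j")
    case False
    have "tmul W p q (weight_part A i p x) (weight_part A j q y) n = \<zero>\<^bsub>grade (A n) (p + q)\<^esub>"
      by (rule tmul_eq_zero[OF x' y']) (use False in \<open>auto simp: weight_part_def\<close>)
    thus ?thesis using False by (simp add: weight_part_def)
  next
    case True
    interpret V: module R "grade (A n) (p + q)" by (rule modA)
    let ?t = "\<lambda>k. \<mu> k (n - k) p q (weight_part A i p x k) (weight_part A j q y (n - k))"
    have z: "?t k = \<zero>\<^bsub>grade (A n) (p + q)\<^esub>" if "k \<le> n" "k \<noteq> i" for k
      by (rule mul_zero[OF x' y' that(1)]) (use that in \<open>auto simp: weight_part_def\<close>)
    have ti: "?t i = \<mu> i j p q x y" using True by (simp add: weight_part_def)
    have c: "?t i \<in> carrier (grade (A n) (p + q))"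
      unfolding ti using bilinear_closed[OF mul_bilinear x y] True by simp
    have "(\<Oplus>\<^bsub>grade (A n) (p + q)\<^esub>k\<in>{i}. ?t k) = (\<Oplus>\<^bsub>grade (A n) (p + q)\<^esub>k\<in>{..n}. ?t k)"
    proof (rule V.add.finprod_mono_neutral_cong_left)
      show "?t \<in> {..n} \<rightarrow> carrier (grade (A n) (p + q))"
      proof (rule Pi_I)
        fix k assume "k \<in> {..n}"
        thus "?t k \<in> carrier (grade (A n) (p + q))" using z[of k] c by (cases "k = i") auto
      qed
    qed (use True z in auto)
    moreover have "(\<Oplus>\<^bsub>grade (A n) (p + q)\<^esub>k\<in>{i}. ?t k) = ?t i"
      using c by (subst V.finsum_insert) auto
    ultimately show ?thesis using True ti by (simp add: weighted_simps weight_part_def)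
  qed
qed

end

section \<open>The tensor algebra and labelled words\<close>

locale s_module =
  fixes R :: "('r, 'k) ring_scheme" and \<gamma> :: "('r, 'a) smod"
  assumes cringR: "cring R" and sym: "sym_module R \<gamma>"
begin

definition typed :: "'a word \<Rightarrow> bool"
  where "typed w \<longleftrightarrow> (\<forall>(l, x)\<in>set w. x \<in> carrier (grade \<gamma> (length l)))"

definition good :: "nat \<Rightarrow> 'a word \<Rightarrow> bool"
  where "good p w \<longleftrightarrow> typed w \<and> mset (labels w) = mset (iota p)"

text \<open>\<open>tens_compat\<close> transported to words of length \<open>n\<close>. Balancing is
  demanded for one letter at a time, and the labels are unrestricted, so that the conditions survive
  relabelling and insertion into a context.\<close>

definition compat :: "nat \<Rightarrow> ('r, 'b, 'n) module_scheme \<Rightarrow> ('a word \<Rightarrow> 'b) \<Rightarrow> bool"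
  where "compat n V H \<longleftrightarrow>
    (\<forall>w. length w = n \<longrightarrow> H w \<in> carrier V) \<and>
    (\<forall>u v l x y. length u + Suc (length v) = n \<longrightarrow> typed u \<longrightarrow> typed v \<longrightarrow>
      x \<in> carrier (grade \<gamma> (length l)) \<longrightarrow> y \<in> carrier (grade \<gamma> (length l)) \<longrightarrow>
      H (u @ (l, x \<oplus>\<^bsub>grade \<gamma> (length l)\<^esub> y) # v) = H (u @ (l, x) # v) \<oplus>\<^bsub>V\<^esub> H (u @ (l, y) # v)) \<and>
    (\<forall>u v l r x. length u + Suc (length v) = n \<longrightarrow> typed u \<longrightarrow> typed v \<longrightarrow>
      r \<in> carrier R \<longrightarrow> x \<in> carrier (grade \<gamma> (length l)) \<longrightarrow>
      H (u @ (l, r \<odot>\<^bsub>grade \<gamma> (length l)\<^esub> x) # v) = r \<odot>\<^bsub>V\<^esub> H (u @ (l, x) # v)) \<and>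
    (\<forall>u v l \<tau> x. length u + Suc (length v) = n \<longrightarrow> typed u \<longrightarrow> typed v \<longrightarrow>
      \<tau> permutes {1..length l} \<longrightarrow> x \<in> carrier (grade \<gamma> (length l)) \<longrightarrow>
      H (u @ (plist \<tau> l, x) # v) = H (u @ (l, act \<gamma> (length l) \<tau> x) # v))"

lemma compatD:
  assumes "compat n V H"
  shows "length w = n \<Longrightarrow> H w \<in> carrier V"
    and "length u + Suc (length v) = n \<Longrightarrow> typed u \<Longrightarrow> typed v \<Longrightarrow>
      x \<in> carrier (grade \<gamma> (length l)) \<Longrightarrow> y \<in> carrier (grade \<gamma> (length l)) \<Longrightarrow>
      H (u @ (l, x \<oplus>\<^bsub>grade \<gamma> (length l)\<^esub> y) # v) = H (u @ (l, x) # v) \<oplus>\<^bsub>V\<^esub> H (u @ (l, y) # v)"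
    and "length u + Suc (length v) = n \<Longrightarrow> typed u \<Longrightarrow> typed v \<Longrightarrow>
      r \<in> carrier R \<Longrightarrow> x \<in> carrier (grade \<gamma> (length l)) \<Longrightarrow>
      H (u @ (l, r \<odot>\<^bsub>grade \<gamma> (length l)\<^esub> x) # v) = r \<odot>\<^bsub>V\<^esub> H (u @ (l, x) # v)"
    and "length u + Suc (length v) = n \<Longrightarrow> typed u \<Longrightarrow> typed v \<Longrightarrow>
      \<tau> permutes {1..length l} \<Longrightarrow> x \<in> carrier (grade \<gamma> (length l)) \<Longrightarrow>
      H (u @ (plist \<tau> l, x) # v) = H (u @ (l, act \<gamma> (length l) \<tau> x) # v)"
  using assms unfolding compat_def by blast+

lemma typed_simps [simp]: "typed []" "typed ((l, x) # w) \<longleftrightarrow> x \<in> carrier (grade \<gamma> (length l)) \<and> typed w"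
  "typed (u @ v) \<longleftrightarrow> typed u \<and> typed v" "typed (relabel f w) \<longleftrightarrow> typed w"
  by (auto simp: typed_def relabel_def)

lemma typed_lab: "typed (lab \<sigma> w) \<longleftrightarrow> (\<forall>(i, x)\<in>set w. x \<in> carrier (grade \<gamma> i))"
  by (induct \<sigma> w rule: lab.induct) auto

lemma mod_\<gamma>: "module R (grade \<gamma> m)"
  by (rule sym_moduleD(1)[OF sym])

sublocale pow: tensor_factors R "replicate n \<gamma>" for n
  by (rule tensor_factors.intro) (use cringR sym in auto)

lemma gens_replicate: "(\<sigma>, w) \<in> tensor_gens (replicate n \<gamma>) p \<longleftrightarrow>
    \<sigma> permutes {1..p} \<and> sum_list (map fst w) = p \<and> length w = n \<and> (\<forall>(i, x)\<in>set w. x \<in> carrier (grade \<gamma> i))"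
  by (auto simp: pow.gens_iff all_set_conv_all_nth case_prod_beta)

text \<open>Relabelling acts on the values of labels and balancing on their positions, so the two
  commute (\<open>map_plist\<close>).\<close>

lemma compat_context:
  assumes H: "compat n V H" and u\<^sub>0: "typed u\<^sub>0" and v\<^sub>0: "typed v\<^sub>0" and n: "length u\<^sub>0 + j + length v\<^sub>0 = n"
  shows "compat j V (\<lambda>w. H (u\<^sub>0 @ relabel f w @ v\<^sub>0))"
  unfolding compat_def
proof (intro conjI allI impI)
  show "length w = j \<Longrightarrow> H (u\<^sub>0 @ relabel f w @ v\<^sub>0) \<in> carrier V" for w
    by (rule compatD(1)[OF H]) (use n in auto)
next
  fix u v :: "'a word" and l :: "nat list" and x y
  assume a: "length u + Suc (length v) = j" "typed u" "typed v" "x \<in> carrier (grade \<gamma> (length l))" "y \<in> carrier (grade \<gamma> (length l))"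
  show "H (u\<^sub>0 @ relabel f (u @ (l, x \<oplus>\<^bsub>grade \<gamma> (length l)\<^esub> y) # v) @ v\<^sub>0) =
    H (u\<^sub>0 @ relabel f (u @ (l, x) # v) @ v\<^sub>0) \<oplus>\<^bsub>V\<^esub> H (u\<^sub>0 @ relabel f (u @ (l, y) # v) @ v\<^sub>0)"
    using compatD(2)[OF H, of "u\<^sub>0 @ relabel f u" "relabel f v @ v\<^sub>0" x "map f l" y] a u\<^sub>0 v\<^sub>0 n by simp
next
  fix u v :: "'a word" and l :: "nat list" and r x
  assume a: "length u + Suc (length v) = j" "typed u" "typed v" "r \<in> carrier R" "x \<in> carrier (grade \<gamma> (length l))"
  show "H (u\<^sub>0 @ relabel f (u @ (l, r \<odot>\<^bsub>grade \<gamma> (length l)\<^esub> x) # v) @ v\<^sub>0) =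
    r \<odot>\<^bsub>V\<^esub> H (u\<^sub>0 @ relabel f (u @ (l, x) # v) @ v\<^sub>0)"
    using compatD(3)[OF H, of "u\<^sub>0 @ relabel f u" "relabel f v @ v\<^sub>0" r x "map f l"] a u\<^sub>0 v\<^sub>0 n by simp
next
  fix u v :: "'a word" and l :: "nat list" and \<tau> x
  assume a: "length u + Suc (length v) = j" "typed u" "typed v" "\<tau> permutes {1..length l}" "x \<in> carrier (grade \<gamma> (length l))"
  show "H (u\<^sub>0 @ relabel f (u @ (plist \<tau> l, x) # v) @ v\<^sub>0) =
    H (u\<^sub>0 @ relabel f (u @ (l, act \<gamma> (length l) \<tau> x) # v) @ v\<^sub>0)"
    using compatD(4)[OF H, of "u\<^sub>0 @ relabel f u" "relabel f v @ v\<^sub>0" \<tau> "map f l" x] a u\<^sub>0 v\<^sub>0 n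
    by (simp add: map_plist)
qed

definition balance_rel :: "'a letter \<Rightarrow> 'a letter \<Rightarrow> bool"
  where "balance_rel a b \<longleftrightarrow> (\<exists>l x \<tau>. \<tau> permutes {1..length l} \<and> x \<in> carrier (grade \<gamma> (length l)) \<and>
    a = (plist \<tau> l, x) \<and> b = (l, act \<gamma> (length l) \<tau> x))"

text \<open>Balancing in all factors at once is carried out letter by letter from the left;
  \<open>u\<close> is the part already treated.\<close>

lemma compat_balanced:
  assumes "compat n V H"
  shows "list_all2 balance_rel w w' \<Longrightarrow> typed u \<Longrightarrow> length u + length w = n \<Longrightarrow> H (u @ w) = H (u @ w')"
proof (induct arbitrary: u rule: list_all2_induct)
  case (Cons a w b w')
  have tw: "list_all2 balance_rel w w' \<Longrightarrow> typed w" for w w'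
    by (induct rule: list_all2_induct) (auto simp: balance_rel_def)
  from Cons(1) obtain l x \<tau> where *: "\<tau> permutes {1..length l}" "x \<in> carrier (grade \<gamma> (length l))"
    "a = (plist \<tau> l, x)" "b = (l, act \<gamma> (length l) \<tau> x)" by (auto simp: balance_rel_def)
  have "H (u @ a # w) = H (u @ b # w)"
    using compatD(4)[OF assms _ Cons(4) tw[OF Cons(2)] *(1,2)] Cons(5) * by simp
  also have "\<dots> = H ((u @ [b]) @ w)" by simp
  also have "\<dots> = H ((u @ [b]) @ w')"
    by (rule Cons(3)) (use Cons(4,5) * sym_moduleD(5)[OF sym] in auto)
  finally show ?case by simp
qed simp

text \<open>A product of permutations acts on the blocks of positions separately, hence on the
  labels of each letter separately.\<close>

lemma balance_lab:
  "list_all2 (\<lambda>(i, x) \<tau>. \<tau> permutes {1..i}) w \<tau>s \<Longrightarrow> \<forall>(i, x)\<in>set w. x \<in> carrier (grade \<gamma> i) \<Longrightarrow>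
   list_all2 balance_rel (lab (\<lambda>k. \<sigma> (perm_prods (zip (map fst w) \<tau>s) k)) w)
     (lab \<sigma> (map2 (\<lambda>(i, x) \<tau>. (i, act \<gamma> i \<tau> x)) w \<tau>s))"
proof (induct arbitrary: \<sigma> rule: list_all2_induct)
  case (Cons a w \<tau> \<tau>s)
  obtain i x where a: "a = (i, x)" by (cases a)
  let ?r = "perm_prods (zip (map fst w) \<tau>s)"
  have "lab (\<lambda>k. \<sigma> (perm_prod i \<tau> ?r (k + i))) w = lab (\<lambda>k. \<sigma> (?r k + i)) w"
    by (rule lab_cong) (auto simp: perm_prod_def add.commute)
  moreover have "map (\<lambda>k. \<sigma> (perm_prod i \<tau> ?r k)) (iota i) = plist \<tau> (map \<sigma> (iota i))"
    using Cons(1) by (simp add: a plist_map_iota perm_prod_def)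
  moreover have "balance_rel (plist \<tau> (map \<sigma> (iota i)), x) (map \<sigma> (iota i), act \<gamma> i \<tau> x)"
    using Cons(1,4) by (auto simp: a balance_rel_def intro!: exI[of _ "map \<sigma> (iota i)"])
  ultimately show ?case using Cons(3)[of "\<lambda>k. \<sigma> (k + i)"] Cons(4) by (simp add: a)
qed simp

lemma tens_compat_lab:
  assumes V: "compat n V H"
  shows "tens_compat R (replicate n \<gamma>) p V (\<lambda>(\<sigma>, w). H (lab \<sigma> w))"
  unfolding tens_compat_def prod.case
proof (intro conjI allI impI ballI)
  fix s assume "s \<in> tensor_gens (replicate n \<gamma>) p"
  thus "(case s of (\<sigma>, w) \<Rightarrow> H (lab \<sigma> w)) \<in> carrier V"
    by (cases s) (auto simp: gens_replicate intro: compatD(1)[OF V])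
next
  fix \<sigma> u i x y v assume "(\<sigma>, u @ (i, x) # v) \<in> tensor_gens (replicate n \<gamma>) p" "(\<sigma>, u @ (i, y) # v) \<in> tensor_gens (replicate n \<gamma>) p"
  thus "H (lab \<sigma> (u @ (i, x \<oplus>\<^bsub>grade (replicate n \<gamma> ! length u) i\<^esub> y) # v)) =
    H (lab \<sigma> (u @ (i, x) # v)) \<oplus>\<^bsub>V\<^esub> H (lab \<sigma> (u @ (i, y) # v))"
    using compatD(2)[OF V, of _ _ x "map (\<lambda>k. \<sigma> (k + sum_list (map fst u))) (iota i)" y]
    by (auto simp: gens_replicate lab_append typed_lab)
next
  fix \<sigma> u i r x v assume "r \<in> carrier R" "(\<sigma>, u @ (i, x) # v) \<in> tensor_gens (replicate n \<gamma>) p"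
  thus "H (lab \<sigma> (u @ (i, r \<odot>\<^bsub>grade (replicate n \<gamma> ! length u) i\<^esub> x) # v)) = r \<odot>\<^bsub>V\<^esub> H (lab \<sigma> (u @ (i, x) # v))"
    using compatD(3)[OF V, of _ _ r x "map (\<lambda>k. \<sigma> (k + sum_list (map fst u))) (iota i)"]
    by (auto simp: gens_replicate lab_append typed_lab)
next
  fix \<sigma> w \<tau>s assume g: "(\<sigma>, w) \<in> tensor_gens (replicate n \<gamma>) p" and b: "list_all2 (\<lambda>(i, x) \<tau>. \<tau> permutes {1..i}) w \<tau>s"
  have "map (\<lambda>(M, (i, x), \<tau>). (i, act M i \<tau> x)) (zip (replicate n \<gamma>) (zip w \<tau>s)) =
    map2 (\<lambda>(i, x) \<tau>. (i, act \<gamma> i \<tau> x)) w \<tau>s"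
    using g list_all2_lengthD[OF b] by (intro nth_equalityI) (auto simp: gens_replicate case_prod_beta)
  moreover have "H ([] @ lab (\<lambda>k. \<sigma> (perm_prods (zip (map fst w) \<tau>s) k)) w) =
      H ([] @ lab \<sigma> (map2 (\<lambda>(i, x) \<tau>. (i, act \<gamma> i \<tau> x)) w \<tau>s))"
    by (rule compat_balanced[OF V balance_lab[OF b]]) (use g in \<open>auto simp: gens_replicate\<close>)
  ultimately show "H (lab (\<sigma> \<circ> perm_prods (zip (map fst w) \<tau>s)) w) =
      H (lab \<sigma> (map (\<lambda>(M, (i, x), \<tau>). (i, act M i \<tau> x)) (zip (replicate n \<gamma>) (zip w \<tau>s))))"
    by (simp add: o_def)
qed

section \<open>Classes of words in the tensor powers\<close>

abbreviation "pmod n p \<equiv> tensor_module R (replicate n \<gamma>) p"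

text \<open>The class of a labelled word; words whose labels are not a permutation of \<open>1, \<dots>, p\<close>
  count as zero, so that all identities between words hold without side conditions on labels.\<close>

definition wclass :: "nat \<Rightarrow> 'a word \<Rightarrow> ('r, 'a) tens"
  where "wclass p w = (if good p w then tensor_class R (replicate (length w) \<gamma>) (perm_of (labels w)) (plain w)
    else \<zero>\<^bsub>pmod (length w) p\<^esub>)"

lemma good_gens: "good p w \<Longrightarrow> (perm_of (labels w), plain w) \<in> tensor_gens (replicate (length w) \<gamma>) p"
  by (auto simp: good_def gens_replicate perm_of_permutes sum_plain mset_eq_iota)
    (auto simp: typed_def plain_def)

lemma good_lab: "(\<sigma>, w) \<in> tensor_gens (replicate n \<gamma>) p \<Longrightarrow> good p (lab \<sigma> w)"
  by (auto simp: good_def gens_replicate typed_lab labels_lab mset_map_permutes simp del: mset_map)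

lemma wclass_lab: "(\<sigma>, w) \<in> tensor_gens (replicate n \<gamma>) p \<Longrightarrow> wclass p (lab \<sigma> w) = tensor_class R (replicate n \<gamma>) \<sigma> w"
  using good_lab[of \<sigma> w n p] by (auto simp: wclass_def gens_replicate labels_lab perm_of_map_iota)

lemma wclass_closed: "length w = n \<Longrightarrow> wclass p w \<in> carrier (pmod n p)"
  using pow.class_closed[OF good_gens] module_zero_closed[OF pow.module_tensor] by (auto simp: wclass_def)

text \<open>Each relation preserves the multiset of labels. So either all its words have labels
  forming a permutation, and the relation is one of the tensor product, or none has, and all terms
  are zero.\<close>

lemma compat_wclass: "compat n (pmod n p) (wclass p)"
proof -
  note P = pow.module_tensor[of n p]
  interpret P: module R "pmod n p" by (rule P)
  note C = tens_compatD[OF pow.class_compat[of n p], unfolded prod.case]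
  have g: "good p w \<Longrightarrow> length w = n \<Longrightarrow> (perm_of (labels w), plain w) \<in> tensor_gens (replicate n \<gamma>) p" for w
    using good_gens by blast
  show ?thesis unfolding compat_def
  proof (intro conjI allI impI)
    show "length w = n \<Longrightarrow> wclass p w \<in> carrier (pmod n p)" for w by (rule wclass_closed)
  next
    fix u v :: "'a word" and l :: "nat list" and x y
    assume a: "length u + Suc (length v) = n" "typed u" "typed v" "x \<in> carrier (grade \<gamma> (length l))" "y \<in> carrier (grade \<gamma> (length l))"
    have xy: "x \<oplus>\<^bsub>grade \<gamma> (length l)\<^esub> y \<in> carrier (grade \<gamma> (length l))" by (rule module_add_closed[OF mod_\<gamma> a(4,5)])
    show "wclass p (u @ (l, x \<oplus>\<^bsub>grade \<gamma> (length l)\<^esub> y) # v) = wclass p (u @ (l, x) # v) \<oplus>\<^bsub>pmod n p\<^esub> wclass p (u @ (l, y) # v)"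
    proof (cases "mset (labels (u @ (l, x) # v)) = mset (iota p)")
      case True
      hence G: "good p (u @ (l, x) # v)" "good p (u @ (l, y) # v)" "good p (u @ (l, x \<oplus>\<^bsub>grade \<gamma> (length l)\<^esub> y) # v)"
        using a xy by (auto simp: good_def)
      have n: "replicate n \<gamma> ! length u = \<gamma>" using a(1) by simp
      from C(2)[of "perm_of (labels u @ l @ labels v)" "plain u" "length l" x "plain v" y] g[OF G(1)] g[OF G(2)] a(1) G n
      show ?thesis by (simp add: wclass_def)
    next
      case False
      hence "\<not> good p (u @ (l, x) # v)" "\<not> good p (u @ (l, y) # v)" "\<not> good p (u @ (l, x \<oplus>\<^bsub>grade \<gamma> (length l)\<^esub> y) # v)"
        by (auto simp: good_def)
      thus ?thesis using a(1) by (simp add: wclass_def)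
    qed
  next
    fix u v :: "'a word" and l :: "nat list" and r x
    assume a: "length u + Suc (length v) = n" "typed u" "typed v" "r \<in> carrier R" "x \<in> carrier (grade \<gamma> (length l))"
    have rx: "r \<odot>\<^bsub>grade \<gamma> (length l)\<^esub> x \<in> carrier (grade \<gamma> (length l))" by (rule module_smult_closed[OF mod_\<gamma> a(4,5)])
    show "wclass p (u @ (l, r \<odot>\<^bsub>grade \<gamma> (length l)\<^esub> x) # v) = r \<odot>\<^bsub>pmod n p\<^esub> wclass p (u @ (l, x) # v)"
    proof (cases "mset (labels (u @ (l, x) # v)) = mset (iota p)")
      case True
      hence G: "good p (u @ (l, x) # v)" "good p (u @ (l, r \<odot>\<^bsub>grade \<gamma> (length l)\<^esub> x) # v)"
        using a rx by (auto simp: good_def)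
      have n: "replicate n \<gamma> ! length u = \<gamma>" using a(1) by simp
      from C(3)[of r "perm_of (labels u @ l @ labels v)" "plain u" "length l" x "plain v"] g[OF G(1)] a(1,4) G n
      show ?thesis by (simp add: wclass_def)
    next
      case False
      hence "\<not> good p (u @ (l, x) # v)" "\<not> good p (u @ (l, r \<odot>\<^bsub>grade \<gamma> (length l)\<^esub> x) # v)"
        by (auto simp: good_def)
      thus ?thesis using a(1,4) by (simp add: wclass_def)
    qed
  next
    fix u v :: "'a word" and l :: "nat list" and \<tau> x
    assume a: "length u + Suc (length v) = n" "typed u" "typed v" "\<tau> permutes {1..length l}" "x \<in> carrier (grade \<gamma> (length l))"
    note tx = sym_moduleD(5)[OF sym a(5,4)]
    note ml = mset_plist[OF a(4)]
    show "wclass p (u @ (plist \<tau> l, x) # v) = wclass p (u @ (l, act \<gamma> (length l) \<tau> x) # v)"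
    proof (cases "mset (labels (u @ (l, x) # v)) = mset (iota p)")
      case True
      hence G: "good p (u @ (l, x) # v)" "good p (u @ (plist \<tau> l, x) # v)" "good p (u @ (l, act \<gamma> (length l) \<tau> x) # v)"
        using a tx ml by (auto simp: good_def)
      let ?w = "plain (u @ (l, x) # v)"
      \<comment> \<open>Balancing a single letter is the balancing relation of the tensor power with
        the identity in all other factors.\<close>
      let ?ts = "replicate (length u) id @ \<tau> # replicate (length v) id"
      let ?Ls = "map fst (u @ (l, x) # v)"
      have m: "map fst ?w = map length ?Ls" by (simp add: plain_def case_prod_beta o_def)
      have b1: "list_all2 (\<lambda>L \<tau>. \<tau> permutes {1..length L}) ?Ls ?ts"
        using a(4) by (auto simp: list_all2_conv_all_nth nth_append nth_Cons' permutes_id)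
      have b2: "list_all2 (\<lambda>(i, x) \<tau>. \<tau> permutes {1..i}) ?w ?ts"
        using a(4) by (auto simp: list_all2_conv_all_nth nth_append nth_Cons' permutes_id plain_def case_prod_beta)
      have z: "map2 plist (replicate (length w) id) (map fst w) = map fst w" for w :: "'a word"
        by (induct w) auto
      have "plist (perm_prods (zip (map fst ?w) ?ts)) (labels (u @ (l, x) # v)) = labels (u @ (plist \<tau> l, x) # v)"
        unfolding m labels_def plist_perm_prods[OF b1] by (simp add: z)
      moreover have "perm_prods (zip (map fst ?w) ?ts) permutes {1..length (labels (u @ (l, x) # v))}"
      proof -
        have "list_all2 (\<lambda>i \<tau>. \<tau> permutes {1..i}) (map length ?Ls) ?ts"
          using b1 by (simp only: list_all2_map1)
        from perm_prods_permutes[OF this] show ?thesis unfolding m labels_def length_concat .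
      qed
      ultimately have P: "perm_of (labels (u @ (plist \<tau> l, x) # v)) = perm_of (labels (u @ (l, x) # v)) \<circ> perm_prods (zip (map fst ?w) ?ts)"
        using perm_of_plist by metis
      have y: "map (\<lambda>(M, (i, x), \<tau>). (i, act M i \<tau> x)) (zip (replicate n \<gamma>) (zip ?w ?ts)) = plain (u @ (l, act \<gamma> (length l) \<tau> x) # v)"
      proof -
        have yy: "map (\<lambda>(M, (i, x), \<tau>). (i, act M i \<tau> x)) (zip (replicate (length w) \<gamma>) (zip (plain w) (replicate (length w) id))) = plain w"
          if "typed w" for w using that by (induct w) (auto simp: sym_moduleD(3)[OF sym])
        have "replicate n \<gamma> = replicate (length u) \<gamma> @ \<gamma> # replicate (length v) \<gamma>"
          using a(1) by (metis replicate_Suc replicate_add)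
        thus ?thesis using yy[OF a(2)] yy[OF a(3)] by simp
      qed
      have len: "length (u @ (plist \<tau> l, x) # v) = n" "length (u @ (l, act \<gamma> (length l) \<tau> x) # v) = n"
        "length (u @ (l, x) # v) = n" using a(1) by auto
      have pl: "plain (u @ (plist \<tau> l, x) # v) = plain (u @ (l, x) # v)" by simp
      have lb: "labels (u @ (l, act \<gamma> (length l) \<tau> x) # v) = labels (u @ (l, x) # v)" by simp
      from C(4)[OF g[OF G(1) len(3)] b2] show ?thesis
        unfolding wclass_def len using G y P pl lb by (simp only: if_True)
    next
      case False
      hence "\<not> good p (u @ (plist \<tau> l, x) # v)" "\<not> good p (u @ (l, act \<gamma> (length l) \<tau> x) # v)"
        using ml by (auto simp: good_def)
      thus ?thesis using a(1) by (simp add: wclass_def)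
    qed
  qed
qed

lemma lift_wclass:
  assumes "module R V" "compat n V H"
  shows "linear_map R (pmod n p) V (lift_linear R V (\<lambda>(\<sigma>, w). H (lab \<sigma> w)))"
    and "good p w \<Longrightarrow> length w = n \<Longrightarrow> lift_linear R V (\<lambda>(\<sigma>, w). H (lab \<sigma> w)) (wclass p w) = H w"
proof -
  note T = pow.lift_linear_tensor[OF assms(1) tens_compat_lab[OF assms(2)]]
  show "linear_map R (pmod n p) V (lift_linear R V (\<lambda>(\<sigma>, w). H (lab \<sigma> w)))" by (rule T(1))
  assume w: "good p w" "length w = n"
  from T(2)[OF good_gens[OF w(1), unfolded w(2)]] w
  show "lift_linear R V (\<lambda>(\<sigma>, w). H (lab \<sigma> w)) (wclass p w) = H w" by (simp add: wclass_def lab_perm_of)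
qed

lemma pmod_mspan: "carrier (pmod n p) = mspan R (pmod n p) {wclass p w | w. good p w \<and> length w = n}"
proof -
  have "{tensor_class R (replicate n \<gamma>) \<sigma> w | \<sigma> w. (\<sigma>, w) \<in> tensor_gens (replicate n \<gamma>) p} =
      {wclass p w | w. good p w \<and> length w = n}" (is "?A = ?B")
  proof
    show "?A \<subseteq> ?B" using wclass_lab good_lab by (fastforce simp: gens_replicate)
    show "?B \<subseteq> ?A" using good_gens by (auto simp: wclass_def)
  qed
  thus ?thesis using pow.tensor_mspan[of n p] by simp
qed

lemma good_append_shift: "good p w \<Longrightarrow> good q w' \<Longrightarrow> good (p + q) (w @ shift p w')"
  by (auto simp: good_def iota_add)

text \<open>Expressed in words, the product with one argument fixed is \<open>wclass\<close> of a
  word inserted into a context, so \<open>compat_context\<close> supplies all relations.\<close>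

lemma concat_props:
  shows "bilinear_map R (pmod i p) (pmod j q) (pmod (i + j) (p + q)) (tensor_concat R \<gamma> i j p q)"
    and "good p w \<Longrightarrow> good q w' \<Longrightarrow> length w = i \<Longrightarrow> length w' = j \<Longrightarrow>
      tensor_concat R \<gamma> i j p q (wclass p w) (wclass q w') = wclass (p + q) (w @ shift p w')"
proof -
  let ?V = "pmod (i + j) (p + q)"
  let ?h = "\<lambda>s t. tensor_class R (replicate (i + j) \<gamma>) (perm_prod p (fst s) (fst t)) (snd s @ snd t)"
  have eq: "tensor_concat R \<gamma> i j p q = (\<lambda>X Y. lift_linear R ?V (\<lambda>s. lift_linear R ?V (?h s) Y) X)"
    by (simp add: tensor_concat_def case_prod_unfold fun_eq_iff Let_def)
  have hw: "?h (\<sigma>, w) (\<tau>, w') = wclass (p + q) (lab \<sigma> w @ shift p (lab \<tau> w'))"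
    if "(\<sigma>, w) \<in> tensor_gens (replicate i \<gamma>) p" "(\<tau>, w') \<in> tensor_gens (replicate j \<gamma>) q" for \<sigma> w \<tau> w'
  proof -
    have "(perm_prod p \<sigma> \<tau>, w @ w') \<in> tensor_gens (replicate (i + j) \<gamma>) (p + q)"
      using that by (auto simp: gens_replicate perm_prod_permutes)
    from wclass_lab[OF this] that show ?thesis by (simp add: lab_perm_prod gens_replicate)
  qed
  have c1: "compat j ?V (\<lambda>w'. wclass (p + q) (w @ shift p w'))" if "length w = i" "typed w" for w
    using compat_context[OF compat_wclass that(2), where v\<^sub>0 = "[]" and f = "\<lambda>k. k + p"] that by simp
  have c2: "compat i ?V (\<lambda>w. wclass (p + q) (w @ shift p w'))" if "length w' = j" "typed w'" for w'
    using compat_context[OF compat_wclass, where u\<^sub>0 = "[]" and f = "\<lambda>k. k" and v\<^sub>0 = "shift p w'"] that by simp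
  have h1: "tens_compat R (replicate j \<gamma>) q ?V (?h s)" if "s \<in> tensor_gens (replicate i \<gamma>) p" for s
  proof -
    obtain \<sigma> w where s: "s = (\<sigma>, w)" by (cases s)
    have "compat j ?V (\<lambda>w'. wclass (p + q) (lab \<sigma> w @ shift p w'))"
      by (rule c1) (use that in \<open>auto simp: s gens_replicate typed_lab\<close>)
    from tens_compat_lab[OF this, of q] show ?thesis
      by (rule pow.tens_compat_cong) (use hw that in \<open>auto simp: s\<close>)
  qed
  have h2: "tens_compat R (replicate i \<gamma>) p ?V (\<lambda>s. ?h s t)" if "t \<in> tensor_gens (replicate j \<gamma>) q" for t
  proof -
    obtain \<tau> w' where t: "t = (\<tau>, w')" by (cases t)
    have "compat i ?V (\<lambda>w. wclass (p + q) (w @ shift p (lab \<tau> w')))"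
      by (rule c2) (use that in \<open>auto simp: t gens_replicate typed_lab\<close>)
    from tens_compat_lab[OF this, of p] show ?thesis
      by (rule pow.tens_compat_cong) (use hw that in \<open>auto simp: t\<close>)
  qed
  note B = bilinear_lift_tensor[OF pow.tensor_factors_axioms pow.tensor_factors_axioms pow.module_tensor h1 h2]
  show "bilinear_map R (pmod i p) (pmod j q) ?V (tensor_concat R \<gamma> i j p q)" unfolding eq by (rule B(1))
  assume a: "good p w" "good q w'" "length w = i" "length w' = j"
  note g = good_gens[OF a(1), unfolded a(3)] good_gens[OF a(2), unfolded a(4)]
  have "tensor_concat R \<gamma> i j p q (wclass p w) (wclass q w') = ?h (perm_of (labels w), plain w) (perm_of (labels w'), plain w')"
    using B(2)[OF _ _ g] a unfolding eq wclass_def by simp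
  also have "\<dots> = wclass (p + q) (w @ shift p w')" unfolding hw[OF g] lab_perm_of ..
  finally show "tensor_concat R \<gamma> i j p q (wclass p w) (wclass q w') = wclass (p + q) (w @ shift p w')" .
qed

end

text \<open>An inner segment of a word is recovered from the permutation of the whole word, shifted
  by the number of labels that precede it.\<close>

lemma lab_perm_of_infix:
  "lab (\<lambda>k. perm_of (L @ labels w @ L') (k + length L)) (plain w) = w"
proof -
  have "lab (\<lambda>k. perm_of (L @ labels w @ L') (k + length L)) (plain w) = lab (perm_of (labels w)) (plain w)"
    by (rule lab_cong) (auto simp: perm_of_def nth_append sum_plain)
  thus ?thesis by (simp add: lab_perm_of)
qed

context s_module
begin

text \<open>Compatibility in all lengths at once, that is, the data of a linear map out of the
  tensor algebra (\<open>T_universal\<close>).\<close>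

definition wfun :: "('r, 'b, 'n) module_scheme \<Rightarrow> ('a word \<Rightarrow> 'b) \<Rightarrow> bool"
  where "wfun V H \<longleftrightarrow> (\<forall>n. compat n V H)"

lemma wfunD:
  assumes "wfun V H"
  shows "H w \<in> carrier V"
    and "typed u \<Longrightarrow> typed v \<Longrightarrow> x \<in> carrier (grade \<gamma> (length l)) \<Longrightarrow> y \<in> carrier (grade \<gamma> (length l)) \<Longrightarrow>
      H (u @ (l, x \<oplus>\<^bsub>grade \<gamma> (length l)\<^esub> y) # v) = H (u @ (l, x) # v) \<oplus>\<^bsub>V\<^esub> H (u @ (l, y) # v)"
    and "typed u \<Longrightarrow> typed v \<Longrightarrow> r \<in> carrier R \<Longrightarrow> x \<in> carrier (grade \<gamma> (length l)) \<Longrightarrow>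
      H (u @ (l, r \<odot>\<^bsub>grade \<gamma> (length l)\<^esub> x) # v) = r \<odot>\<^bsub>V\<^esub> H (u @ (l, x) # v)"
    and "typed u \<Longrightarrow> typed v \<Longrightarrow> \<tau> permutes {1..length l} \<Longrightarrow> x \<in> carrier (grade \<gamma> (length l)) \<Longrightarrow>
      H (u @ (plist \<tau> l, x) # v) = H (u @ (l, act \<gamma> (length l) \<tau> x) # v)"
proof -
  have H: "compat n V H" for n using assms by (simp add: wfun_def)
  note C = compatD[OF H]
  show "H w \<in> carrier V" by (rule C(1)[OF refl])
  show "typed u \<Longrightarrow> typed v \<Longrightarrow> x \<in> carrier (grade \<gamma> (length l)) \<Longrightarrow> y \<in> carrier (grade \<gamma> (length l)) \<Longrightarrow>
      H (u @ (l, x \<oplus>\<^bsub>grade \<gamma> (length l)\<^esub> y) # v) = H (u @ (l, x) # v) \<oplus>\<^bsub>V\<^esub> H (u @ (l, y) # v)"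
    by (rule C(2)[OF refl])
  show "typed u \<Longrightarrow> typed v \<Longrightarrow> r \<in> carrier R \<Longrightarrow> x \<in> carrier (grade \<gamma> (length l)) \<Longrightarrow>
      H (u @ (l, r \<odot>\<^bsub>grade \<gamma> (length l)\<^esub> x) # v) = r \<odot>\<^bsub>V\<^esub> H (u @ (l, x) # v)"
    by (rule C(3)[OF refl])
  show "typed u \<Longrightarrow> typed v \<Longrightarrow> \<tau> permutes {1..length l} \<Longrightarrow> x \<in> carrier (grade \<gamma> (length l)) \<Longrightarrow>
      H (u @ (plist \<tau> l, x) # v) = H (u @ (l, act \<gamma> (length l) \<tau> x) # v)"
    by (rule C(4)[OF refl])
qed

lemma wfunI:
  assumes "\<And>w. H w \<in> carrier V"
    and "\<And>u v l x y. typed u \<Longrightarrow> typed v \<Longrightarrow> x \<in> carrier (grade \<gamma> (length l)) \<Longrightarrow> y \<in> carrier (grade \<gamma> (length l)) \<Longrightarrow>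
      H (u @ (l, x \<oplus>\<^bsub>grade \<gamma> (length l)\<^esub> y) # v) = H (u @ (l, x) # v) \<oplus>\<^bsub>V\<^esub> H (u @ (l, y) # v)"
    and "\<And>u v l r x. typed u \<Longrightarrow> typed v \<Longrightarrow> r \<in> carrier R \<Longrightarrow> x \<in> carrier (grade \<gamma> (length l)) \<Longrightarrow>
      H (u @ (l, r \<odot>\<^bsub>grade \<gamma> (length l)\<^esub> x) # v) = r \<odot>\<^bsub>V\<^esub> H (u @ (l, x) # v)"
    and "\<And>u v l \<tau> x. typed u \<Longrightarrow> typed v \<Longrightarrow> \<tau> permutes {1..length l} \<Longrightarrow> x \<in> carrier (grade \<gamma> (length l)) \<Longrightarrow>
      H (u @ (plist \<tau> l, x) # v) = H (u @ (l, act \<gamma> (length l) \<tau> x) # v)"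
  shows "wfun V H"
  unfolding wfun_def compat_def by (intro allI conjI impI assms)

lemma wfun_linear:
  assumes H: "wfun V H" and f: "linear_map R V W f"
  shows "wfun W (\<lambda>w. f (H w))"
  by (rule wfunI) (simp_all add: wfunD[OF H] linear_closed[OF f] linear_add[OF f] linear_smult[OF f])

lemma wfun_minus:
  assumes H: "wfun V H" and V: "module R V"
    and a: "typed u" "typed v" "x \<in> carrier (grade \<gamma> (length l))" "y \<in> carrier (grade \<gamma> (length l))"
  shows "H (u @ (l, x \<ominus>\<^bsub>grade \<gamma> (length l)\<^esub> y) # v) = H (u @ (l, x) # v) \<ominus>\<^bsub>V\<^esub> H (u @ (l, y) # v)"
proof -
  have "linear_map R (grade \<gamma> (length l)) V (\<lambda>x. H (u @ (l, x) # v))"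
    by (rule linear_mapI) (simp_all add: wfunD[OF H] a)
  from linear_minus[OF mod_\<gamma> V this a(3,4)] show ?thesis .
qed

section \<open>The tensor algebra in terms of words\<close>

abbreviation "T \<equiv> tensor_talg R \<gamma>"

lemma grade_power: "grade (tensor_power R \<gamma> n) p = pmod n p"
  by (simp add: tensor_power_def tensor_def)

sublocale TW: weighted R "tensor_power R \<gamma>" "tensor_concat R \<gamma>" "tensor_class R (replicate 0 \<gamma>) id []"
  by (rule weighted.intro) (simp_all only: grade_power cringR pow.module_tensor concat_props)

lemma T_eq: "T = TW.W"
  by (simp add: tensor_talg_def)

lemma module_T: "module R (grade T p)"
  unfolding T_eq by (rule TW.module_grade)

lemma T_grade: "grade T p = fin_supp UNIV (\<lambda>n. pmod n p)"
  unfolding T_eq weighted_simps grade_power ..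

lemma T_zero: "\<zero>\<^bsub>grade T p\<^esub> = (\<lambda>n. \<zero>\<^bsub>pmod n p\<^esub>)"
  unfolding T_grade by (simp add: fin_supp_def)

lemma fam: "module_family R (\<lambda>n. pmod n p)"
  by (simp add: module_family.intro cringR pow.module_tensor)

definition ev :: "nat \<Rightarrow> 'a word \<Rightarrow> nat \<Rightarrow> ('r, 'a) tens"
  where "ev p w = weight_part (tensor_power R \<gamma>) (length w) p (wclass p w)"

lemma ev_single: "ev p w = single (\<lambda>n. pmod n p) (length w) (wclass p w)"
  unfolding ev_def weight_part_eq grade_power ..

lemma ev_closed: "ev p w \<in> carrier (grade T p)"
  unfolding ev_single T_grade by (rule module_family.single_closed[OF fam UNIV_I wclass_closed[OF refl]])

lemma linear_single_T: "linear_map R (pmod n p) (grade T p) (single (\<lambda>n. pmod n p) n)"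
  unfolding T_grade by (rule module_family.linear_single[OF fam UNIV_I])

lemma ev_not_good: "\<not> good p w \<Longrightarrow> ev p w = \<zero>\<^bsub>grade T p\<^esub>"
  unfolding ev_single wclass_def by (simp add: linear_zero[OF pow.module_tensor module_T linear_single_T])

lemma wfun_ev: "wfun (grade T p) (ev p)"
proof (rule wfunI)
  show "ev p w \<in> carrier (grade T p)" for w by (rule ev_closed)
  fix u v :: "'a word" and l :: "nat list" and x y r \<tau>
  define n where "n = length u + Suc (length v)"
  note L = linear_single_T[of n p]
  note C = n_def compatD[OF compat_wclass[of n p]]
  have e: "ev p (u @ a # v) = single (\<lambda>n. pmod n p) n (wclass p (u @ a # v))" for a
    by (simp add: ev_single n_def)
  have c: "wclass p (u @ a # v) \<in> carrier (pmod n p)" for a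
    by (rule wclass_closed) (simp add: n_def)
  assume t: "typed u" "typed v" and x: "x \<in> carrier (grade \<gamma> (length l))"
  show "y \<in> carrier (grade \<gamma> (length l)) \<Longrightarrow>
      ev p (u @ (l, x \<oplus>\<^bsub>grade \<gamma> (length l)\<^esub> y) # v) = ev p (u @ (l, x) # v) \<oplus>\<^bsub>grade T p\<^esub> ev p (u @ (l, y) # v)"
    unfolding e by (simp only: C(3)[OF n_def[symmetric] t x] linear_add[OF L c c])
  show "r \<in> carrier R \<Longrightarrow> ev p (u @ (l, r \<odot>\<^bsub>grade \<gamma> (length l)\<^esub> x) # v) = r \<odot>\<^bsub>grade T p\<^esub> ev p (u @ (l, x) # v)"
    unfolding e by (simp only: C(4)[OF n_def[symmetric] t _ x] linear_smult[OF L _ c])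
  show "\<tau> permutes {1..length l} \<Longrightarrow> ev p (u @ (plist \<tau> l, x) # v) = ev p (u @ (l, act \<gamma> (length l) \<tau> x) # v)"
    unfolding e by (simp only: C(5)[OF n_def[symmetric] t _ x])
qed

lemma T_universal:
  assumes V: "module R V" and H: "wfun V H"
  shows "\<exists>f. linear_map R (grade T p) V f \<and> (\<forall>w. good p w \<longrightarrow> f (ev p w) = H w)"
proof -
  have Hn: "compat n V H" for n using H by (simp add: wfun_def)
  let ?g = "\<lambda>n. lift_linear R V (\<lambda>(\<sigma>, w). H (lab \<sigma> w))"
  let ?f = "supp_sum (\<lambda>n. pmod n p) V ?g"
  have "linear_map R (grade T p) V ?f"
    unfolding T_grade by (rule module_family.linear_supp_sum[OF fam V lift_wclass(1)[OF V Hn]])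
  moreover have "?f (ev p w) = H w" if w: "good p w" for w
    unfolding ev_single
    using module_family.supp_sum_single[OF fam V lift_wclass(1)[OF V Hn] UNIV_I wclass_closed[OF refl]]
      lift_wclass(2)[OF V Hn w refl] by simp
  ultimately show ?thesis by blast
qed

definition T_part :: "nat set \<Rightarrow> nat \<Rightarrow> (nat \<Rightarrow> ('r, 'a) tens) set"
  where "T_part S p = {t \<in> carrier (grade T p). \<forall>i. i \<notin> S \<longrightarrow> t i = \<zero>\<^bsub>pmod i p\<^esub>}"

text \<open>An element is a finite sum of its components, and each tensor power is spanned by its
  words. The cases of interest are the whole algebra (\<open>UNIV\<close>), a weight part
  (\<open>{n}\<close>) and the filtration steps.\<close>

lemma T_part_mspan: "T_part S p = mspan R (grade T p) {ev p w | w. good p w \<and> length w \<in> S}"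
  (is "_ = mspan _ _ ?E")
proof
  have E: "?E \<subseteq> carrier (grade T p)" using ev_closed by auto
  note sub = mspan_submodule[OF module_T E]
  note D = submoduleD[OF sub module_T]
  show "mspan R (grade T p) ?E \<subseteq> T_part S p"
  proof (rule mspan_minimal)
    have "ev p w i = \<zero>\<^bsub>pmod i p\<^esub>" if "length w \<in> S" "i \<notin> S" for w i
      using that by (auto simp: ev_single single_def)
    thus "?E \<subseteq> T_part S p" using ev_closed by (auto simp: T_part_def)
    interpret M: module R "grade T p" by (rule module_T)
    interpret P: module R "pmod n p" for n by (rule pow.module_tensor)
    show "submodule (T_part S p) R (grade T p)"
      by (rule M.submoduleI') (auto simp: T_part_def T_grade fin_supp_def M.zero_closed[unfolded T_grade fin_supp_def, simplified]
        M.add.m_closed[unfolded T_grade fin_supp_def, simplified] M.smult_closed[unfolded T_grade fin_supp_def, simplified])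
  qed
  show "T_part S p \<subseteq> mspan R (grade T p) ?E"
  proof
    fix t assume "t \<in> T_part S p"
    hence "t \<in> carrier (fin_supp S (\<lambda>n. pmod n p))"
      unfolding T_part_def T_grade by (auto simp: fin_supp_def)
    thus "t \<in> mspan R (grade T p) ?E"
    proof (induct rule: module_family.fin_supp_induct[OF fam, consumes 1])
      case 1
      show ?case using D(2) unfolding T_zero .
    next
      case (2 i x f)
      have ad: "a \<oplus>\<^bsub>fin_supp S (\<lambda>n. pmod n p)\<^esub> b = a \<oplus>\<^bsub>grade T p\<^esub> b" for a b
        unfolding T_grade by (simp add: fin_supp_def)
      have "single (\<lambda>n. pmod n p) i x \<in> mspan R (grade T p) ?E"
      proof (rule linear_vanish_mspan[OF pow.module_tensor module_T linear_single_T _ _ sub])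
        show "{wclass p w | w. good p w \<and> length w = i} \<subseteq> carrier (pmod i p)" using wclass_closed by auto
        show "x \<in> mspan R (pmod i p) {wclass p w | w. good p w \<and> length w = i}" using 2(2) pmod_mspan[of i p] by simp
        fix s assume "s \<in> {wclass p w | w. good p w \<and> length w = i}"
        then obtain w where w: "s = wclass p w" "good p w" "length w = i" by blast
        hence "ev p w \<in> ?E" using 2(1) by auto
        moreover have "single (\<lambda>n. pmod n p) i s = ev p w" using w by (simp add: ev_single)
        ultimately show "single (\<lambda>n. pmod n p) i s \<in> mspan R (grade T p) ?E" by (simp only: hull_inc)
      qed
      thus ?case unfolding ad by (rule D(4)[OF _ 2(4)])
    qed
  qed
qed

lemma T_mspan: "carrier (grade T p) = mspan R (grade T p) {ev p w | w. good p w}"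
  using T_part_mspan[of UNIV p] by (simp add: T_part_def)

lemma good_append_shift_iff1: "good p w \<Longrightarrow> good (p + q) (w @ shift p w') \<longleftrightarrow> good q w'"
proof -
  assume w: "good p w"
  have "mset (map (\<lambda>k. k + p) L) = mset (map (\<lambda>k. k + p) L') \<longleftrightarrow> mset L = mset L'" for L L' :: "nat list"
  proof
    assume "mset (map (\<lambda>k. k + p) L) = mset (map (\<lambda>k. k + p) L')"
    hence "image_mset (\<lambda>k. k - p) (mset (map (\<lambda>k. k + p) L)) = image_mset (\<lambda>k. k - p) (mset (map (\<lambda>k. k + p) L'))"
      by (rule arg_cong)
    thus "mset L = mset L'" by (simp add: multiset.map_comp o_def)
  qed simp
  from this[of "labels w'" "iota q"] w show ?thesis by (auto simp: good_def iota_add)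
qed

lemma good_append_shift_iff2: "good q w' \<Longrightarrow> mset (labels (w @ shift p w')) = mset (iota (p + q)) \<longleftrightarrow> mset (labels w) = mset (iota p)"
  by (simp add: good_def iota_add)

lemma bilinear_tmul_T: "bilinear_map R (grade T p) (grade T q) (grade T (p + q)) (tmul T p q)"
  unfolding T_eq by (rule TW.bilinear_tmul)

lemma ev_mul_good: "good p w \<Longrightarrow> good q w' \<Longrightarrow> tmul T p q (ev p w) (ev q w') = ev (p + q) (w @ shift p w')"
  unfolding ev_def T_eq
  by (subst TW.tmul_weight_part) (simp_all add: grade_power wclass_closed concat_props(2))

text \<open>If the other factor has bad labels, both sides vanish. One good factor is essential: as
  labels are arbitrary numbers, two bad words may concatenate to a good one.\<close>

lemma ev_mul1: "good p w \<Longrightarrow> tmul T p q (ev p w) (ev q w') = ev (p + q) (w @ shift p w')"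
proof (cases "good q w'")
  case False
  moreover assume w: "good p w"
  ultimately show ?thesis
    using linear_zero[OF module_T module_T bilinear_right[OF bilinear_tmul_T ev_closed]]
    by (simp add: ev_not_good good_append_shift_iff1[OF w])
qed (rule ev_mul_good)

lemma ev_mul2: "good q w' \<Longrightarrow> tmul T p q (ev p w) (ev q w') = ev (p + q) (w @ shift p w')"
proof (cases "good p w")
  case False
  assume w: "good q w'"
  with False have "\<not> good (p + q) (w @ shift p w')"
    using good_append_shift_iff2[OF w, of w p] by (auto simp: good_def)
  thus ?thesis
    using linear_zero[OF module_T module_T bilinear_left[OF bilinear_tmul_T ev_closed]] False
    by (simp add: ev_not_good)
qed (rule ev_mul_good)

lemma act_T: "act T p \<sigma> t n = act (tensor R (replicate n \<gamma>)) p \<sigma> (t n)"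
  unfolding T_eq weighted_simps tensor_power_def ..

lemma linear_act_T:
  assumes "\<sigma> permutes {1..p}"
  shows "linear_map R (grade T p) (grade T p) (act T p \<sigma>)"
  unfolding T_eq
proof (rule TW.linear_into_grade)
  note A = pow.act_tensor(1)[OF assms]
  have c: "linear_map R (grade TW.W p) (pmod n p) (\<lambda>f. f n)" for n using TW.linear_coord[of p n] by (simp only: grade_power)
  show "linear_map R (grade TW.W p) (grade (tensor_power R \<gamma> n) p) (\<lambda>t. act TW.W p \<sigma> t n)" for n
    unfolding grade_power act_T[unfolded T_eq] by (rule linear_comp[OF c A])
  fix t assume "t \<in> carrier (grade TW.W p)"
  hence "finite {n. t n \<noteq> \<zero>\<^bsub>pmod n p\<^esub>}" unfolding weighted_simps grade_power by (simp add: fin_supp_def)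
  moreover have "{n. act TW.W p \<sigma> t n \<noteq> \<zero>\<^bsub>pmod n p\<^esub>} \<subseteq> {n. t n \<noteq> \<zero>\<^bsub>pmod n p\<^esub>}"
    using linear_zero[OF pow.module_tensor pow.module_tensor A] unfolding act_T[unfolded T_eq] by auto
  ultimately show "finite {n. act TW.W p \<sigma> t n \<noteq> \<zero>\<^bsub>grade (tensor_power R \<gamma> n) p\<^esub>}"
    unfolding grade_power by (rule finite_subset[rotated])
qed

lemma good_relabel: "\<sigma> permutes {1..p} \<Longrightarrow> good p (relabel \<sigma> w) \<longleftrightarrow> good p w"
  unfolding good_def by (simp only: typed_simps labels_simps mset_map_permutes')

lemma act_ev:
  assumes s: "\<sigma> permutes {1..p}"
  shows "act T p \<sigma> (ev p w) = ev p (relabel \<sigma> w)"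
proof (cases "good p w")
  case False
  thus ?thesis using linear_zero[OF module_T module_T linear_act_T[OF s]]
    by (simp add: ev_not_good good_relabel[OF s])
next
  case True
  have p: "length (labels w) = p" using True mset_eq_iota by (auto simp: good_def)
  have "perm_of (map \<sigma> (labels w)) = \<sigma> \<circ> perm_of (labels w)"
    using permutes_not_in[OF s] p by (auto simp: perm_of_def fun_eq_iff)
  hence "act (tensor R (replicate (length w) \<gamma>)) p \<sigma> (wclass p w) = wclass p (relabel \<sigma> w)"
    using True good_relabel[OF s] pow.act_tensor(2)[OF s good_gens[OF True]] by (simp add: wclass_def)
  moreover have "act (tensor R (replicate n \<gamma>)) p \<sigma> \<zero>\<^bsub>pmod n p\<^esub> = \<zero>\<^bsub>pmod n p\<^esub>" for n
    by (rule linear_zero[OF pow.module_tensor pow.module_tensor pow.act_tensor(1)[OF s]])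
  ultimately show ?thesis by (simp add: ev_single single_def act_T fun_eq_iff)
qed

lemma T_agree:
  assumes "module R V" "linear_map R (grade T p) V f" "linear_map R (grade T p) V g"
    "\<And>w. good p w \<Longrightarrow> f (ev p w) = g (ev p w)" "t \<in> carrier (grade T p)"
  shows "f t = g t"
proof (rule linear_agree[OF module_T assms(1-3)])
  show "{ev p w | w. good p w} \<subseteq> carrier (grade T p)" using ev_closed by auto
  show "t \<in> mspan R (grade T p) {ev p w | w. good p w}" using assms(5) T_mspan by simp
qed (use assms(4) in auto)

lemma sym_module_T: "sym_module R T"
  unfolding sym_module_def
proof (intro allI conjI impI ballI module_T linear_act_T)
  fix p t assume t: "t \<in> carrier (grade T p)"
  show "act T p id t = t"
    by (rule T_agree[OF module_T linear_act_T[OF permutes_id] linear_id _ t]) (simp add: act_ev permutes_id)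
next
  fix p \<sigma> \<tau> t assume t: "t \<in> carrier (grade T p)" and s: "\<sigma> permutes {1..p}" and u: "\<tau> permutes {1..p}"
  note su = permutes_compose[OF u s]
  show "act T p (\<sigma> \<circ> \<tau>) t = act T p \<sigma> (act T p \<tau> t)"
    by (rule T_agree[OF module_T linear_act_T[OF su] linear_comp[OF linear_act_T[OF u] linear_act_T[OF s]] _ t])
      (simp add: act_ev[OF s] act_ev[OF u] act_ev[OF su] relabel_comp)
qed

lemma good_Nil: "good 0 []" by (simp add: good_def)

lemma tone_ev: "tone T = ev 0 []"
proof -
  have "perm_of [] = id" by (auto simp: perm_of_def)
  thus ?thesis using good_Nil by (simp add: T_eq weighted_simps ev_def wclass_def)
qed

lemma good_letter: "x \<in> carrier (grade \<gamma> m) \<Longrightarrow> good m [(iota m, x)]"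
  by (simp add: good_def)

lemma tensor_incl_ev: "x \<in> carrier (grade \<gamma> m) \<Longrightarrow> tensor_incl R \<gamma> m x = ev m [(iota m, x)]"
  using good_letter[of x m] by (simp add: tensor_incl_def ev_def wclass_def One_nat_def)

end

section \<open>The ideals of the symmetric and enveloping algebras\<close>

context s_module
begin

text \<open>The conditions of \<open>wfun\<close> in a single letter; a word function is a
  \<open>wfun\<close> when it is an \<open>lfun\<close> in each letter. Functions defined by sums
  over grafted words are treated letter by letter in this way.\<close>

definition lfun :: "('r, 'b, 'n) module_scheme \<Rightarrow> ('a letter \<Rightarrow> 'b) \<Rightarrow> bool"
  where "lfun V \<phi> \<longleftrightarrow> (\<forall>a. \<phi> a \<in> carrier V) \<and>
    (\<forall>l. \<forall>x\<in>carrier (grade \<gamma> (length l)). \<forall>y\<in>carrier (grade \<gamma> (length l)).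
      \<phi> (l, x \<oplus>\<^bsub>grade \<gamma> (length l)\<^esub> y) = \<phi> (l, x) \<oplus>\<^bsub>V\<^esub> \<phi> (l, y)) \<and>
    (\<forall>l. \<forall>r\<in>carrier R. \<forall>x\<in>carrier (grade \<gamma> (length l)).
      \<phi> (l, r \<odot>\<^bsub>grade \<gamma> (length l)\<^esub> x) = r \<odot>\<^bsub>V\<^esub> \<phi> (l, x)) \<and>
    (\<forall>l \<tau>. \<forall>x\<in>carrier (grade \<gamma> (length l)). \<tau> permutes {1..length l} \<longrightarrow>
      \<phi> (plist \<tau> l, x) = \<phi> (l, act \<gamma> (length l) \<tau> x))"

lemma lfunD:
  assumes "lfun V \<phi>"
  shows "\<phi> a \<in> carrier V"
    and "x \<in> carrier (grade \<gamma> (length l)) \<Longrightarrow> y \<in> carrier (grade \<gamma> (length l)) \<Longrightarrow>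
      \<phi> (l, x \<oplus>\<^bsub>grade \<gamma> (length l)\<^esub> y) = \<phi> (l, x) \<oplus>\<^bsub>V\<^esub> \<phi> (l, y)"
    and "r \<in> carrier R \<Longrightarrow> x \<in> carrier (grade \<gamma> (length l)) \<Longrightarrow> \<phi> (l, r \<odot>\<^bsub>grade \<gamma> (length l)\<^esub> x) = r \<odot>\<^bsub>V\<^esub> \<phi> (l, x)"
    and "\<tau> permutes {1..length l} \<Longrightarrow> x \<in> carrier (grade \<gamma> (length l)) \<Longrightarrow>
      \<phi> (plist \<tau> l, x) = \<phi> (l, act \<gamma> (length l) \<tau> x)"
  using assms by (simp_all only: lfun_def simp_thms)

lemma lfunI:
  assumes "\<And>a. \<phi> a \<in> carrier V"
    and "\<And>l x y. x \<in> carrier (grade \<gamma> (length l)) \<Longrightarrow> y \<in> carrier (grade \<gamma> (length l)) \<Longrightarrow>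
      \<phi> (l, x \<oplus>\<^bsub>grade \<gamma> (length l)\<^esub> y) = \<phi> (l, x) \<oplus>\<^bsub>V\<^esub> \<phi> (l, y)"
    and "\<And>l r x. r \<in> carrier R \<Longrightarrow> x \<in> carrier (grade \<gamma> (length l)) \<Longrightarrow> \<phi> (l, r \<odot>\<^bsub>grade \<gamma> (length l)\<^esub> x) = r \<odot>\<^bsub>V\<^esub> \<phi> (l, x)"
    and "\<And>l \<tau> x. \<tau> permutes {1..length l} \<Longrightarrow> x \<in> carrier (grade \<gamma> (length l)) \<Longrightarrow>
      \<phi> (plist \<tau> l, x) = \<phi> (l, act \<gamma> (length l) \<tau> x)"
  shows "lfun V \<phi>"
  unfolding lfun_def by (intro conjI allI ballI impI assms)

lemma lfun_wfun: "wfun V H \<Longrightarrow> typed u \<Longrightarrow> typed v \<Longrightarrow> lfun V (\<lambda>a. H (u @ a # v))"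
  by (rule lfunI) (simp_all only: wfunD)

lemma wfun_lfunI:
  assumes "\<And>w. H w \<in> carrier V" "\<And>u v. typed u \<Longrightarrow> typed v \<Longrightarrow> lfun V (\<lambda>a. H (u @ a # v))"
  shows "wfun V H"
  by (rule wfunI) (rule assms(1), (rule lfunD[OF assms(2)], assumption+)+)

lemma lfun_zero: "module R V \<Longrightarrow> lfun V (\<lambda>a. \<zero>\<^bsub>V\<^esub>)"
proof (rule lfunI)
  assume "module R V" then interpret V: module R V .
  show "\<zero>\<^bsub>V\<^esub> \<in> carrier V" "\<zero>\<^bsub>V\<^esub> = \<zero>\<^bsub>V\<^esub> \<oplus>\<^bsub>V\<^esub> \<zero>\<^bsub>V\<^esub>" "\<And>r. r \<in> carrier R \<Longrightarrow> \<zero>\<^bsub>V\<^esub> = r \<odot>\<^bsub>V\<^esub> \<zero>\<^bsub>V\<^esub>" by auto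
qed simp

lemma lfun_plus:
  assumes V: "module R V" and f: "lfun V \<phi>" and g: "lfun V \<psi>"
  shows "lfun V (\<lambda>a. \<phi> a \<oplus>\<^bsub>V\<^esub> \<psi> a)"
proof -
  interpret V: module R V by (rule V)
  note c = lfunD(1)[OF f] lfunD(1)[OF g]
  show ?thesis
    by (rule lfunI) (simp_all add: c lfunD(2-4)[OF f] lfunD(2-4)[OF g] V.a_ac V.smult_r_distr)
qed

lemma lfun_msum:
  assumes V: "module R V" and f: "\<And>x. x \<in># A \<Longrightarrow> lfun V (F x)" and c: "\<And>x a. F x a \<in> carrier V"
  shows "lfun V (\<lambda>a. msum V (\<lambda>x. F x a) A)"
  using f
proof (induct A)
  case empty show ?case unfolding msum_empty[OF V] by (rule lfun_zero[OF V])
next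
  case (add x A)
  have "lfun V (F x)" "lfun V (\<lambda>a. msum V (\<lambda>x. F x a) A)" using add by auto
  from lfun_plus[OF V this] show ?case by (simp only: msum_add_mset[OF V c])
qed

lemma typed_Cons: "typed (a # w) \<longleftrightarrow> typed [a] \<and> typed w"
  by (cases a) simp

end

text \<open>An equivariant bilinear product without further identities; in particular its bracket
  need not satisfy the Jacobi identity. The pre-Lie product gives \<open>U\<close>, the zero product
  gives \<open>Sym\<close>.\<close>

locale word_op = s_module R \<gamma> for R :: "('r, 'k) ring_scheme" and \<gamma> :: "('r, 'a) smod" +
  fixes opr :: "nat \<Rightarrow> nat \<Rightarrow> 'a \<Rightarrow> 'a \<Rightarrow> 'a"
  assumes opr_bilinear: "bilinear_map R (grade \<gamma> m) (grade \<gamma> n) (grade \<gamma> (m + n)) (opr m n)"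
    and opr_equivariant: "\<sigma> permutes {1..m} \<Longrightarrow> \<tau> permutes {1..n} \<Longrightarrow> x \<in> carrier (grade \<gamma> m) \<Longrightarrow> y \<in> carrier (grade \<gamma> n) \<Longrightarrow>
      act \<gamma> (m + n) (perm_prod m \<sigma> \<tau>) (opr m n x y) = opr m n (act \<gamma> m \<sigma> x) (act \<gamma> n \<tau> y)"
begin

text \<open>Concatenating the labels encodes equivariance: relabelling both letters relabels their
  product, with no permutation left over.\<close>

definition lop :: "'a letter \<Rightarrow> 'a letter \<Rightarrow> 'a letter"
  where "lop a b = (fst a @ fst b, opr (length (fst a)) (length (fst b)) (snd a) (snd b))"

lemma lop_simp [simp]: "lop (l, x) (l', y) = (l @ l', opr (length l) (length l') x y)"
  by (simp add: lop_def)

lemma typed_lop: "typed [a] \<Longrightarrow> typed [b] \<Longrightarrow> typed [lop a b]"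
  by (cases a; cases b) (simp add: bilinear_closed[OF opr_bilinear])

lemma labels_lop [simp]: "fst (lop a b) = fst a @ fst b"
  by (simp add: lop_def)

text \<open>Balancing the left letter by \<tau> is balancing the product by the product of \<tau>
  and the identity; equivariance of \<open>opr\<close> moves that permutation back to the left
  letter.\<close>

lemma lfun_lop_left:
  assumes f: "lfun V \<phi>" and b: "typed [b]"
  shows "lfun V (\<lambda>a. \<phi> (lop a b))"
proof -
  obtain l' z where b': "b = (l', z)" by (cases b)
  with b have z: "z \<in> carrier (grade \<gamma> (length l'))" by simp
  note L = bilinear_left[OF opr_bilinear z]
  note c = bilinear_closed[OF opr_bilinear _ z]
  show ?thesis unfolding b'
  proof (rule lfunI)
    show "\<phi> (lop a (l', z)) \<in> carrier V" for a by (rule lfunD(1)[OF f])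
    fix l :: "nat list" and x y assume x: "x \<in> carrier (grade \<gamma> (length l))" and y: "y \<in> carrier (grade \<gamma> (length l))"
    show "\<phi> (lop (l, x \<oplus>\<^bsub>grade \<gamma> (length l)\<^esub> y) (l', z)) = \<phi> (lop (l, x) (l', z)) \<oplus>\<^bsub>V\<^esub> \<phi> (lop (l, y) (l', z))"
      using lfunD(2)[OF f, of _ "l @ l'"] c[OF x] c[OF y] by (simp add: linear_add[OF L x y])
  next
    fix l :: "nat list" and r x assume r: "r \<in> carrier R" and x: "x \<in> carrier (grade \<gamma> (length l))"
    show "\<phi> (lop (l, r \<odot>\<^bsub>grade \<gamma> (length l)\<^esub> x) (l', z)) = r \<odot>\<^bsub>V\<^esub> \<phi> (lop (l, x) (l', z))"
      using lfunD(3)[OF f r, of _ "l @ l'"] c[OF x] by (simp add: linear_smult[OF L r x])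
  next
    fix l :: "nat list" and \<tau> x assume t: "\<tau> permutes {1..length l}" and x: "x \<in> carrier (grade \<gamma> (length l))"
    have "perm_prod (length l) \<tau> id permutes {1..length (l @ l')}" using perm_prod_permutes[OF t permutes_id] by simp
    from lfunD(4)[OF f this, of "opr (length l) (length l') x z"] c[OF x]
    have "\<phi> (plist \<tau> l @ l', opr (length l) (length l') x z) =
        \<phi> (l @ l', act \<gamma> (length l + length l') (perm_prod (length l) \<tau> id) (opr (length l) (length l') x z))"
      using plist_perm_prod[OF t permutes_id, of l'] by simp
    also have "act \<gamma> (length l + length l') (perm_prod (length l) \<tau> id) (opr (length l) (length l') x z) =
        opr (length l) (length l') (act \<gamma> (length l) \<tau> x) z"
      by (simp add: opr_equivariant[OF t permutes_id x z] sym_moduleD(3)[OF sym z])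
    finally show "\<phi> (lop (plist \<tau> l, x) (l', z)) = \<phi> (lop (l, act \<gamma> (length l) \<tau> x) (l', z))" by simp
  qed
qed

lemma lfun_lop_right:
  assumes f: "lfun V \<phi>" and b: "typed [b]"
  shows "lfun V (\<lambda>a. \<phi> (lop b a))"
proof -
  obtain l' z where b': "b = (l', z)" by (cases b)
  with b have z: "z \<in> carrier (grade \<gamma> (length l'))" by simp
  note L = bilinear_right[OF opr_bilinear z]
  note c = bilinear_closed[OF opr_bilinear z]
  show ?thesis unfolding b'
  proof (rule lfunI)
    show "\<phi> (lop (l', z) a) \<in> carrier V" for a by (rule lfunD(1)[OF f])
    fix l :: "nat list" and x y assume x: "x \<in> carrier (grade \<gamma> (length l))" and y: "y \<in> carrier (grade \<gamma> (length l))"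
    show "\<phi> (lop (l', z) (l, x \<oplus>\<^bsub>grade \<gamma> (length l)\<^esub> y)) = \<phi> (lop (l', z) (l, x)) \<oplus>\<^bsub>V\<^esub> \<phi> (lop (l', z) (l, y))"
      using lfunD(2)[OF f, of _ "l' @ l"] c[OF x] c[OF y] by (simp add: linear_add[OF L x y])
  next
    fix l :: "nat list" and r x assume r: "r \<in> carrier R" and x: "x \<in> carrier (grade \<gamma> (length l))"
    show "\<phi> (lop (l', z) (l, r \<odot>\<^bsub>grade \<gamma> (length l)\<^esub> x)) = r \<odot>\<^bsub>V\<^esub> \<phi> (lop (l', z) (l, x))"
      using lfunD(3)[OF f r, of _ "l' @ l"] c[OF x] by (simp add: linear_smult[OF L r x])
  next
    fix l :: "nat list" and \<tau> x assume t: "\<tau> permutes {1..length l}" and x: "x \<in> carrier (grade \<gamma> (length l))"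
    have "perm_prod (length l') id \<tau> permutes {1..length (l' @ l)}" using perm_prod_permutes[OF permutes_id t] by simp
    from lfunD(4)[OF f this, of "opr (length l') (length l) z x"] c[OF x]
    have "\<phi> (l' @ plist \<tau> l, opr (length l') (length l) z x) =
        \<phi> (l' @ l, act \<gamma> (length l' + length l) (perm_prod (length l') id \<tau>) (opr (length l') (length l) z x))"
      using plist_perm_prod[OF permutes_id t, of l'] by simp
    also have "act \<gamma> (length l' + length l) (perm_prod (length l') id \<tau>) (opr (length l') (length l) z x) =
        opr (length l') (length l) z (act \<gamma> (length l) \<tau> x)"
      by (simp add: opr_equivariant[OF permutes_id t z x] sym_moduleD(3)[OF sym z])
    finally show "\<phi> (lop (l', z) (plist \<tau> l, x)) = \<phi> (lop (l', z) (l, act \<gamma> (length l) \<tau> x))" by simp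
  qed
qed

definition bracket :: "nat \<Rightarrow> nat \<Rightarrow> 'a \<Rightarrow> 'a \<Rightarrow> 'a"
  where "bracket m n x y = opr m n x y
    \<ominus>\<^bsub>grade \<gamma> (m + n)\<^esub> act \<gamma> (m + n) (block_perm (transpose 1 2) [n, m]) (opr n m y x)"

text \<open>The relation xy - (12)yx - {x,y} placed between \<open>u\<close> and \<open>v\<close>.
  The permutation (12) is invisible, because the letters keep their labels when they are
  exchanged.\<close>

definition rel_elem :: "('r, 'b, 'n) module_scheme \<Rightarrow> ('a word \<Rightarrow> 'b) \<Rightarrow> 'a word \<Rightarrow> 'a letter \<Rightarrow> 'a letter \<Rightarrow> 'a word \<Rightarrow> 'b"
  where "rel_elem V H u a b v =
    (H (u @ a # b # v) \<ominus>\<^bsub>V\<^esub> H (u @ b # a # v)) \<ominus>\<^bsub>V\<^esub> (H (u @ lop a b # v) \<ominus>\<^bsub>V\<^esub> H (u @ lop b a # v))"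

definition erel :: "nat \<Rightarrow> (nat \<Rightarrow> ('r, 'a) tens) set"
  where "erel p = {rel_elem (grade T p) (ev p) u a b v | u a b v. typed u \<and> typed [a] \<and> typed [b] \<and> typed v}"

abbreviation "I \<equiv> env_ideal R \<gamma> bracket"
abbreviation "Isp p \<equiv> mspan R (grade T p) (erel p)"

definition gen_elem :: "nat \<Rightarrow> nat \<Rightarrow> 'a \<Rightarrow> 'a \<Rightarrow> nat \<Rightarrow> ('r, 'a) tens"
  where "gen_elem m n x y = twisted_commutator R \<gamma> m n x y
    \<ominus>\<^bsub>grade T (m + n)\<^esub> tensor_incl R \<gamma> (m + n) (bracket m n x y)"

lemma linear_rel_elem:
  assumes "module R V" "module R W" "linear_map R V W f" "\<And>w. H w \<in> carrier V"
  shows "f (rel_elem V H u a b v) = rel_elem W (\<lambda>w. f (H w)) u a b v"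
  unfolding rel_elem_def
  by (simp only: linear_minus[OF assms(1-3)] assms(4) module_minus_closed[OF assms(1)])

lemma erelI: "typed u \<Longrightarrow> typed [a] \<Longrightarrow> typed [b] \<Longrightarrow> typed v \<Longrightarrow> rel_elem (grade T p) (ev p) u a b v \<in> erel p"
  unfolding erel_def by blast

lemma erel_closed: "erel p \<subseteq> carrier (grade T p)"
  unfolding erel_def rel_elem_def using ev_closed module_minus_closed[OF module_T] by auto

lemma submodule_Isp: "submodule (Isp p) R (grade T p)"
  by (rule mspan_submodule[OF module_T erel_closed])

lemma map_swap_iota:
  "map (block_perm (transpose 1 2) [n, m]) (iota n) = map (\<lambda>k. k + m) (iota n)"
  "map (block_perm (transpose 1 2) [n, m] \<circ> (\<lambda>k. k + n)) (iota m) = iota m"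
  by (auto simp: block_perm_12 block_perm_23 intro!: map_idI)

text \<open>In the standard product xy the labels of x are 1, ..., m and those of y follow. Acting
  on yx by the block permutation restores exactly these labels, so the two words differ only in the
  order of the letters.\<close>

lemma gen_elem_eq:
  assumes x: "x \<in> carrier (grade \<gamma> m)" and y: "y \<in> carrier (grade \<gamma> n)"
  shows "gen_elem m n x y = rel_elem (grade T (m + n)) (ev (m + n)) [] (iota m, x) (map (\<lambda>k. k + m) (iota n), y) []"
proof -
  let ?B = "block_perm (transpose 1 2) [n, m]" and ?p = "m + n"
  have B: "?B permutes {1..m + n}" by (rule block_perm_12_permutes) simp
  have B': "?B permutes {1..length (iota (m + n))}" using B by simp
  have xy: "opr m n x y \<in> carrier (grade \<gamma> (m + n))" and yx: "opr n m y x \<in> carrier (grade \<gamma> (m + n))"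
    using bilinear_closed[OF opr_bilinear x y] bilinear_closed[OF opr_bilinear y x] by (simp_all add: add.commute)
  have Byx: "act \<gamma> (m + n) ?B (opr n m y x) \<in> carrier (grade \<gamma> (m + n))" by (rule sym_moduleD(5)[OF sym yx B])
  have br: "bracket m n x y \<in> carrier (grade \<gamma> (m + n))"
    unfolding bracket_def by (rule module_minus_closed[OF mod_\<gamma> xy Byx])
  have "tmul T m n (tensor_incl R \<gamma> m x) (tensor_incl R \<gamma> n y) = ev ?p ([] @ (iota m, x) # (map (\<lambda>k. k + m) (iota n), y) # [])"
    by (simp add: tensor_incl_ev x y ev_mul_good good_letter)
  moreover have "act T ?p ?B (tmul T n m (tensor_incl R \<gamma> n y) (tensor_incl R \<gamma> m x)) =
      ev ?p ([] @ (map (\<lambda>k. k + m) (iota n), y) # (iota m, x) # [])"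
  proof -
    have "tmul T n m (tensor_incl R \<gamma> n y) (tensor_incl R \<gamma> m x) = ev ?p [(iota n, y), (map (\<lambda>k. k + n) (iota m), x)]"
      by (simp add: tensor_incl_ev x y ev_mul_good good_letter add.commute)
    thus ?thesis by (simp add: act_ev[OF B] map_swap_iota)
  qed
  moreover have "tensor_incl R \<gamma> ?p (bracket m n x y) =
      ev ?p ([] @ lop (iota m, x) (map (\<lambda>k. k + m) (iota n), y) # []) \<ominus>\<^bsub>grade T ?p\<^esub>
      ev ?p ([] @ lop (map (\<lambda>k. k + m) (iota n), y) (iota m, x) # [])"
  proof -
    have "tensor_incl R \<gamma> ?p (bracket m n x y) = ev ?p ([] @ (iota ?p, bracket m n x y) # [])"
      by (simp add: tensor_incl_ev br)
    also have "\<dots> = ev ?p ([] @ (iota ?p, opr m n x y) # []) \<ominus>\<^bsub>grade T ?p\<^esub>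
        ev ?p ([] @ (iota ?p, act \<gamma> ?p ?B (opr n m y x)) # [])"
      unfolding bracket_def
      using wfun_minus[OF wfun_ev module_T, of "[]" "[]" "opr m n x y" "iota ?p"] xy Byx by simp
    \<comment> \<open>Balancing moves the permutation from the vector into the labels, where it
      produces the concatenated labels of \<open>lop\<close> in the opposite order.\<close>
    also have "ev ?p ([] @ (iota ?p, act \<gamma> ?p ?B (opr n m y x)) # []) = ev ?p ([] @ (plist ?B (iota ?p), opr n m y x) # [])"
      using wfunD(4)[OF wfun_ev, of "[]" "[]" ?B "iota ?p" "opr n m y x"] B' yx by simp
    also have "plist ?B (iota ?p) = map (\<lambda>k. k + m) (iota n) @ iota m"
      unfolding iota_add by (rule plist_block_perm_12) auto
    finally show ?thesis by (simp add: iota_add)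
  qed
  ultimately show ?thesis unfolding gen_elem_def twisted_commutator_def Let_def rel_elem_def by simp
qed

lemma good_perm: "mset (labels w) = mset (labels w') \<Longrightarrow> typed w \<Longrightarrow> typed w' \<Longrightarrow> good p w \<longleftrightarrow> good p w'"
  by (simp add: good_def)

lemma typed_rel:
  assumes "typed u" "typed [a]" "typed [b]" "typed v"
  shows "typed (u @ a # b # v)" "typed (u @ b # a # v)" "typed (u @ lop a b # v)" "typed (u @ lop b a # v)"
  using assms typed_lop[of a b] typed_lop[of b a] by (cases a; cases b; simp)+

lemma good_rel:
  assumes "typed u" "typed [a]" "typed [b]" "typed v"
  shows "good p (u @ b # a # v) \<longleftrightarrow> good p (u @ a # b # v)" "good p (u @ lop a b # v) \<longleftrightarrow> good p (u @ a # b # v)"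
    "good p (u @ lop b a # v) \<longleftrightarrow> good p (u @ a # b # v)"
  by (rule good_perm; use typed_rel[OF assms] in simp)+

lemma rel_elem_not_good:
  assumes "typed u" "typed [a]" "typed [b]" "typed v" "\<not> good p (u @ a # b # v)"
  shows "rel_elem (grade T p) (ev p) u a b v = \<zero>\<^bsub>grade T p\<^esub>"
proof -
  interpret M: module R "grade T p" by (rule module_T)
  show ?thesis using assms(5) by (simp add: rel_elem_def ev_not_good good_rel[OF assms(1-4)] a_minus_def)
qed

text \<open>A relation with arbitrary context and labels arises from a generator of the ideal by
  multiplying with \<open>u\<close> and \<open>v\<close>, given standard labels, and acting with the
  permutation that the labels of the whole word describe. Every twisted ideal is stable under these
  operations.\<close>

lemma rel_elem_in_ideal:
  assumes J: "twisted_ideal R T J"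
    and G: "\<And>m n x y. x \<in> carrier (grade \<gamma> m) \<Longrightarrow> y \<in> carrier (grade \<gamma> n) \<Longrightarrow> gen_elem m n x y \<in> J (m + n)"
    and t: "typed u" "typed [a]" "typed [b]" "typed v"
  shows "rel_elem (grade T p) (ev p) u a b v \<in> J p"
proof (cases "good p (u @ a # b # v)")
  case False
  have "submodule (J p) R (grade T p)" using J by (simp add: twisted_ideal_def)
  thus ?thesis using rel_elem_not_good[OF t False] submoduleD(2)[OF _ module_T] by simp
next
  case True
  have J1: "\<sigma> permutes {1..q} \<Longrightarrow> z \<in> J q \<Longrightarrow> act T q \<sigma> z \<in> J q" for q \<sigma> z
    using J by (simp add: twisted_ideal_def sym_group_carrier)
  have J2: "z \<in> J q \<Longrightarrow> c \<in> carrier (grade T r) \<Longrightarrow> tmul T r q c z \<in> J (r + q)"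
    "z \<in> J q \<Longrightarrow> c \<in> carrier (grade T r) \<Longrightarrow> tmul T q r z c \<in> J (q + r)" for q r z c
    using J by (simp_all add: twisted_ideal_def)
  obtain la x where a: "a = (la, x)" by (cases a)
  obtain lb y where b: "b = (lb, y)" by (cases b)
  let ?m = "length la" and ?n = "length lb"
  let ?L = "labels (u @ a # b # v)"
  let ?s = "perm_of ?L"
  have L: "mset ?L = mset (iota p)" using True by (simp add: good_def)
  have s: "?s permutes {1..p}" by (rule perm_of_permutes[OF L])
  have pl: "length (labels u) + (?m + ?n + length (labels v)) = p" using mset_eq_iota[OF L] by (simp add: a b)
  \<comment> \<open>The outer words with labels 1, 2, ... in reading order; the true labels are
    restored at the end by \<open>?s\<close>.\<close>
  define u0 where "u0 = lab id (plain u)"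
  define v0 where "v0 = lab id (plain v)"
  define q where "q = length (labels u)"
  define r where "r = length (labels v)"
  have "typed (lab id (plain w))" if "typed w" for w using that by (simp only: typed_lab) (auto simp: plain_def typed_def)
  hence u0: "good q u0" and v0: "good r v0"
    using t by (auto simp: good_def u0_def v0_def labels_lab q_def r_def sum_plain)
  have xy: "x \<in> carrier (grade \<gamma> ?m)" "y \<in> carrier (grade \<gamma> ?n)" using t by (auto simp: a b)
  have eu: "relabel ?s u0 = u"
    unfolding u0_def relabel_lab using lab_perm_of_infix[of "[]" u "la @ lb @ labels v"] by (simp add: a b)
  have ev0: "relabel ?s (shift q (shift (?m + ?n) v0)) = v"
    unfolding v0_def relabel_lab relabel_comp using lab_perm_of_infix[of "labels u @ la @ lb" v "[]"]
    by (simp add: a b q_def ac_simps o_def)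
  have "lab (\<lambda>k. perm_of ?L (k + q)) (plain [a, b]) = [a, b]"
    using lab_perm_of_infix[of "labels u" "[a, b]" "labels v"] by (simp add: q_def a b)
  hence ea: "map (\<lambda>k. perm_of ?L (k + q)) (iota ?m) = la" and eb: "map (\<lambda>k. perm_of ?L (k + ?m + q)) (iota ?n) = lb"
    by (simp_all add: a b)
  \<comment> \<open>\<open>F\<close> places an element of degree \<open>?m + ?n\<close> between
    \<open>u\<close> and \<open>v\<close>; being linear, it may be applied to the generator term by
    term.\<close>
  define F where "F = (\<lambda>z. act T p ?s (tmul T q (?m + ?n + r) (ev q u0) (tmul T (?m + ?n) r z (ev r v0))))"
  have p: "p = q + (?m + ?n + r)" using pl by (simp add: q_def r_def)
  have linF: "linear_map R (grade T (?m + ?n)) (grade T p) F"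
    unfolding F_def
    by (rule linear_comp[OF linear_comp[OF bilinear_left[OF bilinear_tmul_T ev_closed]
      bilinear_right[OF bilinear_tmul_T ev_closed]]]) (use linear_act_T[OF s] p in simp)
  have Fev: "F (ev (?m + ?n) w) = ev p (u @ relabel ?s (shift q w) @ v)" for w
  proof -
    have "F (ev (?m + ?n) w) = act T p ?s (ev p (u0 @ shift q (w @ shift (?m + ?n) v0)))"
      unfolding F_def by (simp add: ev_mul2[OF v0] ev_mul1[OF u0] p)
    thus ?thesis by (simp only: act_ev[OF s] relabel_simps eu ev0)
  qed
  let ?a = "(iota ?m, x)" and ?b = "(map (\<lambda>k. k + ?m) (iota ?n), y)"
  have "F (gen_elem ?m ?n x y) = rel_elem (grade T p) (\<lambda>w. ev p (u @ relabel ?s (shift q w) @ v)) [] ?a ?b []"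
    unfolding gen_elem_eq[OF xy] linear_rel_elem[OF module_T module_T linF ev_closed] Fev ..
  also have "\<dots> = rel_elem (grade T p) (ev p) u a b v"
    using ea eb by (simp add: rel_elem_def relabel_comp o_def a b ac_simps)
  finally have "F (gen_elem ?m ?n x y) = rel_elem (grade T p) (ev p) u a b v" .
  moreover have "F (gen_elem ?m ?n x y) \<in> J p"
    unfolding F_def by (rule J1[OF s]) (unfold p, intro J2 G xy ev_closed)
  ultimately show ?thesis by simp
qed

lemma act_Isp: "\<sigma> permutes {1..p} \<Longrightarrow> t \<in> Isp p \<Longrightarrow> act T p \<sigma> t \<in> Isp p"
proof (rule linear_vanish_mspan[OF module_T module_T linear_act_T erel_closed _ submodule_Isp])
  assume s: "\<sigma> permutes {1..p}"
  fix e assume "e \<in> erel p"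
  then obtain u a b v where e: "e = rel_elem (grade T p) (ev p) u a b v" and t: "typed u" "typed [a]" "typed [b]" "typed v"
    unfolding erel_def by blast
  obtain la x lb y where ab: "a = (la, x)" "b = (lb, y)" by (cases a; cases b)
  have "act T p \<sigma> e = rel_elem (grade T p) (ev p) (relabel \<sigma> u) (map \<sigma> la, x) (map \<sigma> lb, y) (relabel \<sigma> v)"
    unfolding e linear_rel_elem[OF module_T module_T linear_act_T[OF s] ev_closed] act_ev[OF s]
    by (simp add: rel_elem_def ab)
  thus "act T p \<sigma> e \<in> Isp p" using t by (simp add: hull_inc erelI ab)
qed

text \<open>Multiplying a relation by a good word only lengthens its context and shifts labels, so
  it yields another relation.\<close>

lemma mul_Isp:
  assumes t: "t \<in> Isp p" and c: "c \<in> carrier (grade T q)"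
  shows "tmul T q p c t \<in> Isp (q + p)" "tmul T p q t c \<in> Isp (p + q)"
proof -
  have E: "{ev q w | w. good q w} \<subseteq> carrier (grade T q)" using ev_closed by auto
  have c': "c \<in> mspan R (grade T q) {ev q w | w. good q w}" using c T_mspan by simp
  have "tmul T q p s e \<in> Isp (q + p) \<and> tmul T p q e s \<in> Isp (p + q)" if se: "s \<in> {ev q w | w. good q w}" "e \<in> erel p" for s e
  proof -
    from se obtain w where w: "s = ev q w" "good q w" by blast
    from se obtain u a b v where e: "e = rel_elem (grade T p) (ev p) u a b v" and t: "typed u" "typed [a]" "typed [b]" "typed v"
      unfolding erel_def by blast
    obtain la x lb y where ab: "a = (la, x)" "b = (lb, y)" by (cases a; cases b)
    have "tmul T q p s e = rel_elem (grade T (q + p)) (ev (q + p)) (w @ shift q u) (map (\<lambda>k. k + q) la, x) (map (\<lambda>k. k + q) lb, y) (shift q v)"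
      unfolding e w(1) linear_rel_elem[OF module_T module_T bilinear_right[OF bilinear_tmul_T ev_closed] ev_closed] ev_mul1[OF w(2)]
      by (simp add: rel_elem_def ab)
    moreover have "tmul T p q e s = rel_elem (grade T (p + q)) (ev (p + q)) u a b (v @ shift p w)"
      unfolding e w(1) linear_rel_elem[OF module_T module_T bilinear_left[OF bilinear_tmul_T ev_closed] ev_closed] ev_mul2[OF w(2)]
      by (simp add: rel_elem_def)
    moreover have "typed w" using w(2) by (simp add: good_def)
    ultimately show ?thesis using t by (simp add: hull_inc erelI ab)
  qed
  hence 1: "\<And>s e. s \<in> {ev q w | w. good q w} \<Longrightarrow> e \<in> erel p \<Longrightarrow> tmul T q p s e \<in> Isp (q + p)"
    and 2: "\<And>e s. e \<in> erel p \<Longrightarrow> s \<in> {ev q w | w. good q w} \<Longrightarrow> tmul T p q e s \<in> Isp (p + q)" by blast+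
  show "tmul T q p c t \<in> Isp (q + p)"
    by (rule bilinear_vanish_mspan[OF module_T module_T module_T bilinear_tmul_T E erel_closed 1 submodule_Isp c' t])
  show "tmul T p q t c \<in> Isp (p + q)"
    by (rule bilinear_vanish_mspan[OF module_T module_T module_T bilinear_tmul_T erel_closed E 2 submodule_Isp t c'])
qed

lemma twisted_ideal_Isp: "twisted_ideal R T Isp"
  unfolding twisted_ideal_def sym_group_carrier mem_Collect_eq
  using submodule_Isp act_Isp mul_Isp by (auto simp: sym_group_carrier)

text \<open>The span of the relations in context is itself a twisted ideal, and every twisted ideal
  with the prescribed generators contains it. This linear description of the ideal is what allows
  maps out of the quotient to be defined on words.\<close>

lemma I_eq: "I p = Isp p"
proof -
  let ?G = "\<lambda>p. {gen_elem m n x y | m n x y. m + n = p \<and> x \<in> carrier (grade \<gamma> m) \<and> y \<in> carrier (grade \<gamma> n)}"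
  have I: "I p = \<Inter>{J p | J. twisted_ideal R T J \<and> (\<forall>q. ?G q \<subseteq> J q)}"
  proof -
    have "{twisted_commutator R \<gamma> m n x y \<ominus>\<^bsub>grade T p\<^esub> tensor_incl R \<gamma> p (bracket m n x y) | m n x y.
      m + n = p \<and> x \<in> carrier (grade \<gamma> m) \<and> y \<in> carrier (grade \<gamma> n)} = ?G p" for p
      unfolding gen_elem_def by blast
    thus ?thesis unfolding env_ideal_def ideal_generated_def by simp
  qed
  show ?thesis
  proof
    have "?G q \<subseteq> Isp q" for q
    proof
      fix z assume "z \<in> ?G q"
      then obtain m n x y where z: "z = gen_elem m n x y" "m + n = q" and xy: "x \<in> carrier (grade \<gamma> m)" "y \<in> carrier (grade \<gamma> n)" by blast
      have "z \<in> erel q" using xy unfolding z(1) gen_elem_eq[OF xy] z(2) erel_def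
        by (intro CollectI exI[of _ "[]"] exI[of _ "(iota m, x)"] exI[of _ "(map (\<lambda>k. k + m) (iota n), y)"]) auto
      thus "z \<in> Isp q" by (rule hull_inc)
    qed
    thus "I p \<subseteq> Isp p" unfolding I using twisted_ideal_Isp by blast
    show "Isp p \<subseteq> I p" unfolding I
    proof (rule Inter_greatest, clarify)
      fix J t assume J: "twisted_ideal R T J" and G: "\<forall>q. ?G q \<subseteq> J q" and t: "t \<in> Isp p"
      have "Isp p \<subseteq> J p"
      proof (rule mspan_minimal)
        have G': "gen_elem m n x y \<in> J (m + n)" if "x \<in> carrier (grade \<gamma> m)" "y \<in> carrier (grade \<gamma> n)" for m n x y
          using spec[OF G, of "m + n"] that by blast
        show "erel p \<subseteq> J p" unfolding erel_def using rel_elem_in_ideal[OF J G'] by blast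
        show "submodule (J p) R (grade T p)" using J by (simp add: twisted_ideal_def)
      qed
      thus "t \<in> J p" using t by blast
    qed
  qed
qed

end

section \<open>Tensor squares\<close>

text \<open>As for words, the generator \<open>\<sigma> \<otimes> (s \<otimes> t)\<close> is encoded by the lists \<open>L\<close>, \<open>L'\<close> of values of
  \<open>\<sigma>\<close> on its two blocks.\<close>

definition pair_class ::
  "('r, 'k) ring_scheme \<Rightarrow> ('r, 'a, 'm) smod_scheme \<Rightarrow> nat \<Rightarrow> nat list \<Rightarrow> nat list \<Rightarrow> 'a \<Rightarrow> 'a \<Rightarrow> ('r, 'a) tens"
  where "pair_class R M p L L' s t =
    (if mset (L @ L') = mset (iota p) then tensor_class R [M, M] (perm_of (L @ L')) [(length L, s), (length L', t)]
     else \<zero>\<^bsub>tensor_module R [M, M] p\<^esub>)"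

locale square =
  fixes R :: "('r, 'k) ring_scheme" and M :: "('r, 'a, 'm) smod_scheme"
  assumes cring: "cring R" and symM: "sym_module R M"
begin

sublocale sq: tensor_factors R "[M, M]"
  by (rule tensor_factors.intro) (use cring symM in auto)

abbreviation "sqmod p \<equiv> tensor_module R [M, M] p"

lemma gens_pair: "(\<sigma>, [(a, s), (b, t)]) \<in> tensor_gens [M, M] p \<longleftrightarrow>
    \<sigma> permutes {1..p} \<and> a + b = p \<and> s \<in> carrier (grade M a) \<and> t \<in> carrier (grade M b)"
  by (auto simp: sq.gens_iff less_Suc_eq)

lemma gens_cases:
  assumes "(\<sigma>, w) \<in> tensor_gens [M, M] p"
  obtains a s b t where "w = [(a, s), (b, t)]"
proof -
  have "length w = 2" using assms by (simp add: sq.gens_iff)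
  then obtain x y where "w = [x, y]" by (auto simp: numeral_2_eq_2 length_Suc_conv)
  thus thesis using that by (cases x; cases y) simp
qed

lemma pair_gens: "mset (L @ L') = mset (iota p) \<Longrightarrow> s \<in> carrier (grade M (length L)) \<Longrightarrow> t \<in> carrier (grade M (length L')) \<Longrightarrow>
    (perm_of (L @ L'), [(length L, s), (length L', t)]) \<in> tensor_gens [M, M] p"
  using mset_eq_iota[of "L @ L'" p] by (simp add: gens_pair perm_of_permutes)

lemma pair_class_closed: "s \<in> carrier (grade M (length L)) \<Longrightarrow> t \<in> carrier (grade M (length L')) \<Longrightarrow>
    pair_class R M p L L' s t \<in> carrier (sqmod p)"
  using sq.class_closed[OF pair_gens] module_zero_closed[OF sq.module_tensor] by (auto simp: pair_class_def)

lemma bilinear_pair_class: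
  "bilinear_map R (grade M (length L)) (grade M (length L')) (sqmod p) (pair_class R M p L L')"
proof (cases "mset (L @ L') = mset (iota p)")
  case False
  hence "pair_class R M p L L' = (\<lambda>s t. \<zero>\<^bsub>sqmod p\<^esub>)" by (simp add: fun_eq_iff pair_class_def)
  thus ?thesis by (simp add: bilinear_map_def linear_const_zero[OF sq.module_tensor])
next
  case True
  note C = tens_compatD[OF sq.class_compat[of p], unfolded prod.case]
  note P = pair_gens[OF True]
  have e: "pair_class R M p L L' s t = tensor_class R [M, M] (perm_of (L @ L')) [(length L, s), (length L', t)]" for s t
    using True by (simp add: pair_class_def)
  show ?thesis unfolding bilinear_map_def
  proof (intro conjI ballI linear_mapI pair_class_closed)
    fix s x y assume s: "s \<in> carrier (grade M (length L))" and x: "x \<in> carrier (grade M (length L'))" and y: "y \<in> carrier (grade M (length L'))"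
    show "pair_class R M p L L' s (x \<oplus>\<^bsub>grade M (length L')\<^esub> y) = pair_class R M p L L' s x \<oplus>\<^bsub>sqmod p\<^esub> pair_class R M p L L' s y"
      using C(2)[of "perm_of (L @ L')" "[(length L, s)]" "length L'" x "[]" y] P[OF s x] P[OF s y] by (simp add: e)
  next
    fix s r x assume s: "s \<in> carrier (grade M (length L))" and r: "r \<in> carrier R" and x: "x \<in> carrier (grade M (length L'))"
    show "pair_class R M p L L' s (r \<odot>\<^bsub>grade M (length L')\<^esub> x) = r \<odot>\<^bsub>sqmod p\<^esub> pair_class R M p L L' s x"
      using C(3)[OF r, of "perm_of (L @ L')" "[(length L, s)]" "length L'" x "[]"] P[OF s x] by (simp add: e)
  next
    fix t x y assume t: "t \<in> carrier (grade M (length L'))" and x: "x \<in> carrier (grade M (length L))" and y: "y \<in> carrier (grade M (length L))"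
    show "pair_class R M p L L' (x \<oplus>\<^bsub>grade M (length L)\<^esub> y) t = pair_class R M p L L' x t \<oplus>\<^bsub>sqmod p\<^esub> pair_class R M p L L' y t"
      using C(2)[of "perm_of (L @ L')" "[]" "length L" x "[(length L', t)]" y] P[OF x t] P[OF y t] by (simp add: e)
  next
    fix t r x assume t: "t \<in> carrier (grade M (length L'))" and r: "r \<in> carrier R" and x: "x \<in> carrier (grade M (length L))"
    show "pair_class R M p L L' (r \<odot>\<^bsub>grade M (length L)\<^esub> x) t = r \<odot>\<^bsub>sqmod p\<^esub> pair_class R M p L L' x t"
      using C(3)[OF r, of "perm_of (L @ L')" "[]" "length L" x "[(length L', t)]"] P[OF x t] by (simp add: e)
  qed
qed

lemma perm_prods_two:
  assumes "\<beta> permutes {1..b}"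
  shows "perm_prods (zip [a, b] [\<alpha>, \<beta>]) = perm_prod a \<alpha> \<beta>"
proof -
  have "perm_prod b \<beta> id k = \<beta> k" for k
    using permutes_not_in[OF assms, of k] by (auto simp: perm_prod_def)
  thus ?thesis by (simp add: fun_eq_iff perm_prod_def)
qed

lemma pair_class_plist:
  assumes a: "\<alpha> permutes {1..length L}" and b: "\<beta> permutes {1..length L'}"
    and s: "s \<in> carrier (grade M (length L))" and t: "t \<in> carrier (grade M (length L'))"
  shows "pair_class R M p (plist \<alpha> L) (plist \<beta> L') s t = pair_class R M p L L' (act M (length L) \<alpha> s) (act M (length L') \<beta> t)"
proof (cases "mset (L @ L') = mset (iota p)")
  case False
  thus ?thesis by (simp add: pair_class_def mset_plist[OF a] mset_plist[OF b])
next
  case True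
  have "perm_of (L @ L') \<circ> perm_prod (length L) \<alpha> \<beta> = perm_of (plist \<alpha> L @ plist \<beta> L')"
    using perm_of_plist[of "perm_prod (length L) \<alpha> \<beta>" "L @ L'"] perm_prod_permutes[OF a b] plist_perm_prod[OF a b] by simp
  moreover have "tensor_class R [M, M] (perm_of (L @ L') \<circ> perm_prod (length L) \<alpha> \<beta>) [(length L, s), (length L', t)] =
      tensor_class R [M, M] (perm_of (L @ L')) [(length L, act M (length L) \<alpha> s), (length L', act M (length L') \<beta> t)]"
    using tens_compatD(4)[OF sq.class_compat pair_gens[OF True s t], of "[\<alpha>, \<beta>]"] a b perm_prods_two[OF b, of "length L" \<alpha>]
    by simp
  ultimately show ?thesis using True by (simp add: pair_class_def mset_plist[OF a] mset_plist[OF b])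
qed

lemma act_pair_class:
  assumes p: "\<sigma> permutes {1..p}" and s: "s \<in> carrier (grade M (length L))" and t: "t \<in> carrier (grade M (length L'))"
  shows "act (tensor R [M, M]) p \<sigma> (pair_class R M p L L' s t) = pair_class R M p (map \<sigma> L) (map \<sigma> L') s t"
proof (cases "mset (L @ L') = mset (iota p)")
  case True
  have "perm_of (map \<sigma> (L @ L')) = \<sigma> \<circ> perm_of (L @ L')"
    using permutes_not_in[OF p] mset_eq_iota[OF True] by (auto simp: perm_of_def fun_eq_iff nth_append)
  thus ?thesis using True mset_map_permutes'[OF p, of "L @ L'"] sq.act_tensor(2)[OF p pair_gens[OF True s t]]
    by (simp add: pair_class_def)
next
  case False
  thus ?thesis using mset_map_permutes'[OF p, of "L @ L'"] linear_zero[OF sq.module_tensor sq.module_tensor sq.act_tensor(1)[OF p]]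
    by (simp add: pair_class_def)
qed

abbreviation "lft p \<sigma> w \<equiv> take (fst (w ! 0)) (map \<sigma> (iota p))"
abbreviation "rgt p \<sigma> w \<equiv> drop (fst (w ! 0)) (map \<sigma> (iota p))"

lemma length_lft_rgt:
  assumes "(\<sigma>, [(a, s), (b, t)]) \<in> tensor_gens [M, M] p"
  shows "length (lft p \<sigma> [(a, s), (b, t)]) = a" "length (rgt p \<sigma> [(a, s), (b, t)]) = b"
    "mset (lft p \<sigma> [(a, s), (b, t)] @ rgt p \<sigma> [(a, s), (b, t)]) = mset (iota p)"
proof -
  have "\<sigma> permutes {1..p}" "p = a + b" using assms by (auto simp: gens_pair)
  thus "length (lft p \<sigma> [(a, s), (b, t)]) = a" "length (rgt p \<sigma> [(a, s), (b, t)]) = b"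
    "mset (lft p \<sigma> [(a, s), (b, t)] @ rgt p \<sigma> [(a, s), (b, t)]) = mset (iota p)"
    by (simp_all add: mset_map_permutes del: mset_map)
qed

lemma class_eq_pair_class:
  assumes "(\<sigma>, [(a, s), (b, t)]) \<in> tensor_gens [M, M] p"
  shows "tensor_class R [M, M] \<sigma> [(a, s), (b, t)] =
    pair_class R M p (take a (map \<sigma> (iota p))) (drop a (map \<sigma> (iota p))) s t"
  using length_lft_rgt[OF assms] assms perm_of_map_iota[of \<sigma> p]
  by (simp add: pair_class_def gens_pair)

text \<open>The analogue of \<open>compat\<close> for tensor squares: the conditions under which a
  function of two labelled elements descends.\<close>

definition pair_compat :: "nat \<Rightarrow> ('r, 'c, 'l) module_scheme \<Rightarrow> (nat list \<Rightarrow> nat list \<Rightarrow> 'a \<Rightarrow> 'a \<Rightarrow> 'c) \<Rightarrow> bool"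
  where "pair_compat p V K \<longleftrightarrow> (\<forall>L L'. length L + length L' = p \<longrightarrow>
    bilinear_map R (grade M (length L)) (grade M (length L')) V (K L L') \<and>
    (\<forall>\<alpha> \<beta>. \<forall>s\<in>carrier (grade M (length L)). \<forall>t\<in>carrier (grade M (length L')).
      \<alpha> permutes {1..length L} \<longrightarrow> \<beta> permutes {1..length L'} \<longrightarrow>
      K (plist \<alpha> L) (plist \<beta> L') s t = K L L' (act M (length L) \<alpha> s) (act M (length L') \<beta> t)))"

lemma pair_compatD:
  assumes "pair_compat p V K" "length L + length L' = p"
  shows "bilinear_map R (grade M (length L)) (grade M (length L')) V (K L L')"
    and "\<alpha> permutes {1..length L} \<Longrightarrow> \<beta> permutes {1..length L'} \<Longrightarrow>
      s \<in> carrier (grade M (length L)) \<Longrightarrow> t \<in> carrier (grade M (length L')) \<Longrightarrow>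
      K (plist \<alpha> L) (plist \<beta> L') s t = K L L' (act M (length L) \<alpha> s) (act M (length L') \<beta> t)"
  using assms by (simp_all add: pair_compat_def)

lemma split_two:
  assumes "(\<sigma>, u @ (i, x) # v) \<in> tensor_gens [M, M] p"
  obtains b t where "u = []" "v = [(b, t)]" | a s where "u = [(a, s)]" "v = []"
proof -
  have "length u + length v = 1" using assms by (auto simp: sq.gens_iff)
  thus thesis using that by (cases u; cases v) auto
qed

text \<open>The one-line notation of \<sigma> is cut after the degree of the first factor. Composing
  \<sigma> with a product permutation rearranges the two pieces separately, which is the balancing
  demanded by \<open>pair_compat\<close>.\<close>

lemma pair_compat_tens:
  assumes K: "pair_compat p V K"
  shows "tens_compat R [M, M] p V (\<lambda>(\<sigma>, w). K (lft p \<sigma> w) (rgt p \<sigma> w) (snd (w ! 0)) (snd (w ! 1)))"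
  unfolding tens_compat_def prod.case
proof (intro conjI allI impI ballI)
  have B: "bilinear_map R (grade M a) (grade M b) V (K (take a (map \<sigma> (iota p))) (drop a (map \<sigma> (iota p))))"
    if "(\<sigma>, [(a, s), (b, t)]) \<in> tensor_gens [M, M] p" for \<sigma> a s b t
    using pair_compatD(1)[OF K, of "lft p \<sigma> [(a, s), (b, t)]" "rgt p \<sigma> [(a, s), (b, t)]"]
      length_lft_rgt(1,2)[OF that] that by (simp add: gens_pair)
  {
    fix z assume z: "z \<in> tensor_gens [M, M] p"
    obtain \<sigma> a s b t where e: "z = (\<sigma>, [(a, s), (b, t)])" using z by (cases z) (auto elim: gens_cases)
    note g = z[unfolded e]
    thus "(case z of (\<sigma>, w) \<Rightarrow> K (lft p \<sigma> w) (rgt p \<sigma> w) (snd (w ! 0)) (snd (w ! 1))) \<in> carrier V"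
      using bilinear_closed[OF B[OF g], of s t] g by (simp add: e gens_pair)
  next
    fix \<sigma> u i x y v assume g: "(\<sigma>, u @ (i, x) # v) \<in> tensor_gens [M, M] p" "(\<sigma>, u @ (i, y) # v) \<in> tensor_gens [M, M] p"
    let ?w = "\<lambda>x. u @ (i, x) # v"
    let ?K = "\<lambda>w. K (lft p \<sigma> w) (rgt p \<sigma> w) (snd (w ! 0)) (snd (w ! 1))"
    show "?K (?w (x \<oplus>\<^bsub>grade ([M, M] ! length u) i\<^esub> y)) = ?K (?w x) \<oplus>\<^bsub>V\<^esub> ?K (?w y)"
      using g(1)
    proof (cases rule: split_two)
      case (1 b t)
      have gg: "(\<sigma>, [(i, x), (b, t)]) \<in> tensor_gens [M, M] p" "(\<sigma>, [(i, y), (b, t)]) \<in> tensor_gens [M, M] p" using g 1 by auto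
      show ?thesis using linear_add[OF bilinear_left[OF B[OF gg(1)]]] gg by (simp add: 1 gens_pair)
    next
      case (2 a s)
      have gg: "(\<sigma>, [(a, s), (i, x)]) \<in> tensor_gens [M, M] p" "(\<sigma>, [(a, s), (i, y)]) \<in> tensor_gens [M, M] p" using g 2 by auto
      show ?thesis using linear_add[OF bilinear_right[OF B[OF gg(1)]]] gg by (simp add: 2 gens_pair)
    qed
  next
    fix \<sigma> u i r x v assume r: "r \<in> carrier R" and g: "(\<sigma>, u @ (i, x) # v) \<in> tensor_gens [M, M] p"
    let ?w = "\<lambda>x. u @ (i, x) # v"
    let ?K = "\<lambda>w. K (lft p \<sigma> w) (rgt p \<sigma> w) (snd (w ! 0)) (snd (w ! 1))"
    show "?K (?w (r \<odot>\<^bsub>grade ([M, M] ! length u) i\<^esub> x)) = r \<odot>\<^bsub>V\<^esub> ?K (?w x)"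
      using g
    proof (cases rule: split_two)
      case (1 b t)
      have gg: "(\<sigma>, [(i, x), (b, t)]) \<in> tensor_gens [M, M] p" using g 1 by auto
      show ?thesis using linear_smult[OF bilinear_left[OF B[OF gg]] r] gg by (simp add: 1 gens_pair)
    next
      case (2 a s)
      have gg: "(\<sigma>, [(a, s), (i, x)]) \<in> tensor_gens [M, M] p" using g 2 by auto
      show ?thesis using linear_smult[OF bilinear_right[OF B[OF gg]] r] gg by (simp add: 2 gens_pair)
    qed
  next
    fix \<sigma> w \<tau>s assume g: "(\<sigma>, w) \<in> tensor_gens [M, M] p" and b: "list_all2 (\<lambda>(i, x) \<tau>. \<tau> permutes {1..i}) w \<tau>s"
    obtain a s b' t where w: "w = [(a, s), (b', t)]" using g by (rule gens_cases)
    obtain \<alpha> \<beta> where ts: "\<tau>s = [\<alpha>, \<beta>]" and a: "\<alpha> permutes {1..a}" and b: "\<beta> permutes {1..b'}"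
      using b by (auto simp: w list_all2_Cons1)
    let ?KK = "\<lambda>\<sigma> w. K (lft p \<sigma> w) (rgt p \<sigma> w) (snd (w ! 0)) (snd (w ! 1))"
    let ?L = "take a (map \<sigma> (iota p))" and ?L' = "drop a (map \<sigma> (iota p))"
    have s: "\<sigma> permutes {1..p}" "p = a + b'" "s \<in> carrier (grade M a)" "t \<in> carrier (grade M b')"
      using g by (auto simp: w gens_pair)
    have l: "length ?L = a" "length ?L' = b'" using s by auto
    have pp: "perm_prods (zip (map fst w) \<tau>s) = perm_prod a \<alpha> \<beta>"
      using perm_prods_two[OF b] by (simp add: w ts)
    have "map (\<sigma> \<circ> perm_prod a \<alpha> \<beta>) (iota p) = plist (perm_prod a \<alpha> \<beta>) (map \<sigma> (iota p))"
      using plist_map_iota[of "perm_prod a \<alpha> \<beta>" p] perm_prod_permutes[OF a b] s(2) by simp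
    also have "\<dots> = plist (perm_prod a \<alpha> \<beta>) (?L @ ?L')" by simp
    also have "\<dots> = plist \<alpha> ?L @ plist \<beta> ?L'"
      using plist_perm_prod[of \<alpha> ?L \<beta> ?L'] a b unfolding l by simp
    finally have m: "map (\<sigma> \<circ> perm_prod a \<alpha> \<beta>) (iota p) = plist \<alpha> ?L @ plist \<beta> ?L'" .
    have "K (plist \<alpha> ?L) (plist \<beta> ?L') s t = K ?L ?L' (act M a \<alpha> s) (act M b' \<beta> t)"
      using pair_compatD(2)[OF K, of ?L ?L' \<alpha> \<beta> s t] a b s unfolding l by simp
    moreover have "take a (plist \<alpha> ?L @ plist \<beta> ?L') = plist \<alpha> ?L" "drop a (plist \<alpha> ?L @ plist \<beta> ?L') = plist \<beta> ?L'"
      using l by simp_all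
    moreover have "min p a = a" using s(2) by simp
    ultimately show "?KK (\<sigma> \<circ> perm_prods (zip (map fst w) \<tau>s)) w =
       ?KK \<sigma> (map (\<lambda>(M, (i, x), \<tau>). (i, act M i \<tau> x)) (zip [M, M] (zip w \<tau>s)))"
      unfolding pp m by (simp add: w ts)
  }
qed

lemma pair_lift:
  assumes V: "module R V" and K: "pair_compat p V K"
    and h: "\<And>\<sigma> a s b t. (\<sigma>, [(a, s), (b, t)]) \<in> tensor_gens [M, M] p \<Longrightarrow>
      h (\<sigma>, [(a, s), (b, t)]) = K (take a (map \<sigma> (iota p))) (drop a (map \<sigma> (iota p))) s t"
  shows "tens_compat R [M, M] p V h"
proof (rule sq.tens_compat_cong[OF pair_compat_tens[OF K]])
  fix z assume z: "z \<in> tensor_gens [M, M] p"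
  obtain \<sigma> a s b t where e: "z = (\<sigma>, [(a, s), (b, t)])" using z by (cases z) (auto elim: gens_cases)
  show "h z = (case z of (\<sigma>, w) \<Rightarrow> K (lft p \<sigma> w) (rgt p \<sigma> w) (snd (w ! 0)) (snd (w ! 1)))"
    using h[OF z[unfolded e]] by (simp add: e)
qed

lemma lift_pair_class:
  assumes V: "module R V" and K: "pair_compat p V K"
    and h: "\<And>\<sigma> a s b t. (\<sigma>, [(a, s), (b, t)]) \<in> tensor_gens [M, M] p \<Longrightarrow>
      h (\<sigma>, [(a, s), (b, t)]) = K (take a (map \<sigma> (iota p))) (drop a (map \<sigma> (iota p))) s t"
  shows "linear_map R (sqmod p) V (lift_linear R V h)"
    and "mset (L @ L') = mset (iota p) \<Longrightarrow> s \<in> carrier (grade M (length L)) \<Longrightarrow> t \<in> carrier (grade M (length L')) \<Longrightarrow>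
      lift_linear R V h (pair_class R M p L L' s t) = K L L' s t"
proof -
  note T = sq.lift_linear_tensor[OF V pair_lift[OF V K h]]
  show "linear_map R (sqmod p) V (lift_linear R V h)" by (rule T(1))
  assume a: "mset (L @ L') = mset (iota p)" "s \<in> carrier (grade M (length L))" "t \<in> carrier (grade M (length L'))"
  have "map (perm_of (L @ L')) (iota p) = L @ L'" using map_perm_of_iota[of "L @ L'"] mset_eq_iota[OF a(1)] by simp
  thus "lift_linear R V h (pair_class R M p L L' s t) = K L L' s t"
    using T(2)[OF _ pair_gens[OF a]] h[OF pair_gens[OF a]] a(1) by (simp add: pair_class_def)
qed

end

section \<open>Maps between tensor squares and the product of a tensor square\<close>

lemma tensor_map2_pair_class:
  assumes M: "square R M" and N: "square R N" and f: "smod_hom R M N f"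
  shows "linear_map R (tensor_module R [M, M] p) (tensor_module R [N, N] p) (tensor_map2 R N f p)"
    and "s \<in> carrier (grade M (length L)) \<Longrightarrow> t \<in> carrier (grade M (length L')) \<Longrightarrow>
      tensor_map2 R N f p (pair_class R M p L L' s t) = pair_class R N p L L' (f (length L) s) (f (length L') t)"
proof -
  interpret M: square R M by (rule M)
  interpret N: square R N by (rule N)
  have fl: "linear_map R (grade M m) (grade N m) (f m)" for m using f by (simp add: smod_hom_def)
  have fa: "\<sigma> permutes {1..m} \<Longrightarrow> x \<in> carrier (grade M m) \<Longrightarrow> f m (act M m \<sigma> x) = act N m \<sigma> (f m x)" for m \<sigma> x
    using f by (simp add: smod_hom_def sym_group_carrier)
  let ?K = "\<lambda>L L' s t. pair_class R N p L L' (f (length L) s) (f (length L') t)"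
  let ?h = "\<lambda>(\<sigma>, w). tensor_class R [N, N] \<sigma> (map (\<lambda>(i, x). (i, f i x)) w)"
  have K: "M.pair_compat p (tensor_module R [N, N] p) ?K"
    unfolding M.pair_compat_def
    by (intro allI impI conjI ballI bilinear_comp_args[OF N.bilinear_pair_class fl fl])
      (simp add: N.pair_class_plist linear_closed[OF fl] fa)
  have h: "?h (\<sigma>, [(a, s), (b, t)]) = ?K (take a (map \<sigma> (iota p))) (drop a (map \<sigma> (iota p))) s t"
    if g: "(\<sigma>, [(a, s), (b, t)]) \<in> tensor_gens [M, M] p" for \<sigma> a s b t
  proof -
    have "(\<sigma>, [(a, f a s), (b, f b t)]) \<in> tensor_gens [N, N] p"
      using g linear_closed[OF fl] by (simp add: M.gens_pair N.gens_pair)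
    from N.class_eq_pair_class[OF this] M.length_lft_rgt(1,2)[OF g] show ?thesis by simp
  qed
  note T = M.lift_pair_class[OF N.sq.module_tensor K h]
  show L: "linear_map R (tensor_module R [M, M] p) (tensor_module R [N, N] p) (tensor_map2 R N f p)"
    unfolding tensor_map2_def by (rule T(1))
  assume a: "s \<in> carrier (grade M (length L))" "t \<in> carrier (grade M (length L'))"
  show "tensor_map2 R N f p (pair_class R M p L L' s t) = ?K L L' s t"
  proof (cases "mset (L @ L') = mset (iota p)")
    case True thus ?thesis unfolding tensor_map2_def using T(2)[OF _ True a] by simp
  next
    case False
    thus ?thesis using linear_zero[OF M.sq.module_tensor N.sq.module_tensor L] by (simp add: pair_class_def)
  qed
qed

text \<open>Bilinearity and equivariance of the product are what makes the product on the tensor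
  square well defined; associativity does not enter the definition.\<close>

locale talg_square = square R A for R :: "('r, 'k) ring_scheme" and A :: "('r, 'a, 'm) talg_scheme" +
  assumes bilinear_tmul: "bilinear_map R (grade A m) (grade A n) (grade A (m + n)) (tmul A m n)"
    and tmul_act: "\<sigma> permutes {1..m} \<Longrightarrow> \<tau> permutes {1..n} \<Longrightarrow> x \<in> carrier (grade A m) \<Longrightarrow> y \<in> carrier (grade A n) \<Longrightarrow>
      tmul A m n (act A m \<sigma> x) (act A n \<tau> y) = act A (m + n) (perm_prod m \<sigma> \<tau>) (tmul A m n x y)"
begin

text \<open>In labelled form the block permutation (23) disappears: the labels of \<open>u\<close>
  and \<open>x\<close> are put together, likewise those of \<open>v\<close> and \<open>y\<close>,
  with the second pair shifted by \<open>p\<close>.\<close>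

lemma mul_gen_eq:
  assumes g: "(\<sigma>, [(a, u), (b, v)]) \<in> tensor_gens [A, A] p" "(\<tau>, [(c, x), (d, y)]) \<in> tensor_gens [A, A] q"
  shows "tensor_square_mul_gen R A (\<sigma>, [(a, u), (b, v)]) (\<tau>, [(c, x), (d, y)]) =
    pair_class R A (p + q) (take a (map \<sigma> (iota p)) @ map (\<lambda>k. k + p) (take c (map \<tau> (iota q))))
      (drop a (map \<sigma> (iota p)) @ map (\<lambda>k. k + p) (drop c (map \<tau> (iota q)))) (tmul A a c u x) (tmul A b d v y)"
proof -
  let ?U = "take a (map \<sigma> (iota p))" and ?V = "drop a (map \<sigma> (iota p))"
  let ?X = "map (\<lambda>k. k + p) (take c (map \<tau> (iota q)))" and ?Y = "map (\<lambda>k. k + p) (drop c (map \<tau> (iota q)))"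
  let ?B = "block_perm (transpose 2 3) [a, c, b, d]"
  have s: "\<sigma> permutes {1..p}" "p = a + b" and t: "\<tau> permutes {1..q}" "q = c + d" using g by (auto simp: gens_pair)
  have st: "perm_prod p \<sigma> \<tau> permutes {1..p + q}" by (rule perm_prod_permutes[OF s(1) t(1)])
  have B: "?B permutes {1..p + q}" by (rule block_perm_23_permutes) (simp add: s t)
  have g': "(perm_prod p \<sigma> \<tau> \<circ> ?B, [(a + c, tmul A a c u x), (b + d, tmul A b d v y)]) \<in> tensor_gens [A, A] (p + q)"
    using permutes_compose[OF B st] g bilinear_closed[OF bilinear_tmul] by (simp add: gens_pair)
  have "map (perm_prod p \<sigma> \<tau>) (iota (p + q)) = map \<sigma> (iota p) @ map (\<lambda>k. k + p) (map \<tau> (iota q))"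
    by (simp add: map_perm_prod[OF t(1)] o_def)
  also have "\<dots> = ?U @ ?V @ ?X @ ?Y"
    by (simp flip: map_append append_assoc add: append_take_drop_id[of a "map \<sigma> (iota p)"])
  finally have "map (perm_prod p \<sigma> \<tau> \<circ> ?B) (iota (p + q)) = plist ?B (?U @ ?V @ ?X @ ?Y)"
    using plist_map_iota[OF B, of "perm_prod p \<sigma> \<tau>"] by simp
  also have "\<dots> = ?U @ ?X @ ?V @ ?Y"
    by (rule plist_block_perm_23) (use s t in auto)
  finally have m: "map (perm_prod p \<sigma> \<tau> \<circ> ?B) (iota (p + q)) = (?U @ ?X) @ (?V @ ?Y)" by simp
  have l: "length (?U @ ?X) = a + c" using s t by simp
  have "take (a + c) ((?U @ ?X) @ (?V @ ?Y)) = ?U @ ?X" "drop (a + c) ((?U @ ?X) @ (?V @ ?Y)) = ?V @ ?Y"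
    using append_eq_conv_conj[of "?U @ ?X" "?V @ ?Y" "(?U @ ?X) @ (?V @ ?Y)"] unfolding l by metis+
  with class_eq_pair_class[OF g', unfolded m] s(2) show ?thesis
    by (simp only: tensor_square_mul_gen_def Let_def prod.case nth_Cons_0 nth_Cons_Suc One_nat_def)
qed

text \<open>On labelled pairs the product is componentwise. For it to descend it must be balanced in
  either pair while the other is fixed.\<close>

lemma tensor_square_tmul:
  shows "bilinear_map R (sqmod p) (sqmod q) (sqmod (p + q)) (tmul (tensor_square R A) p q)"
    and "mset (L @ L') = mset (iota p) \<Longrightarrow> mset (X @ X') = mset (iota q) \<Longrightarrow>
      s \<in> carrier (grade A (length L)) \<Longrightarrow> t \<in> carrier (grade A (length L')) \<Longrightarrow>
      x \<in> carrier (grade A (length X)) \<Longrightarrow> y \<in> carrier (grade A (length X')) \<Longrightarrow>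
      tmul (tensor_square R A) p q (pair_class R A p L L' s t) (pair_class R A q X X' x y) =
      pair_class R A (p + q) (L @ map (\<lambda>k. k + p) X) (L' @ map (\<lambda>k. k + p) X')
        (tmul A (length L) (length X) s x) (tmul A (length L') (length X') t y)"
proof -
  let ?V = "sqmod (p + q)"
  let ?h = "tensor_square_mul_gen R A"
  let ?P = "\<lambda>L L' X X' s t x y. pair_class R A (p + q) (L @ map (\<lambda>k. k + p) X) (L' @ map (\<lambda>k. k + p) X')
        (tmul A (length L) (length X) s x) (tmul A (length L') (length X') t y)"
  have bp: "bilinear_map R (grade A (length L + length X)) (grade A (length L' + length X')) ?V
      (pair_class R A (p + q) (L @ map (\<lambda>k. k + p) X) (L' @ map (\<lambda>k. k + p) X'))" for L L' X X'
    using bilinear_pair_class[of "L @ map (\<lambda>k. k + p) X" "L' @ map (\<lambda>k. k + p) X'" "p + q"] by simp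
  \<comment> \<open>Balancing in all four factors at once; the two cases needed follow by taking
    identities in one pair.\<close>
  have act1: "?P (plist \<alpha> L) (plist \<beta> L') (plist \<alpha>' X) (plist \<beta>' X') s t x y =
      ?P L L' X X' (act A (length L) \<alpha> s) (act A (length L') \<beta> t) (act A (length X) \<alpha>' x) (act A (length X') \<beta>' y)"
    if a: "\<alpha> permutes {1..length L}" "\<beta> permutes {1..length L'}" "\<alpha>' permutes {1..length X}" "\<beta>' permutes {1..length X'}"
      and s: "s \<in> carrier (grade A (length L))" "t \<in> carrier (grade A (length L'))"
        "x \<in> carrier (grade A (length X))" "y \<in> carrier (grade A (length X'))"
    for \<alpha> \<beta> \<alpha>' \<beta>' L L' X X' s t x y
  proof -
    have a': "\<alpha>' permutes {1..length (map (\<lambda>k. k + p) X)}" "\<beta>' permutes {1..length (map (\<lambda>k. k + p) X')}" using a by auto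
    have e: "plist \<alpha> L @ map (\<lambda>k. k + p) (plist \<alpha>' X) = plist (perm_prod (length L) \<alpha> \<alpha>') (L @ map (\<lambda>k. k + p) X)"
      "plist \<beta> L' @ map (\<lambda>k. k + p) (plist \<beta>' X') = plist (perm_prod (length L') \<beta> \<beta>') (L' @ map (\<lambda>k. k + p) X')"
      by (simp_all add: map_plist a plist_perm_prod[OF a(1) a'(1)] plist_perm_prod[OF a(2) a'(2)])
    have pp: "perm_prod (length L) \<alpha> \<alpha>' permutes {1..length (L @ map (\<lambda>k. k + p) X)}"
      "perm_prod (length L') \<beta> \<beta>' permutes {1..length (L' @ map (\<lambda>k. k + p) X')}"
      using perm_prod_permutes a by simp_all
    show ?thesis
      unfolding e length_plist
      using pair_class_plist[OF pp, of "tmul A (length L) (length X) s x" "tmul A (length L') (length X') t y" "p + q"]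
      by (simp add: tmul_act a s bilinear_closed[OF bilinear_tmul])
  qed
  note act0 = act1[OF _ _ permutes_id permutes_id] act1[OF permutes_id permutes_id]
  have act2: "?P (plist \<alpha> L) (plist \<beta> L') X X' s t x y = ?P L L' X X' (act A (length L) \<alpha> s) (act A (length L') \<beta> t) x y"
    if "\<alpha> permutes {1..length L}" "\<beta> permutes {1..length L'}"
      "s \<in> carrier (grade A (length L))" "t \<in> carrier (grade A (length L'))"
        "x \<in> carrier (grade A (length X))" "y \<in> carrier (grade A (length X'))"
    for \<alpha> \<beta> L L' X X' s t x y
    using act0(1)[OF that] that by (simp add: sym_moduleD(3)[OF symM])
  have act3: "?P L L' (plist \<alpha> X) (plist \<beta> X') s t x y = ?P L L' X X' s t (act A (length X) \<alpha> x) (act A (length X') \<beta> y)"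
    if "\<alpha> permutes {1..length X}" "\<beta> permutes {1..length X'}"
      "s \<in> carrier (grade A (length L))" "t \<in> carrier (grade A (length L'))"
        "x \<in> carrier (grade A (length X))" "y \<in> carrier (grade A (length X'))"
    for \<alpha> \<beta> L L' X X' s t x y
    using act0(2)[OF that] that by (simp add: sym_moduleD(3)[OF symM])
  have K1: "pair_compat q ?V (\<lambda>X X' x y. ?P L L' X X' s t x y)"
    if s: "s \<in> carrier (grade A (length L))" "t \<in> carrier (grade A (length L'))" for L L' s t
    unfolding pair_compat_def
    by (intro allI impI conjI ballI bilinear_comp_args[OF bp bilinear_right[OF bilinear_tmul s(1)] bilinear_right[OF bilinear_tmul s(2)]])
      (rule act3[OF _ _ s])
  have K2: "pair_compat p ?V (\<lambda>L L' s t. ?P L L' X X' s t x y)"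
    if s: "x \<in> carrier (grade A (length X))" "y \<in> carrier (grade A (length X'))" for X X' x y
    unfolding pair_compat_def
    by (intro allI impI conjI ballI bilinear_comp_args[OF bp bilinear_left[OF bilinear_tmul s(1)] bilinear_left[OF bilinear_tmul s(2)]])
      (rule act2[OF _ _ _ _ s])
  have h1: "tens_compat R [A, A] q ?V (?h s)" if gs: "s \<in> tensor_gens [A, A] p" for s
  proof -
    obtain \<sigma> a u b v where s: "s = (\<sigma>, [(a, u), (b, v)])" using gs by (cases s) (auto elim: gens_cases)
    note g = gs[unfolded s]
    note l = length_lft_rgt(1,2)[OF g, simplified]
    have uv: "u \<in> carrier (grade A a)" "v \<in> carrier (grade A b)" using g by (auto simp: gens_pair)
    have K: "pair_compat q ?V (\<lambda>X X' x y. ?P (take a (map \<sigma> (iota p))) (drop a (map \<sigma> (iota p))) X X' u v x y)"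
      by (rule K1) (use uv l in auto)
    show ?thesis unfolding s
    proof (rule pair_lift[OF sq.module_tensor K])
      fix \<tau> c x d y assume g2: "(\<tau>, [(c, x), (d, y)]) \<in> tensor_gens [A, A] q"
      note l2 = length_lft_rgt(1,2)[OF g2, simplified]
      show "?h (\<sigma>, [(a, u), (b, v)]) (\<tau>, [(c, x), (d, y)]) = ?P (take a (map \<sigma> (iota p))) (drop a (map \<sigma> (iota p)))
          (take c (map \<tau> (iota q))) (drop c (map \<tau> (iota q))) u v x y"
        unfolding mul_gen_eq[OF g g2] using l l2 by simp
    qed
  qed
  have h2: "tens_compat R [A, A] p ?V (\<lambda>s. ?h s t)" if gt: "t \<in> tensor_gens [A, A] q" for t
  proof -
    obtain \<tau> c x d y where t: "t = (\<tau>, [(c, x), (d, y)])" using gt by (cases t) (auto elim: gens_cases)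
    note g2 = gt[unfolded t]
    note l2 = length_lft_rgt(1,2)[OF g2, simplified]
    have xy: "x \<in> carrier (grade A c)" "y \<in> carrier (grade A d)" using g2 by (auto simp: gens_pair)
    have K: "pair_compat p ?V (\<lambda>L L' s t. ?P L L' (take c (map \<tau> (iota q))) (drop c (map \<tau> (iota q))) s t x y)"
      by (rule K2) (use xy l2 in auto)
    show ?thesis unfolding t
    proof (rule pair_lift[OF sq.module_tensor K])
      fix \<sigma> a u b v assume g: "(\<sigma>, [(a, u), (b, v)]) \<in> tensor_gens [A, A] p"
      note l = length_lft_rgt(1,2)[OF g, simplified]
      show "?h (\<sigma>, [(a, u), (b, v)]) (\<tau>, [(c, x), (d, y)]) = ?P (take a (map \<sigma> (iota p))) (drop a (map \<sigma> (iota p)))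
          (take c (map \<tau> (iota q))) (drop c (map \<tau> (iota q))) u v x y"
        unfolding mul_gen_eq[OF g g2] using l l2 by simp
    qed
  qed
  have eq: "tmul (tensor_square R A) p q = (\<lambda>X Y. lift_linear R ?V (\<lambda>s. lift_linear R ?V (?h s) Y) X)"
    by (simp add: tensor_square_def Let_def)
  note T = bilinear_lift_tensor[OF sq.tensor_factors_axioms sq.tensor_factors_axioms sq.module_tensor h1 h2]
  show "bilinear_map R (sqmod p) (sqmod q) ?V (tmul (tensor_square R A) p q)" unfolding eq by (rule T(1))
  assume a: "mset (L @ L') = mset (iota p)" "mset (X @ X') = mset (iota q)"
    "s \<in> carrier (grade A (length L))" "t \<in> carrier (grade A (length L'))"
    "x \<in> carrier (grade A (length X))" "y \<in> carrier (grade A (length X'))"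
  note g = pair_gens[OF a(1,3,4)] pair_gens[OF a(2,5,6)]
  have mm: "map (perm_of (L @ L')) (iota p) = L @ L'" "map (perm_of (X @ X')) (iota q) = X @ X'"
    using map_perm_of_iota[of "L @ L'"] mset_eq_iota[OF a(1)] map_perm_of_iota[of "X @ X'"] mset_eq_iota[OF a(2)] by simp_all
  show "tmul (tensor_square R A) p q (pair_class R A p L L' s t) (pair_class R A q X X' x y) = ?P L L' X X' s t x y"
    using T(2)[OF _ _ g] mul_gen_eq[OF g] a(1,2) unfolding eq mm by (simp add: pair_class_def)
qed

end

lemma (in abelian_group) minus_eq_minus_iff:
  assumes "x \<in> carrier G" "y \<in> carrier G" "z \<in> carrier G" "w \<in> carrier G"
  shows "x \<ominus> y = z \<ominus> w \<longleftrightarrow> x \<oplus> w = y \<oplus> z"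
proof -
  have "x \<ominus> y = z \<ominus> w \<longleftrightarrow> x = (z \<ominus> w) \<oplus> y"
    by (rule minus_eq_iff) (use assms in auto)
  also have "(z \<ominus> w) \<oplus> y = (y \<oplus> z) \<ominus> w"
    using assms by (simp add: a_minus_def a_ac)
  also have "x = (y \<oplus> z) \<ominus> w \<longleftrightarrow> x \<oplus> w = y \<oplus> z"
    using minus_eq_iff[of "y \<oplus> z" w x] assms by auto
  finally show ?thesis .
qed

lemma linear_image_mspan:
  assumes M: "module R M" and V: "module R V" and f: "linear_map R M V f" and S: "S \<subseteq> carrier M"
  shows "f ` mspan R M S = mspan R V (f ` S)"
proof
  have fS: "f ` S \<subseteq> carrier V" using linear_closed[OF f] S by auto
  have "f s \<in> mspan R V (f ` S)" if "s \<in> S" for s using that by (intro hull_inc imageI)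
  from linear_vanish_mspan[OF M V f S this mspan_submodule[OF V fS]]
  show "f ` mspan R M S \<subseteq> mspan R V (f ` S)" by (intro image_subsetI)
  interpret V: module R V by (rule V)
  note D = submoduleD[OF mspan_submodule[OF M S] M]
  have cl: "x \<in> carrier M" if "x \<in> mspan R M S" for x using D(1) that by auto
  show "mspan R V (f ` S) \<subseteq> f ` mspan R M S"
  proof (rule mspan_minimal)
    show "f ` S \<subseteq> f ` mspan R M S" by (rule image_mono) (rule hull_subset)
    show "submodule (f ` mspan R M S) R V"
    proof (rule V.submoduleI')
      show "f ` mspan R M S \<subseteq> carrier V" using cl linear_closed[OF f] by auto
      show "\<zero>\<^bsub>V\<^esub> \<in> f ` mspan R M S" using linear_zero[OF M V f] D(2) by (metis imageI)
      show "a \<oplus>\<^bsub>V\<^esub> b \<in> f ` mspan R M S" if "a \<in> f ` mspan R M S" "b \<in> f ` mspan R M S" for a b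
      proof -
        from that obtain x y where "x \<in> mspan R M S" "y \<in> mspan R M S" "a = f x" "b = f y" by blast
        thus ?thesis using linear_add[OF f cl cl] D(4) by (metis imageI)
      qed
      show "r \<odot>\<^bsub>V\<^esub> a \<in> f ` mspan R M S" if "r \<in> carrier R" "a \<in> f ` mspan R M S" for r a
      proof -
        from that obtain x where "x \<in> mspan R M S" "a = f x" by blast
        thus ?thesis using linear_smult[OF f that(1) cl] D(6)[OF that(1)] by (metis imageI)
      qed
    qed
  qed
qed

section \<open>Quotients of the tensor algebra\<close>

context word_op
begin

abbreviation "Q \<equiv> tensor_quot R \<gamma> I"
abbreviation "cl p t \<equiv> I p +>\<^bsub>grade T p\<^esub> t"

lemma subI: "submodule (I p) R (grade T p)"
  unfolding I_eq by (rule submodule_Isp)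

lemma grade_Q: "grade Q p = FactModule (grade T p) (I p)"
  by (simp add: tensor_quot_def quotient_talg_def)

lemma module_Q: "module R (grade Q p)"
  unfolding grade_Q by (rule module_FactModule[OF module_T subI])

lemma linear_cl: "linear_map R (grade T p) (grade Q p) (cl p)"
  unfolding grade_Q by (rule linear_coset[OF module_T subI])

lemma carrier_Q: "carrier (grade Q p) = cl p ` carrier (grade T p)"
  unfolding grade_Q FactModule_simps ..

lemma cl_eq_iff: "s \<in> carrier (grade T p) \<Longrightarrow> t \<in> carrier (grade T p) \<Longrightarrow> cl p s = cl p t \<longleftrightarrow> s \<ominus>\<^bsub>grade T p\<^esub> t \<in> I p"
  by (rule coset_eq_iff[OF module_T subI])

lemma act_cl: "\<sigma> permutes {1..p} \<Longrightarrow> t \<in> carrier (grade T p) \<Longrightarrow> act Q p \<sigma> (cl p t) = cl p (act T p \<sigma> t)"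
  using coset_map_linear[OF module_T subI module_T subI linear_act_T[of \<sigma> p], of t] act_Isp[of \<sigma> p]
  by (simp add: tensor_quot_def quotient_talg_def I_eq)

lemma tmul_cl: "s \<in> carrier (grade T p) \<Longrightarrow> t \<in> carrier (grade T r) \<Longrightarrow>
    tmul Q p r (cl p s) (cl r t) = cl (p + r) (tmul T p r s t)"
  using coset_map2_bilinear[OF module_T module_T module_T subI subI subI bilinear_tmul_T, of p r s t] mul_Isp[of _ p _ r] mul_Isp[of _ r _ p]
  by (simp add: tensor_quot_def quotient_talg_def I_eq)

lemma linear_act_Q: "\<sigma> permutes {1..p} \<Longrightarrow> linear_map R (grade Q p) (grade Q p) (act Q p \<sigma>)"
  unfolding grade_Q
  by (rule linear_from_FactModule[OF module_T subI linear_comp[OF linear_act_T linear_cl[unfolded grade_Q]]])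
    (simp_all add: act_cl)

lemma bilinear_tmul_Q: "bilinear_map R (grade Q p) (grade Q r) (grade Q (p + r)) (tmul Q p r)"
  unfolding grade_Q
  by (rule bilinear_from_FactModule[OF module_T subI module_T subI
      bilinear_comp_linear[OF bilinear_tmul_T linear_cl[unfolded grade_Q]]]) (rule tmul_cl)

lemma sym_module_Q: "sym_module R Q"
  unfolding sym_module_def
proof (intro allI conjI impI ballI module_Q linear_act_Q)
  fix p x assume "x \<in> carrier (grade Q p)"
  thus "act Q p id x = x" unfolding carrier_Q by (auto simp: act_cl permutes_id sym_moduleD(3)[OF sym_module_T])
next
  fix p \<sigma> \<tau> x assume x: "x \<in> carrier (grade Q p)" and s: "\<sigma> permutes {1..p}" and t: "\<tau> permutes {1..p}"
  obtain z where z: "z \<in> carrier (grade T p)" "x = cl p z" using x unfolding carrier_Q by blast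
  show "act Q p (\<sigma> \<circ> \<tau>) x = act Q p \<sigma> (act Q p \<tau> x)"
    using sym_moduleD(4)[OF sym_module_T z(1) s t] sym_moduleD(5)[OF sym_module_T z(1) t] z(1)
    by (simp add: z(2) act_cl s t permutes_compose)
qed

definition evq :: "nat \<Rightarrow> 'a word \<Rightarrow> (nat \<Rightarrow> ('r, 'a) tens) set"
  where "evq p w = cl p (ev p w)"

lemma evq_closed: "evq p w \<in> carrier (grade Q p)"
  unfolding evq_def carrier_Q using ev_closed by blast

lemma evq_not_good: "\<not> good p w \<Longrightarrow> evq p w = \<zero>\<^bsub>grade Q p\<^esub>"
  unfolding evq_def by (simp add: ev_not_good linear_zero[OF module_T module_Q linear_cl])

lemma act_evq: "\<sigma> permutes {1..p} \<Longrightarrow> act Q p \<sigma> (evq p w) = evq p (relabel \<sigma> w)"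
  by (simp add: evq_def act_cl ev_closed act_ev)

lemma evq_mul: "good p w \<Longrightarrow> good r w' \<Longrightarrow> tmul Q p r (evq p w) (evq r w') = evq (p + r) (w @ shift p w')"
  by (simp add: evq_def tmul_cl ev_closed ev_mul_good)

lemma tone_Q: "tone Q = evq 0 []"
  by (simp add: tensor_quot_def quotient_talg_def evq_def tone_ev)

lemma quot_incl_evq: "x \<in> carrier (grade \<gamma> m) \<Longrightarrow> quot_incl R \<gamma> I m x = evq m [(iota m, x)]"
  by (simp add: quot_incl_def evq_def tensor_incl_ev)

lemma tensor_image_eq: "tensor_image R \<gamma> I S p = cl p ` T_part S p"
  by (simp add: tensor_image_def T_part_def grade_power)

lemma tensor_image_mspan: "tensor_image R \<gamma> I S p = mspan R (grade Q p) {evq p w | w. good p w \<and> length w \<in> S}"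
proof -
  have "{ev p w | w. good p w \<and> length w \<in> S} \<subseteq> carrier (grade T p)" using ev_closed by auto
  from linear_image_mspan[OF module_T module_Q linear_cl this]
  have "tensor_image R \<gamma> I S p = mspan R (grade Q p) (cl p ` {ev p w | w. good p w \<and> length w \<in> S})"
    unfolding tensor_image_eq T_part_mspan .
  also have "cl p ` {ev p w | w. good p w \<and> length w \<in> S} = {evq p w | w. good p w \<and> length w \<in> S}"
    unfolding evq_def by blast
  finally show ?thesis .
qed

lemma evq_set_closed: "{evq p w | w. good p w \<and> length w \<in> S} \<subseteq> carrier (grade Q p)"
  using evq_closed by auto

lemma submodule_image: "submodule (tensor_image R \<gamma> I S p) R (grade Q p)"
  unfolding tensor_image_mspan by (rule mspan_submodule[OF module_Q evq_set_closed])

lemma Q_mspan: "carrier (grade Q p) = mspan R (grade Q p) {evq p w | w. good p w}"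
proof -
  have "tensor_image R \<gamma> I UNIV p = carrier (grade Q p)" by (simp add: tensor_image_eq T_part_def carrier_Q)
  thus ?thesis using tensor_image_mspan[of UNIV p] by simp
qed

lemma Q_agree:
  assumes "module R V" "linear_map R (grade Q p) V f" "linear_map R (grade Q p) V g"
    "\<And>w. good p w \<Longrightarrow> f (evq p w) = g (evq p w)" "x \<in> carrier (grade Q p)"
  shows "f x = g x"
proof (rule linear_agree[OF module_Q assms(1-3)])
  show "{evq p w | w. good p w} \<subseteq> carrier (grade Q p)" using evq_closed by auto
  show "x \<in> mspan R (grade Q p) {evq p w | w. good p w}" using assms(5) Q_mspan by simp
qed (use assms(4) in auto)

text \<open>Word functions that vanish on the defining relations, in other words linear maps out of
  the quotient (\<open>Q_universal\<close>). The relation is written without subtraction so that it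
  can be verified by rearranging sums.\<close>

definition relfun :: "('r, 'b, 'n) module_scheme \<Rightarrow> ('a word \<Rightarrow> 'b) \<Rightarrow> bool"
  where "relfun V H \<longleftrightarrow> wfun V H \<and> (\<forall>u a b v. typed u \<longrightarrow> typed [a] \<longrightarrow> typed [b] \<longrightarrow> typed v \<longrightarrow>
    H (u @ a # b # v) \<oplus>\<^bsub>V\<^esub> H (u @ lop b a # v) = H (u @ b # a # v) \<oplus>\<^bsub>V\<^esub> H (u @ lop a b # v))"

lemma relfunD:
  assumes "relfun V H"
  shows "wfun V H" and "H w \<in> carrier V"
    and "typed u \<Longrightarrow> typed [a] \<Longrightarrow> typed [b] \<Longrightarrow> typed v \<Longrightarrow>
    H (u @ a # b # v) \<oplus>\<^bsub>V\<^esub> H (u @ lop b a # v) = H (u @ b # a # v) \<oplus>\<^bsub>V\<^esub> H (u @ lop a b # v)"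
  using assms wfunD(1) unfolding relfun_def by blast+

lemma relfunI:
  assumes "wfun V H" and "\<And>u a b v. typed u \<Longrightarrow> typed [a] \<Longrightarrow> typed [b] \<Longrightarrow> typed v \<Longrightarrow>
    H (u @ a # b # v) \<oplus>\<^bsub>V\<^esub> H (u @ lop b a # v) = H (u @ b # a # v) \<oplus>\<^bsub>V\<^esub> H (u @ lop a b # v)"
  shows "relfun V H"
  using assms unfolding relfun_def by blast

lemma rel_elem_zero_iff:
  assumes V: "module R V" and H: "\<And>w. H w \<in> carrier V"
  shows "rel_elem V H u a b v = \<zero>\<^bsub>V\<^esub> \<longleftrightarrow>
    H (u @ a # b # v) \<oplus>\<^bsub>V\<^esub> H (u @ lop b a # v) = H (u @ b # a # v) \<oplus>\<^bsub>V\<^esub> H (u @ lop a b # v)"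
proof -
  interpret V: module R V by (rule V)
  show ?thesis unfolding rel_elem_def
    by (simp add: V.minus_eq_zero_iff V.minus_eq_minus_iff H)
qed

lemma relfun_evq: "relfun (grade Q p) (evq p)"
proof (rule relfunI)
  show "wfun (grade Q p) (evq p)"
    using wfun_linear[OF wfun_ev linear_cl] by (simp add: evq_def[abs_def])
  fix u a b v assume t: "typed u" "typed [a]" "typed [b]" "typed v"
  have "rel_elem (grade T p) (ev p) u a b v \<in> I p" unfolding I_eq using erelI[OF t] by (rule hull_inc)
  hence "cl p (rel_elem (grade T p) (ev p) u a b v) = \<zero>\<^bsub>grade Q p\<^esub>"
    using coset_eq_zero_iff[OF module_T subI] subsetD[OF erel_closed erelI[OF t]] by (simp add: grade_Q FactModule_simps)
  hence "rel_elem (grade Q p) (evq p) u a b v = \<zero>\<^bsub>grade Q p\<^esub>"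
    using linear_rel_elem[OF module_T module_Q linear_cl ev_closed] by (simp add: evq_def[abs_def])
  thus "evq p (u @ a # b # v) \<oplus>\<^bsub>grade Q p\<^esub> evq p (u @ lop b a # v) =
      evq p (u @ b # a # v) \<oplus>\<^bsub>grade Q p\<^esub> evq p (u @ lop a b # v)"
    by (rule iffD1[OF rel_elem_zero_iff[where H = "evq p", OF module_Q evq_closed]])
qed

lemma relfun_linear:
  assumes H: "relfun V H" and f: "linear_map R V W f"
  shows "relfun W (\<lambda>w. f (H w))"
proof (rule relfunI[OF wfun_linear[OF relfunD(1)[OF H] f]])
  note c = relfunD(2)[OF H]
  fix u a b v assume t: "typed u" "typed [a]" "typed [b]" "typed v"
  show "f (H (u @ a # b # v)) \<oplus>\<^bsub>W\<^esub> f (H (u @ lop b a # v)) = f (H (u @ b # a # v)) \<oplus>\<^bsub>W\<^esub> f (H (u @ lop a b # v))"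
    by (simp only: linear_add[OF f c c, symmetric] relfunD(3)[OF H t])
qed

text \<open>The map out of the tensor algebra given by \<open>H\<close> kills every relation: one
  with good labels by hypothesis, any other because it is already zero in the tensor
  algebra.\<close>

lemma Q_universal:
  assumes V: "module R V" and H: "relfun V H"
  shows "\<exists>f. linear_map R (grade Q p) V f \<and> (\<forall>w. good p w \<longrightarrow> f (evq p w) = H w)"
proof -
  obtain f where f: "linear_map R (grade T p) V f" and fe: "\<And>w. good p w \<Longrightarrow> f (ev p w) = H w"
    using T_universal[OF V relfunD(1)[OF H]] by blast
  have "f e \<in> {\<zero>\<^bsub>V\<^esub>}" if "e \<in> erel p" for e
  proof -
    from that obtain u a b v where e: "e = rel_elem (grade T p) (ev p) u a b v"
      and t: "typed u" "typed [a]" "typed [b]" "typed v" unfolding erel_def by blast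
    show ?thesis
    proof (cases "good p (u @ a # b # v)")
      case False
      thus ?thesis using rel_elem_not_good[OF t False] linear_zero[OF module_T V f] by (simp add: e)
    next
      case True
      have "f e = rel_elem V (\<lambda>w. f (ev p w)) u a b v" unfolding e by (rule linear_rel_elem[OF module_T V f ev_closed])
      also have "\<dots> = rel_elem V H u a b v" using True by (simp add: rel_elem_def fe good_rel[OF t])
      also have "\<dots> = \<zero>\<^bsub>V\<^esub>"
        by (rule iffD2[OF rel_elem_zero_iff[where H = H, OF V relfunD(2)[OF H]] relfunD(3)[OF H t]])
      finally show ?thesis by simp
    qed
  qed
  from linear_vanish_mspan[OF module_T V f erel_closed this zero_submodule[OF V]]
  have k: "f x = \<zero>\<^bsub>V\<^esub>" if "x \<in> I p" for x using that unfolding I_eq by blast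
  obtain g where "linear_map R (FactModule (grade T p) (I p)) V g" "\<forall>x\<in>carrier (grade T p). g (cl p x) = f x"
    using quotient_linear_exists[OF module_T subI V f k] by blast
  thus ?thesis using fe ev_closed unfolding grade_Q evq_def by metis
qed

text \<open>Equivariance compares linear maps and multiplicativity compares bilinear ones, so both
  are tested on the spanning words; \<open>H\<close> gives the images of words.\<close>

lemma Q_talg_homI:
  assumes B: "\<And>p. module R (grade B p)" and f: "\<And>p. linear_map R (grade Q p) (grade B p) (f p)"
    and fe: "\<And>p w. good p w \<Longrightarrow> f p (evq p w) = H p w"
    and actB: "\<And>p \<sigma>. \<sigma> permutes {1..p} \<Longrightarrow> linear_map R (grade B p) (grade B p) (act B p \<sigma>)"
    and actH: "\<And>p \<sigma> w. \<sigma> permutes {1..p} \<Longrightarrow> good p w \<Longrightarrow> act B p \<sigma> (H p w) = H p (relabel \<sigma> w)"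
    and one: "H 0 [] = tone B"
    and mulB: "\<And>p r. bilinear_map R (grade B p) (grade B r) (grade B (p + r)) (tmul B p r)"
    and mulH: "\<And>p r w w'. good p w \<Longrightarrow> good r w' \<Longrightarrow> tmul B p r (H p w) (H r w') = H (p + r) (w @ shift p w')"
  shows "talg_hom R Q B f"
  unfolding talg_hom_def smod_hom_def
proof (intro conjI allI ballI f)
  fix p \<sigma> x assume s: "\<sigma> \<in> carrier (sym_group p)" and x: "x \<in> carrier (grade Q p)"
  hence s: "\<sigma> permutes {1..p}" by (simp add: sym_group_carrier)
  show "f p (act Q p \<sigma> x) = act B p \<sigma> (f p x)"
    by (rule Q_agree[OF B linear_comp[OF linear_act_Q[OF s] f] linear_comp[OF f actB[OF s]] _ x])
      (simp add: act_evq[OF s] fe good_relabel[OF s] actH[OF s])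
next
  show "f 0 (tone Q) = tone B" by (simp add: tone_Q fe good_Nil one)
next
  fix p r x y assume x: "x \<in> carrier (grade Q p)" and y: "y \<in> carrier (grade Q r)"
  have S: "{evq p w | w. good p w} \<subseteq> carrier (grade Q p)" for p using evq_closed by auto
  have e: "f (p + r) (tmul Q p r s t) = tmul B p r (f p s) (f r t)"
    if st: "s \<in> {evq p w | w. good p w}" "t \<in> {evq r w | w. good r w}" for s t
  proof -
    from st obtain w w' where "s = evq p w" "good p w" "t = evq r w'" "good r w'" by blast
    thus ?thesis by (simp add: evq_mul fe good_append_shift mulH)
  qed
  show "f (p + r) (tmul Q p r x y) = tmul B p r (f p x) (f r y)"
    by (rule bilinear_agree[OF module_Q module_Q B bilinear_comp_linear[OF bilinear_tmul_Q f]
        bilinear_comp_args[OF mulB f f] S S e]) (use x y Q_mspan in auto)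
qed

sublocale Qs: talg_square R Q
proof (intro talg_square.intro square.intro talg_square_axioms.intro)
  show "cring R" by (rule cringR)
  show "sym_module R Q" by (rule sym_module_Q)
  show "bilinear_map R (grade Q m) (grade Q n) (grade Q (m + n)) (tmul Q m n)" for m n by (rule bilinear_tmul_Q)
  fix \<sigma> \<tau> :: "nat \<Rightarrow> nat" and m n x y
  assume s: "\<sigma> permutes {1..m}" and t: "\<tau> permutes {1..n}" and x: "x \<in> carrier (grade Q m)" and y: "y \<in> carrier (grade Q n)"
  have S: "{evq p w | w. good p w} \<subseteq> carrier (grade Q p)" for p using evq_closed by auto
  note st = perm_prod_permutes[OF s t]
  have e: "tmul Q m n (act Q m \<sigma> a) (act Q n \<tau> b) = act Q (m + n) (perm_prod m \<sigma> \<tau>) (tmul Q m n a b)"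
    if "a \<in> {evq m w | w. good m w}" "b \<in> {evq n w | w. good n w}" for a b
  proof -
    from that obtain w w' where w: "a = evq m w" "good m w" "b = evq n w'" "good n w'" by blast
    have "relabel (perm_prod m \<sigma> \<tau>) w = relabel \<sigma> w"
      using w(2) mset_eq_iota by (intro relabel_cong) (auto simp: good_def perm_prod_def)
    moreover have "relabel (perm_prod m \<sigma> \<tau>) (shift m w') = shift m (relabel \<tau> w')"
      unfolding relabel_comp using w(4) mset_eq_iota[of "labels w'" n]
      by (intro relabel_cong) (auto simp: good_def perm_prod_def)
    ultimately show ?thesis using w
      by (simp add: act_evq s t st good_relabel evq_mul)
  qed
  show "tmul Q m n (act Q m \<sigma> x) (act Q n \<tau> y) = act Q (m + n) (perm_prod m \<sigma> \<tau>) (tmul Q m n x y)"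
    by (rule bilinear_agree[OF module_Q module_Q module_Q
        bilinear_comp_args[OF bilinear_tmul_Q linear_act_Q[OF s] linear_act_Q[OF t]]
        bilinear_comp_linear[OF bilinear_tmul_Q linear_act_Q[OF st]] S S e]) (use x y Q_mspan in auto)
qed

section \<open>The coproduct\<close>

lemma relfun_relabel:
  assumes H: "relfun V H"
  shows "relfun V (\<lambda>w. H (relabel f w))"
proof (rule relfunI)
  have "compat n V (\<lambda>w. H ([] @ relabel f w @ []))" for n
    by (rule compat_context[of n]) (use relfunD(1)[OF H] in \<open>auto simp: wfun_def\<close>)
  thus "wfun V (\<lambda>w. H (relabel f w))" by (simp add: wfun_def)
  fix u a b v assume t: "typed u" "typed [a]" "typed [b]" "typed v"
  obtain la x lb y where ab: "a = (la, x)" "b = (lb, y)" by (cases a; cases b)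
  show "H (relabel f (u @ a # b # v)) \<oplus>\<^bsub>V\<^esub> H (relabel f (u @ lop b a # v)) =
      H (relabel f (u @ b # a # v)) \<oplus>\<^bsub>V\<^esub> H (relabel f (u @ lop a b # v))"
    using relfunD(3)[OF H, of "relabel f u" "(map f la, x)" "(map f lb, y)" "relabel f v"] t by (simp add: ab)
qed

text \<open>All words in one of the defining identities carry the same labels.\<close>

lemma relfun_local:
  assumes c: "\<And>w. H w \<in> carrier V"
    and K: "\<And>L. \<exists>K. relfun V K \<and> (\<forall>w. typed w \<longrightarrow> mset (labels w) = mset L \<longrightarrow> H w = K w)"
  shows "relfun V H"
proof (rule relfunI)
  show "wfun V H"
  proof (rule wfunI[OF c])
    fix u v :: "'a word" and l :: "nat list" and x y r \<tau>
    assume t: "typed u" "typed v" and x: "x \<in> carrier (grade \<gamma> (length l))"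
    obtain K where K: "relfun V K" and e: "\<And>w. typed w \<Longrightarrow> mset (labels w) = mset (labels (u @ (l, x) # v)) \<Longrightarrow> H w = K w"
      using K[of "labels (u @ (l, x) # v)"] by blast
    note W = wfunD[OF relfunD(1)[OF K]]
    show "y \<in> carrier (grade \<gamma> (length l)) \<Longrightarrow> H (u @ (l, x \<oplus>\<^bsub>grade \<gamma> (length l)\<^esub> y) # v) = H (u @ (l, x) # v) \<oplus>\<^bsub>V\<^esub> H (u @ (l, y) # v)"
      using W(2)[OF t x] x t by (simp add: e module_add_closed[OF mod_\<gamma>])
    show "r \<in> carrier R \<Longrightarrow> H (u @ (l, r \<odot>\<^bsub>grade \<gamma> (length l)\<^esub> x) # v) = r \<odot>\<^bsub>V\<^esub> H (u @ (l, x) # v)"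
      using W(3)[OF t _ x] x t by (simp add: e module_smult_closed[OF mod_\<gamma>])
    show "\<tau> permutes {1..length l} \<Longrightarrow> H (u @ (plist \<tau> l, x) # v) = H (u @ (l, act \<gamma> (length l) \<tau> x) # v)"
      using W(4)[OF t _ x] x t by (simp add: e sym_moduleD(5)[OF sym] mset_plist)
  qed
  fix u a b v assume t: "typed u" "typed [a]" "typed [b]" "typed v"
  obtain K where K: "relfun V K" and e: "\<And>w. typed w \<Longrightarrow> mset (labels w) = mset (labels (u @ a # b # v)) \<Longrightarrow> H w = K w"
    using K[of "labels (u @ a # b # v)"] by blast
  show "H (u @ a # b # v) \<oplus>\<^bsub>V\<^esub> H (u @ lop b a # v) = H (u @ b # a # v) \<oplus>\<^bsub>V\<^esub> H (u @ lop a b # v)"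
    using relfunD(3)[OF K t] e[OF typed_rel(1)[OF t]] e[OF typed_rel(2)[OF t]] e[OF typed_rel(3)[OF t]] e[OF typed_rel(4)[OF t]]
    by simp
qed

text \<open>Standardisation with respect to \<open>L\<close>: a label is replaced by its position in
  \<open>L\<close>.\<close>

definition unlab :: "nat list \<Rightarrow> nat \<Rightarrow> nat"
  where "unlab L = inv_into {1..length L} (perm_of L)"

lemma unlab:
  assumes "distinct L"
  shows "k \<in> set L \<Longrightarrow> perm_of L (unlab L k) = k" "map (unlab L) L = iota (length L)"
proof -
  have im: "perm_of L ` {1..length L} = set L"
    by (metis map_perm_of_iota set_iota set_map)
  have inj: "inj_on (perm_of L) {1..length L}"
    by (rule eq_card_imp_inj_on) (simp_all only: im distinct_card[OF assms] finite_atLeastAtMost, simp)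
  show "k \<in> set L \<Longrightarrow> perm_of L (unlab L k) = k"
    unfolding unlab_def using im by (simp add: f_inv_into_f)
  have "map (unlab L) (map (perm_of L) (iota (length L))) = iota (length L)"
    unfolding unlab_def map_map by (rule map_idI) (simp add: inv_into_f_f[OF inj])
  thus "map (unlab L) L = iota (length L)" by (simp only: map_perm_of_iota)
qed

text \<open>The element of the quotient obtained by standardising a word in its own reading order.
  The labels are forgotten here and enter again through \<open>pair_class\<close> in
  \<open>ev2\<close>.\<close>

definition word_class :: "'a word \<Rightarrow> (nat \<Rightarrow> ('r, 'a) tens) set"
  where "word_class w = evq (length (labels w)) (lab id (plain w))"

definition ev2 :: "nat \<Rightarrow> 'a word \<Rightarrow> 'a word \<Rightarrow> ('r, (nat \<Rightarrow> ('r, 'a) tens) set) tens"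
  where "ev2 p u v = pair_class R Q p (labels u) (labels v) (word_class u) (word_class v)"

lemma word_class_closed: "length (labels w) = m \<Longrightarrow> word_class w \<in> carrier (grade Q m)"
  unfolding word_class_def using evq_closed by blast

lemma ev2_closed: "ev2 p u v \<in> carrier (tensor_module R [Q, Q] p)"
  unfolding ev2_def by (intro Qs.pair_class_closed word_class_closed refl)

lemma word_class_relabel [simp]: "word_class (relabel f w) = word_class w"
  by (simp add: word_class_def)

lemma typed_lab_plain: "typed (lab \<sigma> (plain w)) \<longleftrightarrow> typed w"
  unfolding typed_lab by (auto simp: plain_def typed_def)

text \<open>Standardising by a reference list \<open>L\<close> instead of the reading order changes
  the class by the permutation that relates the two lists.\<close>

lemma evq_unlab:
  assumes L: "distinct L" and w: "typed w" "mset (labels w) = mset L"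
  shows "\<exists>\<rho>. \<rho> permutes {1..length L} \<and> evq (length L) (relabel (unlab L) w) = act Q (length L) \<rho> (word_class w) \<and> plist \<rho> L = labels w"
proof -
  let ?w = "relabel (unlab L) w" and ?m = "length L"
  have len: "length (labels w) = ?m" using w(2) by (rule mset_eq_length)
  have ms: "mset (labels ?w) = mset (iota ?m)"
    using arg_cong[OF w(2), of "image_mset (unlab L)"] unlab(2)[OF L] by (metis labels_simps(4) mset_map)
  let ?r = "perm_of (labels ?w)"
  have r: "?r permutes {1..?m}" by (rule perm_of_permutes[OF ms])
  have "relabel ?r (lab id (plain w)) = ?w"
    unfolding relabel_lab using lab_perm_of[of ?w] by simp
  hence "evq ?m ?w = act Q ?m ?r (word_class w)"
    by (simp only: word_class_def len act_evq[OF r])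
  moreover have "plist ?r L = labels w"
  proof -
    have "plist ?r L = plist ?r (map (perm_of L) (iota ?m))" by simp
    also have "\<dots> = map (perm_of L \<circ> ?r) (iota ?m)" by (rule plist_map_iota[OF r])
    also have "\<dots> = map (perm_of L) (map ?r (iota (length (labels ?w))))" using len by simp
    also have "\<dots> = map (perm_of L) (labels ?w)" by (simp only: map_perm_of_iota)
    also have "\<dots> = labels w"
      using unlab(1)[OF L] mset_eq_setD[OF w(2)] by (auto intro!: map_idI)
    finally show ?thesis .
  qed
  ultimately show ?thesis using r by blast
qed

text \<open>The words of one relation have the same labels in different reading orders. Referring
  all of them to fixed lists makes \<open>ev2\<close> visibly linear in the classes of the words;
  the correcting permutations are absorbed by balancing.\<close>

lemma ev2_eq:
  assumes LL: "distinct L" "distinct L'"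
    and u: "typed u" "mset (labels u) = mset L" and v: "typed v" "mset (labels v) = mset L'"
  shows "ev2 p u v = pair_class R Q p L L' (evq (length L) (relabel (unlab L) u)) (evq (length L') (relabel (unlab L') v))"
proof -
  obtain \<rho> where r: "\<rho> permutes {1..length L}" "evq (length L) (relabel (unlab L) u) = act Q (length L) \<rho> (word_class u)" "plist \<rho> L = labels u"
    using evq_unlab[OF LL(1) u] by blast
  obtain \<rho>' where r': "\<rho>' permutes {1..length L'}" "evq (length L') (relabel (unlab L') v) = act Q (length L') \<rho>' (word_class v)" "plist \<rho>' L' = labels v"
    using evq_unlab[OF LL(2) v] by blast
  show ?thesis unfolding ev2_def r(2) r'(2) r(3)[symmetric] r'(3)[symmetric]
    by (rule Qs.pair_class_plist[OF r(1) r'(1)]; rule word_class_closed, rule mset_eq_length, fact)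
qed

lemma relfun_zero: "module R V \<Longrightarrow> relfun V (\<lambda>w. \<zero>\<^bsub>V\<^esub>)"
proof -
  assume V: "module R V"
  show ?thesis
    by (rule relfunI[OF wfun_lfunI]) (simp_all add: lfun_zero[OF V] module_zero_closed[OF V])
qed

text \<open>One multiset of labels is treated at a time. If it does not complete the labels of the
  fixed word to a permutation, all values are zero; otherwise \<open>ev2_eq\<close> exhibits a
  linear map applied to \<open>evq\<close> of a relabelled word.\<close>

lemma relfun_ev2:
  shows "typed v \<Longrightarrow> relfun (tensor_module R [Q, Q] p) (\<lambda>u. ev2 p u v)"
    and "typed u \<Longrightarrow> relfun (tensor_module R [Q, Q] p) (ev2 p u)"
proof -
  let ?V = "tensor_module R [Q, Q] p"
  {
    assume v: "typed v"
    show "relfun ?V (\<lambda>u. ev2 p u v)"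
    proof (rule relfun_local[OF ev2_closed])
      fix L show "\<exists>K. relfun ?V K \<and> (\<forall>w. typed w \<longrightarrow> mset (labels w) = mset L \<longrightarrow> ev2 p w v = K w)"
      proof (cases "mset (L @ labels v) = mset (iota p)")
        case False
        thus ?thesis using relfun_zero[OF Qs.sq.module_tensor]
          by (intro exI[of _ "\<lambda>w. \<zero>\<^bsub>?V\<^esub>"]) (simp add: ev2_def pair_class_def)
      next
        case True
        hence d: "distinct L" "distinct (labels v)" using mset_eq_iota[OF True] by auto
        let ?t = "evq (length (labels v)) (relabel (unlab (labels v)) v)"
        have "relfun ?V (\<lambda>w. pair_class R Q p L (labels v) (evq (length L) (relabel (unlab L) w)) ?t)"
          by (rule relfun_linear[OF relfun_relabel[OF relfun_evq] bilinear_left[OF Qs.bilinear_pair_class evq_closed]])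
        thus ?thesis using ev2_eq[OF d _ _ v refl, of _ p] by blast
      qed
    qed
  next
    assume u: "typed u"
    show "relfun ?V (ev2 p u)"
    proof (rule relfun_local[OF ev2_closed])
      fix L show "\<exists>K. relfun ?V K \<and> (\<forall>w. typed w \<longrightarrow> mset (labels w) = mset L \<longrightarrow> ev2 p u w = K w)"
      proof (cases "mset (labels u @ L) = mset (iota p)")
        case False
        thus ?thesis using relfun_zero[OF Qs.sq.module_tensor]
          by (intro exI[of _ "\<lambda>w. \<zero>\<^bsub>?V\<^esub>"]) (simp add: ev2_def pair_class_def)
      next
        case True
        hence d: "distinct (labels u)" "distinct L" using mset_eq_iota[OF True] by auto
        let ?t = "evq (length (labels u)) (relabel (unlab (labels u)) u)"
        have "relfun ?V (\<lambda>w. pair_class R Q p (labels u) L ?t (evq (length L) (relabel (unlab L) w)))"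
          by (rule relfun_linear[OF relfun_relabel[OF relfun_evq] bilinear_right[OF Qs.bilinear_pair_class evq_closed]])
        thus ?thesis using ev2_eq[OF d u refl, of _ p] by blast
      qed
    qed
  }
qed

end

section \<open>Splitting respects the relations and yields the coproduct\<close>

lemma splits_map: "splits (map g w) = image_mset (\<lambda>z. (map g (fst z), map g (snd z))) (splits w)"
  by (induct w) (auto simp: multiset.map_comp o_def case_prod_unfold)

lemma splits_mem: "z \<in># splits w \<Longrightarrow> set (fst z) \<subseteq> set w \<and> set (snd z) \<subseteq> set w \<and>
    mset (labels (fst z) @ labels (snd z)) = mset (labels w)"
proof (induct w arbitrary: z)
  case (Cons a w)
  then obtain y where "y \<in># splits w" "z = (a # fst y, snd y) \<or> z = (fst y, a # snd y)"
    by (auto simp: case_prod_unfold)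
  with Cons(1)[of y] show ?case by auto
qed simp

lemma (in s_module) splits_typed:
  assumes "z \<in># splits w" "typed w"
  shows "typed (fst z)" "typed (snd z)"
  using splits_mem[OF assms(1)] assms(2) by (auto simp: typed_def)

lemma bilinear_msum:
  assumes M: "module R M" and N: "module R N" and V: "module R V" and f: "bilinear_map R M N V f"
    and g: "\<And>x. g x \<in> carrier M" and h: "\<And>y. h y \<in> carrier N"
  shows "f (msum M g A) (msum N h B) = msum V (\<lambda>x. msum V (\<lambda>y. f (g x) (h y)) B) A"
proof -
  have "f (msum M g A) (msum N h B) = msum V (\<lambda>x. f (g x) (msum N h B)) A"
    by (rule linear_msum[OF M V bilinear_left[OF f msum_closed[OF N h]] g])
  moreover have "f (g x) (msum N h B) = msum V (\<lambda>y. f (g x) (h y)) B" for x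
    by (rule linear_msum[OF N V bilinear_right[OF f g] h])
  ultimately show ?thesis by simp
qed

context word_op
begin

text \<open>Where the two letters of a relation fall on the same side, the relation holds by the
  hypothesis on that argument of \<open>G\<close>. Where they are separated, the terms are symmetric
  in the two letters. The single letters \<open>lop a b\<close> and \<open>lop b a\<close> fall on
  one side and complete the terms of the first kind.\<close>

lemma relfun_splits:
  assumes V: "module R V" and c: "\<And>u v. G u v \<in> carrier V"
    and G1: "\<And>v. typed v \<Longrightarrow> relfun V (\<lambda>u. G u v)" and G2: "\<And>u. typed u \<Longrightarrow> relfun V (G u)"
  shows "relfun V (\<lambda>w. msum V (\<lambda>z. G (fst z) (snd z)) (splits w))"
proof -
  interpret V: module R V by (rule V)
  \<comment> \<open>The sum over all splittings of the context \<open>u\<close>, \<open>v\<close>,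
    with the splitting of the middle part taken out.\<close>
  define D where "D u v f = msum V (\<lambda>p. msum V (\<lambda>q. f p q) (splits v)) (splits u)"
    for u v :: "'a word" and f :: "'a word \<times> 'a word \<Rightarrow> 'a word \<times> 'a word \<Rightarrow> _"
  let ?S = "\<lambda>w. msum V (\<lambda>z. G (fst z) (snd z)) (splits w)"
  note mc = msum_closed[OF V]
  have Dc: "D u v f \<in> carrier V" if "\<And>p q. f p q \<in> carrier V" for u v f
    unfolding D_def by (intro mc that)
  have Dp: "D u v f \<oplus>\<^bsub>V\<^esub> D u v g = D u v (\<lambda>p q. f p q \<oplus>\<^bsub>V\<^esub> g p q)"
    if "\<And>p q. f p q \<in> carrier V" "\<And>p q. g p q \<in> carrier V" for u v f g
    unfolding D_def by (simp add: msum_plus[OF V] mc that)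
  have Dcong: "D u v f = D u v g"
    if "\<And>p q. f p q \<in> carrier V" "\<And>p q. g p q \<in> carrier V" "\<And>p q. p \<in># splits u \<Longrightarrow> q \<in># splits v \<Longrightarrow> f p q = g p q" for u v f g
    unfolding D_def by (intro msum_cong[OF V] mc that)
  have ex: "?S (u @ x @ v) = msum V (\<lambda>r. D u v (\<lambda>p q. G (fst p @ fst r @ fst q) (snd p @ snd r @ snd q))) (splits x)" for u x v
  proof -
    have "?S (u @ x @ v) = msum V (\<lambda>p. msum V (\<lambda>r. msum V (\<lambda>q. G (fst p @ fst r @ fst q) (snd p @ snd r @ snd q)) (splits v)) (splits x)) (splits u)"
      unfolding splits_append[of u] splits_append[of x]
      by (simp add: msum_bind[OF V] msum_image[OF V] c mc image_sum_mset multiset.map_comp o_def)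
    thus ?thesis unfolding D_def by (simp add: msum_swap[OF V, of _ "splits x"] mc c)
  qed
  have S1: "?S (u @ a # v) = D u v (\<lambda>p q. G (fst p @ a # fst q) (snd p @ snd q)) \<oplus>\<^bsub>V\<^esub> D u v (\<lambda>p q. G (fst p @ fst q) (snd p @ a # snd q))" for u a v
    using ex[of u "[a]" v] by (simp add: msum_add_mset[OF V] msum_empty[OF V] Dc c V.a_ac)
  have S2: "?S (u @ a # b # v) = (D u v (\<lambda>p q. G (fst p @ a # b # fst q) (snd p @ snd q)) \<oplus>\<^bsub>V\<^esub> D u v (\<lambda>p q. G (fst p @ a # fst q) (snd p @ b # snd q)))
     \<oplus>\<^bsub>V\<^esub> (D u v (\<lambda>p q. G (fst p @ b # fst q) (snd p @ a # snd q)) \<oplus>\<^bsub>V\<^esub> D u v (\<lambda>p q. G (fst p @ fst q) (snd p @ a # b # snd q)))" for u a b v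
    using ex[of u "[a, b]" v] by (simp add: msum_add_mset[OF V] msum_empty[OF V] Dc c V.a_ac)
  show ?thesis
  proof (rule relfunI[OF wfun_lfunI])
    show "?S w \<in> carrier V" for w by (rule mc[OF c])
    fix u v assume t: "typed u" "typed v"
    show "lfun V (\<lambda>a. ?S (u @ a # v))"
      unfolding S1 D_def
    proof (intro lfun_plus[OF V] lfun_msum[OF V] mc c)
      fix p q assume "p \<in># splits u" "q \<in># splits v"
      note T = splits_typed[OF this(1) t(1)] splits_typed[OF this(2) t(2)]
      show "lfun V (\<lambda>a. G (fst p @ a # fst q) (snd p @ snd q))"
        by (rule lfun_wfun[OF relfunD(1)[OF G1]]) (use T in auto)
      show "lfun V (\<lambda>a. G (fst p @ fst q) (snd p @ a # snd q))"
        by (rule lfun_wfun[OF relfunD(1)[OF G2]]) (use T in auto)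
    qed
  next
    fix u a b v assume t: "typed u" "typed [a]" "typed [b]" "typed v"
    let ?X = "\<lambda>x. D u v (\<lambda>p q. G (fst p @ x @ fst q) (snd p @ snd q))"
    let ?Y = "\<lambda>x. D u v (\<lambda>p q. G (fst p @ fst q) (snd p @ x @ snd q))"
    have X: "?X [a, b] \<oplus>\<^bsub>V\<^esub> ?X [lop b a] = ?X [b, a] \<oplus>\<^bsub>V\<^esub> ?X [lop a b]"
    proof (simp only: Dp c, rule Dcong, simp_all only: c V.a_closed)
      fix p q assume "p \<in># splits u" "q \<in># splits v"
      note T = splits_typed[OF this(1) t(1)] splits_typed[OF this(2) t(4)]
      have "typed (snd p @ snd q)" using T by simp
      from relfunD(3)[OF G1[OF this] T(1) t(2,3) T(3)]
      show "G (fst p @ [a, b] @ fst q) (snd p @ snd q) \<oplus>\<^bsub>V\<^esub> G (fst p @ [lop b a] @ fst q) (snd p @ snd q) =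
         G (fst p @ [b, a] @ fst q) (snd p @ snd q) \<oplus>\<^bsub>V\<^esub> G (fst p @ [lop a b] @ fst q) (snd p @ snd q)" by simp
    qed
    have Y: "?Y [a, b] \<oplus>\<^bsub>V\<^esub> ?Y [lop b a] = ?Y [b, a] \<oplus>\<^bsub>V\<^esub> ?Y [lop a b]"
    proof (simp only: Dp c, rule Dcong, simp_all only: c V.a_closed)
      fix p q assume "p \<in># splits u" "q \<in># splits v"
      note T = splits_typed[OF this(1) t(1)] splits_typed[OF this(2) t(4)]
      have "typed (fst p @ fst q)" using T by simp
      from relfunD(3)[OF G2[OF this] T(2) t(2,3) T(4)]
      show "G (fst p @ fst q) (snd p @ [a, b] @ snd q) \<oplus>\<^bsub>V\<^esub> G (fst p @ fst q) (snd p @ [lop b a] @ snd q) =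
         G (fst p @ fst q) (snd p @ [b, a] @ snd q) \<oplus>\<^bsub>V\<^esub> G (fst p @ fst q) (snd p @ [lop a b] @ snd q)" by simp
    qed
    \<comment> \<open>The terms with \<open>x\<close> on the left and \<open>y\<close> on the right.
      Exchanging the two letters permutes these terms, so they cancel from the relation.\<close>
    let ?Z = "\<lambda>x y. D u v (\<lambda>p q. G (fst p @ x # fst q) (snd p @ y # snd q))"
    have cl: "?X x \<in> carrier V" "?Y x \<in> carrier V" "?Z y y' \<in> carrier V" for x y y' by (intro Dc c)+
    have E1: "?S (u @ x # v) = ?X [x] \<oplus>\<^bsub>V\<^esub> ?Y [x]" for x unfolding S1 by simp
    have E2: "?S (u @ x # y # v) = (?X [x, y] \<oplus>\<^bsub>V\<^esub> ?Z x y) \<oplus>\<^bsub>V\<^esub> (?Z y x \<oplus>\<^bsub>V\<^esub> ?Y [x, y])" for x y unfolding S2 by simp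
    have "?S (u @ a # b # v) \<oplus>\<^bsub>V\<^esub> ?S (u @ lop b a # v) =
      (?X [a, b] \<oplus>\<^bsub>V\<^esub> ?X [lop b a]) \<oplus>\<^bsub>V\<^esub> ((?Z a b \<oplus>\<^bsub>V\<^esub> ?Z b a) \<oplus>\<^bsub>V\<^esub> (?Y [a, b] \<oplus>\<^bsub>V\<^esub> ?Y [lop b a]))"
      unfolding E1 E2 by (simp only: V.a_ac cl V.a_closed)
    also have "\<dots> = ?S (u @ b # a # v) \<oplus>\<^bsub>V\<^esub> ?S (u @ lop a b # v)"
      unfolding X Y E1 E2 by (simp only: V.a_ac cl V.a_closed)
    finally show "?S (u @ a # b # v) \<oplus>\<^bsub>V\<^esub> ?S (u @ lop b a # v) = ?S (u @ b # a # v) \<oplus>\<^bsub>V\<^esub> ?S (u @ lop a b # v)" .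
  qed
qed

abbreviation "sqQ p \<equiv> tensor_module R [Q, Q] p"

definition coproduct_word :: "nat \<Rightarrow> 'a word \<Rightarrow> ('r, (nat \<Rightarrow> ('r, 'a) tens) set) tens"
  where "coproduct_word p w = msum (sqQ p) (\<lambda>z. ev2 p (fst z) (snd z)) (splits w)"

lemma relfun_coproduct_word: "relfun (sqQ p) (coproduct_word p)"
  unfolding coproduct_word_def[abs_def]
  by (rule relfun_splits[OF Qs.sq.module_tensor ev2_closed relfun_ev2])

definition coproduct :: "nat \<Rightarrow> (nat \<Rightarrow> ('r, 'a) tens) set \<Rightarrow> ('r, (nat \<Rightarrow> ('r, 'a) tens) set) tens"
  where "coproduct p = (SOME f. linear_map R (grade Q p) (sqQ p) f \<and>
    (\<forall>w. good p w \<longrightarrow> f (evq p w) = coproduct_word p w))"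

lemma linear_coproduct: "linear_map R (grade Q p) (sqQ p) (coproduct p)"
  and coproduct_evq: "good p w \<Longrightarrow> coproduct p (evq p w) = coproduct_word p w"
  using someI_ex[OF Q_universal[OF Qs.sq.module_tensor relfun_coproduct_word]] unfolding coproduct_def by blast+

lemma act_ev2: "\<sigma> permutes {1..p} \<Longrightarrow> act (tensor R [Q, Q]) p \<sigma> (ev2 p u v) = ev2 p (relabel \<sigma> u) (relabel \<sigma> v)"
  unfolding ev2_def by (subst Qs.act_pair_class) (auto intro: word_class_closed)

lemma splits_relabel: "splits (relabel f w) = image_mset (\<lambda>z. (relabel f (fst z), relabel f (snd z))) (splits w)"
  unfolding relabel_def by (rule splits_map)

text \<open>\<open>word_class\<close> forgets labels, so the shift by an arbitrary \<open>p\<close>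
  is harmless; standardised words multiply by concatenation.\<close>

lemma word_class_mul:
  assumes "typed u" "typed v"
  shows "tmul Q (length (labels u)) (length (labels v)) (word_class u) (word_class v) = word_class (u @ shift p v)"
proof -
  have g: "good (length (labels w)) (lab id (plain w))" if "typed w" for w
    using that by (simp add: good_def typed_lab_plain labels_lab sum_plain)
  have "lab id (plain u) @ shift (length (labels u)) (lab id (plain v)) = lab id (plain (u @ shift p v))"
    by (simp add: lab_append relabel_lab sum_plain)
  thus ?thesis unfolding word_class_def by (simp add: evq_mul g assms)
qed

lemma ev2_mul:
  assumes "mset (labels u @ labels v) = mset (iota p)" "mset (labels u' @ labels v') = mset (iota r)"
    "typed u" "typed v" "typed u'" "typed v'"
  shows "tmul (tensor_square R Q) p r (ev2 p u v) (ev2 r u' v') = ev2 (p + r) (u @ shift p u') (v @ shift p v')"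
  unfolding ev2_def
  by (subst Qs.tensor_square_tmul(2)[OF assms(1,2)])
    (simp_all add: word_class_closed word_class_mul[of _ _ p] assms)

lemma standard_coproduct_coproduct: "standard_coproduct R \<gamma> I coproduct"
  unfolding standard_coproduct_def Let_def
proof (intro conjI allI ballI)
  have gr: "grade (tensor_square R Q) p = sqQ p" and ac: "act (tensor_square R Q) = act (tensor R [Q, Q])" for p
    by (simp_all add: tensor_square_def tensor_def)
  note Vm = Qs.sq.module_tensor
  have lp: "perm_of [] = id" by (auto simp: perm_of_def)
  show "talg_hom R Q (tensor_square R Q) coproduct"
  proof (rule Q_talg_homI[where H = coproduct_word], unfold gr ac)
    show "module R (sqQ p)" for p by (rule Vm)
    show "linear_map R (grade Q p) (sqQ p) (coproduct p)" for p by (rule linear_coproduct)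
    show "good p w \<Longrightarrow> coproduct p (evq p w) = coproduct_word p w" for p w by (rule coproduct_evq)
    show "\<sigma> permutes {1..p} \<Longrightarrow> linear_map R (sqQ p) (sqQ p) (act (tensor R [Q, Q]) p \<sigma>)" for p \<sigma>
      by (rule Qs.sq.act_tensor(1))
    show "act (tensor R [Q, Q]) p \<sigma> (coproduct_word p w) = coproduct_word p (relabel \<sigma> w)" if s: "\<sigma> permutes {1..p}" for p \<sigma> w
      unfolding coproduct_word_def splits_relabel
      by (simp add: linear_msum[OF Vm Vm Qs.sq.act_tensor(1)[OF s]] ev2_closed msum_image[OF Vm] act_ev2[OF s])
    show "coproduct_word 0 [] = tone (tensor_square R Q)"
    proof -
      have "coproduct_word 0 [] = ev2 0 [] []"
        unfolding coproduct_word_def splits.simps by (subst msum_single[OF Vm]) (simp_all add: ev2_closed)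
      thus ?thesis by (simp add: ev2_def pair_class_def lp word_class_def tensor_square_def tone_Q)
    qed
    show "bilinear_map R (sqQ p) (sqQ r) (sqQ (p + r)) (tmul (tensor_square R Q) p r)" for p r
      by (rule Qs.tensor_square_tmul(1))
    fix p r w w' assume w: "good p w" and w': "good r w'"
    have "tmul (tensor_square R Q) p r (coproduct_word p w) (coproduct_word r w') =
      msum (sqQ (p + r)) (\<lambda>x. msum (sqQ (p + r)) (\<lambda>y. tmul (tensor_square R Q) p r (ev2 p (fst x) (snd x)) (ev2 r (fst y) (snd y))) (splits w')) (splits w)"
      unfolding coproduct_word_def by (rule bilinear_msum[OF Vm Vm Vm Qs.tensor_square_tmul(1) ev2_closed ev2_closed])
    also have "\<dots> = msum (sqQ (p + r)) (\<lambda>x. msum (sqQ (p + r)) (\<lambda>y. ev2 (p + r) (fst x @ shift p (fst y)) (snd x @ shift p (snd y))) (splits w')) (splits w)"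
    proof (intro msum_cong[OF Vm] msum_closed[OF Vm] ev2_closed bilinear_closed[OF Qs.tensor_square_tmul(1)])
      fix x y assume x: "x \<in># splits w" and y: "y \<in># splits w'"
      have t: "typed w" "typed w'" using w w' by (auto simp: good_def)
      show "tmul (tensor_square R Q) p r (ev2 p (fst x) (snd x)) (ev2 r (fst y) (snd y)) = ev2 (p + r) (fst x @ shift p (fst y)) (snd x @ shift p (snd y))"
        using splits_mem[OF x] splits_mem[OF y] splits_typed[OF x t(1)] splits_typed[OF y t(2)] w w'
        by (intro ev2_mul) (auto simp: good_def)
    qed
    also have "\<dots> = coproduct_word (p + r) (w @ shift p w')"
      unfolding coproduct_word_def splits_append splits_relabel
      by (simp add: msum_bind[OF Vm] msum_image[OF Vm] ev2_closed msum_closed[OF Vm] multiset.map_comp o_def)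
    finally show "tmul (tensor_square R Q) p r (coproduct_word p w) (coproduct_word r w') = coproduct_word (p + r) (w @ shift p w')" .
  qed
  fix m x assume x: "x \<in> carrier (grade \<gamma> m)"
  let ?a = "(iota m, x)"
  have "coproduct m (evq m [?a]) = ev2 m [] [?a] \<oplus>\<^bsub>sqQ m\<^esub> ev2 m [?a] []"
  proof -
    interpret V: module R "sqQ m" by (rule Vm)
    show ?thesis
      by (simp add: coproduct_evq good_letter x coproduct_word_def msum_add_mset[OF Vm] msum_empty[OF Vm] ev2_closed V.a_ac)
  qed
  also have "ev2 m [] [?a] = tensor_class R [Q, Q] id [(0, tone Q), (m, evq m [?a])]"
    by (simp add: ev2_def pair_class_def word_class_def tone_Q)
  also have "ev2 m [?a] [] = tensor_class R [Q, Q] id [(m, evq m [?a]), (0, tone Q)]"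
    by (simp add: ev2_def pair_class_def word_class_def tone_Q)
  finally show "coproduct m (quot_incl R \<gamma> I m x) =
      tensor_class R [Q, Q] id [(0, tone Q), (m, quot_incl R \<gamma> I m x)] \<oplus>\<^bsub>sqQ m\<^esub>
      tensor_class R [Q, Q] id [(m, quot_incl R \<gamma> I m x), (0, tone Q)]"
    by (simp only: quot_incl_evq[OF x])
qed

section \<open>The counit\<close>

lemma module_unit_grade: "module R (grade (unit_talg R) p)"
proof (cases "p = 0")
  case True
  thus ?thesis using module_self_module[OF cringR] by (simp add: unit_talg_def self_module_def)
next
  case False
  interpret R: cring R by (rule cringR)
  show ?thesis
    by (rule module_image[OF module_self_module[OF cringR], where f = "\<lambda>x. \<zero>\<^bsub>R\<^esub>"])
      (use False in \<open>auto simp: unit_talg_def self_module_simps intro!: exI[of _ "\<zero>\<^bsub>R\<^esub>"]\<close>)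
qed

definition counit_word :: "nat \<Rightarrow> 'a word \<Rightarrow> 'r"
  where "counit_word p w = (if w = [] \<and> p = 0 then \<one>\<^bsub>R\<^esub> else \<zero>\<^bsub>R\<^esub>)"

lemma relfun_counit_word: "relfun (grade (unit_talg R) p) (counit_word p)"
proof (rule relfunI[OF wfun_lfunI])
  interpret R: cring R by (rule cringR)
  have z: "\<zero>\<^bsub>grade (unit_talg R) p\<^esub> = \<zero>\<^bsub>R\<^esub>" by (simp add: unit_talg_def)
  show "counit_word p w \<in> carrier (grade (unit_talg R) p)" for w
    by (auto simp: counit_word_def unit_talg_def)
  show "lfun (grade (unit_talg R) p) (\<lambda>a. counit_word p (u @ a # v))" for u v
    using lfun_zero[OF module_unit_grade[of p]] by (simp add: counit_word_def z)
  show "counit_word p (u @ a # b # v) \<oplus>\<^bsub>grade (unit_talg R) p\<^esub> counit_word p (u @ lop b a # v) =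
      counit_word p (u @ b # a # v) \<oplus>\<^bsub>grade (unit_talg R) p\<^esub> counit_word p (u @ lop a b # v)" for u a b v
    by (simp add: counit_word_def)
qed

definition counit :: "nat \<Rightarrow> (nat \<Rightarrow> ('r, 'a) tens) set \<Rightarrow> 'r"
  where "counit p = (SOME f. linear_map R (grade Q p) (grade (unit_talg R) p) f \<and>
    (\<forall>w. good p w \<longrightarrow> f (evq p w) = counit_word p w))"

lemma linear_counit: "linear_map R (grade Q p) (grade (unit_talg R) p) (counit p)"
  and counit_evq: "good p w \<Longrightarrow> counit p (evq p w) = counit_word p w"
  using someI_ex[OF Q_universal[OF module_unit_grade relfun_counit_word]] unfolding counit_def by blast+

lemma standard_counit_counit: "standard_counit R \<gamma> I counit"
  unfolding standard_counit_def
proof (intro conjI allI ballI)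
  interpret R: cring R by (rule cringR)
  show "talg_hom R Q (unit_talg R) counit"
  proof (rule Q_talg_homI[where H = counit_word])
    show "module R (grade (unit_talg R) p)" for p by (rule module_unit_grade)
    show "linear_map R (grade Q p) (grade (unit_talg R) p) (counit p)" for p by (rule linear_counit)
    show "good p w \<Longrightarrow> counit p (evq p w) = counit_word p w" for p w by (rule counit_evq)
    show "linear_map R (grade (unit_talg R) p) (grade (unit_talg R) p) (act (unit_talg R) p \<sigma>)" for p \<sigma>
      by (simp add: unit_talg_def linear_id)
    show "act (unit_talg R) p \<sigma> (counit_word p w) = counit_word p (relabel \<sigma> w)" for p \<sigma> w
      by (auto simp: unit_talg_def counit_word_def relabel_def)
    show "counit_word 0 [] = tone (unit_talg R)" by (simp add: counit_word_def unit_talg_def)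
    show "bilinear_map R (grade (unit_talg R) p) (grade (unit_talg R) r) (grade (unit_talg R) (p + r)) (tmul (unit_talg R) p r)" for p r
      unfolding bilinear_map_def
      by (intro conjI ballI linear_mapI)
        (auto simp: unit_talg_def R.l_distr R.r_distr R.m_ac split: if_splits)
    fix p r w w' assume "good p w" "good r w'"
    thus "tmul (unit_talg R) p r (counit_word p w) (counit_word r w') = counit_word (p + r) (w @ shift p w')"
      by (auto simp: unit_talg_def counit_word_def relabel_def)
  qed
  show "counit m (quot_incl R \<gamma> I m x) = \<zero>\<^bsub>R\<^esub>" if "x \<in> carrier (grade \<gamma> m)" for m x
    using that by (simp add: quot_incl_evq counit_evq good_letter counit_word_def)
qed

end

section \<open>Grafting and the pre-Lie identity\<close>

lemma graft_append: "graft f u (v @ w) = (\<Sum>u'\<in>#graft f u v. graft f u' w)"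
  by (induct v arbitrary: u) (simp_all add: sum_mset_bind)

text \<open>Appending every letter produces \<open>u @ v\<close>. Each attachment replaces an
  appending step and adds no letter, so every other term is shorter.\<close>

lemma graft_leading: "\<exists>M. graft f u v = add_mset (u @ v) M \<and> (\<forall>x\<in>#M. length x < length u + length v)"
proof (induct f u v rule: graft.induct)
  case (2 f u a v)
  have att: "x \<in># attach f u a \<Longrightarrow> length x = length u" for x
    by (induct u arbitrary: x) auto
  obtain M where M: "graft f (u @ [a]) v = add_mset ((u @ [a]) @ v) M"
    "\<forall>x\<in>#M. length x < length (u @ [a]) + length v" using 2(1) by blast
  have "length y < length u + length (a # v)" if x: "x \<in># attach f u a" and y: "y \<in># graft f x v" for x y
  proof -
    obtain M' where "graft f x v = add_mset (x @ v) M'" "\<forall>y\<in>#M'. length y < length x + length v"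
      using 2(2)[OF x] by blast
    thus ?thesis using y att[OF x] by auto
  qed
  thus ?case using M by (intro exI[of _ "M + (\<Sum>u'\<in>#attach f u a. graft f u' v)"]) auto
qed simp

lemma attach_map:
  assumes "\<And>a b. g (f a b) = f' (g a) (g b)"
  shows "attach f' (map g u) (g a) = image_mset (map g) (attach f u a)"
  by (induct u) (auto simp: assms multiset.map_comp o_def)

lemma graft_map:
  assumes "\<And>a b. g (f a b) = f' (g a) (g b)"
  shows "graft f' (map g u) (map g v) = image_mset (map g) (graft f u v)"
proof (induct v arbitrary: u)
  case (Cons a v)
  show ?case using Cons[of "u @ [a]"]
    by (simp add: attach_map[of g f f', OF assms] image_sum_mset multiset.map_comp o_def Cons)
qed simp

locale pre_lie = word_op R \<gamma> opr for R :: "('r, 'k) ring_scheme" and \<gamma> :: "('r, 'a) smod" and opr +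
  assumes pre_lie_identity: "x \<in> carrier (grade \<gamma> a) \<Longrightarrow> y \<in> carrier (grade \<gamma> b) \<Longrightarrow> z \<in> carrier (grade \<gamma> d) \<Longrightarrow>
    opr (a + b) d (opr a b x y) z \<ominus>\<^bsub>grade \<gamma> (a + b + d)\<^esub> opr a (b + d) x (opr b d y z) =
    act \<gamma> (a + b + d) (block_perm (transpose 2 3) [a, d, b])
      (opr (a + d) b (opr a d x z) y \<ominus>\<^bsub>grade \<gamma> (a + b + d)\<^esub> opr a (d + b) x (opr d b z y))"
begin

text \<open>By balancing, the permutation (23) passes from the vector to the labels and turns those
  of \<open>a\<close>, \<open>b\<close>, \<open>c\<close> into those of \<open>a\<close>,
  \<open>c\<close>, \<open>b\<close>, which are the labels of the products on the other side. The
  identity becomes the untwisted one, written additively.\<close>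

lemma pre_lie_lop:
  assumes V: "module R V" and f: "lfun V \<phi>" and t: "typed [a]" "typed [b]" "typed [c]"
  shows "\<phi> (lop (lop a b) c) \<oplus>\<^bsub>V\<^esub> \<phi> (lop a (lop c b)) = \<phi> (lop (lop a c) b) \<oplus>\<^bsub>V\<^esub> \<phi> (lop a (lop b c))"
proof -
  interpret V: module R V by (rule V)
  obtain l1 x where a: "a = (l1, x)" by (cases a)
  obtain l2 y where b: "b = (l2, y)" by (cases b)
  obtain l3 z where c: "c = (l3, z)" by (cases c)
  let ?a = "length l1" and ?b = "length l2" and ?d = "length l3"
  let ?M = "grade \<gamma> (?a + ?b + ?d)"
  have xyz: "x \<in> carrier (grade \<gamma> ?a)" "y \<in> carrier (grade \<gamma> ?b)" "z \<in> carrier (grade \<gamma> ?d)"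
    using t by (auto simp: a b c)
  note oc = bilinear_closed[OF opr_bilinear]
  define X where "X = opr (?a + ?b) ?d (opr ?a ?b x y) z"
  define Y where "Y = opr ?a (?b + ?d) x (opr ?b ?d y z)"
  define Z where "Z = opr (?a + ?d) ?b (opr ?a ?d x z) y"
  define W where "W = opr ?a (?d + ?b) x (opr ?d ?b z y)"
  have X: "X \<in> carrier ?M" unfolding X_def by (intro oc xyz)
  have Y: "Y \<in> carrier ?M" unfolding Y_def using oc[OF xyz(1) oc[OF xyz(2,3)]] by (simp add: ac_simps)
  have Z: "Z \<in> carrier ?M" unfolding Z_def using oc[OF oc[OF xyz(1,3)] xyz(2)] by (simp add: ac_simps)
  have W: "W \<in> carrier ?M" unfolding W_def using oc[OF xyz(1) oc[OF xyz(3,2)]] by (simp add: ac_simps)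
  have lin: "linear_map R ?M V (\<lambda>m. \<phi> (L, m))" if "length L = ?a + ?b + ?d" for L
    by (rule linear_mapI)
      (use lfunD(2)[OF f, where l = L] lfunD(3)[OF f, where l = L] lfunD(1)[OF f] that in auto)
  let ?L = "l1 @ l2 @ l3" and ?L' = "l1 @ l3 @ l2"
  let ?B = "block_perm (transpose 2 3) [?a, ?d, ?b]"
  have B: "?B permutes {1..length ?L}" by (rule block_perm_23_short_permutes) simp
  have L: "length ?L = ?a + ?b + ?d" and L': "length ?L' = ?a + ?b + ?d" by simp_all
  have "\<phi> (?L, X) \<ominus>\<^bsub>V\<^esub> \<phi> (?L, Y) = \<phi> (?L, X \<ominus>\<^bsub>?M\<^esub> Y)"
    by (rule linear_minus[OF mod_\<gamma> V lin[OF L] X Y, symmetric])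
  also have "X \<ominus>\<^bsub>?M\<^esub> Y = act \<gamma> (length ?L) ?B (Z \<ominus>\<^bsub>?M\<^esub> W)"
    unfolding X_def Y_def Z_def W_def L by (rule pre_lie_identity[OF xyz])
  also have "\<phi> (?L, act \<gamma> (length ?L) ?B (Z \<ominus>\<^bsub>?M\<^esub> W)) = \<phi> (plist ?B ?L, Z \<ominus>\<^bsub>?M\<^esub> W)"
    by (rule lfunD(4)[OF f B, symmetric]) (simp only: L module_minus_closed[OF mod_\<gamma> Z W])
  also have "plist ?B ?L = ?L'" by (rule plist_block_perm_23_short) simp_all
  also have "\<phi> (?L', Z \<ominus>\<^bsub>?M\<^esub> W) = \<phi> (?L', Z) \<ominus>\<^bsub>V\<^esub> \<phi> (?L', W)"
    by (rule linear_minus[OF mod_\<gamma> V lin[OF L'] Z W])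
  finally have "\<phi> (?L, X) \<oplus>\<^bsub>V\<^esub> \<phi> (?L', W) = \<phi> (?L, Y) \<oplus>\<^bsub>V\<^esub> \<phi> (?L', Z)"
    using V.minus_eq_minus_iff lfunD(1)[OF f] by simp
  hence "\<phi> (?L, X) \<oplus>\<^bsub>V\<^esub> \<phi> (?L', W) = \<phi> (?L', Z) \<oplus>\<^bsub>V\<^esub> \<phi> (?L, Y)"
    using V.a_comm lfunD(1)[OF f] by simp
  thus ?thesis by (simp add: a b c X_def Y_def Z_def W_def)
qed

lemma typed_attach: "x \<in># attach lop u a \<Longrightarrow> typed u \<Longrightarrow> typed [a] \<Longrightarrow> typed x"
proof (induct u arbitrary: x)
  case (Cons b u)
  have b: "typed [b]" "typed u" using Cons(3) typed_Cons by blast+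
  from Cons(2) consider "x = lop b a # u" | y where "y \<in># attach lop u a" "x = b # y" by auto
  thus ?case
  proof cases
    case 1 thus ?thesis using typed_lop[OF b(1) Cons(4)] b(2) typed_Cons by blast
  next
    case 2 thus ?thesis using Cons(1)[OF 2(1) b(2) Cons(4)] b(1) typed_Cons by blast
  qed
qed simp

lemma typed_graft: "x \<in># graft lop u v \<Longrightarrow> typed u \<Longrightarrow> typed v \<Longrightarrow> typed x"
proof (induct v arbitrary: u)
  case (Cons a v)
  have av: "typed [a]" "typed v" using Cons(4) typed_Cons by blast+
  from Cons(2) consider "x \<in># graft lop (u @ [a]) v" | u' where "u' \<in># attach lop u a" "x \<in># graft lop u' v" by auto
  thus ?case
  proof cases
    case 1 thus ?thesis using Cons(1)[of "u @ [a]"] Cons(3) av by simp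
  next
    case 2 thus ?thesis using Cons(1)[of u'] typed_attach[OF 2(1) Cons(3) av(1)] av by simp
  qed
qed simp

text \<open>Word functions that factor through the symmetric algebra: they satisfy the relations for
  the zero product (\<open>symfun_S_relfun\<close>). Exchanging neighbours suffices to generate all
  reorderings.\<close>

definition symfun :: "('r, 'b, 'n) module_scheme \<Rightarrow> ('a word \<Rightarrow> 'b) \<Rightarrow> bool"
  where "symfun V K \<longleftrightarrow> wfun V K \<and>
    (\<forall>u a b v. typed u \<longrightarrow> typed [a] \<longrightarrow> typed [b] \<longrightarrow> typed v \<longrightarrow> K (u @ a # b # v) = K (u @ b # a # v))"

lemma symfunD:
  assumes "symfun V K"
  shows "wfun V K" "K w \<in> carrier V"
    and "typed u \<Longrightarrow> typed [a] \<Longrightarrow> typed [b] \<Longrightarrow> typed v \<Longrightarrow> K (u @ a # b # v) = K (u @ b # a # v)"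
  using assms wfunD(1) unfolding symfun_def by blast+

context
  fixes V :: "('r, 'b, 'n) module_scheme"
  assumes V: "module R V"
begin

interpretation V: module R V by (rule V)

lemmas msimps = msum_empty[OF V] msum_add_mset[OF V] msum_union[OF V] msum_image[OF V] msum_bind[OF V] msum_plus[OF V] msum_closed[OF V]

text \<open>Linearity in the grafted letter; \<open>r\<close> collects the letters already passed by
  the recursion of \<open>attach\<close>.\<close>

lemma lfun_attach:
  assumes K: "wfun V K"
  shows "typed r \<Longrightarrow> typed u \<Longrightarrow> lfun V (\<lambda>a. msum V (\<lambda>x. K (r @ x)) (attach lop u a))"
proof (induct u arbitrary: r)
  case Nil
  show ?case using lfun_zero[OF V] by (simp add: msimps)
next
  case (Cons b u)
  note c = wfunD(1)[OF K]
  have b: "typed [b]" "typed u" using Cons(3) typed_Cons by blast+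
  have "lfun V (\<lambda>a. K (r @ lop b a # u))" by (rule lfun_lop_right[OF lfun_wfun[OF K Cons(2) b(2)] b(1)])
  moreover have "lfun V (\<lambda>a. msum V (\<lambda>x. K ((r @ [b]) @ x)) (attach lop u a))"
    by (rule Cons(1)) (use Cons(2) b in auto)
  ultimately have "lfun V (\<lambda>a. K (r @ lop b a # u) \<oplus>\<^bsub>V\<^esub> msum V (\<lambda>x. K ((r @ [b]) @ x)) (attach lop u a))"
    by (rule lfun_plus[OF V])
  thus ?case by (simp add: msimps c)
qed

lemma attach_mid: "attach lop (u @ b # v) a =
    image_mset (\<lambda>x. x @ b # v) (attach lop u a) + add_mset (u @ lop b a # v) (image_mset (\<lambda>x. u @ b # x) (attach lop v a))"
  by (simp add: attach_append multiset.map_comp o_def)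

text \<open>The right action of a letter is well defined on the symmetric algebra. This is stated
  dually: composing a function on that algebra with u \<mapsto> ua + u \<circ> a gives such a
  function again. Each letter of \<open>u\<close> is grafted upon in turn, so the sum does not
  depend on the order of the letters.\<close>

lemma symfun_step:
  assumes K: "symfun V K" and a: "typed [a]"
  shows "symfun V (\<lambda>u. K (u @ [a]) \<oplus>\<^bsub>V\<^esub> msum V K (attach lop u a))"
  unfolding symfun_def
proof (intro conjI allI impI wfun_lfunI)
  note c = symfunD(2)[OF K] and W = symfunD(1)[OF K] and sw = symfunD(3)[OF K]
  show "K (w @ [a]) \<oplus>\<^bsub>V\<^esub> msum V K (attach lop w a) \<in> carrier V" for w using c by (simp add: msimps)
  {
    fix u v assume t: "typed u" "typed v"
    have "lfun V (\<lambda>b. K (u @ b # v @ [a]) \<oplus>\<^bsub>V\<^esub> (msum V (\<lambda>x. K (x @ b # v)) (attach lop u a) \<oplus>\<^bsub>V\<^esub>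
       (K (u @ lop b a # v) \<oplus>\<^bsub>V\<^esub> msum V (\<lambda>x. K (u @ b # x)) (attach lop v a))))"
    proof (intro lfun_plus[OF V] lfun_msum[OF V] c)
      show "lfun V (\<lambda>b. K (u @ b # v @ [a]))" by (rule lfun_wfun[OF W t(1)]) (use t a in simp)
      show "lfun V (\<lambda>b. K (u @ lop b a # v))" by (rule lfun_lop_left[OF lfun_wfun[OF W t] a])
      show "lfun V (\<lambda>b. K (x @ b # v))" if "x \<in># attach lop u a" for x
        by (rule lfun_wfun[OF W typed_attach[OF that t(1) a] t(2)])
      show "lfun V (\<lambda>b. K (u @ b # x))" if "x \<in># attach lop v a" for x
        by (rule lfun_wfun[OF W t(1) typed_attach[OF that t(2) a]])
    qed
    thus "lfun V (\<lambda>b. K ((u @ b # v) @ [a]) \<oplus>\<^bsub>V\<^esub> msum V K (attach lop (u @ b # v) a))"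
      unfolding attach_mid by (simp add: msimps c V.a_lcomm)
  next
    fix u b b' v assume t: "typed u" "typed [b]" "typed [b']" "typed v"
    have ex: "msum V K (attach lop (u @ b # b' # v) a) = msum V (\<lambda>x. K (x @ b # b' # v)) (attach lop u a) \<oplus>\<^bsub>V\<^esub>
       (K (u @ lop b a # b' # v) \<oplus>\<^bsub>V\<^esub> (K (u @ b # lop b' a # v) \<oplus>\<^bsub>V\<^esub> msum V (\<lambda>x. K (u @ b # b' # x)) (attach lop v a)))" for b b'
      unfolding attach_mid by (simp add: msimps c multiset.map_comp o_def V.a_lcomm)
    have "msum V (\<lambda>x. K (x @ b # b' # v)) (attach lop u a) = msum V (\<lambda>x. K (x @ b' # b # v)) (attach lop u a)"
      by (intro msum_cong[OF V] c sw t typed_attach[OF _ t(1) a])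
    moreover have "msum V (\<lambda>x. K (u @ b # b' # x)) (attach lop v a) = msum V (\<lambda>x. K (u @ b' # b # x)) (attach lop v a)"
      by (intro msum_cong[OF V] c sw t typed_attach[OF _ t(4) a])
    moreover have "K (u @ lop b a # b' # v) = K (u @ b' # lop b a # v)" "K (u @ b # lop b' a # v) = K (u @ lop b' a # b # v)"
      by (intro sw t typed_lop a)+
    moreover have "K (u @ b # b' # v @ [a]) = K (u @ b' # b # v @ [a])"
      by (intro sw t) (use t a in simp)
    ultimately show "K ((u @ b # b' # v) @ [a]) \<oplus>\<^bsub>V\<^esub> msum V K (attach lop (u @ b # b' # v) a) =
      K ((u @ b' # b # v) @ [a]) \<oplus>\<^bsub>V\<^esub> msum V K (attach lop (u @ b' # b # v) a)"
      unfolding ex by (simp add: V.a_lcomm c msimps)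
  }
qed

lemma graft_step:
  assumes c: "\<And>w. K w \<in> carrier V"
  shows "msum V K (graft lop u (a # v)) = msum V K (graft lop (u @ [a]) v) \<oplus>\<^bsub>V\<^esub>
    msum V (\<lambda>x. msum V K (graft lop x v)) (attach lop u a)"
  by (simp add: msimps c)

text \<open>Iterating the dual action of single letters; the last letter of \<open>v\<close> is the
  first to be applied to \<open>K\<close>.\<close>

lemma symfun_graft:
  assumes K: "symfun V K"
  shows "typed v \<Longrightarrow> symfun V (\<lambda>u. msum V K (graft lop u v))"
proof (induct v)
  case Nil
  show ?case using K by (simp add: msimps symfunD(2)[OF K])
next
  case (Cons a v)
  have t: "typed [a]" "typed v" using Cons(2) typed_Cons by blast+
  from symfun_step[OF Cons(1)[OF t(2)] t(1)] show ?case unfolding graft_step[OF symfunD(2)[OF K]] .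
qed

text \<open>The expression (u \<circ> a) \<circ> b + u \<circ> (b \<circ> a) is symmetric in
  \<open>a\<close> and \<open>b\<close>. Terms in which the two letters are grafted onto different
  letters of \<open>u\<close> are symmetric already; those in which both go to the same letter are
  handled by the pre-Lie identity.\<close>

lemma double_attach:
  assumes G: "wfun V G" and a: "typed [a]" and b: "typed [b]"
  shows "typed r \<Longrightarrow> typed u \<Longrightarrow>
    msum V (\<lambda>x. msum V (\<lambda>y. G (r @ y)) (attach lop x b)) (attach lop u a) \<oplus>\<^bsub>V\<^esub> msum V (\<lambda>y. G (r @ y)) (attach lop u (lop b a)) =
    msum V (\<lambda>x. msum V (\<lambda>y. G (r @ y)) (attach lop x a)) (attach lop u b) \<oplus>\<^bsub>V\<^esub> msum V (\<lambda>y. G (r @ y)) (attach lop u (lop a b))"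
proof (induct u arbitrary: r)
  case Nil
  show ?case by (simp add: msimps)
next
  case (Cons e u)
  note c = wfunD(1)[OF G]
  have e: "typed [e]" "typed u" using Cons(3) typed_Cons by blast+
  let ?R = "\<lambda>a b. msum V (\<lambda>x. msum V (\<lambda>y. G (r @ e # y)) (attach lop x b)) (attach lop u a)"
  let ?N = "\<lambda>d. msum V (\<lambda>y. G (r @ e # y)) (attach lop u d)"
  \<comment> \<open>The mixed terms: the first argument is grafted onto \<open>e\<close> and the
    second onto a letter of \<open>u\<close>. They occur in both orders.\<close>
  let ?X = "\<lambda>a b. msum V (\<lambda>y. G (r @ lop e a # y)) (attach lop u b)"
  have ex: "msum V (\<lambda>x. msum V (\<lambda>y. G (r @ y)) (attach lop x b)) (attach lop (e # u) a) =
      (G (r @ lop (lop e a) b # u) \<oplus>\<^bsub>V\<^esub> ?X a b) \<oplus>\<^bsub>V\<^esub> (?X b a \<oplus>\<^bsub>V\<^esub> ?R a b)" for a b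
    by (simp add: msimps c)
  have nx: "msum V (\<lambda>y. G (r @ y)) (attach lop (e # u) d) = G (r @ lop e d # u) \<oplus>\<^bsub>V\<^esub> ?N d" for d
    by (simp add: msimps c)
  have P: "G (r @ lop (lop e a) b # u) \<oplus>\<^bsub>V\<^esub> G (r @ lop e (lop b a) # u) =
      G (r @ lop (lop e b) a # u) \<oplus>\<^bsub>V\<^esub> G (r @ lop e (lop a b) # u)"
    by (rule pre_lie_lop[OF V lfun_wfun[OF G Cons(2) e(2)] e(1) a b])
  have I: "?R a b \<oplus>\<^bsub>V\<^esub> ?N (lop b a) = ?R b a \<oplus>\<^bsub>V\<^esub> ?N (lop a b)"
    using Cons(1)[of "r @ [e]"] Cons(2) e by simp
  have cl: "?R a b \<in> carrier V" "?N d \<in> carrier V" "?X a b \<in> carrier V" for a b d by (intro msum_closed[OF V] c)+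
  have "((G (r @ lop (lop e a) b # u) \<oplus>\<^bsub>V\<^esub> ?X a b) \<oplus>\<^bsub>V\<^esub> (?X b a \<oplus>\<^bsub>V\<^esub> ?R a b)) \<oplus>\<^bsub>V\<^esub> (G (r @ lop e (lop b a) # u) \<oplus>\<^bsub>V\<^esub> ?N (lop b a)) =
     (G (r @ lop (lop e a) b # u) \<oplus>\<^bsub>V\<^esub> G (r @ lop e (lop b a) # u)) \<oplus>\<^bsub>V\<^esub> ((?X a b \<oplus>\<^bsub>V\<^esub> ?X b a) \<oplus>\<^bsub>V\<^esub> (?R a b \<oplus>\<^bsub>V\<^esub> ?N (lop b a)))"
    by (simp only: V.a_ac cl c V.a_closed)
  also have "\<dots> = ((G (r @ lop (lop e b) a # u) \<oplus>\<^bsub>V\<^esub> ?X b a) \<oplus>\<^bsub>V\<^esub> (?X a b \<oplus>\<^bsub>V\<^esub> ?R b a)) \<oplus>\<^bsub>V\<^esub> (G (r @ lop e (lop a b) # u) \<oplus>\<^bsub>V\<^esub> ?N (lop a b))"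
    unfolding P I by (simp only: V.a_ac cl c V.a_closed)
  finally show ?case unfolding ex nx .
qed

text \<open>This is the module property for the enveloping algebra: acting by \<open>a\<close> and
  then \<open>b\<close>, minus the opposite order, is acting by the bracket. The prefix
  \<open>u\<close> has already produced words \<open>x\<close>, and the suffix \<open>v\<close> is
  absorbed into the function \<open>?G\<close> on the symmetric algebra.\<close>

lemma relfun_graft:
  assumes K: "symfun V K"
  shows "relfun V (\<lambda>w. msum V K (graft lop [] w))"
proof (rule relfunI[OF wfun_lfunI])
  note c = symfunD(2)[OF K]
  show "msum V K (graft lop [] w) \<in> carrier V" for w by (rule msum_closed[OF V c])
  have ap: "msum V K (graft lop [] (u @ v)) = msum V (\<lambda>x. msum V K (graft lop x v)) (graft lop [] u)" for u v
    unfolding graft_append by (simp add: msimps c)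
  {
    fix u v assume t: "typed u" "typed v"
    let ?G = "\<lambda>u. msum V K (graft lop u v)"
    note G = symfun_graft[OF K t(2)]
    note Gc = symfunD(2)[OF G]
    have "lfun V (\<lambda>a. msum V (\<lambda>x. ?G (x @ a # []) \<oplus>\<^bsub>V\<^esub> msum V (\<lambda>y. ?G ([] @ y)) (attach lop x a)) (graft lop [] u))"
    proof (intro lfun_msum[OF V] lfun_plus[OF V])
      fix x assume "x \<in># graft lop [] u"
      hence x: "typed x" using typed_graft t(1) by fastforce
      show "lfun V (\<lambda>a. ?G (x @ a # []))" by (rule lfun_wfun[OF symfunD(1)[OF G] x]) simp
      show "lfun V (\<lambda>a. msum V (\<lambda>y. ?G ([] @ y)) (attach lop x a))"
        by (rule lfun_attach[OF symfunD(1)[OF G] _ x]) simp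
    qed (intro V.a_closed msum_closed[OF V] c)
    thus "lfun V (\<lambda>a. msum V K (graft lop [] (u @ a # v)))"
      unfolding ap graft_step[OF c] by simp
  next
    fix u a b v assume t: "typed u" "typed [a]" "typed [b]" "typed v"
    let ?G = "\<lambda>u. msum V K (graft lop u v)"
    note G = symfun_graft[OF K t(4)]
    note Gc = symfunD(2)[OF G]
    have step2: "msum V K (graft lop x (a # b # v)) \<oplus>\<^bsub>V\<^esub> msum V K (graft lop x (lop b a # v)) =
        msum V K (graft lop x (b # a # v)) \<oplus>\<^bsub>V\<^esub> msum V K (graft lop x (lop a b # v))" if x: "typed x" for x
    proof -
      let ?P = "\<lambda>a b. msum V (\<lambda>y. ?G (y @ [b])) (attach lop x a)"
      let ?R = "\<lambda>a b. msum V (\<lambda>y. msum V ?G (attach lop y b)) (attach lop x a)"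
      let ?N = "\<lambda>d. msum V ?G (attach lop x d)"
      \<comment> \<open>The action of \<open>a\<close> followed by that of \<open>b\<close> on x is
        xab + (x \<circ> b)a + x(a \<circ> b) + (x \<circ> a)b + (x \<circ> a) \<circ> b;
        \<open>?P a b\<close> stands for (x \<circ> a)b and \<open>?R a b\<close> for the last term.
        Adding the action of \<open>lop b a\<close> makes everything symmetric, by commutativity and
        \<open>double_attach\<close>.\<close>
      have W: "msum V K (graft lop x (a # b # v)) =
        (?G (x @ [a, b]) \<oplus>\<^bsub>V\<^esub> (?P b a \<oplus>\<^bsub>V\<^esub> ?G (x @ [lop a b]))) \<oplus>\<^bsub>V\<^esub> (?P a b \<oplus>\<^bsub>V\<^esub> ?R a b)" for a b
        unfolding graft_step[OF c] by (simp add: attach_append msimps c Gc V.a_ac)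
      have cl: "?R a b \<in> carrier V" "?N d \<in> carrier V" "?P a b \<in> carrier V" for a b d by (intro msum_closed[OF V] c)+
      have D: "?R a b \<oplus>\<^bsub>V\<^esub> ?N (lop b a) = ?R b a \<oplus>\<^bsub>V\<^esub> ?N (lop a b)"
        using double_attach[OF symfunD(1)[OF G] t(2,3), of "[]" x] x by simp
      have S: "?G (x @ [a, b]) = ?G (x @ [b, a])"
        using symfunD(3)[OF G x t(2,3), of "[]"] by simp
      have N: "msum V K (graft lop x (d # v)) = ?G (x @ [d]) \<oplus>\<^bsub>V\<^esub> ?N d" for d by (rule graft_step[OF c])
      have "((?G (x @ [a, b]) \<oplus>\<^bsub>V\<^esub> (?P b a \<oplus>\<^bsub>V\<^esub> ?G (x @ [lop a b]))) \<oplus>\<^bsub>V\<^esub> (?P a b \<oplus>\<^bsub>V\<^esub> ?R a b)) \<oplus>\<^bsub>V\<^esub> (?G (x @ [lop b a]) \<oplus>\<^bsub>V\<^esub> ?N (lop b a)) =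
        (?G (x @ [a, b]) \<oplus>\<^bsub>V\<^esub> ((?P a b \<oplus>\<^bsub>V\<^esub> ?P b a) \<oplus>\<^bsub>V\<^esub> (?G (x @ [lop a b]) \<oplus>\<^bsub>V\<^esub> ?G (x @ [lop b a])))) \<oplus>\<^bsub>V\<^esub> (?R a b \<oplus>\<^bsub>V\<^esub> ?N (lop b a))"
        by (simp only: V.a_ac cl Gc V.a_closed)
      also have "\<dots> = ((?G (x @ [b, a]) \<oplus>\<^bsub>V\<^esub> (?P a b \<oplus>\<^bsub>V\<^esub> ?G (x @ [lop b a]))) \<oplus>\<^bsub>V\<^esub> (?P b a \<oplus>\<^bsub>V\<^esub> ?R b a)) \<oplus>\<^bsub>V\<^esub> (?G (x @ [lop a b]) \<oplus>\<^bsub>V\<^esub> ?N (lop a b))"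
        unfolding D S by (simp only: V.a_ac cl Gc V.a_closed)
      finally show ?thesis unfolding W N .
    qed
    have mc: "msum V K (graft lop x w) \<in> carrier V" for x w by (intro msum_closed[OF V] c)
    show "msum V K (graft lop [] (u @ a # b # v)) \<oplus>\<^bsub>V\<^esub> msum V K (graft lop [] (u @ lop b a # v)) =
       msum V K (graft lop [] (u @ b # a # v)) \<oplus>\<^bsub>V\<^esub> msum V K (graft lop [] (u @ lop a b # v))"
      unfolding ap msum_plus[OF V mc mc, symmetric]
    proof (intro msum_cong[OF V] V.a_closed mc step2)
      fix x assume "x \<in># graft lop [] u"
      thus "typed x" using typed_graft t(1) by fastforce
    qed
  }
qed

end

end

section \<open>The associated graded algebra\<close>

text \<open>Cosets do not refer to the carrier, so classes in a filtration step may be computed in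
  the whole algebra.\<close>

lemma a_r_coset_carrier_update: "N +>\<^bsub>M\<lparr>carrier := H\<rparr>\<^esub> x = N +>\<^bsub>M\<^esub> x"
  by (simp add: a_r_coset_def r_coset_def)

lemma submodule_carrier_update:
  assumes "module R M" "submodule H R M" "submodule N R M" "N \<subseteq> H"
  shows "submodule N R (M\<lparr>carrier := H\<rparr>)"
proof -
  interpret MH: module R "M\<lparr>carrier := H\<rparr>" by (rule submodule.submodule_is_module[OF assms(2,1)])
  note D = submoduleD[OF assms(3,1)]
  show ?thesis by (rule MH.submoduleI') (use D assms(4) in auto)
qed

lemma linear_restrict:
  assumes "linear_map R M V f" "H \<subseteq> carrier M" "\<And>x. x \<in> H \<Longrightarrow> f x \<in> K"
  shows "linear_map R (M\<lparr>carrier := H\<rparr>) (V\<lparr>carrier := K\<rparr>) f"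
  by (rule linear_mapI) (use assms(2,3) in \<open>auto simp: linear_add[OF assms(1)] linear_smult[OF assms(1)] subset_iff\<close>)

lemma linear_restrict_domain:
  assumes "linear_map R M V f" "H \<subseteq> carrier M"
  shows "linear_map R (M\<lparr>carrier := H\<rparr>) V f"
  by (rule linear_mapI) (use assms(2) in \<open>auto simp: linear_closed[OF assms(1)] linear_add[OF assms(1)] linear_smult[OF assms(1)] subset_iff\<close>)

text \<open>A quotient of a submodule and the quotient of the whole module by the same
  \<open>N\<close> have the same cosets as sets, so the inclusion is the identity function.\<close>

lemma linear_inclusion_FactModule:
  assumes "H \<subseteq> carrier M"
  shows "linear_map R (FactModule (M\<lparr>carrier := H\<rparr>) N) (FactModule M N) (\<lambda>X. X)"
proof (rule linear_mapI)
  show "X \<in> carrier (FactModule M N)" if "X \<in> carrier (FactModule (M\<lparr>carrier := H\<rparr>) N)" for X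
    using that assms by (auto simp: FactModule_simps a_r_coset_carrier_update)
qed (simp_all add: FactModule_def set_add_def set_mult_def coset_map_def[abs_def] a_r_coset_carrier_update)

context word_op
begin

abbreviation "F n p \<equiv> tensor_image R \<gamma> I {..n} p"
abbreviation "F' n p \<equiv> tensor_image R \<gamma> I {..<n} p"
abbreviation "QF n p \<equiv> (grade Q p)\<lparr>carrier := F n p\<rparr>"

lemma tensor_image_mono: "S \<subseteq> S' \<Longrightarrow> tensor_image R \<gamma> I S p \<subseteq> tensor_image R \<gamma> I S' p"
  unfolding tensor_image_eq T_part_def by blast

lemma F'_sub_F: "F' n p \<subseteq> F n p"
  by (rule tensor_image_mono) auto

lemma image_sub_Q: "tensor_image R \<gamma> I S p \<subseteq> carrier (grade Q p)"
  by (rule submoduleD(1)[OF submodule_image module_Q])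

lemma module_QF: "module R (QF n p)"
  by (rule submodule.submodule_is_module[OF submodule_image module_Q])

lemma submodule_F'_QF: "submodule (F' n p) R (QF n p)"
  by (rule submodule_carrier_update[OF module_Q submodule_image submodule_image F'_sub_F])

lemma evq_in_image: "length w \<in> S \<Longrightarrow> evq p w \<in> tensor_image R \<gamma> I S p"
proof (cases "good p w")
  case True
  assume "length w \<in> S"
  thus ?thesis unfolding tensor_image_mspan using True by (intro hull_inc) auto
qed (simp add: evq_not_good submoduleD(2)[OF submodule_image module_Q])

lemma tmul_image:
  assumes "x \<in> tensor_image R \<gamma> I S p" "y \<in> tensor_image R \<gamma> I S' r" "\<And>i j. i \<in> S \<Longrightarrow> j \<in> S' \<Longrightarrow> i + j \<in> S''"
  shows "tmul Q p r x y \<in> tensor_image R \<gamma> I S'' (p + r)"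
proof (rule bilinear_vanish_mspan[OF module_Q module_Q module_Q bilinear_tmul_Q evq_set_closed evq_set_closed _ submodule_image
      assms(1)[unfolded tensor_image_mspan] assms(2)[unfolded tensor_image_mspan]])
  fix s t assume "s \<in> {evq p w | w. good p w \<and> length w \<in> S}" "t \<in> {evq r w | w. good r w \<and> length w \<in> S'}"
  then obtain w w' where "s = evq p w" "good p w" "length w \<in> S" "t = evq r w'" "good r w'" "length w' \<in> S'" by blast
  thus "tmul Q p r s t \<in> tensor_image R \<gamma> I S'' (p + r)" using assms(3) by (simp add: evq_mul evq_in_image)
qed

lemma act_image:
  assumes "\<sigma> permutes {1..p}" "x \<in> tensor_image R \<gamma> I S p"
  shows "act Q p \<sigma> x \<in> tensor_image R \<gamma> I S p"
proof (rule linear_vanish_mspan[OF module_Q module_Q linear_act_Q[OF assms(1)] evq_set_closed _ submodule_image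
      assms(2)[unfolded tensor_image_mspan]])
  fix s assume "s \<in> {evq p w | w. good p w \<and> length w \<in> S}"
  thus "act Q p \<sigma> s \<in> tensor_image R \<gamma> I S p" using evq_in_image[of "relabel \<sigma> _" S p] by (auto simp: act_evq[OF assms(1)])
qed

abbreviation "gp \<equiv> gr_part R \<gamma> I"

lemma grade_gp: "grade (gp n) p = FactModule (QF n p) (F' n p)"
  by (simp add: gr_part_def Let_def)

lemma module_gp: "module R (grade (gp n) p)"
  unfolding grade_gp by (rule module_FactModule[OF module_QF submodule_F'_QF])

abbreviation "mu i j p q \<equiv> coset_map2 (grade Q (p + q)) (F' (i + j) (p + q)) (tmul Q p q)"
abbreviation "fc n p x \<equiv> F' n p +>\<^bsub>grade Q p\<^esub> x"

lemma linear_fc: "linear_map R (QF n p) (grade (gp n) p) (fc n p)"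
  unfolding grade_gp using linear_coset[OF module_QF submodule_F'_QF, of n p] by (simp add: a_r_coset_carrier_update)

lemma linear_fc_full: "linear_map R (grade Q p) (FactModule (grade Q p) (F' n p)) (fc n p)"
  by (rule linear_coset[OF module_Q submodule_image])

lemma carrier_gp: "carrier (grade (gp n) p) = fc n p ` F n p"
  unfolding grade_gp FactModule_simps by (simp add: a_r_coset_carrier_update)

lemma zero_gp: "\<zero>\<^bsub>grade (gp n) p\<^esub> = F' n p"
  unfolding grade_gp FactModule_simps ..

lemma bilinear_tmul_QF: "bilinear_map R (QF i p) (QF j q) (grade Q (p + q)) (tmul Q p q)"
  unfolding bilinear_map_def using image_sub_Q[of "{..i}" p] image_sub_Q[of "{..j}" q]
  by (auto intro!: linear_restrict_domain bilinear_left[OF bilinear_tmul_Q] bilinear_right[OF bilinear_tmul_Q] simp: subset_iff)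

lemma mu_fc:
  assumes "x \<in> F i p" "y \<in> F j q"
  shows "mu i j p q (fc i p x) (fc j q y) = fc (i + j) (p + q) (tmul Q p q x y)"
  using coset_map2_bilinear[OF module_QF module_QF module_Q submodule_F'_QF submodule_F'_QF submodule_image bilinear_tmul_QF, of i p j q "{..<i + j}" x y]
    tmul_image[of _ "{..<i}" p _ "{..j}" q "{..<i + j}"] tmul_image[of _ "{..i}" p _ "{..<j}" q "{..<i + j}"] assms
  by (simp add: a_r_coset_carrier_update)

lemma bilinear_mu: "bilinear_map R (grade (gp i) p) (grade (gp j) q) (grade (gp (i + j)) (p + q)) (mu i j p q)"
proof -
  have c: "tmul Q p q x y \<in> F (i + j) (p + q)" if "x \<in> F i p" "y \<in> F j q" for x y
    by (rule tmul_image[OF that]) auto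
  have "bilinear_map R (QF i p) (QF j q) (QF (i + j) (p + q)) (tmul Q p q)"
    unfolding bilinear_map_def
  proof (intro conjI ballI)
    fix x assume "x \<in> carrier (QF i p)"
    thus "linear_map R (QF j q) (QF (i + j) (p + q)) (tmul Q p q x)"
      using c by (intro linear_restrict[OF bilinear_right[OF bilinear_tmul_Q subsetD[OF image_sub_Q]] image_sub_Q]) auto
  next
    fix y assume "y \<in> carrier (QF j q)"
    thus "linear_map R (QF i p) (QF (i + j) (p + q)) (\<lambda>x. tmul Q p q x y)"
      using c by (intro linear_restrict[OF bilinear_left[OF bilinear_tmul_Q subsetD[OF image_sub_Q]] image_sub_Q]) auto
  qed
  from bilinear_comp_linear[OF this linear_fc]
  show ?thesis unfolding grade_gp
    by (rule bilinear_from_FactModule[OF module_QF submodule_F'_QF module_QF submodule_F'_QF])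
      (use mu_fc in \<open>simp add: a_r_coset_carrier_update grade_gp\<close>)
qed

sublocale Gr: weighted R gp mu "fc 0 0 (tone Q)"
  by (rule weighted.intro[OF cringR module_gp bilinear_mu])

abbreviation "gr \<equiv> gr_talg R \<gamma> I"

lemma gr_eq: "gr = Gr.W"
  by (simp add: gr_talg_def Let_def)

abbreviation "gcl n p u \<equiv> gr_class R \<gamma> I n p u"

lemma gcl_eq: "gcl n p u = weight_part gp n p (fc n p u)"
  by (simp add: gr_class_def)

lemma module_gr: "module R (grade gr p)"
  unfolding gr_eq by (rule Gr.module_grade)

lemma linear_gcl: "linear_map R (QF n p) (grade gr p) (gr_class R \<gamma> I n p)"
proof -
  have "linear_map R (grade (gp n) p) (grade gr p) (weight_part gp n p)"
    unfolding gr_eq weighted_simps weight_part_eq[abs_def] by (rule module_family.linear_single[OF Gr.fam.module_family_axioms UNIV_I])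
  from linear_comp[OF linear_fc this] show ?thesis by (simp add: gcl_eq[abs_def])
qed

lemma gcl_closed: "u \<in> F n p \<Longrightarrow> gcl n p u \<in> carrier (grade gr p)"
  using linear_closed[OF linear_gcl] by simp

text \<open>The symbol of a word: its class in the weight given by its length.\<close>

definition gr_word :: "nat \<Rightarrow> 'a word \<Rightarrow> nat \<Rightarrow> (nat \<Rightarrow> ('r, 'a) tens) set set"
  where "gr_word p w = gcl (length w) p (evq p w)"

lemma evq_F: "length w = n \<Longrightarrow> evq p w \<in> F n p"
  by (rule evq_in_image) simp

lemma gr_word_closed: "gr_word p w \<in> carrier (grade gr p)"
  unfolding gr_word_def by (rule gcl_closed[OF evq_F[OF refl]])

lemma wfun_gr_word: "wfun (grade gr p) (gr_word p)"
proof (rule wfunI[OF gr_word_closed])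
  fix u v :: "'a word" and l :: "nat list" and x y r \<tau>
  define n where "n = length u + Suc (length v)"
  have e: "gr_word p (u @ a # v) = gcl n p (evq p (u @ a # v))" for a by (simp add: gr_word_def n_def)
  have c: "evq p (u @ a # v) \<in> carrier (QF n p)" for a using evq_F[of "u @ a # v" n p] by (simp add: n_def)
  note W = wfunD[OF relfunD(1)[OF relfun_evq]]
  assume t: "typed u" "typed v" and x: "x \<in> carrier (grade \<gamma> (length l))"
  show "y \<in> carrier (grade \<gamma> (length l)) \<Longrightarrow>
      gr_word p (u @ (l, x \<oplus>\<^bsub>grade \<gamma> (length l)\<^esub> y) # v) = gr_word p (u @ (l, x) # v) \<oplus>\<^bsub>grade gr p\<^esub> gr_word p (u @ (l, y) # v)"
    unfolding e using linear_add[OF linear_gcl c c, of "(l, x)" "(l, y)"] W(2)[OF t x] by simp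
  show "r \<in> carrier R \<Longrightarrow> gr_word p (u @ (l, r \<odot>\<^bsub>grade \<gamma> (length l)\<^esub> x) # v) = r \<odot>\<^bsub>grade gr p\<^esub> gr_word p (u @ (l, x) # v)"
    unfolding e using linear_smult[OF linear_gcl _ c, of r "(l, x)"] W(3)[OF t _ x] by simp
  show "\<tau> permutes {1..length l} \<Longrightarrow> gr_word p (u @ (plist \<tau> l, x) # v) = gr_word p (u @ (l, act \<gamma> (length l) \<tau> x) # v)"
    unfolding e using W(4)[OF t _ x] by simp
qed

lemma fc_eq_iff: "x \<in> carrier (grade Q p) \<Longrightarrow> y \<in> carrier (grade Q p) \<Longrightarrow> fc n p x = fc n p y \<longleftrightarrow> x \<ominus>\<^bsub>grade Q p\<^esub> y \<in> F' n p"
  by (rule coset_eq_iff[OF module_Q submodule_image])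

text \<open>In the enveloping algebra the commutator of neighbouring letters is a difference of
  words that are one letter shorter, so it vanishes in the associated graded algebra.\<close>

lemma gr_word_swap:
  assumes t: "typed u" "typed [a]" "typed [b]" "typed v"
  shows "gr_word p (u @ a # b # v) = gr_word p (u @ b # a # v)"
proof -
  interpret M: module R "grade Q p" by (rule module_Q)
  define n where "n = length u + Suc (Suc (length v))"
  have "evq p (u @ a # b # v) \<ominus>\<^bsub>grade Q p\<^esub> evq p (u @ b # a # v) = evq p (u @ lop a b # v) \<ominus>\<^bsub>grade Q p\<^esub> evq p (u @ lop b a # v)"
    using relfunD(3)[OF relfun_evq t] by (simp add: M.minus_eq_minus_iff evq_closed)
  also have "\<dots> \<in> F' n p"
    by (intro submoduleD(5)[OF submodule_image module_Q] evq_in_image) (simp_all add: n_def)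
  finally have "fc n p (evq p (u @ a # b # v)) = fc n p (evq p (u @ b # a # v))"
    by (simp add: fc_eq_iff evq_closed)
  thus ?thesis by (simp add: gr_word_def gcl_eq n_def)
qed

lemma act_gp:
  assumes s: "\<sigma> permutes {1..p}"
  shows "linear_map R (grade (gp n) p) (grade (gp n) p) (act (gp n) p \<sigma>)"
    and "x \<in> F n p \<Longrightarrow> act (gp n) p \<sigma> (fc n p x) = fc n p (act Q p \<sigma> x)"
proof -
  have a: "act (gp n) p \<sigma> = coset_map (grade Q p) (F' n p) (act Q p \<sigma>)"
    by (simp add: gr_part_def Let_def)
  have e: "act (gp n) p \<sigma> (fc n p x) = fc n p (act Q p \<sigma> x)" if "x \<in> F n p" for x
    using coset_map_linear[OF module_QF submodule_F'_QF module_Q submodule_image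
        linear_restrict_domain[OF linear_act_Q[OF s] image_sub_Q], of n "{..<n}" x] act_image[OF s, of _ "{..<n}"] that
    unfolding a by (simp add: a_r_coset_carrier_update)
  show "x \<in> F n p \<Longrightarrow> act (gp n) p \<sigma> (fc n p x) = fc n p (act Q p \<sigma> x)" by (rule e)
  have "linear_map R (QF n p) (QF n p) (act Q p \<sigma>)"
    by (rule linear_restrict[OF linear_act_Q[OF s] image_sub_Q act_image[OF s]])
  from linear_comp[OF this linear_fc] show "linear_map R (grade (gp n) p) (grade (gp n) p) (act (gp n) p \<sigma>)"
    unfolding grade_gp by (rule linear_from_FactModule[OF module_QF submodule_F'_QF]) (simp add: e a_r_coset_carrier_update)
qed

lemma linear_act_gr:
  assumes s: "\<sigma> permutes {1..p}"
  shows "linear_map R (grade gr p) (grade gr p) (act gr p \<sigma>)"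
  unfolding gr_eq
proof (rule Gr.linear_into_grade)
  show "linear_map R (grade Gr.W p) (grade (gp n) p) (\<lambda>f. act Gr.W p \<sigma> f n)" for n
    unfolding weighted_simps(2) by (rule linear_comp[OF Gr.linear_coord act_gp(1)[OF s]])
  fix f assume "f \<in> carrier (grade Gr.W p)"
  hence "finite {n. f n \<noteq> \<zero>\<^bsub>grade (gp n) p\<^esub>}" unfolding weighted_simps by (simp add: fin_supp_def)
  moreover have "{n. act Gr.W p \<sigma> f n \<noteq> \<zero>\<^bsub>grade (gp n) p\<^esub>} \<subseteq> {n. f n \<noteq> \<zero>\<^bsub>grade (gp n) p\<^esub>}"
    using linear_zero[OF module_gp module_gp act_gp(1)[OF s]] unfolding weighted_simps(2) by auto
  ultimately show "finite {n. act Gr.W p \<sigma> f n \<noteq> \<zero>\<^bsub>grade (gp n) p\<^esub>}" by (rule finite_subset[rotated])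
qed

lemma act_gr_word:
  assumes s: "\<sigma> permutes {1..p}"
  shows "act gr p \<sigma> (gr_word p w) = gr_word p (relabel \<sigma> w)"
proof
  fix n
  have "act (gp n) p \<sigma> \<zero>\<^bsub>grade (gp n) p\<^esub> = \<zero>\<^bsub>grade (gp n) p\<^esub>"
    by (rule linear_zero[OF module_gp module_gp act_gp(1)[OF s]])
  thus "act gr p \<sigma> (gr_word p w) n = gr_word p (relabel \<sigma> w) n"
    using act_gp(2)[OF s evq_F[OF refl], of w]
    by (simp add: gr_eq weighted_simps gr_word_def gcl_eq weight_part_def act_evq[OF s])
qed

lemma gr_word_mul:
  assumes "good p w" "good r w'"
  shows "tmul gr p r (gr_word p w) (gr_word r w') = gr_word (p + r) (w @ shift p w')"
  unfolding gr_eq gr_word_def gcl_eq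
  using evq_F[of w "length w" p] evq_F[of w' "length w'" r]
  by (subst Gr.tmul_weight_part) (simp_all add: carrier_gp mu_fc evq_mul[OF assms])

end

lemma (in abelian_group) minus_plus_cancel: "x \<in> carrier G \<Longrightarrow> y \<in> carrier G \<Longrightarrow> (x \<ominus> y) \<oplus> y = x"
  by (simp add: a_minus_def a_assoc l_neg)

lemma (in abelian_group) minus_minus_cancel: "x \<in> carrier G \<Longrightarrow> y \<in> carrier G \<Longrightarrow> x \<ominus> (x \<ominus> y) = y"
  using minus_eq_iff[of x "x \<ominus> y" y] minus_plus_cancel[of x y] a_comm[of y "x \<ominus> y"] by simp

lemma (in abelian_group) minus_zero_right: "x \<in> carrier G \<Longrightarrow> x \<ominus> \<zero> = x"
  using minus_eq_iff[of x \<zero> x] by simp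

section \<open>Comparison of the symmetric and enveloping algebras\<close>

lemma linear_map_minus:
  assumes M: "module R M" and N: "module R N" and f: "linear_map R M N f" and g: "linear_map R M N g"
  shows "linear_map R M N (\<lambda>x. f x \<ominus>\<^bsub>N\<^esub> g x)"
proof -
  interpret N: module R N by (rule N)
  have "linear_map R M N (\<lambda>x. f x \<oplus>\<^bsub>N\<^esub> (\<ominus>\<^bsub>R\<^esub> \<one>\<^bsub>R\<^esub>) \<odot>\<^bsub>N\<^esub> g x)"
    by (rule linear_plus[OF N f linear_comp[OF g linear_smult_const[OF N]]]) simp
  thus ?thesis
    by (rule linear_cong[OF _ M]) (use linear_closed[OF g] in \<open>simp add: a_minus_def N.inv_eq_smult\<close>)
qed

text \<open>Attaching replaces a letter by a letter and appending adds one, so only the empty action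
  on the empty word yields the empty word. This is what the counit detects.\<close>

lemma graft_Nil_iff: "x \<in># graft f u v \<Longrightarrow> x = [] \<longleftrightarrow> u = [] \<and> v = []"
proof (induct v arbitrary: u)
  case (Cons a v)
  have att: "y \<in># attach f u a \<Longrightarrow> y \<noteq> []" for y by (cases u) auto
  from Cons(2) consider "x \<in># graft f (u @ [a]) v" | y where "y \<in># attach f u a" "x \<in># graft f y v" by auto
  thus ?case by cases (use Cons(1) att in auto)
qed simp

section \<open>Weight components of tensors\<close>

context s_module
begin

definition weight_comp :: "nat \<Rightarrow> nat \<Rightarrow> (nat \<Rightarrow> ('r, 'a) tens) \<Rightarrow> nat \<Rightarrow> ('r, 'a) tens"
  where "weight_comp n p t = single (\<lambda>n. pmod n p) n (t n)"

lemma linear_coord_T: "linear_map R (grade T p) (pmod n p) (\<lambda>t. t n)"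
  unfolding T_grade by (rule module_family.linear_eval[OF fam])

lemma linear_weight_comp_T: "linear_map R (grade T p) (grade T p) (weight_comp n p)"
  unfolding weight_comp_def[abs_def] by (rule linear_comp[OF linear_coord_T linear_single_T])

lemma weight_comp_ev: "weight_comp n p (ev p w) = (if length w = n then ev p w else \<zero>\<^bsub>grade T p\<^esub>)"
  by (auto simp: weight_comp_def ev_single single_def T_zero fun_eq_iff)

lemma weight_comp_T_part: "t \<in> carrier (grade T p) \<Longrightarrow> weight_comp n p t \<in> T_part {n} p"
  using linear_closed[OF linear_weight_comp_T] by (auto simp: T_part_def weight_comp_def single_def fun_eq_iff)

lemma weight_comp_id: "t \<in> T_part {n} p \<Longrightarrow> weight_comp n p t = t"
  by (auto simp: T_part_def weight_comp_def single_def fun_eq_iff)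

lemma weight_comp_lower: "t \<in> T_part {..<n} p \<Longrightarrow> weight_comp n p t = \<zero>\<^bsub>grade T p\<^esub>"
  by (auto simp: T_part_def weight_comp_def single_def T_zero fun_eq_iff)

lemma weight_comp_other: "t \<in> T_part {n} p \<Longrightarrow> m \<noteq> n \<Longrightarrow> weight_comp m p t = \<zero>\<^bsub>grade T p\<^esub>"
  by (auto simp: T_part_def weight_comp_def single_def T_zero fun_eq_iff)

lemma rest_T_part:
  assumes "t \<in> T_part {..n} p"
  shows "t \<ominus>\<^bsub>grade T p\<^esub> weight_comp n p t \<in> T_part {..<n} p"
proof -
  interpret M: module R "grade T p" by (rule module_T)
  interpret P: module R "pmod i p" for i by (rule pow.module_tensor)
  have t: "t \<in> carrier (grade T p)" using assms by (simp add: T_part_def)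
  have c: "weight_comp n p t \<in> carrier (grade T p)" by (rule linear_closed[OF linear_weight_comp_T t])
  have "(t \<ominus>\<^bsub>grade T p\<^esub> weight_comp n p t) i = t i \<ominus>\<^bsub>pmod i p\<^esub> weight_comp n p t i" for i
    by (rule linear_minus[OF module_T pow.module_tensor linear_coord_T t c])
  moreover have "t i \<in> carrier (pmod i p)" for i by (rule linear_closed[OF linear_coord_T t])
  ultimately show ?thesis using assms t c
    by (auto simp: T_part_def weight_comp_def single_def a_minus_def P.r_neg)
qed

lemma T_part_exhaust: "t \<in> carrier (grade T p) \<Longrightarrow> \<exists>n. t \<in> T_part {..<n} p"
proof -
  assume t: "t \<in> carrier (grade T p)"
  hence "finite {n. t n \<noteq> \<zero>\<^bsub>pmod n p\<^esub>}" unfolding T_grade by (simp add: fin_supp_def)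
  then obtain N where "\<forall>n\<in>{n. t n \<noteq> \<zero>\<^bsub>pmod n p\<^esub>}. n < N" using finite_nat_set_iff_bounded by blast
  thus ?thesis using t by (intro exI[of _ N]) (auto simp: T_part_def)
qed

text \<open>An element of the tensor algebra is the sum of its finitely many weight components; the
  induction removes the top one.\<close>

lemma sum_comp_mem:
  assumes t: "t \<in> carrier (grade T p)" and H: "submodule H R (grade T p)" and c: "\<And>n. weight_comp n p t \<in> H"
  shows "t \<in> H"
proof -
  have "t \<in> T_part {..<n} p \<Longrightarrow> (\<And>n. weight_comp n p t \<in> H) \<Longrightarrow> t \<in> H" for n t
  proof (induct n arbitrary: t)
    case 0
    hence "t = \<zero>\<^bsub>grade T p\<^esub>" by (auto simp: T_part_def T_zero)
    thus ?case using submoduleD(2)[OF H module_T] by simp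
  next
    case (Suc n)
    interpret M: module R "grade T p" by (rule module_T)
    have tc: "t \<in> carrier (grade T p)" and tn: "t \<in> T_part {..n} p"
      using Suc(2) by (auto simp: T_part_def lessThan_Suc_atMost)
    let ?r = "t \<ominus>\<^bsub>grade T p\<^esub> weight_comp n p t"
    have cc: "weight_comp n p t \<in> carrier (grade T p)" for n by (rule linear_closed[OF linear_weight_comp_T tc])
    have "weight_comp m p (weight_comp n p t) \<in> H" for m
      using weight_comp_id[OF weight_comp_T_part[OF tc]] weight_comp_other[OF weight_comp_T_part[OF tc], of m n] Suc(3) submoduleD(2)[OF H module_T]
      by (cases "m = n") auto
    hence "weight_comp m p ?r \<in> H" for m
      using submoduleD(5)[OF H module_T] Suc(3) by (simp add: linear_minus[OF module_T module_T linear_weight_comp_T tc cc])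
    hence "?r \<in> H" by (rule Suc(1)[OF rest_T_part[OF tn]])
    moreover have "t = ?r \<oplus>\<^bsub>grade T p\<^esub> weight_comp n p t" by (rule M.minus_plus_cancel[OF tc cc, symmetric])
    ultimately show ?case using submoduleD(4)[OF H module_T _ Suc(3)] by metis
  qed
  thus ?thesis using T_part_exhaust[OF t] c by blast
qed

lemma wfun_zero_letter:
  assumes V: "module R V" and H: "wfun V H" and t: "typed u" "typed v"
  shows "H (u @ (l, \<zero>\<^bsub>grade \<gamma> (length l)\<^esub>) # v) = \<zero>\<^bsub>V\<^esub>"
proof -
  have "linear_map R (grade \<gamma> (length l)) V (\<lambda>x. H (u @ (l, x) # v))"
    by (rule linear_mapI) (simp_all add: wfunD[OF H] t)
  from linear_zero[OF mod_\<gamma> V this] show ?thesis .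
qed

text \<open>The zero product is equivariant because permutations act linearly. Its enveloping
  algebra is the symmetric algebra, so all results on \<open>word_op\<close> apply to both.\<close>

lemma word_op_zero: "word_op R \<gamma> (\<lambda>m n x y. \<zero>\<^bsub>grade \<gamma> (m + n)\<^esub>)"
proof (intro word_op.intro s_module_axioms word_op_axioms.intro)
  show "bilinear_map R (grade \<gamma> m) (grade \<gamma> n) (grade \<gamma> (m + n)) (\<lambda>x y. \<zero>\<^bsub>grade \<gamma> (m + n)\<^esub>)" for m n
    by (simp add: bilinear_map_def linear_const_zero[OF mod_\<gamma>])
  show "\<sigma> permutes {1..m} \<Longrightarrow> \<tau> permutes {1..n} \<Longrightarrow>
      act \<gamma> (m + n) (perm_prod m \<sigma> \<tau>) \<zero>\<^bsub>grade \<gamma> (m + n)\<^esub> = \<zero>\<^bsub>grade \<gamma> (m + n)\<^esub>" for \<sigma> \<tau> m n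
    by (rule linear_zero[OF mod_\<gamma> mod_\<gamma> sym_moduleD(2)[OF sym perm_prod_permutes]])
qed

end

context pre_lie
begin

sublocale S: word_op R \<gamma> "\<lambda>m n x y. \<zero>\<^bsub>grade \<gamma> (m + n)\<^esub>"
  by (rule word_op_zero)

text \<open>For the zero product the bracket term of each generator vanishes, so the two ideals have
  the same generators.\<close>

lemma sym_ideal_eq: "sym_ideal R \<gamma> = S.I"
proof -
  have "twisted_commutator R \<gamma> m n x y \<ominus>\<^bsub>grade T (m + n)\<^esub> tensor_incl R \<gamma> (m + n) (S.bracket m n x y) = twisted_commutator R \<gamma> m n x y"
    if x: "x \<in> carrier (grade \<gamma> m)" and y: "y \<in> carrier (grade \<gamma> n)" for m n x y
  proof -
    interpret M: module R "grade T (m + n)" by (rule module_T)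
    interpret G: module R "grade \<gamma> (m + n)" by (rule mod_\<gamma>)
    have B: "block_perm (transpose 1 2) [n, m] permutes {1..m + n}" by (rule block_perm_12_permutes) simp
    have "act \<gamma> (m + n) (block_perm (transpose 1 2) [n, m]) \<zero>\<^bsub>grade \<gamma> (m + n)\<^esub> = \<zero>\<^bsub>grade \<gamma> (m + n)\<^esub>"
      by (rule linear_zero[OF mod_\<gamma> mod_\<gamma> sym_moduleD(2)[OF sym B]])
    hence br: "S.bracket m n x y = \<zero>\<^bsub>grade \<gamma> (m + n)\<^esub>" by (simp add: S.bracket_def add.commute a_minus_def)
    have "tensor_incl R \<gamma> (m + n) (S.bracket m n x y) = \<zero>\<^bsub>grade T (m + n)\<^esub>"
      using wfun_zero_letter[OF module_T wfun_ev, of "[]" "[]" "m + n" "iota (m + n)"] by (simp add: br tensor_incl_ev)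
    moreover have "tmul T m n (tensor_incl R \<gamma> m x) (tensor_incl R \<gamma> n y) \<in> carrier (grade T (m + n))"
      by (simp add: tensor_incl_ev x y bilinear_closed[OF bilinear_tmul_T] ev_closed)
    moreover have "act T (m + n) (block_perm (transpose 1 2) [n, m]) (tmul T n m (tensor_incl R \<gamma> n y) (tensor_incl R \<gamma> m x)) \<in> carrier (grade T (m + n))"
      using linear_closed[OF linear_act_T[OF B]] bilinear_closed[OF bilinear_tmul_T ev_closed ev_closed, of n m]
      by (simp add: tensor_incl_ev x y add.commute)
    ultimately show ?thesis by (simp add: twisted_commutator_def Let_def a_minus_def)
  qed
  hence "{twisted_commutator R \<gamma> m n x y | m n x y. m + n = p \<and> x \<in> carrier (grade \<gamma> m) \<and> y \<in> carrier (grade \<gamma> n)} =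
    {twisted_commutator R \<gamma> m n x y \<ominus>\<^bsub>grade T p\<^esub> tensor_incl R \<gamma> p (S.bracket m n x y) | m n x y.
      m + n = p \<and> x \<in> carrier (grade \<gamma> m) \<and> y \<in> carrier (grade \<gamma> n)}" for p
    by (intro Collect_cong) metis
  thus ?thesis unfolding sym_ideal_def env_ideal_def by simp
qed

lemma S_lop_zero:
  assumes "module R V" "wfun V H" "typed u" "typed v"
  shows "H (u @ S.lop a b # v) = \<zero>\<^bsub>V\<^esub>"
  using wfun_zero_letter[OF assms, of "fst a @ fst b"] by (simp add: S.lop_def)

lemma symfun_S_relfun:
  assumes V: "module R V" and K: "symfun V K"
  shows "S.relfun V K"
proof (rule S.relfunI[OF symfunD(1)[OF K]])
  fix u a b v assume t: "typed u" "typed [a]" "typed [b]" "typed v"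
  show "K (u @ a # b # v) \<oplus>\<^bsub>V\<^esub> K (u @ S.lop b a # v) = K (u @ b # a # v) \<oplus>\<^bsub>V\<^esub> K (u @ S.lop a b # v)"
    by (simp add: S_lop_zero[OF V symfunD(1)[OF K] t(1,4)] symfunD(3)[OF K t])
qed

lemma symfun_S_evq: "symfun (grade S.Q p) (S.evq p)"
proof -
  interpret M: module R "grade S.Q p" by (rule S.module_Q)
  note W = S.relfunD(1)[OF S.relfun_evq]
  have "S.evq p (u @ a # b # v) = S.evq p (u @ b # a # v)"
    if t: "typed u" "typed [a]" "typed [b]" "typed v" for u a b v
    using S.relfunD(3)[OF S.relfun_evq t, of p] by (simp add: S_lop_zero[OF S.module_Q W t(1,4)] S.evq_closed)
  thus ?thesis using W unfolding symfun_def by blast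
qed

lemma symfun_gr_word: "symfun (grade gr p) (gr_word p)"
  unfolding symfun_def using wfun_gr_word gr_word_swap by blast

section \<open>The canonical morphism and the map in the opposite direction\<close>

definition kappa :: "nat \<Rightarrow> (nat \<Rightarrow> ('r, 'a) tens) set \<Rightarrow> nat \<Rightarrow> (nat \<Rightarrow> ('r, 'a) tens) set set"
  where "kappa p = (SOME f. linear_map R (grade S.Q p) (grade gr p) f \<and> (\<forall>w. good p w \<longrightarrow> f (S.evq p w) = gr_word p w))"

lemma linear_kappa: "linear_map R (grade S.Q p) (grade gr p) (kappa p)"
  and kappa_evq: "good p w \<Longrightarrow> kappa p (S.evq p w) = gr_word p w"
  using someI_ex[OF S.Q_universal[OF module_gr symfun_S_relfun[OF module_gr symfun_gr_word]]]
  unfolding kappa_def by blast+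

lemma talg_hom_kappa: "talg_hom R S.Q gr kappa"
proof (rule S.Q_talg_homI[where H = gr_word])
  show "gr_word 0 [] = tone gr"
    by (simp add: gr_eq weighted_simps gr_word_def gcl_eq tone_Q)
  show "bilinear_map R (grade gr p) (grade gr r) (grade gr (p + r)) (tmul gr p r)" for p r
    unfolding gr_eq by (rule Gr.bilinear_tmul)
qed (simp_all add: module_gr linear_kappa kappa_evq linear_act_gr act_gr_word gr_word_mul)

text \<open>\<open>\<psi> : U \<rightarrow> Sym\<close> lets a product of generators act on \<open>1\<close> from the right.\<close>

definition psi_word :: "nat \<Rightarrow> 'a word \<Rightarrow> (nat \<Rightarrow> ('r, 'a) tens) set"
  where "psi_word p w = msum (grade S.Q p) (S.evq p) (graft lop [] w)"

definition psi :: "nat \<Rightarrow> (nat \<Rightarrow> ('r, 'a) tens) set \<Rightarrow> (nat \<Rightarrow> ('r, 'a) tens) set"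
  where "psi p = (SOME f. linear_map R (grade Q p) (grade S.Q p) f \<and> (\<forall>w. good p w \<longrightarrow> f (evq p w) = psi_word p w))"

lemma relfun_psi_word: "relfun (grade S.Q p) (psi_word p)"
  unfolding psi_word_def[abs_def] by (rule relfun_graft[OF S.module_Q symfun_S_evq])

lemma linear_psi: "linear_map R (grade Q p) (grade S.Q p) (psi p)"
  and psi_evq: "good p w \<Longrightarrow> psi p (evq p w) = psi_word p w"
  using someI_ex[OF Q_universal[OF S.module_Q relfun_psi_word]] unfolding psi_def by blast+

lemma graft_relabel: "graft lop (relabel f u) (relabel f v) = image_mset (relabel f) (graft lop u v)"
  unfolding relabel_def by (rule graft_map) (auto simp: lop_def)

lemma act_psi:
  assumes s: "\<sigma> permutes {1..p}" and x: "x \<in> carrier (grade Q p)"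
  shows "psi p (act Q p \<sigma> x) = act S.Q p \<sigma> (psi p x)"
proof (rule Q_agree[OF S.module_Q linear_comp[OF linear_act_Q[OF s] linear_psi] linear_comp[OF linear_psi S.linear_act_Q[OF s]] _ x])
  fix w assume w: "good p w"
  have "act S.Q p \<sigma> (psi_word p w) = psi_word p (relabel \<sigma> w)"
    unfolding psi_word_def linear_msum[OF S.module_Q S.module_Q S.linear_act_Q[OF s] S.evq_closed] S.act_evq[OF s]
    using graft_relabel[of \<sigma> "[]" w] by (simp add: msum_image[OF S.module_Q] S.evq_closed)
  thus "psi p (act Q p \<sigma> (evq p w)) = act S.Q p \<sigma> (psi p (evq p w))"
    using w by (simp add: act_evq[OF s] psi_evq good_relabel[OF s])
qed

lemma psi_word_leading: "psi_word p w \<ominus>\<^bsub>grade S.Q p\<^esub> S.evq p w \<in> S.F' (length w) p"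
proof -
  interpret M: module R "grade S.Q p" by (rule S.module_Q)
  obtain M where M: "graft lop [] w = add_mset w M" "\<forall>x\<in>#M. length x < length w"
    using graft_leading[of lop "[]" w] by auto
  let ?m = "msum (grade S.Q p) (S.evq p) M"
  have "psi_word p w = S.evq p w \<oplus>\<^bsub>grade S.Q p\<^esub> ?m"
    unfolding psi_word_def M(1) by (rule msum_add_mset[OF S.module_Q S.evq_closed])
  moreover have m: "?m \<in> S.F' (length w) p"
    by (rule msum_in_submodule[OF S.module_Q S.submodule_image S.evq_closed]) (use M(2) in \<open>auto intro: S.evq_in_image\<close>)
  ultimately have "psi_word p w \<ominus>\<^bsub>grade S.Q p\<^esub> S.evq p w = ?m"
    using subsetD[OF S.image_sub_Q m] S.evq_closed M.minus_eq_iff by (simp add: M.a_comm)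
  thus ?thesis using m by simp
qed

text \<open>On a word, \<open>psi\<close> gives the same word in the symmetric algebra plus shorter
  ones; no term is longer than the word it came from.\<close>

lemma psi_lower:
  assumes "x \<in> F' n p"
  shows "psi p x \<in> S.F' n p"
proof (rule linear_vanish_mspan[OF module_Q S.module_Q linear_psi evq_set_closed _ S.submodule_image assms[unfolded tensor_image_mspan]])
  fix s assume "s \<in> {evq p w | w. good p w \<and> length w \<in> {..<n}}"
  then obtain w where w: "s = evq p w" "good p w" "length w < n" by auto
  interpret M: module R "grade S.Q p" by (rule S.module_Q)
  note D = submoduleD[OF S.submodule_image S.module_Q]
  have e: "S.evq p w \<in> S.F' n p" by (rule S.evq_in_image) (use w in simp)
  have d: "psi_word p w \<ominus>\<^bsub>grade S.Q p\<^esub> S.evq p w \<in> S.F' n p"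
    using psi_word_leading[of p w] S.tensor_image_mono[of "{..<length w}" "{..<n}" p] w(3) by auto
  have pc: "psi_word p w \<in> carrier (grade S.Q p)" by (rule relfunD(2)[OF relfun_psi_word])
  have "psi_word p w = (psi_word p w \<ominus>\<^bsub>grade S.Q p\<^esub> S.evq p w) \<oplus>\<^bsub>grade S.Q p\<^esub> S.evq p w"
    by (rule M.minus_plus_cancel[OF pc S.evq_closed, symmetric])
  thus "psi p s \<in> S.F' n p" using D(4)[OF d e] w by (simp add: psi_evq)
qed

text \<open>The linear extension of \<open>psi_word_leading\<close> to tensors of weight
  \<open>n\<close>: modulo lower terms, \<open>psi\<close> sends the class of \<open>t\<close> in
  the enveloping algebra to its class in the symmetric algebra.\<close>

lemma psi_top:
  assumes "t \<in> T_part {n} p"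
  shows "psi p (cl p t) \<ominus>\<^bsub>grade S.Q p\<^esub> S.cl p t \<in> S.F' n p"
proof (rule linear_vanish_mspan[OF module_T S.module_Q linear_map_minus[OF module_T S.module_Q linear_comp[OF linear_cl linear_psi] S.linear_cl]
      _ _ S.submodule_image assms[unfolded T_part_mspan]])
  show "{ev p w | w. good p w \<and> length w \<in> {n}} \<subseteq> carrier (grade T p)" using ev_closed by auto
  fix s assume "s \<in> {ev p w | w. good p w \<and> length w \<in> {n}}"
  then obtain w where w: "s = ev p w" "good p w" "length w = n" by auto
  show "psi p (cl p s) \<ominus>\<^bsub>grade S.Q p\<^esub> S.cl p s \<in> S.F' n p"
    using psi_word_leading[of p w] psi_evq[OF w(2)] w by (simp add: evq_def S.evq_def)
qed

text \<open>For the zero product the shorter terms of a relation vanish, and the remaining two words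
  have the same length. So each relation is homogeneous for the weight.\<close>

lemma S_I_homogeneous:
  assumes "t \<in> S.I p"
  shows "weight_comp n p t \<in> S.I p"
proof (rule linear_vanish_mspan[OF module_T module_T linear_weight_comp_T S.erel_closed _ S.subI assms[unfolded S.I_eq]])
  fix e assume "e \<in> S.erel p"
  then obtain u a b v where e: "e = S.rel_elem (grade T p) (ev p) u a b v"
    and t: "typed u" "typed [a]" "typed [b]" "typed v" unfolding S.erel_def by blast
  interpret M: module R "grade T p" by (rule module_T)
  have z: "ev p (u @ S.lop a b # v) = \<zero>\<^bsub>grade T p\<^esub>" for a b by (rule S_lop_zero[OF module_T wfun_ev t(1,4)])
  have c: "weight_comp n p e = S.rel_elem (grade T p) (\<lambda>w. weight_comp n p (ev p w)) u a b v"
    unfolding e by (rule S.linear_rel_elem[OF module_T module_T linear_weight_comp_T ev_closed])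
  show "weight_comp n p e \<in> S.I p"
  proof (cases "length u + Suc (Suc (length v)) = n")
    case True
    hence "weight_comp n p e = e" unfolding c unfolding e S.rel_elem_def by (simp add: weight_comp_ev z linear_zero[OF module_T module_T linear_weight_comp_T])
    thus ?thesis using S.erelI[OF t, of p] unfolding S.I_eq e by (simp add: hull_inc)
  next
    case False
    hence "weight_comp n p e = \<zero>\<^bsub>grade T p\<^esub>" unfolding c S.rel_elem_def by (simp add: weight_comp_ev z linear_zero[OF module_T module_T linear_weight_comp_T] a_minus_def)
    thus ?thesis using submoduleD(2)[OF S.subI module_T] by simp
  qed
qed

text \<open>The symmetric algebra is graded by weight, so an element of weight \<open>n\<close> that
  is congruent to lower terms is zero. Taking the weight \<open>n\<close> component of
  \<open>t - s\<close> makes this precise.\<close>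

lemma S_top_zero:
  assumes t: "t \<in> T_part {n} p" and l: "S.cl p t \<in> S.F' n p"
  shows "t \<in> S.I p"
proof -
  interpret M: module R "grade T p" by (rule module_T)
  obtain s where s: "s \<in> T_part {..<n} p" "S.cl p t = S.cl p s" using l unfolding S.tensor_image_eq by blast
  have tc: "t \<in> carrier (grade T p)" and sc: "s \<in> carrier (grade T p)" using t s by (auto simp: T_part_def)
  have "t \<ominus>\<^bsub>grade T p\<^esub> s \<in> S.I p" using S.cl_eq_iff[OF tc sc] s(2) by simp
  from S_I_homogeneous[OF this, of n]
  have "t \<ominus>\<^bsub>grade T p\<^esub> \<zero>\<^bsub>grade T p\<^esub> \<in> S.I p"
    unfolding linear_minus[OF module_T module_T linear_weight_comp_T tc sc] weight_comp_id[OF t] weight_comp_lower[OF s(1)] .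
  thus ?thesis unfolding M.minus_zero_right[OF tc] .
qed

text \<open>Both sides are linear in \<open>t\<close> and give the symbol of a word in the weight
  equal to its length, and zero in other weights.\<close>

lemma kappa_coord:
  assumes "t \<in> carrier (grade T p)"
  shows "kappa p (S.cl p t) n = fc n p (cl p (weight_comp n p t))"
proof (rule T_agree[OF module_FactModule[OF module_Q submodule_image] _ _ _ assms])
  have "linear_map R (grade gr p) (grade (gp n) p) (\<lambda>f. f n)" unfolding gr_eq by (rule Gr.linear_coord)
  \<comment> \<open>The graded piece is viewed inside the quotient of the whole algebra, where the
    right-hand side is linear without a filtration argument.\<close>
  moreover have "linear_map R (grade (gp n) p) (FactModule (grade Q p) (F' n p)) (\<lambda>X. X)"
    unfolding grade_gp by (rule linear_inclusion_FactModule[OF image_sub_Q])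
  ultimately show "linear_map R (grade T p) (FactModule (grade Q p) (F' n p)) (\<lambda>t. kappa p (S.cl p t) n)"
    by (rule linear_comp[OF linear_comp[OF linear_comp[OF S.linear_cl linear_kappa]]])
  show "linear_map R (grade T p) (FactModule (grade Q p) (F' n p)) (\<lambda>t. fc n p (cl p (weight_comp n p t)))"
    by (rule linear_comp[OF linear_comp[OF linear_weight_comp_T linear_cl] linear_fc_full])
  fix w assume w: "good p w"
  have "fc n p (cl p \<zero>\<^bsub>grade T p\<^esub>) = F' n p"
    using coset_zero[OF module_Q submodule_image] linear_zero[OF module_T module_Q linear_cl] by simp
  thus "kappa p (S.cl p (ev p w)) n = fc n p (cl p (weight_comp n p (ev p w)))"
    using kappa_evq[OF w]
    by (auto simp: S.evq_def gr_word_def gcl_eq weight_part_def zero_gp weight_comp_ev evq_def)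
qed

text \<open>The existence of \<open>kappa\<close> on the symmetric algebra means that a tensor of
  weight \<open>n\<close> whose class there is zero has zero symbol in weight
  \<open>n\<close>.\<close>

lemma S_I_lower:
  assumes t: "t \<in> T_part {n} p" and i: "t \<in> S.I p"
  shows "cl p t \<in> F' n p"
proof -
  have tc: "t \<in> carrier (grade T p)" using t by (simp add: T_part_def)
  have "S.cl p t = \<zero>\<^bsub>grade S.Q p\<^esub>"
    using coset_eq_zero_iff[OF module_T S.subI tc] i by (simp add: S.grade_Q FactModule_simps)
  hence "kappa p (S.cl p t) n = \<zero>\<^bsub>grade gr p\<^esub> n" using linear_zero[OF S.module_Q module_gr linear_kappa] by simp
  hence "fc n p (cl p t) = F' n p"
    unfolding kappa_coord[OF tc] weight_comp_id[OF t] by (simp add: gr_eq weighted_simps fin_supp_def zero_gp)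
  thus ?thesis using coset_eq_zero_iff[OF module_Q submodule_image linear_closed[OF linear_cl tc]] by simp
qed

lemma split_top:
  assumes t: "t \<in> T_part {..n} p"
  defines "r \<equiv> t \<ominus>\<^bsub>grade T p\<^esub> weight_comp n p t"
  shows "weight_comp n p t \<in> T_part {n} p" "r \<in> T_part {..<n} p" "t = r \<oplus>\<^bsub>grade T p\<^esub> weight_comp n p t"
    "r \<in> carrier (grade T p)" "weight_comp n p t \<in> carrier (grade T p)"
proof -
  interpret M: module R "grade T p" by (rule module_T)
  have tc: "t \<in> carrier (grade T p)" using t by (simp add: T_part_def)
  show c: "weight_comp n p t \<in> T_part {n} p" by (rule weight_comp_T_part[OF tc])
  show r: "r \<in> T_part {..<n} p" unfolding r_def by (rule rest_T_part[OF t])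
  show cc: "weight_comp n p t \<in> carrier (grade T p)" and rc: "r \<in> carrier (grade T p)" using c r by (simp_all add: T_part_def)
  show "t = r \<oplus>\<^bsub>grade T p\<^esub> weight_comp n p t" unfolding r_def by (rule M.minus_plus_cancel[OF tc cc, symmetric])
qed

text \<open>Let \<open>c\<close> be the top component of a representative of \<open>x\<close>. If
  \<open>psi\<close> kills \<open>x\<close>, then the class of \<open>c\<close> in the symmetric
  algebra is lower, hence zero by homogeneity, and so the class of \<open>c\<close> in the
  enveloping algebra is lower by \<open>S_I_lower\<close>. Thus \<open>x\<close> lies in the
  preceding step and the induction applies.\<close>

lemma psi_inj_F': "x \<in> F' n p \<Longrightarrow> psi p x = \<zero>\<^bsub>grade S.Q p\<^esub> \<Longrightarrow> x = \<zero>\<^bsub>grade Q p\<^esub>"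
proof (induct n arbitrary: x)
  case 0
  have "T_part {..<0} p = {\<zero>\<^bsub>grade T p\<^esub>}" using module_zero_closed[OF module_T[of p]] by (auto simp: T_part_def T_zero)
  thus ?case using 0(1) linear_zero[OF module_T module_Q linear_cl] unfolding tensor_image_eq by simp
next
  case (Suc n)
  interpret M: module R "grade S.Q p" by (rule S.module_Q)
  obtain t where t: "t \<in> T_part {..n} p" "x = cl p t" using Suc(2) unfolding tensor_image_eq lessThan_Suc_atMost by blast
  note sp = split_top[OF t(1)]
  define c where "c = weight_comp n p t"
  define r where "r = t \<ominus>\<^bsub>grade T p\<^esub> weight_comp n p t"
  note sp = sp[folded r_def c_def]
  note cl_c = linear_closed[OF linear_cl]
  have x: "x = cl p r \<oplus>\<^bsub>grade Q p\<^esub> cl p c"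
    using linear_add[OF linear_cl sp(4,5)] sp(3) t(2) by simp
  have r': "cl p r \<in> F' n p" using sp(2) unfolding tensor_image_eq by blast
  have d: "psi p (cl p c) \<ominus>\<^bsub>grade S.Q p\<^esub> S.cl p c \<in> S.F' n p" (is "?d \<in> _") by (rule psi_top[OF sp(1)])
  note D = submoduleD[OF S.submodule_image S.module_Q]
  have pr: "psi p (cl p r) \<in> S.F' n p" by (rule psi_lower[OF r'])
  have cc: "psi p (cl p c) \<in> carrier (grade S.Q p)" "S.cl p c \<in> carrier (grade S.Q p)" "psi p (cl p r) \<in> carrier (grade S.Q p)"
    using linear_closed[OF linear_psi cl_c] linear_closed[OF S.linear_cl] sp(4,5) by auto
  have "psi p (cl p r) \<oplus>\<^bsub>grade S.Q p\<^esub> psi p (cl p c) = \<zero>\<^bsub>grade S.Q p\<^esub>"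
    using Suc(3) linear_add[OF linear_psi cl_c[OF sp(4)] cl_c[OF sp(5)]] x by simp
  hence "psi p (cl p c) = \<ominus>\<^bsub>grade S.Q p\<^esub> psi p (cl p r)"
    using cc M.minus_equality M.a_comm by metis
  hence "psi p (cl p c) \<in> S.F' n p" using D(3)[OF pr] by simp
  \<comment> \<open>Both \<open>psi p (cl p c)\<close> and its error \<open>?d\<close> are lower, so
    their difference, the class of \<open>c\<close>, is lower too.\<close>
  from D(5)[OF this d] have "S.cl p c \<in> S.F' n p" unfolding M.minus_minus_cancel[OF cc(1,2)] .
  from S_I_lower[OF sp(1) S_top_zero[OF sp(1) this]] have "x \<in> F' n p"
    using submoduleD(4)[OF submodule_image module_Q r'] x by simp
  thus ?case using Suc(1) Suc(3) by blast
qed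

text \<open>The top component is lifted by taking the class of the same tensor in the enveloping
  algebra; the error is of lower filtration and is corrected by induction.\<close>

lemma psi_surj_F': "S.F' n p \<subseteq> psi p ` F' n p"
proof (induct n)
  case 0
  have "T_part {..<0} p = {\<zero>\<^bsub>grade T p\<^esub>}" using module_zero_closed[OF module_T[of p]] by (auto simp: T_part_def T_zero)
  thus ?case using linear_zero[OF module_T module_Q linear_cl] linear_zero[OF module_T S.module_Q S.linear_cl]
      linear_zero[OF module_Q S.module_Q linear_psi] unfolding tensor_image_eq S.tensor_image_eq by simp
next
  case (Suc n)
  interpret M: module R "grade S.Q p" by (rule S.module_Q)
  interpret N: module R "grade Q p" by (rule module_Q)
  show ?case
  proof
    fix y assume "y \<in> S.F' (Suc n) p"
    then obtain t where t: "t \<in> T_part {..n} p" "y = S.cl p t" unfolding S.tensor_image_eq lessThan_Suc_atMost by blast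
    define c where "c = weight_comp n p t"
    define r where "r = t \<ominus>\<^bsub>grade T p\<^esub> weight_comp n p t"
    note sp = split_top[OF t(1), folded r_def c_def]
    have y: "y = S.cl p r \<oplus>\<^bsub>grade S.Q p\<^esub> S.cl p c"
      using linear_add[OF S.linear_cl sp(4,5)] sp(3) t(2) by simp
    have d: "psi p (cl p c) \<ominus>\<^bsub>grade S.Q p\<^esub> S.cl p c \<in> S.F' n p" (is "?d \<in> _") by (rule psi_top[OF sp(1)])
    have r': "S.cl p r \<in> S.F' n p" using sp(2) unfolding S.tensor_image_eq by blast
    \<comment> \<open>The lower part still to be reached, after subtracting the error
      \<open>?d\<close> of the lifted top component.\<close>
    have "S.cl p r \<ominus>\<^bsub>grade S.Q p\<^esub> ?d \<in> S.F' n p"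
      by (rule submoduleD(5)[OF S.submodule_image S.module_Q r' d])
    then obtain z where z: "z \<in> F' n p" "S.cl p r \<ominus>\<^bsub>grade S.Q p\<^esub> ?d = psi p z" using Suc by blast
    have zc: "z \<in> carrier (grade Q p)" by (rule subsetD[OF image_sub_Q z(1)])
    have cc: "cl p c \<in> carrier (grade Q p)" by (rule linear_closed[OF linear_cl sp(5)])
    have cl: "psi p (cl p c) \<in> carrier (grade S.Q p)" "S.cl p c \<in> carrier (grade S.Q p)" "S.cl p r \<in> carrier (grade S.Q p)"
      using linear_closed[OF linear_psi cc] linear_closed[OF S.linear_cl] sp(4,5) by auto
    have "psi p (z \<oplus>\<^bsub>grade Q p\<^esub> cl p c) = (S.cl p r \<ominus>\<^bsub>grade S.Q p\<^esub> ?d) \<oplus>\<^bsub>grade S.Q p\<^esub> psi p (cl p c)"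
      using linear_add[OF linear_psi zc cc] z(2) by simp
    also have "\<dots> = y"
    proof -
      have pc: "psi p (cl p c) = ?d \<oplus>\<^bsub>grade S.Q p\<^esub> S.cl p c"
        by (rule M.minus_plus_cancel[OF cl(1,2), symmetric])
      have "(S.cl p r \<ominus>\<^bsub>grade S.Q p\<^esub> ?d) \<oplus>\<^bsub>grade S.Q p\<^esub> (?d \<oplus>\<^bsub>grade S.Q p\<^esub> S.cl p c) =
          ((S.cl p r \<ominus>\<^bsub>grade S.Q p\<^esub> ?d) \<oplus>\<^bsub>grade S.Q p\<^esub> ?d) \<oplus>\<^bsub>grade S.Q p\<^esub> S.cl p c"
        using cl by (simp add: M.a_assoc)
      also have "(S.cl p r \<ominus>\<^bsub>grade S.Q p\<^esub> ?d) \<oplus>\<^bsub>grade S.Q p\<^esub> ?d = S.cl p r"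
        using cl by (intro M.minus_plus_cancel) auto
      finally show ?thesis using pc y by simp
    qed
    finally have "y = psi p (z \<oplus>\<^bsub>grade Q p\<^esub> cl p c)" by simp
    moreover have "cl p c \<in> F' (Suc n) p"
      using sp(1) unfolding tensor_image_eq by (intro imageI) (auto simp: T_part_def)
    moreover have "z \<in> F' (Suc n) p" using z(1) tensor_image_mono[of "{..<n}" "{..<Suc n}" p] by auto
    ultimately show "y \<in> psi p ` F' (Suc n) p" using submoduleD(4)[OF submodule_image module_Q] by blast
  qed
qed

lemma psi_image_F': "psi p ` F' n p = S.F' n p"
  using psi_surj_F' psi_lower by blast

text \<open>Tensors have finite support, so the filtrations are exhaustive and bijectivity can be
  checked on each step.\<close>

lemma psi_bij: "bij_betw (psi p) (carrier (grade Q p)) (carrier (grade S.Q p))"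
  unfolding bij_betw_def
proof
  interpret M: module R "grade S.Q p" by (rule S.module_Q)
  interpret N: module R "grade Q p" by (rule module_Q)
  have ex: "\<exists>n. x \<in> F' n p" if x: "x \<in> carrier (grade Q p)" for x
  proof -
    obtain t where t: "t \<in> carrier (grade T p)" "x = cl p t" using x unfolding carrier_Q by blast
    obtain n where "t \<in> T_part {..<n} p" using T_part_exhaust[OF t(1)] by blast
    thus ?thesis using t(2) unfolding tensor_image_eq by blast
  qed
  show "inj_on (psi p) (carrier (grade Q p))"
  proof (rule inj_onI)
    fix x y assume x: "x \<in> carrier (grade Q p)" and y: "y \<in> carrier (grade Q p)" and e: "psi p x = psi p y"
    have "psi p (x \<ominus>\<^bsub>grade Q p\<^esub> y) = \<zero>\<^bsub>grade S.Q p\<^esub>"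
      using linear_minus[OF module_Q S.module_Q linear_psi x y] e M.minus_eq_zero_iff linear_closed[OF linear_psi y] by simp
    moreover obtain n where "x \<ominus>\<^bsub>grade Q p\<^esub> y \<in> F' n p" using ex[of "x \<ominus>\<^bsub>grade Q p\<^esub> y"] x y by auto
    ultimately have "x \<ominus>\<^bsub>grade Q p\<^esub> y = \<zero>\<^bsub>grade Q p\<^esub>" using psi_inj_F' by blast
    thus "x = y" using N.minus_eq_zero_iff[OF x y] by simp
  qed
  show "psi p ` carrier (grade Q p) = carrier (grade S.Q p)"
  proof
    show "psi p ` carrier (grade Q p) \<subseteq> carrier (grade S.Q p)" using linear_closed[OF linear_psi] by blast
    show "carrier (grade S.Q p) \<subseteq> psi p ` carrier (grade Q p)"
    proof
      fix y assume "y \<in> carrier (grade S.Q p)"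
      then obtain t where t: "t \<in> carrier (grade T p)" "y = S.cl p t" unfolding S.carrier_Q by blast
      obtain n where "t \<in> T_part {..<n} p" using T_part_exhaust[OF t(1)] by blast
      hence "y \<in> S.F' n p" using t(2) unfolding S.tensor_image_eq by blast
      thus "y \<in> psi p ` carrier (grade Q p)" using psi_surj_F'[of n p] image_sub_Q[of "{..<n}" p] by blast
    qed
  qed
qed

end

section \<open>Compatibility of \<open>psi\<close> with coproduct and counit\<close>

lemma (in word_op) labels_attach: "x \<in># attach lop u a \<Longrightarrow> mset (labels x) = mset (labels u) + mset (fst a)"
  by (induct u arbitrary: x) auto

lemma (in word_op) labels_graft: "x \<in># graft lop u v \<Longrightarrow> mset (labels x) = mset (labels u) + mset (labels v)"
proof (induct v arbitrary: u)
  case (Cons a v)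
  from Cons(2) consider "x \<in># graft lop (u @ [a]) v" | y where "y \<in># attach lop u a" "x \<in># graft lop y v" by auto
  thus ?case by cases (use Cons(1) labels_attach in \<open>auto simp: ac_simps\<close>)
qed simp

context pre_lie
begin

lemma good_graft: "x \<in># graft lop [] w \<Longrightarrow> good p w \<Longrightarrow> good p x"
  using typed_graft[of x "[]" w] labels_graft[of x "[]" w] by (simp add: good_def)

lemma relabel_unlab_self:
  assumes "distinct (labels u)"
  shows "relabel (unlab (labels u)) u = lab id (plain u)"
proof -
  let ?L = "labels u"
  have "unlab ?L (perm_of ?L k) = k" if "k \<in> {1..length ?L}" for k
  proof -
    have k: "k - 1 < length ?L" "Suc (k - 1) = k" "k \<in> {1..length ?L}" using that by auto
    have "unlab ?L (?L ! (k - 1)) = map (unlab ?L) ?L ! (k - 1)" by (rule nth_map[OF k(1), symmetric])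
    also have "\<dots> = iota (length ?L) ! (k - 1)" by (simp only: unlab(2)[OF assms])
    also have "\<dots> = k" by (simp only: nth_iota[OF k(1)] k(2))
    finally show ?thesis using k(3) by (simp add: perm_of_def)
  qed
  hence "lab (\<lambda>k. unlab ?L (perm_of ?L k)) (plain u) = lab id (plain u)"
    by (intro lab_cong) (simp add: sum_plain)
  thus ?thesis using relabel_lab[of "unlab ?L" "perm_of ?L" "plain u"] by (simp add: lab_perm_of)
qed

lemma smod_hom_psi: "smod_hom R Q S.Q psi"
  unfolding smod_hom_def by (auto simp: linear_psi act_psi sym_group_carrier)

text \<open>\<open>word_class\<close> uses the reading order of \<open>u\<close>, which grafting
  changes. Hence the grafted words are standardised by the labels of \<open>u\<close> and not by
  their own.\<close>

lemma psi_word_class: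
  assumes "typed u" "distinct (labels u)"
  shows "psi (length (labels u)) (word_class u) =
    msum (grade S.Q (length (labels u))) (\<lambda>x. S.evq (length (labels u)) (relabel (unlab (labels u)) x)) (graft lop [] u)"
proof -
  let ?m = "length (labels u)"
  have "good ?m (lab id (plain u))" using assms by (simp add: good_def typed_lab_plain labels_lab sum_plain)
  hence "psi ?m (word_class u) = psi_word ?m (relabel (unlab (labels u)) u)"
    unfolding word_class_def relabel_unlab_self[OF assms(2)] by (rule psi_evq)
  thus ?thesis using graft_relabel[of "unlab (labels u)" "[]" u]
    by (simp add: psi_word_def msum_image[OF S.module_Q] S.evq_closed)
qed

text \<open>Applying \<open>psi\<close> in both factors keeps the label lists of \<open>u\<close>
  and \<open>v\<close>, while the words in the result are grafted. \<open>S.ev2_eq\<close> applies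
  since grafting preserves the multiset of labels.\<close>

lemma tensor_map2_psi_ev2:
  assumes t: "typed u" "typed v" and g: "mset (labels u @ labels v) = mset (iota p)"
  shows "tensor_map2 R S.Q psi p (ev2 p u v) =
    msum (S.sqQ p) (\<lambda>z. S.ev2 p (fst z) (snd z)) (mprod (graft lop [] u) (graft lop [] v))"
proof -
  let ?L = "labels u" and ?L' = "labels v"
  have d: "distinct ?L" "distinct ?L'" using mset_eq_iota[OF g] by auto
  note Vm = S.Qs.sq.module_tensor
  have "tensor_map2 R S.Q psi p (ev2 p u v) = pair_class R S.Q p ?L ?L' (psi (length ?L) (word_class u)) (psi (length ?L') (word_class v))"
    unfolding ev2_def
    by (rule tensor_map2_pair_class(2)[OF Qs.square_axioms S.Qs.square_axioms smod_hom_psi])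
      (rule word_class_closed, rule refl)+
  also have "\<dots> = msum (S.sqQ p) (\<lambda>x. msum (S.sqQ p) (\<lambda>y. pair_class R S.Q p ?L ?L'
      (S.evq (length ?L) (relabel (unlab ?L) x)) (S.evq (length ?L') (relabel (unlab ?L') y))) (graft lop [] v)) (graft lop [] u)"
    unfolding psi_word_class[OF t(1) d(1)] psi_word_class[OF t(2) d(2)]
    by (rule bilinear_msum[OF S.module_Q S.module_Q Vm S.Qs.bilinear_pair_class S.evq_closed S.evq_closed])
  also have "\<dots> = msum (S.sqQ p) (\<lambda>x. msum (S.sqQ p) (\<lambda>y. S.ev2 p x y) (graft lop [] v)) (graft lop [] u)"
  proof (intro msum_cong[OF Vm] msum_closed[OF Vm] S.ev2_closed S.Qs.pair_class_closed S.evq_closed)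
    fix x y assume x: "x \<in># graft lop [] u" and y: "y \<in># graft lop [] v"
    show "pair_class R S.Q p ?L ?L' (S.evq (length ?L) (relabel (unlab ?L) x)) (S.evq (length ?L') (relabel (unlab ?L') y)) = S.ev2 p x y"
      by (rule S.ev2_eq[OF d, symmetric])
        (use typed_graft[OF x] typed_graft[OF y] labels_graft[OF x] labels_graft[OF y] t in auto)
  qed
  also have "\<dots> = msum (S.sqQ p) (\<lambda>z. S.ev2 p (fst z) (snd z)) (mprod (graft lop [] u) (graft lop [] v))"
    unfolding mprod_def by (simp add: msum_bind[OF Vm] msum_image[OF Vm] S.ev2_closed)
  finally show ?thesis .
qed

text \<open>On words both sides are sums of \<open>S.ev2\<close>: over splittings of grafted words
  and over pairs of grafted parts of splittings. These multisets agree by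
  \<open>graft_splits\<close> with an empty first word.\<close>

lemma psi_coproduct:
  assumes "x \<in> carrier (grade Q p)"
  shows "S.coproduct p (psi p x) = tensor_map2 R S.Q psi p (coproduct p x)"
proof -
  note Vm = S.Qs.sq.module_tensor and Um = Qs.sq.module_tensor
  note lin = tensor_map2_pair_class(1)[OF Qs.square_axioms S.Qs.square_axioms smod_hom_psi]
  show ?thesis
  proof (rule Q_agree[OF Vm linear_comp[OF linear_psi S.linear_coproduct] linear_comp[OF linear_coproduct lin] _ assms])
    fix w assume w: "good p w"
    let ?e = "\<lambda>z. S.ev2 p (fst z) (snd z)"
    have t: "typed w" using w by (simp add: good_def)
    have "S.coproduct p (psi p (evq p w)) = msum (S.sqQ p) (\<lambda>x. S.coproduct p (S.evq p x)) (graft lop [] w)"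
      unfolding psi_evq[OF w] psi_word_def by (rule linear_msum[OF S.module_Q Vm S.linear_coproduct S.evq_closed])
    also have "\<dots> = msum (S.sqQ p) (\<lambda>x. msum (S.sqQ p) ?e (splits x)) (graft lop [] w)"
    proof (intro msum_cong[OF Vm] linear_closed[OF S.linear_coproduct] S.evq_closed msum_closed[OF Vm] S.ev2_closed)
      fix x assume "x \<in># graft lop [] w"
      from S.coproduct_evq[OF good_graft[OF this w]]
      show "S.coproduct p (S.evq p x) = msum (S.sqQ p) ?e (splits x)" by (simp add: S.coproduct_word_def)
    qed
    also have "\<dots> = msum (S.sqQ p) ?e (\<Sum>x\<in>#graft lop [] w. splits x)"
      by (simp add: msum_bind[OF Vm] S.ev2_closed)
    also have "(\<Sum>x\<in>#graft lop [] w. splits x) = (\<Sum>z\<in>#splits w. mprod (graft lop [] (fst z)) (graft lop [] (snd z)))"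
      unfolding graft_splits by simp
    also have "msum (S.sqQ p) ?e \<dots> = msum (S.sqQ p) (\<lambda>z. msum (S.sqQ p) ?e (mprod (graft lop [] (fst z)) (graft lop [] (snd z)))) (splits w)"
      by (rule msum_bind[OF Vm S.ev2_closed])
    also have "\<dots> = msum (S.sqQ p) (\<lambda>z. tensor_map2 R S.Q psi p (ev2 p (fst z) (snd z))) (splits w)"
    proof (intro msum_cong[OF Vm] msum_closed[OF Vm] S.ev2_closed linear_closed[OF lin] ev2_closed)
      fix z assume z: "z \<in># splits w"
      show "msum (S.sqQ p) ?e (mprod (graft lop [] (fst z)) (graft lop [] (snd z))) = tensor_map2 R S.Q psi p (ev2 p (fst z) (snd z))"
        by (rule tensor_map2_psi_ev2[OF splits_typed[OF z t], symmetric])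
          (use splits_mem[OF z] w in \<open>simp add: good_def\<close>)
    qed
    also have "\<dots> = tensor_map2 R S.Q psi p (coproduct p (evq p w))"
      unfolding coproduct_evq[OF w] coproduct_word_def by (rule linear_msum[OF Um Vm lin ev2_closed, symmetric])
    finally show "S.coproduct p (psi p (evq p w)) = tensor_map2 R S.Q psi p (coproduct p (evq p w))" .
  qed
qed

text \<open>Grafting a nonempty word gives only nonempty words, on which the counit vanishes; the
  empty word is fixed.\<close>

lemma psi_counit:
  assumes "x \<in> carrier (grade Q p)"
  shows "S.counit p (psi p x) = counit p x"
proof (rule Q_agree[OF module_unit_grade linear_comp[OF linear_psi S.linear_counit] linear_counit _ assms])
  fix w assume w: "good p w"
  note Vm = module_unit_grade[of p]
  have c: "counit_word p w \<in> carrier (grade (unit_talg R) p)" for w by (rule relfunD(2)[OF relfun_counit_word])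
  have "S.counit p (psi p (evq p w)) = msum (grade (unit_talg R) p) (\<lambda>x. S.counit p (S.evq p x)) (graft lop [] w)"
    unfolding psi_evq[OF w] psi_word_def by (rule linear_msum[OF S.module_Q Vm S.linear_counit S.evq_closed])
  also have "\<dots> = msum (grade (unit_talg R) p) (counit_word p) (graft lop [] w)"
  proof (intro msum_cong[OF Vm] linear_closed[OF S.linear_counit] S.evq_closed c)
    fix x assume "x \<in># graft lop [] w"
    from S.counit_evq[OF good_graft[OF this w]] show "S.counit p (S.evq p x) = counit_word p x" .
  qed
  also have "\<dots> = counit_word p w"
  proof (cases "w = []")
    case True
    thus ?thesis by (simp add: msum_single[OF Vm c])
  next
    case False
    have z: "\<zero>\<^bsub>grade (unit_talg R) p\<^esub> = \<zero>\<^bsub>R\<^esub>" by (simp add: unit_talg_def)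
    have "counit_word p x \<in> {\<zero>\<^bsub>grade (unit_talg R) p\<^esub>}" if "x \<in># graft lop [] w" for x
      using graft_Nil_iff[OF that] False by (simp add: counit_word_def z)
    from msum_in_submodule[OF Vm zero_submodule[OF Vm] c this, of "graft lop [] w" "\<lambda>x. x"]
    have "msum (grade (unit_talg R) p) (counit_word p) (graft lop [] w) = \<zero>\<^bsub>R\<^esub>" by (simp add: z)
    also have "\<dots> = counit_word p w" using False by (simp add: counit_word_def)
    finally show ?thesis .
  qed
  finally show "S.counit p (psi p (evq p w)) = counit p (evq p w)" by (simp add: counit_evq[OF w])
qed

section \<open>The inverse of \<open>psi\<close> and the conclusions\<close>

definition phi :: "nat \<Rightarrow> (nat \<Rightarrow> ('r, 'a) tens) set \<Rightarrow> (nat \<Rightarrow> ('r, 'a) tens) set"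
  where "phi p = inv_into (carrier (grade Q p)) (psi p)"

lemma phi_psi: "x \<in> carrier (grade Q p) \<Longrightarrow> phi p (psi p x) = x"
  unfolding phi_def using psi_bij by (rule bij_betw_inv_into_left)

lemma phi_closed: "y \<in> carrier (grade S.Q p) \<Longrightarrow> phi p y \<in> carrier (grade Q p)"
  using bij_betw_inv_into[OF psi_bij, of p] unfolding phi_def bij_betw_def by blast

lemma psi_phi: "y \<in> carrier (grade S.Q p) \<Longrightarrow> psi p (phi p y) = y"
  unfolding phi_def using psi_bij by (rule bij_betw_inv_into_right)

lemma smod_iso_phi: "smod_iso R S.Q Q phi"
  unfolding smod_iso_def smod_hom_def
proof (intro conjI allI ballI)
  fix p
  show "bij_betw (phi p) (carrier (grade S.Q p)) (carrier (grade Q p))"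
    unfolding phi_def by (rule bij_betw_inv_into[OF psi_bij])
  show "linear_map R (grade S.Q p) (grade Q p) (phi p)"
  proof (rule linear_mapI[OF phi_closed])
    fix x y assume x: "x \<in> carrier (grade S.Q p)" and y: "y \<in> carrier (grade S.Q p)"
    have "x \<oplus>\<^bsub>grade S.Q p\<^esub> y = psi p (phi p x \<oplus>\<^bsub>grade Q p\<^esub> phi p y)"
      by (simp add: linear_add[OF linear_psi] phi_closed psi_phi x y)
    thus "phi p (x \<oplus>\<^bsub>grade S.Q p\<^esub> y) = phi p x \<oplus>\<^bsub>grade Q p\<^esub> phi p y"
      by (simp add: phi_psi module_add_closed[OF module_Q] phi_closed x y)
  next
    fix r x assume r: "r \<in> carrier R" and x: "x \<in> carrier (grade S.Q p)"
    have "r \<odot>\<^bsub>grade S.Q p\<^esub> x = psi p (r \<odot>\<^bsub>grade Q p\<^esub> phi p x)"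
      by (simp add: linear_smult[OF linear_psi] phi_closed psi_phi r x)
    thus "phi p (r \<odot>\<^bsub>grade S.Q p\<^esub> x) = r \<odot>\<^bsub>grade Q p\<^esub> phi p x"
      by (simp add: phi_psi module_smult_closed[OF module_Q] phi_closed r x)
  qed
  fix \<sigma> x assume s: "\<sigma> \<in> carrier (sym_group p)" and x: "x \<in> carrier (grade S.Q p)"
  hence s: "\<sigma> permutes {1..p}" by (simp add: sym_group_carrier)
  have "act S.Q p \<sigma> x = psi p (act Q p \<sigma> (phi p x))" by (simp add: act_psi s phi_closed psi_phi x)
  thus "phi p (act S.Q p \<sigma> x) = act Q p \<sigma> (phi p x)"
    by (simp add: phi_psi linear_closed[OF linear_act_Q[OF s]] phi_closed x)
qed

text \<open>On a labelled pair both maps act factor by factor and leave the labels alone, so the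
  identity need only be checked in each factor.\<close>

lemma tensor_map2_phi_psi:
  assumes "X \<in> carrier (sqQ p)"
  shows "tensor_map2 R Q phi p (tensor_map2 R S.Q psi p X) = X"
proof -
  have ph: "smod_hom R S.Q Q phi" using smod_iso_phi by (simp add: smod_iso_def)
  note P = tensor_map2_pair_class[OF Qs.square_axioms S.Qs.square_axioms smod_hom_psi]
  note P' = tensor_map2_pair_class[OF S.Qs.square_axioms Qs.square_axioms ph]
  let ?S = "{tensor_class R [Q, Q] \<sigma> w | \<sigma> w. (\<sigma>, w) \<in> tensor_gens [Q, Q] p}"
  show ?thesis
  proof (rule linear_agree[OF Qs.sq.module_tensor Qs.sq.module_tensor linear_comp[OF P(1) P'(1)] linear_id])
    show "?S \<subseteq> carrier (sqQ p)" using Qs.sq.class_closed by blast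
    show "X \<in> mspan R (sqQ p) ?S" using assms Qs.sq.tensor_mspan[of p] by simp
    fix s assume "s \<in> ?S"
    then obtain \<sigma> w where s: "s = tensor_class R [Q, Q] \<sigma> w" "(\<sigma>, w) \<in> tensor_gens [Q, Q] p" by blast
    obtain a x b y where w: "w = [(a, x), (b, y)]" using s(2) by (rule Qs.gens_cases)
    note g = s(2)[unfolded w]
    note l = Qs.length_lft_rgt(1,2)[OF g, simplified]
    have xy: "x \<in> carrier (grade Q a)" "y \<in> carrier (grade Q b)" using g by (auto simp: Qs.gens_pair)
    show "tensor_map2 R Q phi p (tensor_map2 R S.Q psi p s) = s"
      unfolding s(1) w Qs.class_eq_pair_class[OF g]
      using l xy linear_closed[OF linear_psi] by (simp add: P(2) P'(2) phi_psi)
  qed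
qed

lemma tcoalg_iso_phi: "tcoalg_iso R S.Q S.coproduct S.counit Q coproduct counit phi"
  unfolding tcoalg_iso_def
proof (intro conjI allI ballI smod_iso_phi)
  fix p y assume y: "y \<in> carrier (grade S.Q p)"
  note x = phi_closed[OF y]
  have "S.coproduct p y = tensor_map2 R S.Q psi p (coproduct p (phi p y))"
    using psi_coproduct[OF x] by (simp add: psi_phi[OF y])
  thus "coproduct p (phi p y) = tensor_map2 R Q phi p (S.coproduct p y)"
    by (simp add: tensor_map2_phi_psi linear_closed[OF linear_coproduct x])
  show "counit p (phi p y) = S.counit p y"
    using psi_counit[OF x] by (simp add: psi_phi[OF y])
qed

lemma phi_image_F: "phi p ` S.F n p = F n p"
proof -
  have e: "psi p ` F n p = S.F n p" using psi_image_F'[of p "Suc n"] by (simp add: lessThan_Suc_atMost)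
  show ?thesis unfolding e[symmetric] image_image using phi_psi subsetD[OF image_sub_Q[of "{..n}" p]] by (auto simp: image_iff)
qed

text \<open>With \<open>s\<close> the class of a tensor \<open>t\<close> of weight \<open>n\<close>,
  the error of \<open>psi\<close> on \<open>cl p t\<close> is \<open>psi\<close> of a lower element
  \<open>z\<close>. Hence \<open>phi p s\<close> is \<open>cl p t\<close> minus \<open>z\<close> and
  has the symbol of \<open>cl p t\<close>, which is the value of \<open>kappa\<close>.\<close>

lemma gr_class_phi:
  assumes "s \<in> tensor_image R \<gamma> S.I {n} p"
  shows "gcl n p (phi p s) = kappa p s"
proof
  fix m
  interpret M: module R "grade S.Q p" by (rule S.module_Q)
  interpret N: module R "grade Q p" by (rule module_Q)
  obtain t where t: "t \<in> T_part {n} p" and s: "s = S.cl p t" using assms unfolding S.tensor_image_eq by blast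
  have tc: "t \<in> carrier (grade T p)" using t by (simp add: T_part_def)
  have sc: "s \<in> carrier (grade S.Q p)" unfolding s by (rule linear_closed[OF S.linear_cl tc])
  have cc: "cl p t \<in> carrier (grade Q p)" by (rule linear_closed[OF linear_cl tc])
  show "gcl n p (phi p s) m = kappa p s m"
  proof (cases "m = n")
    case False
    have "fc m p (cl p \<zero>\<^bsub>grade T p\<^esub>) = F' m p"
      using coset_zero[OF module_Q submodule_image] linear_zero[OF module_T module_Q linear_cl] by simp
    thus ?thesis unfolding s kappa_coord[OF tc] weight_comp_other[OF t False]
      using False by (simp add: gcl_eq weight_part_def zero_gp)
  next
    case True
    obtain z where z: "z \<in> F' n p" "psi p (cl p t) \<ominus>\<^bsub>grade S.Q p\<^esub> s = psi p z"
      using psi_top[OF t] psi_surj_F' unfolding s by blast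
    have zc: "z \<in> carrier (grade Q p)" by (rule subsetD[OF image_sub_Q z(1)])
    have pc: "psi p (cl p t) \<in> carrier (grade S.Q p)" by (rule linear_closed[OF linear_psi cc])
    have "psi p (cl p t \<ominus>\<^bsub>grade Q p\<^esub> z) = s"
      unfolding linear_minus[OF module_Q S.module_Q linear_psi cc zc] z(2)[symmetric] by (rule M.minus_minus_cancel[OF pc sc])
    hence ph: "phi p s = cl p t \<ominus>\<^bsub>grade Q p\<^esub> z" using phi_psi[of "cl p t \<ominus>\<^bsub>grade Q p\<^esub> z" p] cc zc by auto
    have "cl p t \<ominus>\<^bsub>grade Q p\<^esub> phi p s = z" unfolding ph by (rule N.minus_minus_cancel[OF cc zc])
    hence "fc n p (cl p t) = fc n p (phi p s)" using fc_eq_iff[OF cc phi_closed[OF sc]] z(1) by simp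
    thus ?thesis unfolding s kappa_coord[OF tc] True weight_comp_id[OF t] by (simp add: gcl_eq weight_part_def s)
  qed
qed

text \<open>If \<open>kappa\<close> kills the class of \<open>t\<close>, each weight component has
  lower class in the enveloping algebra. Applying \<open>psi\<close> makes its class in the
  symmetric algebra lower, hence zero. For surjectivity each coordinate is lifted to a homogeneous
  tensor.\<close>

lemma kappa_bij: "bij_betw (kappa p) (carrier (grade S.Q p)) (carrier (grade gr p))"
  unfolding bij_betw_def
proof
  interpret M: module R "grade S.Q p" by (rule S.module_Q)
  interpret Gm: module R "grade gr p" by (rule module_gr)
  have ker: "x = \<zero>\<^bsub>grade S.Q p\<^esub>" if x: "x \<in> carrier (grade S.Q p)" and k: "kappa p x = \<zero>\<^bsub>grade gr p\<^esub>" for x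
  proof -
    obtain t where t: "t \<in> carrier (grade T p)" "x = S.cl p t" using x unfolding S.carrier_Q by blast
    have "weight_comp n p t \<in> S.I p" for n
    proof -
      have c: "weight_comp n p t \<in> T_part {n} p" by (rule weight_comp_T_part[OF t(1)])
      hence cc: "weight_comp n p t \<in> carrier (grade T p)" by (simp add: T_part_def)
      have "fc n p (cl p (weight_comp n p t)) = F' n p"
        using fun_cong[OF k, of n] unfolding t(2) kappa_coord[OF t(1)]
        by (simp add: gr_eq weighted_simps fin_supp_def zero_gp)
      hence l: "cl p (weight_comp n p t) \<in> F' n p"
        using coset_eq_zero_iff[OF module_Q submodule_image linear_closed[OF linear_cl cc]] by simp
      note pl = psi_lower[OF l] and pt = psi_top[OF c]
      have "psi p (cl p (weight_comp n p t)) \<ominus>\<^bsub>grade S.Q p\<^esub> (psi p (cl p (weight_comp n p t)) \<ominus>\<^bsub>grade S.Q p\<^esub> S.cl p (weight_comp n p t)) \<in> S.F' n p"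
        by (rule submoduleD(5)[OF S.submodule_image S.module_Q pl pt])
      hence "S.cl p (weight_comp n p t) \<in> S.F' n p"
        using M.minus_minus_cancel[OF linear_closed[OF linear_psi linear_closed[OF linear_cl cc]] linear_closed[OF S.linear_cl cc]] by simp
      thus ?thesis by (rule S_top_zero[OF c])
    qed
    hence "t \<in> S.I p" by (rule sum_comp_mem[OF t(1) S.subI])
    thus ?thesis using coset_eq_zero_iff[OF module_T S.subI t(1)] t(2) by (simp add: S.grade_Q FactModule_simps)
  qed
  show "inj_on (kappa p) (carrier (grade S.Q p))"
  proof (rule inj_onI)
    fix x y assume x: "x \<in> carrier (grade S.Q p)" and y: "y \<in> carrier (grade S.Q p)" and e: "kappa p x = kappa p y"
    have "kappa p (x \<ominus>\<^bsub>grade S.Q p\<^esub> y) = \<zero>\<^bsub>grade gr p\<^esub>"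
      using linear_minus[OF S.module_Q module_gr linear_kappa x y] e Gm.minus_eq_zero_iff linear_closed[OF linear_kappa y] by simp
    hence "x \<ominus>\<^bsub>grade S.Q p\<^esub> y = \<zero>\<^bsub>grade S.Q p\<^esub>" using ker x y by simp
    thus "x = y" using M.minus_eq_zero_iff[OF x y] by simp
  qed
  show "kappa p ` carrier (grade S.Q p) = carrier (grade gr p)"
  proof
    show "kappa p ` carrier (grade S.Q p) \<subseteq> carrier (grade gr p)" using linear_closed[OF linear_kappa] by blast
    show "carrier (grade gr p) \<subseteq> kappa p ` carrier (grade S.Q p)"
    proof
      fix g assume "g \<in> carrier (grade gr p)"
      hence g: "\<And>n. g n \<in> carrier (grade (gp n) p)" "finite {n. g n \<noteq> F' n p}"
        unfolding gr_eq weighted_simps by (auto simp: fin_supp_def zero_gp)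
      \<comment> \<open>The lift of a zero coordinate is chosen to be zero, so that the chosen
        coordinates together have finite support.\<close>
      have "\<exists>y\<in>carrier (pmod n p). g n = fc n p (cl p (single (\<lambda>n. pmod n p) n y)) \<and> (g n = F' n p \<longrightarrow> y = \<zero>\<^bsub>pmod n p\<^esub>)" for n
      proof (cases "g n = F' n p")
        case True
        have "single (\<lambda>n. pmod n p) n \<zero>\<^bsub>pmod n p\<^esub> = \<zero>\<^bsub>grade T p\<^esub>"
          by (rule linear_zero[OF pow.module_tensor module_T linear_single_T])
        moreover have "fc n p (cl p \<zero>\<^bsub>grade T p\<^esub>) = F' n p"
          using coset_zero[OF module_Q submodule_image] linear_zero[OF module_T module_Q linear_cl] by simp
        ultimately show ?thesis using True module_zero_closed[OF pow.module_tensor] by (intro bexI[of _ "\<zero>\<^bsub>pmod n p\<^esub>"]) auto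
      next
        case False
        obtain t where t: "t \<in> T_part {..n} p" "g n = fc n p (cl p t)"
          using g(1)[of n] unfolding carrier_gp tensor_image_eq by blast
        note sp = split_top[OF t(1)]
        have tc: "t \<in> carrier (grade T p)" using t(1) by (simp add: T_part_def)
        have "cl p t \<ominus>\<^bsub>grade Q p\<^esub> cl p (weight_comp n p t) \<in> F' n p"
          using linear_minus[OF module_T module_Q linear_cl tc sp(5)] sp(2) unfolding tensor_image_eq by auto
        hence "g n = fc n p (cl p (weight_comp n p t))"
          using fc_eq_iff[OF linear_closed[OF linear_cl tc] linear_closed[OF linear_cl sp(5)]] t(2) by simp
        thus ?thesis using False linear_closed[OF linear_coord_T tc] unfolding weight_comp_def by blast
      qed
      then obtain t where t: "\<And>n. t n \<in> carrier (pmod n p)" "\<And>n. g n = fc n p (cl p (single (\<lambda>n. pmod n p) n (t n)))"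
        "\<And>n. g n = F' n p \<Longrightarrow> t n = \<zero>\<^bsub>pmod n p\<^esub>" by metis
      have "{n. t n \<noteq> \<zero>\<^bsub>pmod n p\<^esub>} \<subseteq> {n. g n \<noteq> F' n p}" using t(3) by blast
      hence tc: "t \<in> carrier (grade T p)"
        using t(1) finite_subset[OF _ g(2)] unfolding T_grade by (auto simp: fin_supp_def)
      have "kappa p (S.cl p t) = g"
        by (rule ext) (simp add: kappa_coord[OF tc] t(2) weight_comp_def)
      thus "g \<in> kappa p ` carrier (grade S.Q p)" using linear_closed[OF S.linear_cl tc] by blast
    qed
  qed
qed

lemma canonical_morphism_kappa: "canonical_morphism R \<gamma> bracket kappa"
  unfolding canonical_morphism_def sym_ideal_eq
proof (intro conjI allI ballI talg_hom_kappa)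
  fix m x assume x: "x \<in> carrier (grade \<gamma> m)"
  show "kappa m (quot_incl R \<gamma> S.I m x) = gcl 1 m (quot_incl R \<gamma> I m x)"
    by (simp add: S.quot_incl_evq quot_incl_evq x kappa_evq good_letter gr_word_def One_nat_def)
qed

lemma smod_iso_kappa: "smod_iso R S.Q gr kappa"
  using talg_hom_kappa kappa_bij by (simp add: smod_iso_def talg_hom_def)

end

text \<open>The structure map is linear on the tensor square, which makes the product bilinear; its
  equivariance combined with the balancing relation gives equivariance of the product under product
  permutations.\<close>

lemma twisted_pre_lie_algebra_pre_lie:
  assumes "cring R" "twisted_pre_lie_algebra R \<gamma> c"
  shows "pre_lie R \<gamma> (prelie_op R \<gamma> c)"
proof -
  have sm: "sym_module R \<gamma>" and hom: "smod_hom R (tensor R [\<gamma>, \<gamma>]) \<gamma> c"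
    using assms(2) smodule_sym_module unfolding twisted_pre_lie_algebra_def by blast+
  interpret sq: square R \<gamma> by (rule square.intro[OF assms(1) sm])
  have gr: "grade (tensor R [\<gamma>, \<gamma>]) = sq.sqmod" by (simp add: tensor_def)
  have lc: "linear_map R (sq.sqmod p) (grade \<gamma> p) (c p)" for p using hom unfolding smod_hom_def gr by blast
  have ac: "\<sigma> permutes {1..p} \<Longrightarrow> X \<in> carrier (sq.sqmod p) \<Longrightarrow> c p (act (tensor R [\<gamma>, \<gamma>]) p \<sigma> X) = act \<gamma> p \<sigma> (c p X)" for p \<sigma> X
    using hom unfolding smod_hom_def gr by (simp add: sym_group_carrier)
  have pc: "tensor_class R [\<gamma>, \<gamma>] id [(m, x), (n, y)] = pair_class R \<gamma> (m + n) (iota m) (map (\<lambda>k. k + m) (iota n)) x y" for m n x y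
    by (simp add: pair_class_def iota_add[symmetric])
  have op: "prelie_op R \<gamma> c m n x y = c (m + n) (pair_class R \<gamma> (m + n) (iota m) (map (\<lambda>k. k + m) (iota n)) x y)" for m n x y
    by (simp add: prelie_op_def pc)
  show ?thesis
  proof (intro pre_lie.intro word_op.intro s_module.intro word_op_axioms.intro pre_lie_axioms.intro assms(1) sm)
    show "bilinear_map R (grade \<gamma> m) (grade \<gamma> n) (grade \<gamma> (m + n)) (prelie_op R \<gamma> c m n)" for m n
      using bilinear_comp_linear[OF sq.bilinear_pair_class[of "iota m" "map (\<lambda>k. k + m) (iota n)" "m + n"] lc]
      by (simp add: op[abs_def])
    fix \<sigma> \<tau> :: "nat \<Rightarrow> nat" and m n x y
    assume s: "\<sigma> permutes {1..m}" and t: "\<tau> permutes {1..n}" and x: "x \<in> carrier (grade \<gamma> m)" and y: "y \<in> carrier (grade \<gamma> n)"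
    let ?L = "iota m" and ?L' = "map (\<lambda>k. k + m) (iota n)"
    note st = perm_prod_permutes[OF s t]
    \<comment> \<open>The two blocks carry consecutive labels in increasing order, so relabelling by
      the product permutation is the same as permuting positions within each block, and balancing
      applies.\<close>
    have e: "map (perm_prod m \<sigma> \<tau>) ?L = plist \<sigma> ?L" "map (perm_prod m \<sigma> \<tau>) ?L' = plist \<tau> ?L'"
      using plist_map_iota[OF s, of id] plist_map_iota[OF t, of "\<lambda>k. k + m"] by (auto simp: perm_prod_def)
    have "act \<gamma> (m + n) (perm_prod m \<sigma> \<tau>) (prelie_op R \<gamma> c m n x y) =
        c (m + n) (act (tensor R [\<gamma>, \<gamma>]) (m + n) (perm_prod m \<sigma> \<tau>) (pair_class R \<gamma> (m + n) ?L ?L' x y))"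
      unfolding op by (rule ac[OF st, symmetric]) (rule sq.pair_class_closed; simp add: x y)
    also have "act (tensor R [\<gamma>, \<gamma>]) (m + n) (perm_prod m \<sigma> \<tau>) (pair_class R \<gamma> (m + n) ?L ?L' x y) =
        pair_class R \<gamma> (m + n) (plist \<sigma> ?L) (plist \<tau> ?L') x y"
      unfolding e[symmetric] by (rule sq.act_pair_class[OF st]) (simp_all add: x y)
    also have "\<dots> = pair_class R \<gamma> (m + n) ?L ?L' (act \<gamma> m \<sigma> x) (act \<gamma> n \<tau> y)"
      using sq.pair_class_plist[of \<sigma> ?L \<tau> ?L' x y "m + n"] s t x y by simp
    finally show "act \<gamma> (m + n) (perm_prod m \<sigma> \<tau>) (prelie_op R \<gamma> c m n x y) = prelie_op R \<gamma> c m n (act \<gamma> m \<sigma> x) (act \<gamma> n \<tau> y)"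
      unfolding op .
  next
    show "\<And>x a y b z d. x \<in> carrier (grade \<gamma> a) \<Longrightarrow> y \<in> carrier (grade \<gamma> b) \<Longrightarrow> z \<in> carrier (grade \<gamma> d) \<Longrightarrow>
      prelie_op R \<gamma> c (a + b) d (prelie_op R \<gamma> c a b x y) z \<ominus>\<^bsub>grade \<gamma> (a + b + d)\<^esub> prelie_op R \<gamma> c a (b + d) x (prelie_op R \<gamma> c b d y z) =
      act \<gamma> (a + b + d) (block_perm (transpose 2 3) [a, d, b])
        (prelie_op R \<gamma> c (a + d) b (prelie_op R \<gamma> c a d x z) y \<ominus>\<^bsub>grade \<gamma> (a + b + d)\<^esub> prelie_op R \<gamma> c a (d + b) x (prelie_op R \<gamma> c d b z y))"
      using assms(2) unfolding twisted_pre_lie_algebra_def Let_def by blast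
  qed
qed

theorem corollary4p5p4:
  fixes R :: "('r, 'k) ring_scheme" and \<gamma> :: "('r, 'a) smod"
    and c :: "nat \<Rightarrow> ('r, 'a) tens \<Rightarrow> 'a"
  assumes "cring R"
    and "twisted_pre_lie_algebra R \<gamma> c"
  shows
    "let br = associated_bracket R \<gamma> c;
         J = sym_ideal R \<gamma>; I = env_ideal R \<gamma> br;
         Sym = tensor_quot R \<gamma> J; U = tensor_quot R \<gamma> I
     in \<exists>\<kappa> \<Delta>\<^sub>S \<epsilon>\<^sub>S \<Delta>\<^sub>U \<epsilon>\<^sub>U.
          canonical_morphism R \<gamma> br \<kappa> \<and>
          standard_coproduct R \<gamma> J \<Delta>\<^sub>S \<and> standard_counit R \<gamma> J \<epsilon>\<^sub>S \<and>
          standard_coproduct R \<gamma> I \<Delta>\<^sub>U \<and> standard_counit R \<gamma> I \<epsilon>\<^sub>U \<and>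
          smod_iso R Sym (gr_talg R \<gamma> I) \<kappa> \<and>
          (\<exists>\<Phi>. tcoalg_iso R Sym \<Delta>\<^sub>S \<epsilon>\<^sub>S U \<Delta>\<^sub>U \<epsilon>\<^sub>U \<Phi> \<and>
               (\<forall>n p. \<Phi> p ` tensor_image R \<gamma> J {..n} p = tensor_image R \<gamma> I {..n} p) \<and>
               (\<forall>n p. \<forall>s\<in>tensor_image R \<gamma> J {n} p. gr_class R \<gamma> I n p (\<Phi> p s) = \<kappa> p s))"
proof -
  interpret pre_lie R \<gamma> "prelie_op R \<gamma> c" by (rule twisted_pre_lie_algebra_pre_lie[OF assms])
  have br: "associated_bracket R \<gamma> c = bracket"
    by (simp add: associated_bracket_def bracket_def fun_eq_iff)
  show ?thesis
    unfolding Let_def br sym_ideal_eq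
    by (intro exI[of _ kappa] exI[of _ S.coproduct] exI[of _ S.counit] exI[of _ coproduct] exI[of _ counit] exI[of _ phi]
        conjI allI ballI canonical_morphism_kappa S.standard_coproduct_coproduct S.standard_counit_counit
        standard_coproduct_coproduct standard_counit_counit smod_iso_kappa tcoalg_iso_phi phi_image_F gr_class_phi)
qed

end
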